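(* There exists a constant $\overline C<\infty$ such that for any $\alpha\in(0,1)$ and integer $d\geq2$ with $$d\Big(1-\exp\Big(-\frac{\sqrt\alpha}{d\alpha+1}\Big)\Big)>\overline C,$$ the set $E^{\geq h}$ contains $\mathbb P^G_{\tilde{\mathbb T}^\alpha_d}$-a.s. an unbounded connected component for all $h\in\mathbb R$, and so $\tilde h_*=\infty$.
   Context: **The graph $\mathbb T^\alpha_d$.** For $\alpha\in(0,1)$ and an integer $d\geq2$, $\mathbb T^\alpha_d$ is the rooted $(d+1)$-regular tree with root $\varnothing$; $T_n$ is the set of vertices at generation $n$ (seen from the root). Weights are $\lambda^{(\alpha)}_{x,y}=\alpha^n$ if $x\in T_n$ and $y\in T_{n+1}$ are neighbours, and $0$ for non-adjacent vertices. The killing measure is $\kappa^{(\alpha)}=0$ if $\alpha>1/d$, and $\kappa^{(\alpha)}=\mathbf 1_{\{\varnothing\}}$ (i.e. $1$ at the root, $0$ elsewhere) if $\alpha\leq1/d$. This graph is transient. **Cable system.** For a weighted graph $\mathcal G=(G,\lambda,\kappa)$ with edge set $E=\{\{x,y\}:\lambda_{x,y}>0\}$ and $\lambda_x=\kappa_x+\sum_y\lambda_{x,y}$, $\tilde{\mathcal G}$ is obtained by joining the endpoints of each edge $e=\{x,y\}\in E$ by an interval $I_e$ of length $1/(2\lambda_{x,y})$ and by gluing to each $x\in G$ the closed end of a half-open interval $I_x$ of length $1/(2\kappa_x)$ ($=\infty$ if $\kappa_x=0$). A connected set $F\subset\tilde{\mathcal G}$ is unbounded if $F\cap G$ is infinite.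 **Diffusion.** Let $m$ be Lebesgue measure on $\tilde{\mathcal G}$. Under $P_x$, $X$ is the $m$-symmetric diffusion on $\tilde{\mathcal G}$ started at $x$ with lifetime $\zeta\in[0,\infty]$ and Dirichlet form $\frac12\int f'g'\,dm$ on $L^2(m)$, with domain the functions $f\in C_0(\tilde{\mathcal G})$ (sup-norm closure of the continuous compactly supported functions) that are $W^{1,2}$ on each cable with $f,f'\in L^2(m)$. Its discrete skeleton on $G$ jumps from $x$ to $y$ with probability $\lambda_{x,y}/\lambda_x$ and is killed with probability $\kappa_x/\lambda_x$. $g(x,y)=E_x[\ell_y(\zeta)]$, where $\ell$ are the local times w.r.t. $m$ (for $x,y\in G$ this is $\lambda_y^{-1}$ times the expected number of visits to $y$ of the skeleton started at $x$). **Gaussian free field.** Under $\mathbb P^G_{\tilde{\mathcal G}}$, $(\phi_x)_{x\in\tilde{\mathcal G}}$ is the continuous centered Gaussian field with covariance $g$; $E^{\geq h}=\{x\in\tilde{\mathcal G}:\phi_x\geq h\}$, and $\tilde h_*=\inf\{h\in\mathbb R:\mathbb P^G_{\tilde{\mathcal G}}(E^{\geq h}\text{ contains an unbounded connected component})=0\}$ ($\inf\varnothing=\infty$). *)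

theory Defs
  imports "HOL-Probability.Probability"
begin

section \<open>Weighted graphs and their cable systems\<close>

record 'v weighted_graph =
  verts :: "'v set"
  weight :: "'v \<Rightarrow> 'v \<Rightarrow> real"
  killing :: "'v \<Rightarrow> real"

text \<open>
  A point of the cable system is a pair of barycentric coordinates on the graph and a position on
  the interval \<open>I\<^sub>x\<close>.  A point at distance \<open>t\<close> from \<open>x\<close> on the interval joining \<open>x\<close> to \<open>y\<close>, of length
  \<open>\<rho> = 1 / (2 * weight x y)\<close>, has coordinates \<open>1 - t / \<rho>\<close> at \<open>x\<close> and \<open>t / \<rho>\<close> at \<open>y\<close>; a point at
  distance \<open>s\<close> from \<open>x\<close> on \<open>I\<^sub>x\<close> is \<open>(indicator {x}, s)\<close>.  The gluing is thereby automatic,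
  and for a locally finite graph the subspace topology inherited from the product topology is
  the topology of the glued space, so that the notions \<open>connected\<close>, \<open>compact\<close>, \<open>continuous_on\<close>
  and \<open>borel\<close> of the libraries apply directly.
\<close>

type_synonym 'v cable_point = "('v \<Rightarrow> real) \<times> real"

definition vertex_point :: "'v \<Rightarrow> 'v cable_point" where
  "vertex_point x = (indicator {x}, 0)"

text \<open>
  Every edge occurs with both orientations, \<open>Edge x y\<close> and \<open>Edge y x\<close>; the multiplicity \<open>1/2\<close>
  compensates for this in sums over cables.
\<close>

datatype 'v cable = Edge 'v 'v | Ray 'v

definition cables :: "'v weighted_graph \<Rightarrow> 'v cable set" where
  "cables G = {Edge x y | x y. x \<in> verts G \<and> y \<in> verts G \<and> weight G x y > 0} \<union> Ray ` verts G"

primrec cable_mult :: "'v cable \<Rightarrow> real" where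
  "cable_mult (Edge x y) = 1 / 2"
| "cable_mult (Ray x) = 1"

text \<open>The condition \<open>2 * killing G x * s < 1\<close> is void if \<open>killing G x = 0\<close>.\<close>

primrec cable_dom :: "'v weighted_graph \<Rightarrow> 'v cable \<Rightarrow> real set" where
  "cable_dom G (Edge x y) = {0 .. 1 / (2 * weight G x y)}"
| "cable_dom G (Ray x) = {s. 0 \<le> s \<and> 2 * killing G x * s < 1}"

primrec cable_map :: "'v weighted_graph \<Rightarrow> 'v cable \<Rightarrow> real \<Rightarrow> 'v cable_point" where
  "cable_map G (Edge x y) t =
     (\<lambda>z. (1 - 2 * weight G x y * t) * indicator {x} z + 2 * weight G x y * t * indicator {y} z, 0)"
| "cable_map G (Ray x) s = (indicator {x}, s)"

definition cable_system :: "'v weighted_graph \<Rightarrow> 'v cable_point set" where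
  "cable_system G = (\<Union>c\<in>cables G. cable_map G c ` cable_dom G c)"

definition unbounded :: "'v weighted_graph \<Rightarrow> 'v cable_point set \<Rightarrow> bool" where
  "unbounded G F \<longleftrightarrow> infinite {x \<in> verts G. vertex_point x \<in> F}"

definition lebesgue_cable :: "'v weighted_graph \<Rightarrow> 'v cable_point measure" where
  "lebesgue_cable G =
     measure_of (cable_system G) (sets (restrict_space borel (cable_system G)))
       (\<lambda>A. \<integral>\<^sup>+ c. ennreal (cable_mult c) * emeasure lborel (cable_dom G c \<inter> cable_map G c -` A)
              \<partial>count_space (cables G))"


section \<open>The Dirichlet form\<close>

text \<open>
  In dimension one, a continuous function is in \<open>W\<^sup>1\<^sup>,\<^sup>2\<close> with weak derivative \<open>u\<close> iff it is an
  indefinite integral of the square-integrable function \<open>u\<close>; \<open>u\<close> is then unique up to null sets.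
\<close>

definition has_weak_deriv :: "real set \<Rightarrow> (real \<Rightarrow> real) \<Rightarrow> (real \<Rightarrow> real) \<Rightarrow> bool" where
  "has_weak_deriv I F u \<longleftrightarrow>
     u \<in> borel_measurable lborel \<and> set_integrable lborel I (\<lambda>t. (u t)\<^sup>2) \<and>
     (\<forall>a\<in>I. \<forall>b\<in>I. a \<le> b \<longrightarrow> F b - F a = (LINT t:{a..b}|lborel. u t))"

definition cable_deriv ::
  "'v weighted_graph \<Rightarrow> ('v cable_point \<Rightarrow> real) \<Rightarrow> 'v cable \<Rightarrow> real \<Rightarrow> real" where
  "cable_deriv G f c = (SOME u. has_weak_deriv (cable_dom G c) (f \<circ> cable_map G c) u)"

definition compactly_supported :: "'v weighted_graph \<Rightarrow> ('v cable_point \<Rightarrow> real) set" where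
  "compactly_supported G = {f. continuous_on (cable_system G) f \<and>
     (\<exists>K\<subseteq>cable_system G. compact K \<and> (\<forall>p\<in>cable_system G - K. f p = 0))}"

definition C0 :: "'v weighted_graph \<Rightarrow> ('v cable_point \<Rightarrow> real) set" where
  "C0 G = {f. \<forall>\<epsilon>>0. \<exists>k\<in>compactly_supported G. \<forall>p\<in>cable_system G. \<bar>f p - k p\<bar> \<le> \<epsilon>}"

definition form_domain :: "'v weighted_graph \<Rightarrow> ('v cable_point \<Rightarrow> real) set" where
  "form_domain G = {f \<in> C0 G.
     (\<forall>c\<in>cables G. \<exists>u. has_weak_deriv (cable_dom G c) (f \<circ> cable_map G c) u) \<and>
     integrable (lebesgue_cable G) (\<lambda>p. (f p)\<^sup>2) \<and>
     (\<lambda>c. LINT t:cable_dom G c|lborel. (cable_deriv G f c t)\<^sup>2) summable_on cables G}"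

text \<open>
  The derivative along an edge changes sign with the orientation of the edge, the product of two
  derivatives does not.
\<close>

definition dirichlet_form ::
  "'v weighted_graph \<Rightarrow> ('v cable_point \<Rightarrow> real) \<Rightarrow> ('v cable_point \<Rightarrow> real) \<Rightarrow> real" where
  "dirichlet_form G f k = 1 / 2 * (\<Sum>\<^sub>\<infinity>c\<in>cables G.
     cable_mult c * (LINT t:cable_dom G c|lborel. cable_deriv G f c t * cable_deriv G k c t))"


section \<open>The diffusion and its local times\<close>

text \<open>
  Paths take values in the cable system together with the cemetery \<open>None\<close>, which also serves as
  the value at negative times: \<open>{t. w t \<noteq> None}\<close> is the interval \<open>[0,\<zeta>)\<close>, with \<open>\<zeta>\<close> the lifetime.
\<close>

type_synonym 'v path = "real \<Rightarrow> 'v cable_point option"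

definition paths :: "'v weighted_graph \<Rightarrow> 'v path set" where
  "paths G = {w. (\<exists>\<zeta>::ereal. \<forall>t. w t \<noteq> None \<longleftrightarrow> 0 \<le> t \<and> ereal t < \<zeta>) \<and>
     (\<forall>t p. w t = Some p \<longrightarrow> p \<in> cable_system G) \<and>
     continuous_on {t. w t \<noteq> None} (\<lambda>t. the (w t))}"

text \<open>The sigma-algebra generated by the process at times in \<open>I\<close>.\<close>

definition path_sigma :: "'v weighted_graph \<Rightarrow> real set \<Rightarrow> 'v path measure" where
  "path_sigma G I = sigma (paths G) {{w \<in> paths G. w t \<in> Some ` A} | t A. t \<in> I \<and> A \<in> sets borel}"

definition path_shift :: "real \<Rightarrow> 'v path \<Rightarrow> 'v path" where
  "path_shift s w = (\<lambda>t. if t < 0 then None else w (s + t))"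

definition semigroup_op ::
  "('v cable_point \<Rightarrow> 'v path measure) \<Rightarrow> real \<Rightarrow> ('v cable_point \<Rightarrow> real) \<Rightarrow> 'v cable_point \<Rightarrow> real"
  where
  "semigroup_op P t f p = (LINT w|P p. (case w t of None \<Rightarrow> 0 | Some q \<Rightarrow> f q))"

definition resolvent_op ::
  "('v cable_point \<Rightarrow> 'v path measure) \<Rightarrow> real \<Rightarrow> ('v cable_point \<Rightarrow> real) \<Rightarrow> 'v cable_point \<Rightarrow> real"
  where
  "resolvent_op P \<beta> f p = (LINT t:{0..}|lborel. exp (- \<beta> * t) * semigroup_op P t f p)"

definition markov_family :: "'v weighted_graph \<Rightarrow> ('v cable_point \<Rightarrow> 'v path measure) \<Rightarrow> bool" where
  "markov_family G P \<longleftrightarrow>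
     (\<forall>p\<in>cable_system G. prob_space (P p) \<and> space (P p) = paths G \<and>
        sets (P p) = sets (path_sigma G {0..}) \<and> (AE w in P p. w 0 = Some p)) \<and>
     (\<forall>B\<in>sets (path_sigma G {0..}).
        (\<lambda>p. emeasure (P p) B) \<in> borel_measurable (restrict_space borel (cable_system G))) \<and>
     (\<forall>p\<in>cable_system G. \<forall>s\<ge>0. \<forall>A\<in>sets (path_sigma G {0..s}). \<forall>B\<in>sets (path_sigma G {0..}).
        emeasure (P p) {w \<in> A. w s \<noteq> None \<and> path_shift s w \<in> B} =
        (\<integral>\<^sup>+ w \<in> A. (case w s of None \<Rightarrow> 0 | Some q \<Rightarrow> emeasure (P q) B) \<partial>P p))"

definition m_symmetric :: "'v weighted_graph \<Rightarrow> ('v cable_point \<Rightarrow> 'v path measure) \<Rightarrow> bool" where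
  "m_symmetric G P \<longleftrightarrow>
     (\<forall>t\<ge>0. \<forall>A\<in>sets (lebesgue_cable G). \<forall>B\<in>sets (lebesgue_cable G).
        (\<integral>\<^sup>+ p \<in> A. emeasure (P p) {w \<in> paths G. w t \<in> Some ` B} \<partial>lebesgue_cable G) =
        (\<integral>\<^sup>+ p \<in> B. emeasure (P p) {w \<in> paths G. w t \<in> Some ` A} \<partial>lebesgue_cable G))"

text \<open>
  The process is associated with the Dirichlet form in the usual way: the resolvent \<open>R\<^sub>\<beta>\<close>
  of its semigroup maps \<open>L\<^sup>2\<close> into the domain, and \<open>E(R\<^sub>\<beta> f, k) + \<beta> (R\<^sub>\<beta> f, k) = (f, k)\<close> for all \<open>k\<close> in
  the domain.  The domain consists of functions in \<open>C\<^sub>0\<close>, not of classes, and \<open>R\<^sub>\<beta> f\<close> is required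
  to belong to it as a function.  This determines the laws \<open>P p\<close> for every starting point \<open>p\<close>, and
  it implies that the process is strongly Markovian.
\<close>

definition associated_with_form ::
  "'v weighted_graph \<Rightarrow> ('v cable_point \<Rightarrow> 'v path measure) \<Rightarrow> bool" where
  "associated_with_form G P \<longleftrightarrow>
     (\<forall>\<beta>>0. \<forall>f\<in>borel_measurable (lebesgue_cable G). integrable (lebesgue_cable G) (\<lambda>p. (f p)\<^sup>2) \<longrightarrow>
        resolvent_op P \<beta> f \<in> form_domain G \<and>
        (\<forall>k\<in>form_domain G.
           dirichlet_form G (resolvent_op P \<beta> f) k
             + \<beta> * (LINT p|lebesgue_cable G. resolvent_op P \<beta> f p * k p)
           = (LINT p|lebesgue_cable G. f p * k p)))"

definition cable_diffusion ::
  "'v weighted_graph \<Rightarrow> ('v cable_point \<Rightarrow> 'v path measure) \<Rightarrow> bool" where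
  "cable_diffusion G P \<longleftrightarrow> markov_family G P \<and> m_symmetric G P \<and> associated_with_form G P"

text \<open>
  \<open>L q t w\<close> is the local time at \<open>q\<close> accumulated by the path \<open>w\<close> up to time \<open>t\<close>: the jointly continuous
  density with respect to \<open>m\<close> of the occupation measure; only times before the lifetime matter.
\<close>

definition local_times ::
  "'v weighted_graph \<Rightarrow> ('v cable_point \<Rightarrow> 'v path measure) \<Rightarrow>
     ('v cable_point \<Rightarrow> real \<Rightarrow> 'v path \<Rightarrow> real) \<Rightarrow> bool" where
  "local_times G P L \<longleftrightarrow>
     (\<forall>q\<in>cable_system G. \<forall>t\<ge>0. L q t \<in> borel_measurable (path_sigma G {0..})) \<and>
     (\<forall>p\<in>cable_system G. AE w in P p.
        continuous_on (cable_system G \<times> {t. w t \<noteq> None}) (\<lambda>(q, t). L q t w) \<and>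
        (\<forall>t. w t \<noteq> None \<longrightarrow>
           (\<forall>q\<in>cable_system G. 0 \<le> L q t w) \<and>
           (\<forall>A\<in>sets (lebesgue_cable G).
              emeasure lborel {s \<in> {0..t}. w s \<in> Some ` A} =
              (\<integral>\<^sup>+ q \<in> A. ennreal (L q t w) \<partial>lebesgue_cable G))))"

text \<open>
  Local times are nondecreasing in time, so that the supremum over the times before the lifetime
  is the local time at the lifetime, which may be infinite.
\<close>

definition green_function ::
  "'v weighted_graph \<Rightarrow> ('v cable_point \<Rightarrow> 'v cable_point \<Rightarrow> real) \<Rightarrow> bool" where
  "green_function G g \<longleftrightarrow> (\<exists>P L. cable_diffusion G P \<and> local_times G P L \<and>
     (\<forall>p\<in>cable_system G. \<forall>q\<in>cable_system G. 0 \<le> g p q \<and>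
        ennreal (g p q) = (\<integral>\<^sup>+ w. (SUP t\<in>{t. w t \<noteq> None}. ennreal (L q t w)) \<partial>P p)))"


section \<open>The Gaussian free field and its level sets\<close>

definition centered_gaussian :: "'a measure \<Rightarrow> ('a \<Rightarrow> real) \<Rightarrow> bool" where
  "centered_gaussian M X \<longleftrightarrow> X \<in> borel_measurable M \<and>
     ((AE \<omega> in M. X \<omega> = 0) \<or>
      (\<exists>\<sigma>>0. distributed M lborel X (\<lambda>x. ennreal (normal_density 0 \<sigma> x))))"

text \<open>
  \<open>M\<close> is the law of the field on the space of continuous functions on the cable system
  with the sigma-algebra generated by the evaluations.
\<close>

definition gaussian_free_field ::
  "'v weighted_graph \<Rightarrow> ('v cable_point \<Rightarrow> real) measure \<Rightarrow> bool" where
  "gaussian_free_field G M \<longleftrightarrow>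
     prob_space M \<and>
     sets M = sets (restrict_space (Pi\<^sub>M (cable_system G) (\<lambda>_. borel))
                      {\<phi>. continuous_on (cable_system G) \<phi>}) \<and>
     (\<forall>F a. finite F \<and> F \<subseteq> cable_system G \<longrightarrow> centered_gaussian M (\<lambda>\<phi>. \<Sum>p\<in>F. a p * \<phi> p)) \<and>
     (\<exists>g. green_function G g \<and>
        (\<forall>p\<in>cable_system G. \<forall>q\<in>cable_system G. (LINT \<phi>|M. \<phi> p * \<phi> q) = g p q))"

definition level_set :: "'v weighted_graph \<Rightarrow> real \<Rightarrow> ('v cable_point \<Rightarrow> real) \<Rightarrow> 'v cable_point set"
  where "level_set G h \<phi> = {p \<in> cable_system G. \<phi> p \<ge> h}"

definition percolates :: "'v weighted_graph \<Rightarrow> real \<Rightarrow> ('v cable_point \<Rightarrow> real) \<Rightarrow> bool" where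
  "percolates G h \<phi> \<longleftrightarrow> (\<exists>F\<in>components (level_set G h \<phi>). unbounded G F)"

definition critical_level :: "'v weighted_graph \<Rightarrow> ('v cable_point \<Rightarrow> real) measure \<Rightarrow> ereal" where
  "critical_level G M = Inf {ereal h | h. AE \<phi> in M. \<not> percolates G h \<phi>}"


section \<open>The weighted regular tree\<close>

text \<open>
  A vertex is the list of labels on its path from the root, most recent label first, so that its
  generation is its length.  The root has \<open>d + 1\<close> children, every other vertex has \<open>d\<close>.
\<close>

inductive_set regular_tree :: "nat \<Rightarrow> nat list set" for d :: nat where
  root: "[] \<in> regular_tree d"
| child: "v \<in> regular_tree d \<Longrightarrow> i < (if v = [] then d + 1 else d) \<Longrightarrow> i # v \<in> regular_tree d"

definition tree_weight :: "real \<Rightarrow> nat list \<Rightarrow> nat list \<Rightarrow> real" where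
  "tree_weight \<alpha> x y =
     (if \<exists>i. y = i # x then \<alpha> ^ length x else if \<exists>i. x = i # y then \<alpha> ^ length y else 0)"

definition tree_killing :: "real \<Rightarrow> nat \<Rightarrow> nat list \<Rightarrow> real" where
  "tree_killing \<alpha> d x = (if \<alpha> \<le> 1 / real d \<and> x = [] then 1 else 0)"

definition tree_graph :: "real \<Rightarrow> nat \<Rightarrow> nat list weighted_graph" where
  "tree_graph \<alpha> d =
     \<lparr>verts = regular_tree d, weight = tree_weight \<alpha>, killing = tree_killing \<alpha> d\<rparr>"

end

theory Submission
  imports Defs
begin

text \<open>
  Call the edge from \<open>x\<close> to its child \<open>v\<close> open if the field, started from a value at least \<open>b\<^sub>x\<close> at \<open>x\<close>,
  stays above a fixed multiple of \<open>b\<^sub>x\<close> on the edge and is at least \<open>b\<^sub>v\<close> at \<open>v\<close>, where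
  \<open>b\<^sub>v = (\<lambda>\<^sub>v (1 + d \<alpha>)) powr (-1/2)\<close> is of the order of the conditional standard deviation of the field at \<open>v\<close>.
  Divided by the harmonic function of the edge, the field has independent symmetric increments along the edge,
  which are also independent of the field outside the branch of \<open>v\<close>.  By the reflection principle the edge is open
  with probability at least a constant times \<open>sqrt \<alpha> / (1 + d \<alpha>)\<close>, independently of the other edges.  If \<open>d\<close>
  times this probability is at least 2, the open edges below any vertex dominate a supercritical branching process.
  As \<open>b\<^sub>v\<close> tends to infinity with the generation of \<open>v\<close>, a surviving open cluster that starts far from the root lies
  above any given level.  Many such starting vertices in disjoint branches give probability one.

  The Green function enters only through consequences of the resolvent equation: it factorises at a point that
  separates the cable system, is piecewise linear along edges, and satisfies the Kirchhoff equation at vertices and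
  a maximum principle.
\<close>

text \<open>The factor \<open>sqrt \<alpha> / (1 + d * \<alpha>)\<close> is a ratio of heights. The
  normalised field on the edge to \<open>v\<close> has total variance
  \<open>1 / (lam v * hit v)\<close> with \<open>hit v\<close> at least
  \<open>1 / (1 + d * \<alpha>)\<close>, so its standard deviation is at most
  \<open>sqrt ((1 + d * \<alpha>) / lam v)\<close>; the threshold of the parent is exactly
  \<open>sqrt \<alpha> / (1 + d * \<alpha>)\<close> times this bound. A symmetric walk started low,
  compared with its final standard deviation, stays nonnegative with a probability of the order of
  that ratio. The obstacle is independence, since edges with a common parent share the field there.
  Openness is therefore a condition on increments only, and independence is reduced to vanishing
  covariances. To keep finitely many variables, edges are observed at dyadic points; the bounds are
  uniform in the dyadic level and in the depth, and finite branching allows the passage to the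
  limit. No formula for the Green function is available. The lower bound for \<open>hit v\<close>
  comes from one Kirchhoff equation in which all returns from the children are dropped.\<close>

subsection \<open>Independence and reflection for Gaussian variables\<close>

text \<open>Divided by \<open>v\<close>, the positive weight \<open>V\<close> is the density of a
  second probability measure. The hypothesis says that \<open>X\<close> has the same characteristic
  function under both measures, and Levy uniqueness identifies the two laws.\<close>

lemma (in prob_space) char_eq_imp_prob_eq:
  fixes X :: "'a \<Rightarrow> real" and V :: "'a \<Rightarrow> real"
  assumes X[measurable]: "X \<in> borel_measurable M" and V[measurable]: "V \<in> borel_measurable M"
    and V0: "\<And>\<omega>. V \<omega> > 0" and V3: "\<And>\<omega>. V \<omega> \<le> K"
    and ch: "\<And>t. (\<integral>\<omega>. V \<omega> *\<^sub>R iexp (t * X \<omega>) \<partial>M) = v *\<^sub>R (\<integral>\<omega>. iexp (t * X \<omega>) \<partial>M)"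
    and B: "B \<in> sets borel"
  shows "(\<integral>\<omega>. V \<omega> * indicator B (X \<omega>) \<partial>M) = v * prob (X -` B \<inter> space M)"
proof -
  have iV: "integrable M V"
    by (rule integrable_const_bound[of _ K]) (use V0 V3 in \<open>auto simp: less_imp_le\<close>)
  have "complex_of_real (\<integral>\<omega>. V \<omega> \<partial>M) = of_real v"
    using ch[of 0] by (simp add: prob_space scaleR_conv_of_real)
  then have ev: "(\<integral>\<omega>. V \<omega> \<partial>M) = v"
    using of_real_eq_iff by blast
  have v0: "v > 0"
  proof -
    have "v \<ge> 0" unfolding ev[symmetric] using V0 by (intro Bochner_Integration.integral_nonneg) (simp add: less_imp_le)
    moreover have "v \<noteq> 0"
    proof
      assume "v = 0"
      then have "AE \<omega> in M. V \<omega> = 0"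
        using integral_nonneg_eq_0_iff_AE[OF iV] V0 ev by (simp add: less_imp_le)
      then have "AE \<omega> in M. False" by (rule eventually_mono) (use V0 in \<open>simp add: less_le\<close>)
      then show False using AE_False by simp
    qed
    ultimately show ?thesis by simp
  qed
  define N where "N = density M (\<lambda>\<omega>. ennreal (V \<omega> / v))"
  have N1: "emeasure N (space N) = 1"
  proof -
    have "emeasure N (space N) = (\<integral>\<^sup>+\<omega>. ennreal (V \<omega> / v) \<partial>M)"
      unfolding N_def by (subst emeasure_density) (auto intro!: nn_integral_cong)
    also have "\<dots> = ennreal (\<integral>\<omega>. V \<omega> / v \<partial>M)"
      by (rule nn_integral_eq_integral) (use iV V0 v0 in \<open>auto simp: less_imp_le\<close>)
    finally show ?thesis using ev v0 by simp
  qed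
  interpret N: prob_space N by (rule prob_spaceI[OF N1])
  have XN[measurable]: "X \<in> borel_measurable N" unfolding N_def by simp
  have rd1: "real_distribution (distr M borel X)" by (rule real_distribution_distr) simp
  have rd2: "real_distribution (distr N borel X)" by (rule N.real_distribution_distr) simp
  have "char (distr N borel X) = char (distr M borel X)"
  proof
    fix t
    have "char (distr N borel X) t = (\<integral>\<omega>. iexp (t * X \<omega>) \<partial>N)"
      unfolding char_def by (simp add: integral_distr)
    also have "\<dots> = (\<integral>\<omega>. (V \<omega> / v) *\<^sub>R iexp (t * X \<omega>) \<partial>M)"
      unfolding N_def by (rule integral_density) (use V0 v0 in \<open>auto simp: less_imp_le\<close>)
    also have "\<dots> = (1/v) *\<^sub>R (\<integral>\<omega>. V \<omega> *\<^sub>R iexp (t * X \<omega>) \<partial>M)"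
      by (subst integral_scaleR_right[symmetric]) (auto intro!: Bochner_Integration.integral_cong simp: divide_inverse mult.commute)
    also have "\<dots> = (\<integral>\<omega>. iexp (t * X \<omega>) \<partial>M)"
      unfolding ch using v0 by simp
    also have "\<dots> = char (distr M borel X) t"
      unfolding char_def by (simp add: integral_distr)
    finally show "char (distr N borel X) t = char (distr M borel X) t" .
  qed
  then have eq: "distr N borel X = distr M borel X"
    by (rule Levy_uniqueness[OF rd2 rd1])
  have "(\<integral>\<omega>. V \<omega> * indicator B (X \<omega>) \<partial>M) = v * (\<integral>\<omega>. (V \<omega> / v) *\<^sub>R indicator B (X \<omega>) \<partial>M)"
    by (subst integral_mult_right_zero[symmetric]) (use v0 in \<open>auto intro!: Bochner_Integration.integral_cong\<close>)
  also have "(\<integral>\<omega>. (V \<omega> / v) *\<^sub>R indicator B (X \<omega>) \<partial>M) = (\<integral>\<omega>. indicator B (X \<omega>) \<partial>N :: real)"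
    unfolding N_def by (rule integral_density[symmetric]) (use V0 v0 B in \<open>auto simp: less_imp_le\<close>)
  also have "\<dots> = (\<integral>x. indicator B x \<partial>distr N borel X)"
    by (rule integral_distr[symmetric]) (use B in auto)
  also have "\<dots> = measure (distr M borel X) B"
    unfolding eq using B by simp
  also have "\<dots> = prob (X -` B \<inter> space M)"
    by (rule measure_distr) (use B in auto)
  finally show ?thesis .
qed

text \<open>Trades an exponential of \<open>X\<close> for an indicator while a bounded complex
  factor \<open>W\<close> is carried along. It reduces to the previous lemma through the real and
  imaginary parts of \<open>W\<close>, made positive by a shift.\<close>

lemma (in prob_space) char_factor_imp_indicator_factor:
  fixes X :: "'a \<Rightarrow> real" and W :: "'a \<Rightarrow> complex"
  assumes X[measurable]: "X \<in> borel_measurable M" and W[measurable]: "W \<in> borel_measurable M"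
    and W1: "\<And>\<omega>. norm (W \<omega>) \<le> 1"
    and ch: "\<And>t. (\<integral>\<omega>. W \<omega> * iexp (t * X \<omega>) \<partial>M) = c * (\<integral>\<omega>. iexp (t * X \<omega>) \<partial>M)"
    and B: "B \<in> sets borel"
  shows "(\<integral>\<omega>. W \<omega> * indicator B (X \<omega>) \<partial>M) = c * of_real (prob (X -` B \<inter> space M))"
proof -
  have [measurable]: "cnj \<in> borel_measurable borel"
    by (intro borel_measurable_continuous_onI continuous_intros)
  have iX: "integrable M (\<lambda>\<omega>. iexp (t * X \<omega>))" for t
    by (rule integrable_const_bound[of _ 1]) auto
  have bd: "norm (W \<omega> * iexp (t * X \<omega>)) \<le> 1" for \<omega> t
    using W1 by (simp add: norm_mult)
  have iW: "integrable M (\<lambda>\<omega>. W \<omega> * iexp (t * X \<omega>))" for t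
    by (rule integrable_const_bound[of _ 1]) (use bd in auto)
  \<comment> \<open>The real and imaginary parts of \<open>W\<close> also involve
    \<open>cnj W\<close>. Its factorisation is the conjugate of the hypothesis at
    \<open>-t\<close>.\<close>
  have chc: "(\<integral>\<omega>. cnj (W \<omega>) * iexp (t * X \<omega>) \<partial>M) = cnj c * (\<integral>\<omega>. iexp (t * X \<omega>) \<partial>M)" for t
  proof -
    have "cnj (\<integral>\<omega>. W \<omega> * iexp ((-t) * X \<omega>) \<partial>M) = cnj c * cnj (\<integral>\<omega>. iexp ((-t) * X \<omega>) \<partial>M)"
      unfolding ch by simp
    moreover have "cnj (\<integral>\<omega>. W \<omega> * iexp ((-t) * X \<omega>) \<partial>M) = (\<integral>\<omega>. cnj (W \<omega>) * iexp (t * X \<omega>) \<partial>M)"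
      by (subst Bochner_Integration.integral_cnj[symmetric]) (simp add: exp_cnj)
    moreover have "cnj (\<integral>\<omega>. iexp ((-t) * X \<omega>) \<partial>M) = (\<integral>\<omega>. iexp (t * X \<omega>) \<partial>M)"
      by (subst Bochner_Integration.integral_cnj[symmetric]) (simp add: exp_cnj)
    ultimately show ?thesis by simp
  qed
  have main: "(\<integral>\<omega>. f (W \<omega>) * indicator B (X \<omega>) \<partial>M) = f c * prob (X -` B \<inter> space M)"
    if f: "f = Re \<or> f = Im" for f :: "complex \<Rightarrow> real"
  proof -
    have [measurable]: "f \<in> borel_measurable borel" using f by auto
    have f1: "\<bar>f (W \<omega>)\<bar> \<le> 1" for \<omega>
      using f W1[of \<omega>] abs_Re_le_cmod[of "W \<omega>"] abs_Im_le_cmod[of "W \<omega>"] by auto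
    have i1: "integrable M (\<lambda>\<omega>. f (W \<omega>) *\<^sub>R iexp (t * X \<omega>))" for t
      by (rule integrable_const_bound[of _ 1]) (use f1 in auto)
    have chf: "(\<integral>\<omega>. f (W \<omega>) *\<^sub>R iexp (t * X \<omega>) \<partial>M) = f c *\<^sub>R (\<integral>\<omega>. iexp (t * X \<omega>) \<partial>M)" for t
    proof -
      have iWc: "integrable M (\<lambda>\<omega>. cnj (W \<omega>) * iexp (t * X \<omega>))"
        by (rule integrable_const_bound[of _ 1]) (use W1 in \<open>auto simp: norm_mult\<close>)
      show ?thesis using f
      proof
        assume "f = Re"
        then have *: "f z = (z + cnj z) / 2" for z by (simp add: complex_eq_iff)
        have "(\<integral>\<omega>. f (W \<omega>) *\<^sub>R iexp (t * X \<omega>) \<partial>M) =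
          (\<integral>\<omega>. (W \<omega> * iexp (t * X \<omega>) + cnj (W \<omega>) * iexp (t * X \<omega>)) / 2 \<partial>M)"
          unfolding scaleR_conv_of_real * by (simp add: field_simps)
        also have "\<dots> = (c * (\<integral>\<omega>. iexp (t * X \<omega>) \<partial>M) + cnj c * (\<integral>\<omega>. iexp (t * X \<omega>) \<partial>M)) / 2"
          using iW[of t] iWc unfolding ch[symmetric] chc[symmetric] by simp
        finally show ?thesis unfolding scaleR_conv_of_real * by (simp add: field_simps)
      next
        assume "f = Im"
        then have *: "f z = (z - cnj z) / (2 * \<i>)" for z by (simp add: complex_eq_iff)
        have "(\<integral>\<omega>. f (W \<omega>) *\<^sub>R iexp (t * X \<omega>) \<partial>M) =
          (\<integral>\<omega>. (W \<omega> * iexp (t * X \<omega>) - cnj (W \<omega>) * iexp (t * X \<omega>)) / (2*\<i>) \<partial>M)"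
          unfolding scaleR_conv_of_real * by (simp add: field_simps)
        also have "\<dots> = (c * (\<integral>\<omega>. iexp (t * X \<omega>) \<partial>M) - cnj c * (\<integral>\<omega>. iexp (t * X \<omega>) \<partial>M)) / (2*\<i>)"
          using iW[of t] iWc unfolding ch[symmetric] chc[symmetric] by simp
        finally show ?thesis unfolding scaleR_conv_of_real * by (simp add: field_simps)
      qed
    qed
    have "(\<integral>\<omega>. (2 + f (W \<omega>)) * indicator B (X \<omega>) \<partial>M) = (2 + f c) * prob (X -` B \<inter> space M)"
    \<comment> \<open>As \<open>\<bar>f (W \<omega>)\<bar> \<le> 1\<close>, the shift by 2 gives a
      weight between 1 and 3. The contribution of the constant 2 is subtracted afterwards.\<close>
    proof (rule char_eq_imp_prob_eq[OF _ _ _ _ _ B])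
      show "0 < 2 + f (W \<omega>)" "2 + f (W \<omega>) \<le> 3" for \<omega> using f1[of \<omega>] by auto
      show "(\<integral>\<omega>. (2 + f (W \<omega>)) *\<^sub>R iexp (t * X \<omega>) \<partial>M) = (2 + f c) *\<^sub>R (\<integral>\<omega>. iexp (t * X \<omega>) \<partial>M)" for t
        unfolding scaleR_add_left Bochner_Integration.integral_add[OF integrable_scaleR_right[OF iX[of t], of 2] i1[of t]]
          chf Bochner_Integration.integral_scaleR_right by (rule refl)
    qed simp_all
    moreover have "(\<integral>\<omega>. (2 + f (W \<omega>)) * indicator B (X \<omega>) \<partial>M) =
      2 * prob (X -` B \<inter> space M) + (\<integral>\<omega>. f (W \<omega>) * indicator B (X \<omega>) \<partial>M)"
    proof -
      have "integrable M (\<lambda>\<omega>. f (W \<omega>) * indicator B (X \<omega>))"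
        by (rule integrable_const_bound[of _ 1]) (use f1 B in \<open>auto simp: indicator_def\<close>)
      moreover have "integrable M (\<lambda>\<omega>. indicator B (X \<omega>) :: real)"
        by (rule integrable_const_bound[of _ 1]) (use B in \<open>auto simp: indicator_def\<close>)
      moreover have "(\<integral>\<omega>. indicator B (X \<omega>) \<partial>M) = prob (X -` B \<inter> space M)"
        by (subst integral_distr[symmetric, of X M borel]) (use B in \<open>auto simp: measure_distr\<close>)
      ultimately show ?thesis by (simp add: distrib_right)
    qed
    ultimately show ?thesis by (simp add: distrib_right)
  qed
  have iB: "integrable M (\<lambda>\<omega>. W \<omega> * indicator B (X \<omega>))"
    by (rule integrable_const_bound[of _ 1]) (use W1 B in \<open>auto simp: indicator_def\<close>)
  have "Re (\<integral>\<omega>. W \<omega> * indicator B (X \<omega>) \<partial>M) = (\<integral>\<omega>. Re (W \<omega>) * indicator B (X \<omega>) \<partial>M)"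
    by (subst integral_Re[symmetric, OF iB]) (auto intro!: Bochner_Integration.integral_cong simp: indicator_def)
  moreover have "Im (\<integral>\<omega>. W \<omega> * indicator B (X \<omega>) \<partial>M) = (\<integral>\<omega>. Im (W \<omega>) * indicator B (X \<omega>) \<partial>M)"
    by (subst integral_Im[symmetric, OF iB]) (auto intro!: Bochner_Integration.integral_cong simp: indicator_def)
  ultimately show ?thesis
    using main[of Re] main[of Im] by (simp add: complex_eq_iff)
qed


section \<open>Centred Gaussian laws, and independence from vanishing covariances\<close>

lemma (in prob_space) centered_gaussian_law:
  assumes "centered_gaussian M Y"
  obtains \<sigma> where "\<sigma> \<ge> 0" "distr M borel Y = distr std_normal_distribution borel (\<lambda>x. \<sigma> * x)"
    "Y \<in> borel_measurable M"
proof -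
  have Y[measurable]: "Y \<in> borel_measurable M" using assms by (simp add: centered_gaussian_def)
  interpret S: prob_space std_normal_distribution by (rule prob_space_normal_density) simp
  from assms consider "AE \<omega> in M. Y \<omega> = 0"
    | \<sigma> where "\<sigma> > 0" "distributed M lborel Y (\<lambda>x. ennreal (normal_density 0 \<sigma> x))"
    by (auto simp: centered_gaussian_def)
  then show ?thesis
  proof cases
    case 1
    have "distr M borel Y = distr M borel (\<lambda>_. 0)"
      by (rule distr_cong_AE) (use 1 in auto)
    also have "\<dots> = return borel 0" by (rule distr_const) simp
    also have "\<dots> = distr std_normal_distribution borel (\<lambda>x. 0 * x)"
      by (simp add: S.distr_const)
    finally show ?thesis using that[of 0] Y by simp
  next
    case (2 \<sigma>)
    then have "distributed M lborel (\<lambda>x. Y x / \<sigma>) std_normal_density"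
      using normal_standard_normal_convert[of \<sigma> Y 0] by simp
    then have "distr M lborel (\<lambda>x. Y x / \<sigma>) = std_normal_distribution"
      by (simp add: distributed_def)
    then have *: "distr M borel (\<lambda>x. Y x / \<sigma>) = distr std_normal_distribution borel (\<lambda>x. x)"
      by (metis (no_types, lifting) distr_cong distr_id2 sets_distr sets_lborel)
    have "distr M borel Y = distr (distr M borel (\<lambda>x. Y x / \<sigma>)) borel (\<lambda>x. \<sigma> * x)"
      by (subst distr_distr) (use 2 in \<open>auto simp: comp_def\<close>)
    also have "\<dots> = distr std_normal_distribution borel (\<lambda>x. \<sigma> * x)"
      unfolding * by (subst distr_distr) (auto simp: comp_def)
    finally show ?thesis using that[of \<sigma>] Y 2 by simp
  qed
qed

lemma std_normal_second_moment:
  "integrable std_normal_distribution (\<lambda>x. x\<^sup>2)" "(\<integral>x. x\<^sup>2 \<partial>std_normal_distribution) = 1"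
proof -
  have "has_bochner_integral lborel (\<lambda>x. std_normal_density x * x ^ (2 * 1)) (fact (2 * 1) / (2 ^ 1 * fact 1))"
    by (rule std_normal_moment_even)
  then have h: "has_bochner_integral lborel (\<lambda>x. std_normal_density x *\<^sub>R x\<^sup>2) 1" by simp
  show "integrable std_normal_distribution (\<lambda>x. x\<^sup>2)"
    by (subst integrable_density) (use h in \<open>auto simp: has_bochner_integral_iff\<close>)
  show "(\<integral>x. x\<^sup>2 \<partial>std_normal_distribution) = 1"
    by (subst integral_density) (use h in \<open>auto simp: has_bochner_integral_iff\<close>)
qed

lemma (in prob_space) centered_gaussian_law_var:
  assumes "centered_gaussian M Y"
  shows "integrable M (\<lambda>\<omega>. (Y \<omega>)\<^sup>2)"
    and "distr M borel Y = distr std_normal_distribution borel (\<lambda>x. sqrt (\<integral>\<omega>. (Y \<omega>)\<^sup>2 \<partial>M) * x)"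
    and "(\<integral>\<omega>. iexp (Y \<omega>) \<partial>M) = of_real (exp (- (\<integral>\<omega>. (Y \<omega>)\<^sup>2 \<partial>M) / 2))"
proof -
  obtain \<sigma> where s: "\<sigma> \<ge> 0" and law: "distr M borel Y = distr std_normal_distribution borel (\<lambda>x. \<sigma> * x)"
    and Y[measurable]: "Y \<in> borel_measurable M"
    by (rule centered_gaussian_law[OF assms])
  have "integrable (distr M borel Y) (\<lambda>x. x\<^sup>2)"
    unfolding law by (subst integrable_distr_eq) (auto simp: power_mult_distrib intro!: std_normal_second_moment)
  then show "integrable M (\<lambda>\<omega>. (Y \<omega>)\<^sup>2)" by (subst (asm) integrable_distr_eq) auto
  have "(\<integral>\<omega>. (Y \<omega>)\<^sup>2 \<partial>M) = (\<integral>x. x\<^sup>2 \<partial>distr M borel Y)" by (subst integral_distr) auto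
  also have "\<dots> = \<sigma>\<^sup>2"
    unfolding law by (subst integral_distr) (auto simp: power_mult_distrib std_normal_second_moment)
  finally have v: "(\<integral>\<omega>. (Y \<omega>)\<^sup>2 \<partial>M) = \<sigma>\<^sup>2" .
  show "distr M borel Y = distr std_normal_distribution borel (\<lambda>x. sqrt (\<integral>\<omega>. (Y \<omega>)\<^sup>2 \<partial>M) * x)"
    unfolding v using s law by simp
  have "(\<integral>\<omega>. iexp (Y \<omega>) \<partial>M) = (\<integral>x. iexp x \<partial>distr M borel Y)" by (subst integral_distr) auto
  also have "\<dots> = (\<integral>x. iexp (\<sigma> * x) \<partial>std_normal_distribution)"
    unfolding law by (subst integral_distr) auto
  also have "\<dots> = char std_normal_distribution \<sigma>" by (simp add: char_def)
  also have "\<dots> = of_real (exp (- \<sigma>\<^sup>2 / 2))" by (simp add: char_std_normal_distribution)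
  finally show "(\<integral>\<omega>. iexp (Y \<omega>) \<partial>M) = of_real (exp (- (\<integral>\<omega>. (Y \<omega>)\<^sup>2 \<partial>M) / 2))" unfolding v by simp
qed

lemma (in prob_space) centered_gaussian_cmult:
  assumes "centered_gaussian M Y" shows "centered_gaussian M (\<lambda>\<omega>. c * Y \<omega>)"
proof (cases "c = 0")
  case True
  then show ?thesis by (simp add: centered_gaussian_def)
next
  case False
  show ?thesis
    using assms normal_density_affine[of Y 0 _ c 0] False unfolding centered_gaussian_def
    by (auto simp: intro!: exI[of _ "\<bar>c\<bar> * _"])
qed

lemma integrable_mult_of_squares:
  fixes X Y :: "'a \<Rightarrow> real"
  assumes [measurable]: "X \<in> borel_measurable M" "Y \<in> borel_measurable M"
    and "integrable M (\<lambda>\<omega>. (X \<omega>)\<^sup>2)" "integrable M (\<lambda>\<omega>. (Y \<omega>)\<^sup>2)"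
  shows "integrable M (\<lambda>\<omega>. X \<omega> * Y \<omega>)"
proof (rule Bochner_Integration.integrable_bound)
  show "integrable M (\<lambda>\<omega>. (X \<omega>)\<^sup>2 + (Y \<omega>)\<^sup>2)" using assms by simp
  have "\<bar>x * y\<bar> \<le> x\<^sup>2 + y\<^sup>2" for x y :: real
    using sum_squares_bound[of "\<bar>x\<bar>" "\<bar>y\<bar>"] mult_nonneg_nonneg[of "\<bar>x\<bar>" "\<bar>y\<bar>"]
    unfolding abs_mult power2_abs mult.assoc by linarith
  then show "AE \<omega> in M. norm (X \<omega> * Y \<omega>) \<le> norm ((X \<omega>)\<^sup>2 + (Y \<omega>)\<^sup>2)" by simp
qed simp

text \<open>Without correlations the variance of a linear combination is the sum of the variances,
  so the joint characteristic function is a product. Independence follows without a multivariate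
  uniqueness theorem: the exponentials are replaced by indicators one coordinate at a time.\<close>

theorem (in prob_space) gaussian_uncorrelated_imp_indep:
  fixes X :: "'i \<Rightarrow> 'a \<Rightarrow> real"
  assumes fin: "finite I"
    and gauss: "\<And>a. centered_gaussian M (\<lambda>\<omega>. \<Sum>i\<in>I. a i * X i \<omega>)"
    and uncor: "\<And>i j. i \<in> I \<Longrightarrow> j \<in> I \<Longrightarrow> i \<noteq> j \<Longrightarrow> (\<integral>\<omega>. X i \<omega> * X j \<omega> \<partial>M) = 0"
  shows "indep_vars (\<lambda>_. borel) X I"
proof (cases "I = {}")
  case True
  then show ?thesis by (simp add: indep_vars_def indep_sets_def)
next
  case False
  have gi: "centered_gaussian M (X i)" if "i \<in> I" for i
    using gauss[of "\<lambda>j. if j = i then 1 else 0"] that fin by (simp add: if_distrib[of "\<lambda>x. x * _"] cong: if_cong)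
  have Xm[measurable]: "X i \<in> borel_measurable M" if "i \<in> I" for i
    using gi[OF that] by (simp add: centered_gaussian_def)
  have iXX: "integrable M (\<lambda>\<omega>. X i \<omega> * X j \<omega>)" if "i \<in> I" "j \<in> I" for i j
    by (intro integrable_mult_of_squares Xm that centered_gaussian_law_var(1) gi)
  have base: "(\<integral>\<omega>. (\<Prod>i\<in>I. iexp (t i * X i \<omega>)) \<partial>M) = (\<Prod>i\<in>I. \<integral>\<omega>. iexp (t i * X i \<omega>) \<partial>M)" for t
  proof -
    have var: "(\<integral>\<omega>. (\<Sum>i\<in>I. t i * X i \<omega>)\<^sup>2 \<partial>M) = (\<Sum>i\<in>I. \<integral>\<omega>. (t i * X i \<omega>)\<^sup>2 \<partial>M)"
    proof -
      have "(\<integral>\<omega>. (\<Sum>i\<in>I. t i * X i \<omega>)\<^sup>2 \<partial>M) = (\<integral>\<omega>. (\<Sum>i\<in>I. \<Sum>j\<in>I. (t i * t j) * (X i \<omega> * X j \<omega>)) \<partial>M)"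
        by (simp add: power2_eq_square sum_product mult.assoc mult.left_commute)
      also have "\<dots> = (\<Sum>i\<in>I. \<Sum>j\<in>I. (t i * t j) * (\<integral>\<omega>. X i \<omega> * X j \<omega> \<partial>M))"
        by (simp add: iXX)
      also have "\<dots> = (\<Sum>i\<in>I. \<Sum>j\<in>I. if j = i then (t i * t i) * (\<integral>\<omega>. X i \<omega> * X i \<omega> \<partial>M) else 0)"
        by (intro sum.cong refl) (auto simp: uncor)
      also have "\<dots> = (\<Sum>i\<in>I. \<integral>\<omega>. (t i * X i \<omega>)\<^sup>2 \<partial>M)"
        using fin iXX by (auto simp: power_mult_distrib power2_eq_square mult.assoc mult.left_commute intro!: sum.cong)
      finally show ?thesis .
    qed
    have "(\<integral>\<omega>. (\<Prod>i\<in>I. iexp (t i * X i \<omega>)) \<partial>M) = (\<integral>\<omega>. iexp (\<Sum>i\<in>I. t i * X i \<omega>) \<partial>M)"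
      using fin by (simp add: exp_sum sum_distrib_left)
    also have "\<dots> = of_real (exp (- (\<Sum>i\<in>I. \<integral>\<omega>. (t i * X i \<omega>)\<^sup>2 \<partial>M) / 2))"
      using centered_gaussian_law_var(3)[OF gauss[of t]] var by simp
    also have "\<dots> = (\<Prod>i\<in>I. of_real (exp (- (\<integral>\<omega>. (t i * X i \<omega>)\<^sup>2 \<partial>M) / 2)))"
      unfolding of_real_prod[symmetric] exp_sum[OF fin, symmetric] by (simp add: sum_negf sum_divide_distrib)
    also have "\<dots> = (\<Prod>i\<in>I. \<integral>\<omega>. iexp (t i * X i \<omega>) \<partial>M)"
      by (intro prod.cong refl) (rule centered_gaussian_law_var(3)[OF centered_gaussian_cmult[OF gi], symmetric])
    finally show ?thesis .
  qed
  \<comment> \<open>Interpolates between characteristic functions (\<open>J = {}\<close>, which is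
    \<open>base\<close>) and probabilities (\<open>J = I\<close>). Each induction step frees the
    frequency of one coordinate \<open>j\<close> and keeps the other factors in
    \<open>W\<close>.\<close>
  have Q: "(\<integral>\<omega>. (\<Prod>i\<in>J. indicator (B i) (X i \<omega>)) * (\<Prod>i\<in>I - J. iexp (t i * X i \<omega>)) \<partial>M) =
      (\<Prod>i\<in>J. of_real (prob (X i -` B i \<inter> space M))) * (\<Prod>i\<in>I - J. \<integral>\<omega>. iexp (t i * X i \<omega>) \<partial>M)"
    if J: "J \<subseteq> I" and B: "\<And>i. B i \<in> sets borel" for J B t
    using finite_subset[OF J fin] J
  proof (induction J arbitrary: t rule: finite_induct)
    case empty
    show ?case using base[of t] by simp
  next
    case (insert j J)
    have jI: "j \<in> I" and JI: "J \<subseteq> I" using insert by auto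
    define W :: "'a \<Rightarrow> complex" where
      "W \<omega> = (\<Prod>i\<in>J. indicator (B i) (X i \<omega>)) * (\<Prod>i\<in>I - insert j J. iexp (t i * X i \<omega>))" for \<omega>
    define c where "c = (\<Prod>i\<in>J. complex_of_real (prob (X i -` B i \<inter> space M))) *
      (\<Prod>i\<in>I - insert j J. \<integral>\<omega>. iexp (t i * X i \<omega>) \<partial>M)"
    have IJ: "I - J = insert j (I - insert j J)" using jI insert by auto
    have "(\<integral>\<omega>. W \<omega> * indicator (B j) (X j \<omega>) \<partial>M) = c * of_real (prob (X j -` B j \<inter> space M))"
    proof (rule char_factor_imp_indicator_factor)
      show "X j \<in> borel_measurable M" by (rule Xm[OF jI])
      have "\<And>i. i \<in> J \<Longrightarrow> (\<lambda>\<omega>. indicator (B i) (X i \<omega>) :: complex) \<in> borel_measurable M"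
        using B JI by (intro measurable_compose[OF Xm]) auto
      moreover have "\<And>i. i \<in> I - insert j J \<Longrightarrow> (\<lambda>\<omega>. iexp (t i * X i \<omega>)) \<in> borel_measurable M"
        by (intro measurable_compose[OF Xm]) auto
      ultimately show "W \<in> borel_measurable M" unfolding W_def[abs_def]
        by (intro borel_measurable_times[OF borel_measurable_prod borel_measurable_prod])
      have "norm (\<Prod>i\<in>J. indicator (B i) (X i \<omega>) :: complex) \<le> 1" for \<omega>
        unfolding prod_norm[symmetric] by (intro prod_le_1) (auto simp: indicator_def)
      moreover have "norm (\<Prod>i\<in>I - insert j J. iexp (t i * X i \<omega>)) = 1" for \<omega>
        unfolding prod_norm[symmetric] by simp
      ultimately show "norm (W \<omega>) \<le> 1" for \<omega> unfolding W_def by (simp add: norm_mult)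
      show "B j \<in> sets borel" by (rule B)
      fix s
      have "(\<integral>\<omega>. W \<omega> * iexp (s * X j \<omega>) \<partial>M) =
        (\<integral>\<omega>. (\<Prod>i\<in>J. indicator (B i) (X i \<omega>)) * (\<Prod>i\<in>I - J. iexp ((t(j := s)) i * X i \<omega>)) \<partial>M)"
        unfolding IJ using fin by (intro Bochner_Integration.integral_cong refl)
          (auto simp: W_def mult.assoc mult.commute intro!: prod.cong)
      also have "\<dots> = c * (\<integral>\<omega>. iexp (s * X j \<omega>) \<partial>M)"
        unfolding insert.IH[OF JI] unfolding IJ c_def using fin by (auto simp: mult.assoc mult.commute intro!: prod.cong)
      finally show "(\<integral>\<omega>. W \<omega> * iexp (s * X j \<omega>) \<partial>M) = c * (\<integral>\<omega>. iexp (s * X j \<omega>) \<partial>M)" .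
    qed
    then show ?case unfolding W_def c_def using insert.hyps by (simp add: mult.assoc mult.commute mult.left_commute)
  qed
  show ?thesis unfolding indep_vars_def2
  proof (intro conjI ballI)
    show "indep_sets (\<lambda>i. {X i -` A \<inter> space M |A. A \<in> sets borel}) I"
    proof (subst indep_sets_finite[OF False fin])
      show "{X i -` A \<inter> space M |A. A \<in> sets borel} \<subseteq> events" if "i \<in> I" for i
        using Xm[OF that] by (auto intro: measurable_sets)
      show "space M \<in> {X i -` A \<inter> space M |A. A \<in> sets borel}" if "i \<in> I" for i
        by (rule CollectI, rule exI[of _ UNIV]) auto
      show "\<forall>A\<in>Pi I (\<lambda>i. {X i -` A \<inter> space M |A. A \<in> sets borel}). prob (\<Inter>j\<in>I. A j) = (\<Prod>j\<in>I. prob (A j))"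
      proof
        fix A assume "A \<in> Pi I (\<lambda>i. {X i -` A \<inter> space M |A. A \<in> sets borel})"
        then have "\<forall>i. \<exists>B. B \<in> sets borel \<and> (i \<in> I \<longrightarrow> A i = X i -` B \<inter> space M)"
          by (auto simp: Pi_iff) (metis sets.empty_sets)
        then obtain B where B: "\<And>i. B i \<in> sets borel" "\<And>i. i \<in> I \<Longrightarrow> A i = X i -` B i \<inter> space M"
          by metis
        have eq: "(\<Prod>i\<in>I. indicator (B i) (X i \<omega>)) = (indicator (\<Inter>j\<in>I. A j) \<omega> :: complex)" if "\<omega> \<in> space M" for \<omega>
        proof (cases "\<forall>i\<in>I. X i \<omega> \<in> B i")
          case True then show ?thesis using B that by simp
        next
          case F: False then show ?thesis using B that fin by (auto simp: indicator_def)
        qed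
        have ev: "(\<Inter>j\<in>I. A j) \<in> events"
          using fin False B Xm by (intro sets.finite_INT) (auto intro: measurable_sets)
        have "prob (\<Inter>j\<in>I. A j) = (\<integral>\<omega>. indicator (\<Inter>j\<in>I. A j) \<omega> \<partial>M)"
          using ev by simp
        then have "complex_of_real (prob (\<Inter>j\<in>I. A j)) = (\<integral>\<omega>. complex_of_real (indicator (\<Inter>j\<in>I. A j) \<omega>) \<partial>M)"
          by (simp only: integral_complex_of_real)
        also have "\<dots> = (\<integral>\<omega>. (\<Prod>i\<in>I. indicator (B i) (X i \<omega>)) \<partial>M)"
          by (intro Bochner_Integration.integral_cong refl) (simp only: eq of_real_indicator)
        also have "\<dots> = of_real (\<Prod>j\<in>I. prob (A j))"
          using Q[of I B "\<lambda>_. 0"] B by simp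
        finally show "prob (\<Inter>j\<in>I. A j) = (\<Prod>j\<in>I. prob (A j))" using of_real_eq_iff by blast
      qed
    qed
  qed (use Xm in auto)
qed


text \<open>Discrete reflection principle. Among the walks that end at \<open>b\<close> or above,
  those that become negative are sorted by the first such index; flipping all later increments
  preserves the law and sends them to walks that end at \<open>- b\<close> or below.\<close>

lemma (in prob_space) reflection_lower_bound:
  fixes \<xi> :: "nat \<Rightarrow> 'a \<Rightarrow> real"
  assumes ind: "indep_vars (\<lambda>_. borel) \<xi> {..<N}"
    and sym: "\<And>i. i < N \<Longrightarrow> distr M borel (\<lambda>\<omega>. - \<xi> i \<omega>) = distr M borel (\<xi> i)"
    and ab: "a \<ge> 0" "b \<ge> 0"
  shows "prob {\<omega> \<in> space M. a + (\<Sum>i<N. \<xi> i \<omega>) \<ge> b} - prob {\<omega> \<in> space M. a + (\<Sum>i<N. \<xi> i \<omega>) \<le> - b}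
    \<le> prob {\<omega> \<in> space M. (\<forall>k\<le>N. a + (\<Sum>i<k. \<xi> i \<omega>) \<ge> 0) \<and> a + (\<Sum>i<N. \<xi> i \<omega>) \<ge> b}"
proof (cases "N = 0")
  case True
  then show ?thesis using ab by (simp add: measure_nonneg)
next
  case False
  define I where "I = {..<N}"
  have I: "I \<noteq> {}" "finite I" using False by (auto simp: I_def lessThan_empty_iff)
  define s where "s k f = a + (\<Sum>i\<in>{..<k} \<inter> I. f i)" for k and f :: "nat \<Rightarrow> real"
  define X where "X \<omega> = (\<lambda>i\<in>I. \<xi> i \<omega>)" for \<omega>
  let ?P = "PiM I (\<lambda>_. borel :: real measure)"
  have \<xi>m: "i \<in> I \<Longrightarrow> \<xi> i \<in> borel_measurable M" for i
    using ind by (auto simp: indep_vars_def I_def)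
  have Xm[measurable]: "X \<in> measurable M ?P"
    unfolding X_def by (intro measurable_restrict \<xi>m)
  have sm[measurable]: "s k \<in> borel_measurable ?P" for k
    unfolding s_def[abs_def] by (intro borel_measurable_add borel_measurable_sum measurable_component_singleton) auto
  have sX: "s k (X \<omega>) = a + (\<Sum>i<k. \<xi> i \<omega>)" if "k \<le> N" for k \<omega>
    unfolding s_def X_def using that by (intro arg_cong2[of _ _ _ _ "(+)"] refl sum.cong) (auto simp: I_def)
  define T where "T k \<omega> \<longleftrightarrow> (\<forall>j<k. s j (X \<omega>) \<ge> 0) \<and> s k (X \<omega>) < 0" for k \<omega>
  have Tm[measurable]: "Measurable.pred M (T k)" for k unfolding T_def[abs_def] by measurable
  have flip: "prob {\<omega> \<in> space M. T k \<omega> \<and> s N (X \<omega>) \<ge> b} \<le> prob {\<omega> \<in> space M. T k \<omega> \<and> s N (X \<omega>) \<le> - b}"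
    if k: "k \<le> N" for k
  proof -
    \<comment> \<open>The partial sum up to \<open>k\<close> only contains increments with index
      below \<open>k\<close>, so flipping from \<open>k\<close> on leaves it unchanged and reflects
      the endpoint to \<open>2 * s k - s N\<close>.\<close>
    define Y where "Y i \<omega> = (if i < k then \<xi> i \<omega> else - \<xi> i \<omega>)" for i \<omega>
    have Y: "Y i = (\<lambda>\<omega>. (if i < k then (\<lambda>x. x) else uminus) (\<xi> i \<omega>))" for i
      by (auto simp: Y_def)
    have indY: "indep_vars (\<lambda>_. borel) Y I"
      unfolding Y I_def by (rule indep_vars_compose2[OF ind]) auto
    have Ym: "i \<in> I \<Longrightarrow> Y i \<in> borel_measurable M" for i
      using indY by (auto simp: indep_vars_def)
    have "distr M ?P (\<lambda>\<omega>. \<lambda>i\<in>I. Y i \<omega>) = PiM I (\<lambda>i. distr M borel (Y i))"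
      using indY indep_vars_iff_distr_eq_PiM'[OF I(1) Ym] by simp
    also have "\<dots> = PiM I (\<lambda>i. distr M borel (\<xi> i))"
    proof (intro PiM_cong refl)
      fix i assume "i \<in> I"
      then show "distr M borel (Y i) = distr M borel (\<xi> i)"
        unfolding Y_def[abs_def] I_def using sym[of i] by (cases "i < k") auto
    qed
    also have "\<dots> = distr M ?P X"
      using ind indep_vars_iff_distr_eq_PiM'[OF I(1) \<xi>m] by (simp add: X_def[abs_def] I_def)
    finally have law: "distr M ?P (\<lambda>\<omega>. \<lambda>i\<in>I. Y i \<omega>) = distr M ?P X" .
    define A where "A = {f \<in> space ?P. (\<forall>j<k. s j f \<ge> 0) \<and> s k f < 0 \<and> s N f \<ge> b}"
    have A[measurable]: "A \<in> sets ?P" unfolding A_def by measurable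
    have sY: "s j (\<lambda>i\<in>I. Y i \<omega>) = s j (X \<omega>)" if "j \<le> k" for j \<omega>
      unfolding s_def X_def using that by (intro arg_cong2[of _ _ _ _ "(+)"] refl sum.cong) (auto simp: Y_def)
    have sYN: "s N (\<lambda>i\<in>I. Y i \<omega>) = 2 * s k (X \<omega>) - s N (X \<omega>)" for \<omega>
    proof -
      have split: "s N f = s k f + (\<Sum>i\<in>{k..<N}. f i)" for f
      proof -
        have "sum f {..<N} = sum f {..<k} + sum f {k..<N}"
          using sum.atLeastLessThan_concat[of 0 k N f] k by (simp add: lessThan_atLeast0)
        moreover have "{..<N} \<inter> I = {..<N}" "{..<k} \<inter> I = {..<k}" using k by (auto simp: I_def)
        ultimately show ?thesis unfolding s_def by simp
      qed
      have "(\<Sum>i\<in>{k..<N}. (\<lambda>i\<in>I. Y i \<omega>) i) = - (\<Sum>i\<in>{k..<N}. X \<omega> i)"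
        unfolding sum_negf[symmetric] by (intro sum.cong) (auto simp: X_def Y_def I_def)
      then show ?thesis using split[of "\<lambda>i\<in>I. Y i \<omega>"] split[of "X \<omega>"] sY[of k \<omega>] by simp
    qed
    have sp: "X \<omega> \<in> space ?P" "(\<lambda>i\<in>I. Y i \<omega>) \<in> space ?P" for \<omega>
      by (auto simp: X_def space_PiM)
    have "prob {\<omega> \<in> space M. T k \<omega> \<and> s N (X \<omega>) \<ge> b} = measure (distr M ?P X) A"
      by (subst measure_distr) (auto simp: A_def T_def sp intro!: arg_cong[of _ _ prob])
    also have "\<dots> = prob {\<omega> \<in> space M. T k \<omega> \<and> 2 * s k (X \<omega>) - s N (X \<omega>) \<ge> b}"
      unfolding law[symmetric] using Ym
      by (subst measure_distr) (auto simp: A_def T_def sp sYN sY intro!: arg_cong[of _ _ prob] measurable_restrict)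
    \<comment> \<open>Only an inequality, because the walk overshoots: \<open>s k < 0\<close> puts
      the reflected endpoint below \<open>- b\<close> rather than at it.\<close>
    also have "\<dots> \<le> prob {\<omega> \<in> space M. T k \<omega> \<and> s N (X \<omega>) \<le> - b}"
      by (intro finite_measure_mono) (auto simp: T_def)
    finally show ?thesis .
  qed
  define G where "G = {\<omega> \<in> space M. (\<forall>k\<le>N. s k (X \<omega>) \<ge> 0) \<and> s N (X \<omega>) \<ge> b}"
  have Gm[measurable]: "G \<in> events" unfolding G_def by measurable
  have "{\<omega> \<in> space M. s N (X \<omega>) \<ge> b} \<subseteq> G \<union> (\<Union>k\<le>N. {\<omega> \<in> space M. T k \<omega> \<and> s N (X \<omega>) \<ge> b})"
  proof
    fix \<omega> assume w: "\<omega> \<in> {\<omega> \<in> space M. s N (X \<omega>) \<ge> b}"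
    show "\<omega> \<in> G \<union> (\<Union>k\<le>N. {\<omega> \<in> space M. T k \<omega> \<and> s N (X \<omega>) \<ge> b})"
    proof (cases "\<exists>k\<le>N. s k (X \<omega>) < 0")
      case True
      define k where "k = (LEAST k. s k (X \<omega>) < 0)"
      obtain k' where k': "k' \<le> N" "s k' (X \<omega>) < 0" using True by auto
      have "s k (X \<omega>) < 0" unfolding k_def using k'(2) by (rule LeastI)
      moreover have "k \<le> N" using k' Least_le[of "\<lambda>k. s k (X \<omega>) < 0" k'] by (simp add: k_def)
      moreover have "\<forall>j<k. s j (X \<omega>) \<ge> 0" using not_less_Least by (fastforce simp: k_def not_less)
      ultimately show ?thesis using w by (auto simp: T_def)
    next
      case False then show ?thesis using w by (auto simp: G_def not_less)
    qed
  qed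
  then have "prob {\<omega> \<in> space M. s N (X \<omega>) \<ge> b} \<le> prob (G \<union> (\<Union>k\<le>N. {\<omega> \<in> space M. T k \<omega> \<and> s N (X \<omega>) \<ge> b}))"
    by (intro finite_measure_mono) measurable
  also have "\<dots> \<le> prob G + prob (\<Union>k\<le>N. {\<omega> \<in> space M. T k \<omega> \<and> s N (X \<omega>) \<ge> b})"
    by (intro measure_Un_le) measurable
  also have "prob (\<Union>k\<le>N. {\<omega> \<in> space M. T k \<omega> \<and> s N (X \<omega>) \<ge> b}) \<le> (\<Sum>k\<le>N. prob {\<omega> \<in> space M. T k \<omega> \<and> s N (X \<omega>) \<ge> b})"
    by (intro finite_measure_subadditive_finite) auto
  also have "\<dots> \<le> (\<Sum>k\<le>N. prob {\<omega> \<in> space M. T k \<omega> \<and> s N (X \<omega>) \<le> - b})"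
    by (intro sum_mono flip) auto
  also have "\<dots> = prob (\<Union>k\<le>N. {\<omega> \<in> space M. T k \<omega> \<and> s N (X \<omega>) \<le> - b})"
  proof (intro finite_measure_finite_Union[symmetric])
    show "disjoint_family_on (\<lambda>k. {\<omega> \<in> space M. T k \<omega> \<and> s N (X \<omega>) \<le> - b}) {..N}"
      unfolding disjoint_family_on_def T_def
    proof (intro ballI impI)
      fix m n :: nat assume "m \<noteq> n"
      then consider "m < n" | "n < m" by linarith
      then show "{\<omega> \<in> space M. ((\<forall>j<m. 0 \<le> s j (X \<omega>)) \<and> s m (X \<omega>) < 0) \<and> s N (X \<omega>) \<le> - b} \<inter>
        {\<omega> \<in> space M. ((\<forall>j<n. 0 \<le> s j (X \<omega>)) \<and> s n (X \<omega>) < 0) \<and> s N (X \<omega>) \<le> - b} = {}"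
        by cases (auto simp: not_less[symmetric])
    qed
  qed auto
  also have "\<dots> \<le> prob {\<omega> \<in> space M. s N (X \<omega>) \<le> - b}"
    by (intro finite_measure_mono) auto
  finally have fin: "prob {\<omega> \<in> space M. s N (X \<omega>) \<ge> b} - prob {\<omega> \<in> space M. s N (X \<omega>) \<le> - b} \<le> prob G"
    by simp
  have "G = {\<omega> \<in> space M. (\<forall>k\<le>N. a + (\<Sum>i<k. \<xi> i \<omega>) \<ge> 0) \<and> a + (\<Sum>i<N. \<xi> i \<omega>) \<ge> b}"
    unfolding G_def by (auto simp: sX)
  then show ?thesis using fin by (simp add: sX)
qed

text \<open>On \<open>[0, 2]\<close> the density is at least its value at 2. This is the origin of
  the constant \<open>std_normal_density 2\<close> in all later bounds.\<close>

lemma std_normal_interval: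
  assumes "0 \<le> u" "0 \<le> \<delta>" "u + \<delta> \<le> 2"
  shows "measure std_normal_distribution {u..<u + \<delta>} \<ge> \<delta> * std_normal_density 2"
proof -
  interpret S: prob_space std_normal_distribution by (rule prob_space_normal_density) simp
  have "ennreal (\<delta> * std_normal_density 2) = (\<integral>\<^sup>+x. ennreal (std_normal_density 2) * indicator {u..<u+\<delta>} x \<partial>lborel)"
    using assms by (simp add: nn_integral_cmult_indicator ennreal_mult'[symmetric] mult.commute)
  also have "\<dots> \<le> (\<integral>\<^sup>+x. ennreal (std_normal_density x) * indicator {u..<u+\<delta>} x \<partial>lborel)"
  proof (intro nn_integral_mono)
    fix x
    show "ennreal (std_normal_density 2) * indicator {u..<u+\<delta>} x \<le> ennreal (std_normal_density x) * indicator {u..<u+\<delta>} x"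
    proof (cases "x \<in> {u..<u+\<delta>}")
      case True
      then have "x\<^sup>2 \<le> 2\<^sup>2" using assms by (intro power_mono) auto
      then have "std_normal_density 2 \<le> std_normal_density x"
        by (auto simp: std_normal_density_def intro!: divide_right_mono)
      then show ?thesis using True by (simp add: ennreal_leI)
    qed simp
  qed
  also have "\<dots> = emeasure std_normal_distribution {u..<u + \<delta>}"
    by (subst emeasure_density) auto
  finally show ?thesis using assms by (simp add: S.emeasure_eq_measure)
qed


lemma distr_uminus_std_normal:
  "distr std_normal_distribution borel uminus = distr std_normal_distribution borel (\<lambda>x. x)"
proof -
  interpret S: prob_space std_normal_distribution by (rule prob_space_normal_density) simp
  have "distributed std_normal_distribution lborel (\<lambda>x. x) (normal_density 0 1)"
    by (auto simp: distributed_def intro!: distr_id2)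
  from S.normal_density_affine[OF this, of "-1" 0]
  have "distr std_normal_distribution lborel uminus = std_normal_distribution"
    by (simp add: distributed_def)
  moreover have "distr std_normal_distribution lborel uminus = distr std_normal_distribution borel uminus"
    by (rule distr_cong) auto
  moreover have "distr std_normal_distribution borel (\<lambda>x. x) = std_normal_distribution"
    by (rule distr_id2) simp
  ultimately show ?thesis by simp
qed

lemma (in prob_space) centered_gaussian_distr_uminus:
  assumes "centered_gaussian M Y"
  shows "distr M borel (\<lambda>\<omega>. - Y \<omega>) = distr M borel Y"
proof -
  obtain \<sigma> where law: "distr M borel Y = distr std_normal_distribution borel (\<lambda>x. \<sigma> * x)"
    and Y[measurable]: "Y \<in> borel_measurable M"
    by (rule centered_gaussian_law[OF assms])
  have "distr M borel (\<lambda>\<omega>. - Y \<omega>) = distr (distr M borel Y) borel uminus"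
    by (subst distr_distr) (auto simp: comp_def)
  also have "\<dots> = distr (distr std_normal_distribution borel uminus) borel (\<lambda>x. \<sigma> * x)"
    unfolding law by (subst (1 2) distr_distr) (auto simp: comp_def)
  also have "\<dots> = distr M borel Y"
    unfolding distr_uminus_std_normal law by (subst distr_distr) (auto simp: comp_def)
  finally show ?thesis .
qed

text \<open>By symmetry the second probability is that of \<open>S \<ge> b + a\<close>, so the
  difference is the mass of a window of half-width \<open>a\<close> around \<open>b\<close>. In
  units of \<open>\<sigma>\<close> the window contains an interval of length \<open>\<delta>\<close>
  to the right of \<open>b / \<sigma>\<close>, and that interval lies in
  \<open>[0, 2]\<close>.\<close>

lemma (in prob_space) centered_gaussian_two_sided:
  assumes S: "centered_gaussian M S" and v: "(\<integral>\<omega>. (S \<omega>)\<^sup>2 \<partial>M) = \<sigma>\<^sup>2" "\<sigma> > 0"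
    and b: "0 \<le> b" "b \<le> \<sigma>" and \<delta>: "0 \<le> \<delta>" "\<delta> \<le> 1" "\<delta> * \<sigma> \<le> a"
  shows "\<delta> * std_normal_density 2 \<le>
    prob {\<omega> \<in> space M. a + S \<omega> \<ge> b} - prob {\<omega> \<in> space M. a + S \<omega> \<le> - b}"
proof -
  interpret N: prob_space std_normal_distribution by (rule prob_space_normal_density) simp
  have Sm[measurable]: "S \<in> borel_measurable M" using S by (simp add: centered_gaussian_def)
  have law: "distr M borel S = distr std_normal_distribution borel (\<lambda>x. \<sigma> * x)"
    using centered_gaussian_law_var(2)[OF S] v by simp
  have eq: "prob {\<omega> \<in> space M. S \<omega> \<in> A} = N.prob {x. \<sigma> * x \<in> A}" if "A \<in> sets borel" for A
  proof -
    have "prob {\<omega> \<in> space M. S \<omega> \<in> A} = measure (distr M borel S) A"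
      using that by (subst measure_distr) (auto intro!: arg_cong[of _ _ prob])
    also have "\<dots> = N.prob {x. \<sigma> * x \<in> A}"
      unfolding law using that by (subst measure_distr) (auto simp: vimage_def)
    finally show ?thesis .
  qed
  have 1: "prob {\<omega> \<in> space M. a + S \<omega> \<ge> b} = N.prob {(b - a) / \<sigma>..}"
  proof -
    have "{\<omega> \<in> space M. a + S \<omega> \<ge> b} = {\<omega> \<in> space M. S \<omega> \<in> {b - a..}}" by auto
    moreover have "{x. \<sigma> * x \<in> {b - a..}} = {(b - a) / \<sigma>..}" using v by (auto simp: field_simps)
    ultimately show ?thesis using eq[of "{b - a..}"] by simp
  qed
  have 2: "prob {\<omega> \<in> space M. a + S \<omega> \<le> - b} = N.prob {..(- b - a) / \<sigma>}"
  proof -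
    have "{\<omega> \<in> space M. a + S \<omega> \<le> - b} = {\<omega> \<in> space M. S \<omega> \<in> {..- b - a}}" by auto
    moreover have "{x. \<sigma> * x \<in> {..- b - a}} = {..(- b - a) / \<sigma>}" using v by (auto simp: field_simps)
    ultimately show ?thesis using eq[of "{..- b - a}"] by simp
  qed
  have 3: "N.prob {..(- b - a) / \<sigma>} = N.prob {(b + a) / \<sigma>..}"
  proof -
    have "measure (distr std_normal_distribution borel uminus) {..(- b - a) / \<sigma>} =
      measure (distr std_normal_distribution borel (\<lambda>x. x)) {..(- b - a) / \<sigma>}"
      by (simp add: distr_uminus_std_normal)
    moreover have "uminus -` {..(- b - a) / \<sigma>} = {(b + a) / \<sigma>..}" using v by (auto simp: field_simps)
    ultimately show ?thesis by (simp add: measure_distr)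
  qed
  have "\<delta> * std_normal_density 2 \<le> N.prob {b / \<sigma>..<b / \<sigma> + \<delta>}"
  proof (intro std_normal_interval)
    have "b / \<sigma> \<le> 1" using b v by simp
    then show "b / \<sigma> + \<delta> \<le> 2" using \<delta> by simp
  qed (use b v \<delta> in auto)
  also have "\<dots> \<le> N.prob ({(b - a) / \<sigma>..} - {(b + a) / \<sigma>..})"
  proof (intro N.finite_measure_mono)
    have "0 \<le> a" using \<delta> v by (meson mult_nonneg_nonneg less_imp_le order_trans)
    moreover have "\<delta> \<le> a / \<sigma>" using \<delta> v by (simp add: field_simps)
    ultimately show "{b / \<sigma>..<b / \<sigma> + \<delta>} \<subseteq> {(b - a) / \<sigma>..} - {(b + a) / \<sigma>..}"
      using v by (auto simp: add_divide_distrib diff_divide_distrib)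
  qed simp
  also have "\<dots> = N.prob {(b - a) / \<sigma>..} - N.prob {(b + a) / \<sigma>..}"
  proof (intro N.finite_measure_Diff)
    have "0 \<le> a" using \<delta> v by (meson mult_nonneg_nonneg less_imp_le order_trans)
    then have "(b - a) / \<sigma> \<le> (b + a) / \<sigma>" using v by (intro divide_right_mono) auto
    then show "{(b + a) / \<sigma>..} \<subseteq> {(b - a) / \<sigma>..}" by auto
  qed auto
  finally show ?thesis unfolding 1 2 3 .
qed

subsection \<open>Survival of open clusters in a regular tree\<close>

text \<open>\<open>\<eta> w\<close> is the state of the edge between \<open>w\<close> and its
  parent. The recursion asks for a path of open edges through \<open>L\<close> generations below
  \<open>v\<close>; the state of \<open>v\<close> itself does not enter.\<close>

primrec reach :: "nat \<Rightarrow> (nat list \<Rightarrow> bool) \<Rightarrow> nat \<Rightarrow> nat list \<Rightarrow> bool" where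
  "reach d \<eta> 0 v \<longleftrightarrow> True"
| "reach d \<eta> (Suc L) v \<longleftrightarrow> (\<exists>i<d. \<eta> (i # v) \<and> reach d \<eta> L (i # v))"

definition descendants :: "nat \<Rightarrow> nat \<Rightarrow> nat list \<Rightarrow> nat list set" where
  "descendants d L v = (\<lambda>u. u @ v) ` {u. set u \<subseteq> {..<d} \<and> length u \<le> L}"

lemma finite_descendants: "finite (descendants d L v)"
  unfolding descendants_def by (intro finite_imageI finite_lists_length_le) auto

lemma self_in_descendants: "v \<in> descendants d L v"
  unfolding descendants_def by (auto intro!: image_eqI[of _ _ "[]"])

lemma descendants_child: "i < d \<Longrightarrow> descendants d L (i # v) \<subseteq> descendants d (Suc L) v - {v}"
  unfolding descendants_def by (auto intro!: image_eqI[of _ _ "_ @ [i]"])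

lemma descendants_disjoint_children:
  "i \<noteq> j \<Longrightarrow> descendants d L (i # v) \<inter> descendants d L (j # v) = {}"
  unfolding descendants_def by (auto simp: append_eq_append_conv2 Cons_eq_append_conv)

lemma reach_cong:
  "(\<And>w. w \<in> descendants d L v - {v} \<Longrightarrow> \<eta> w = \<eta>' w) \<Longrightarrow> reach d \<eta> L v = reach d \<eta>' L v"
proof (induction L arbitrary: v)
  case (Suc L)
  have "\<eta> (i # v) = \<eta>' (i # v) \<and> reach d \<eta> L (i # v) = reach d \<eta>' L (i # v)" if "i < d" for i
  proof
    show "\<eta> (i # v) = \<eta>' (i # v)"
      using Suc.prems descendants_child[OF that, of L v] self_in_descendants[of "i # v" d L] by blast
    show "reach d \<eta> L (i # v) = reach d \<eta>' L (i # v)"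
      using Suc.prems descendants_child[OF that, of L v] by (intro Suc.IH) blast
  qed
  then show ?case by auto
qed simp

text \<open>Independence of events that are determined by disjoint finite blocks of independent
  Boolean variables.\<close>

lemma (in prob_space) prob_all_blocks:
  fixes \<eta> :: "'i \<Rightarrow> 'a \<Rightarrow> bool" and P :: "'c \<Rightarrow> ('i \<Rightarrow> bool) \<Rightarrow> bool"
  assumes ind: "indep_vars (\<lambda>_. count_space UNIV) \<eta> V" and C: "finite C"
    and K: "\<And>c. c \<in> C \<Longrightarrow> K c \<subseteq> V" "\<And>c. c \<in> C \<Longrightarrow> finite (K c)" "disjoint_family_on K C"
    and P: "\<And>c f g. c \<in> C \<Longrightarrow> (\<And>v. v \<in> K c \<Longrightarrow> f v = g v) \<Longrightarrow> P c f = P c g"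
  shows "prob {\<omega> \<in> space M. \<forall>c\<in>C. P c (\<lambda>v. \<eta> v \<omega>)} = (\<Prod>c\<in>C. prob {\<omega> \<in> space M. P c (\<lambda>v. \<eta> v \<omega>)})"
proof (cases "C = {}")
  case True then show ?thesis by (simp add: prob_space)
next
  case False
  let ?B = "\<lambda>_. count_space (UNIV :: bool set)"
  \<comment> \<open>A finite product of discrete Boolean spaces has only finitely many points, each
    of them measurable, so every predicate on it is measurable.\<close>
  have m: "P c \<in> measurable (PiM (K c) ?B) (count_space UNIV)" if c: "c \<in> C" for c
  proof -
    have fs: "finite (space (PiM (K c) ?B))"
      using K(2)[OF c] by (simp add: space_PiM finite_PiE)
    have all: "A \<in> sets (PiM (K c) ?B)" if A: "A \<subseteq> space (PiM (K c) ?B)" for A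
    proof -
      have "{f} \<in> sets (PiM (K c) ?B)" if "f \<in> A" for f
      proof -
        have "f \<in> extensional (K c)" using that A by (auto simp: space_PiM PiE_def)
        then have "{f} = PiE (K c) (\<lambda>v. {f v})" by (metis PiE_singleton)
        then show ?thesis using K(2)[OF c] by (simp add: sets_PiM_I_finite)
      qed
      then have "(\<Union>f\<in>A. {f}) \<in> sets (PiM (K c) ?B)"
        using finite_subset[OF A fs] by (intro sets.finite_UN) auto
      then show ?thesis by simp
    qed
    show ?thesis by (intro measurableI all) auto
  qed
  have "indep_vars (\<lambda>_. count_space UNIV) (\<lambda>c \<omega>. P c (restrict (\<lambda>v. \<eta> v \<omega>) (K c))) C"
    by (rule indep_vars_compose2[OF indep_vars_restrict[OF ind K(1) K(3)] m])
  then have iv: "indep_vars (\<lambda>_. count_space UNIV) (\<lambda>c \<omega>. P c (\<lambda>v. \<eta> v \<omega>)) C"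
    by (rule indep_vars_cong[THEN iffD1, rotated -1]) (auto intro!: ext P)
  have "prob (\<Inter>c\<in>C. (\<lambda>\<omega>. P c (\<lambda>v. \<eta> v \<omega>)) -` {True} \<inter> space M) =
      (\<Prod>c\<in>C. prob ((\<lambda>\<omega>. P c (\<lambda>v. \<eta> v \<omega>)) -` {True} \<inter> space M))"
    by (rule indep_varsD_finite[OF iv False C]) auto
  moreover have "(\<Inter>c\<in>C. (\<lambda>\<omega>. P c (\<lambda>v. \<eta> v \<omega>)) -` {True} \<inter> space M) = {\<omega> \<in> space M. \<forall>c\<in>C. P c (\<lambda>v. \<eta> v \<omega>)}"
    using False by auto
  moreover have "(\<lambda>\<omega>. P c (\<lambda>v. \<eta> v \<omega>)) -` {True} \<inter> space M = {\<omega> \<in> space M. P c (\<lambda>v. \<eta> v \<omega>)}" for c by auto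
  ultimately show ?thesis by simp
qed

lemma reach_measurable:
  assumes "\<And>w. w \<in> descendants d L v - {v} \<Longrightarrow> Measurable.pred M (\<eta> w)"
  shows "Measurable.pred M (\<lambda>\<omega>. reach d (\<lambda>w. \<eta> w \<omega>) L v)"
  using assms
proof (induction L arbitrary: v)
  case (Suc L)
  have "Measurable.pred M (\<lambda>\<omega>. \<eta> (i # v) \<omega> \<and> reach d (\<lambda>w. \<eta> w \<omega>) L (i # v))" if "i < d" for i
  proof -
    have "Measurable.pred M (\<eta> (i # v))"
      using Suc.prems descendants_child[OF that, of L v] self_in_descendants[of "i # v" d L] by blast
    moreover have "Measurable.pred M (\<lambda>\<omega>. reach d (\<lambda>w. \<eta> w \<omega>) L (i # v))"
      using Suc.prems descendants_child[OF that, of L v] by (intro Suc.IH) blast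
    ultimately show ?thesis by measurable
  qed
  then have "Measurable.pred M (\<lambda>\<omega>. \<exists>i\<in>{..<d}. \<eta> (i # v) \<omega> \<and> reach d (\<lambda>w. \<eta> w \<omega>) L (i # v))"
    by (intro pred_intros_finite) auto
  moreover have "(\<lambda>\<omega>. reach d (\<lambda>w. \<eta> w \<omega>) (Suc L) v) =
      (\<lambda>\<omega>. \<exists>i\<in>{..<d}. \<eta> (i # v) \<omega> \<and> reach d (\<lambda>w. \<eta> w \<omega>) L (i # v))" by auto
  ultimately show ?case by (simp only:)
qed simp

text \<open>Blocks are used twice: first the descendant sets of the different \<open>c\<close>,
  then, for each \<open>c\<close>, the variable at \<open>c\<close> against those strictly below it,
  on which \<open>reach\<close> depends.\<close>

lemma (in prob_space) prob_no_reach: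
  assumes ind: "indep_vars (\<lambda>_. count_space UNIV) \<eta> V" and C: "finite C"
    and D: "\<And>c. c \<in> C \<Longrightarrow> descendants d L c \<subseteq> V"
    and disj: "disjoint_family_on (descendants d L) C"
  shows "prob {\<omega> \<in> space M. \<forall>c\<in>C. \<not> (\<eta> c \<omega> \<and> reach d (\<lambda>v. \<eta> v \<omega>) L c)} =
    (\<Prod>c\<in>C. 1 - prob {\<omega> \<in> space M. \<eta> c \<omega>} * prob {\<omega> \<in> space M. reach d (\<lambda>v. \<eta> v \<omega>) L c})"
proof -
  have em: "Measurable.pred M (\<eta> w)" if "w \<in> V" for w
    using ind that by (auto simp: indep_vars_def)
  have rm: "Measurable.pred M (\<lambda>\<omega>. reach d (\<lambda>v. \<eta> v \<omega>) L c)" if "c \<in> C" for c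
    using D[OF that] em by (intro reach_measurable) auto
  have "prob {\<omega> \<in> space M. \<forall>c\<in>C. \<not> (\<eta> c \<omega> \<and> reach d (\<lambda>v. \<eta> v \<omega>) L c)} =
    (\<Prod>c\<in>C. prob {\<omega> \<in> space M. \<not> (\<eta> c \<omega> \<and> reach d (\<lambda>v. \<eta> v \<omega>) L c)})"
  proof (rule prob_all_blocks[OF ind C D _ disj, of "\<lambda>c f. \<not> (f c \<and> reach d f L c)"])
    show "finite (descendants d L c)" for c by (rule finite_descendants)
    fix c and f g :: "nat list \<Rightarrow> bool" assume "\<And>v. v \<in> descendants d L c \<Longrightarrow> f v = g v"
    then show "(\<not> (f c \<and> reach d f L c)) = (\<not> (g c \<and> reach d g L c))"
      using reach_cong[of d L c f g] self_in_descendants[of c d L] by blast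
  qed
  also have "\<dots> = (\<Prod>c\<in>C. 1 - prob {\<omega> \<in> space M. \<eta> c \<omega>} * prob {\<omega> \<in> space M. reach d (\<lambda>v. \<eta> v \<omega>) L c})"
  proof (intro prod.cong refl)
    fix c assume c: "c \<in> C"
    have cV: "c \<in> V" using D[OF c] self_in_descendants by auto
    \<comment> \<open>A Boolean index selects between the two blocks \<open>{c}\<close> and the
      proper descendants.\<close>
    define P where "P b f = (if b then f c else reach d f L c)" for b :: bool and f
    have "prob {\<omega> \<in> space M. \<forall>b\<in>UNIV. P b (\<lambda>v. \<eta> v \<omega>)} = (\<Prod>b\<in>UNIV. prob {\<omega> \<in> space M. P b (\<lambda>v. \<eta> v \<omega>)})"
    proof (rule prob_all_blocks[OF ind, of UNIV "\<lambda>b. if b then {c} else descendants d L c - {c}"])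
      show "disjoint_family_on (\<lambda>b. if b then {c} else descendants d L c - {c}) UNIV"
        by (auto simp: disjoint_family_on_def)
      fix b and f g :: "nat list \<Rightarrow> bool" assume "\<And>v. v \<in> (if b then {c} else descendants d L c - {c}) \<Longrightarrow> f v = (g v :: bool)"
      then show "P b f = P b g" unfolding P_def using reach_cong[of d L c f g] by (cases b) auto
    qed (use D[OF c] cV finite_descendants in auto)
    then have "prob {\<omega> \<in> space M. \<eta> c \<omega> \<and> reach d (\<lambda>v. \<eta> v \<omega>) L c} =
      prob {\<omega> \<in> space M. \<eta> c \<omega>} * prob {\<omega> \<in> space M. reach d (\<lambda>v. \<eta> v \<omega>) L c}"
      unfolding UNIV_bool Set.ball_simps(7) P_def by (simp add: conj_commute mult.commute)
    moreover have "prob {\<omega> \<in> space M. \<not> (\<eta> c \<omega> \<and> reach d (\<lambda>v. \<eta> v \<omega>) L c)} =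
      1 - prob {\<omega> \<in> space M. \<eta> c \<omega> \<and> reach d (\<lambda>v. \<eta> v \<omega>) L c}"
      using em[OF cV] rm[OF c] by (intro prob_neg) measurable
    ultimately show "prob {\<omega> \<in> space M. \<not> (\<eta> c \<omega> \<and> reach d (\<lambda>v. \<eta> v \<omega>) L c)} =
      1 - prob {\<omega> \<in> space M. \<eta> c \<omega>} * prob {\<omega> \<in> space M. reach d (\<lambda>v. \<eta> v \<omega>) L c}" by simp
  qed
  finally show ?thesis .
qed

text \<open>The bound 1/2 reproduces itself. If each child survives with probability at least 1/2,
  all attempts from \<open>v\<close> fail with probability at most \<open>exp (- p / 2) ^ d\<close>,
  which is at most \<open>exp (- 1)\<close> when \<open>d * p \<ge> 2\<close>, hence at most
  1/2.\<close>

lemma (in prob_space) prob_reach_ge_half: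
  assumes ind: "indep_vars (\<lambda>_. count_space UNIV) \<eta> V"
    and D: "descendants d L v - {v} \<subseteq> V"
    and p: "\<And>w. w \<in> descendants d L v - {v} \<Longrightarrow> p \<le> prob {\<omega> \<in> space M. \<eta> w \<omega>}" and p0: "0 \<le> p"
    and dp: "real d * p \<ge> 2"
  shows "prob {\<omega> \<in> space M. reach d (\<lambda>w. \<eta> w \<omega>) L v} \<ge> 1 / 2"
  using D p
proof (induction L arbitrary: v)
  case 0
  then show ?case by (simp add: prob_space)
next
  case (Suc L)
  define C where "C = (\<lambda>i. i # v) ` {..<d}"
  have em: "Measurable.pred M (\<eta> w)" if "w \<in> V" for w
    using ind that by (auto simp: indep_vars_def)
  have sub: "descendants d L c \<subseteq> descendants d (Suc L) v - {v}" if "c \<in> C" for c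
    using that descendants_child unfolding C_def by blast
  have ge: "prob {\<omega> \<in> space M. reach d (\<lambda>w. \<eta> w \<omega>) L c} \<ge> 1 / 2" if "c \<in> C" for c
    using sub[OF that] Suc.prems by (intro Suc.IH) auto
  have pc: "p \<le> prob {\<omega> \<in> space M. \<eta> c \<omega>}" if "c \<in> C" for c
    using sub[OF that] self_in_descendants[of c d L] by (intro Suc.prems(2)) auto
  have "prob {\<omega> \<in> space M. \<forall>c\<in>C. \<not> (\<eta> c \<omega> \<and> reach d (\<lambda>v. \<eta> v \<omega>) L c)} =
    (\<Prod>c\<in>C. 1 - prob {\<omega> \<in> space M. \<eta> c \<omega>} * prob {\<omega> \<in> space M. reach d (\<lambda>v. \<eta> v \<omega>) L c})"
  proof (rule prob_no_reach[OF ind])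
    show "disjoint_family_on (descendants d L) C"
      unfolding disjoint_family_on_def C_def using descendants_disjoint_children by auto
    show "descendants d L c \<subseteq> V" if "c \<in> C" for c using sub[OF that] Suc.prems by auto
  qed (simp add: C_def)
  also have "\<dots> \<le> (\<Prod>c\<in>C. exp (- (p / 2)))"
  proof (intro prod_mono conjI)
    fix c assume c: "c \<in> C"
    have "p * (1/2) \<le> prob {\<omega> \<in> space M. \<eta> c \<omega>} * prob {\<omega> \<in> space M. reach d (\<lambda>v. \<eta> v \<omega>) L c}"
      using ge[OF c] pc[OF c] p0 by (intro mult_mono) auto
    moreover have "1 - p / 2 \<le> exp (- (p / 2))" using exp_ge_add_one_self[of "- (p/2)"] by simp
    ultimately show "1 - prob {\<omega> \<in> space M. \<eta> c \<omega>} * prob {\<omega> \<in> space M. reach d (\<lambda>v. \<eta> v \<omega>) L c} \<le> exp (- (p / 2))"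
      by simp
    show "0 \<le> 1 - prob {\<omega> \<in> space M. \<eta> c \<omega>} * prob {\<omega> \<in> space M. reach d (\<lambda>v. \<eta> v \<omega>) L c}"
      using mult_le_one[of "prob {\<omega> \<in> space M. \<eta> c \<omega>}" "prob {\<omega> \<in> space M. reach d (\<lambda>v. \<eta> v \<omega>) L c}"] by simp
  qed
  also have "\<dots> = exp (- (p / 2)) ^ d" by (simp add: C_def card_image inj_on_def)
  also have "\<dots> = exp (- (real d * p / 2))" by (simp flip: exp_of_nat_mult)
  also have "\<dots> \<le> exp (- 1)" using dp by simp
  also have "\<dots> \<le> 1 / 2" using exp_ge_add_one_self[of 1] by (simp add: exp_minus field_simps)
  finally have *: "prob {\<omega> \<in> space M. \<forall>c\<in>C. \<not> (\<eta> c \<omega> \<and> reach d (\<lambda>v. \<eta> v \<omega>) L c)} \<le> 1 / 2" .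
  have "{\<omega> \<in> space M. \<forall>c\<in>C. \<not> (\<eta> c \<omega> \<and> reach d (\<lambda>v. \<eta> v \<omega>) L c)} = {\<omega> \<in> space M. \<not> reach d (\<lambda>w. \<eta> w \<omega>) (Suc L) v}"
    by (auto simp: C_def)
  moreover have "prob {\<omega> \<in> space M. \<not> reach d (\<lambda>w. \<eta> w \<omega>) (Suc L) v} = 1 - prob {\<omega> \<in> space M. reach d (\<lambda>w. \<eta> w \<omega>) (Suc L) v}"
  proof (rule prob_neg)
    have "Measurable.pred M (\<lambda>\<omega>. reach d (\<lambda>w. \<eta> w \<omega>) (Suc L) v)"
      using Suc.prems em by (intro reach_measurable) auto
    then show "{\<omega> \<in> space M. reach d (\<lambda>w. \<eta> w \<omega>) (Suc L) v} \<in> events" by measurable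
  qed
  ultimately show ?case using * by simp
qed

subsection \<open>Weak derivatives\<close>

lemma integrable_lborel_indicator_Icc [simp]: "integrable lborel (indicator {a..b} :: real \<Rightarrow> real)"
  by (intro integrable_real_indicator) (auto simp: emeasure_lborel_Icc_eq)

text \<open>Cut off to \<open>{a..b}\<close>, the positive and the negative part of \<open>z\<close>
  are densities of two finite measures that agree on all half-lines, hence are equal; so the two
  densities agree almost everywhere.\<close>

lemma AE_eq_0_if_interval_integrals_eq_0:
  fixes z :: "real \<Rightarrow> real"
  assumes int: "set_integrable lborel {a..b} z"
    and zero: "\<And>c. a \<le> c \<Longrightarrow> c \<le> b \<Longrightarrow> (LINT t:{c..b}|lborel. z t) = 0"
  shows "AE t in lborel. t \<in> {a..b} \<longrightarrow> z t = 0"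
proof -
  define y where "y t = indicator {a..b} t * z t" for t
  have y: "integrable lborel y" using int by (simp add: set_integrable_def y_def[abs_def])
  then have [measurable]: "y \<in> borel_measurable lborel" by auto
  define p n where "p t = max 0 (y t)" and "n t = max 0 (- y t)" for t
  have pn: "integrable lborel p" "integrable lborel n"
    using y unfolding p_def[abs_def] n_def[abs_def] by auto
  have zero': "(\<integral>t. y t * indicator {x<..} t \<partial>lborel) = 0" for x
  proof (cases "x < b")
    case True
    define c where "c = max a x"
    have "(\<integral>t. y t * indicator {x<..} t \<partial>lborel) = (\<integral>t. indicator {c..b} t *\<^sub>R z t \<partial>lborel)"
    proof (rule integral_cong_AE)
      have "AE t in lborel. t \<noteq> x" by (rule AE_lborel_singleton)
      then show "AE t in lborel. y t * indicator {x<..} t = indicator {c..b} t *\<^sub>R z t"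
        by eventually_elim (auto simp: y_def c_def indicator_def)
      have "(\<lambda>t. indicator {c..b} t *\<^sub>R y t) \<in> borel_measurable lborel" by measurable
      moreover have "indicator {c..b} t *\<^sub>R y t = indicator {c..b} t *\<^sub>R z t" for t
        by (auto simp: y_def c_def indicator_def)
      ultimately show "(\<lambda>t. indicator {c..b} t *\<^sub>R z t) \<in> borel_measurable lborel" by (simp only:)
    qed measurable
    also have "\<dots> = 0"
    proof (cases "c \<le> b")
      case True
      then show ?thesis using zero[of c] by (simp add: c_def set_lebesgue_integral_def)
    qed simp
    finally show ?thesis .
  next
    case False
    then have "(\<lambda>t. y t * indicator {x<..} t) = (\<lambda>t. 0)" by (auto simp: y_def indicator_def)
    then show ?thesis by (simp only: Bochner_Integration.integral_zero)
  qed
  have eq: "density lborel p = density lborel n"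
  proof (rule measure_eqI_lessThan)
    fix x
    have ip: "integrable lborel (\<lambda>t. p t * indicator {x<..} t)" "integrable lborel (\<lambda>t. n t * indicator {x<..} t)"
      using pn by (auto intro!: integrable_real_mult_indicator)
    have e: "emeasure (density lborel p) {x<..} = ennreal (\<integral>t. p t * indicator {x<..} t \<partial>lborel)"
      using ip(1) by (subst emeasure_density) (auto simp: nn_integral_eq_integral[symmetric] p_def ennreal_mult' ennreal_indicator)
    have e': "emeasure (density lborel n) {x<..} = ennreal (\<integral>t. n t * indicator {x<..} t \<partial>lborel)"
      using ip(2) by (subst emeasure_density) (auto simp: nn_integral_eq_integral[symmetric] n_def ennreal_mult' ennreal_indicator)
    show "emeasure (density lborel p) {x<..} < \<infinity>" unfolding e by simp
    have "y t * indicator {x<..} t = p t * indicator {x<..} t - n t * indicator {x<..} t" for t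
      by (auto simp: p_def n_def indicator_def)
    then have "(\<integral>t. p t * indicator {x<..} t \<partial>lborel) - (\<integral>t. n t * indicator {x<..} t \<partial>lborel) = 0"
      using zero'[of x] ip by simp
    then show "emeasure (density lborel p) {x<..} = emeasure (density lborel n) {x<..}"
      unfolding e e' by simp
  qed (auto simp: p_def n_def)
  have "AE t in lborel. ennreal (p t) = ennreal (n t)"
    by (rule sigma_finite_measure.density_unique[OF sigma_finite_lborel _ _ eq]) (auto simp: p_def[abs_def] n_def[abs_def])
  then show ?thesis
  proof eventually_elim
    case (elim t)
    have "0 \<le> p t" "0 \<le> n t" by (auto simp: p_def n_def)
    then have "p t = n t" using elim by simp
    then have "y t = 0" by (auto simp: p_def n_def max_def split: if_splits)
    then show ?case by (auto simp: y_def)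
  qed
qed

lemma has_weak_deriv_integrable:
  assumes "has_weak_deriv I F u" "{a..b} \<subseteq> I"
  shows "set_integrable lborel {a..b} u"
proof -
  have u[measurable]: "u \<in> borel_measurable lborel" using assms by (simp add: has_weak_deriv_def)
  have "set_integrable lborel {a..b} (\<lambda>t. (u t)\<^sup>2)"
    by (rule set_integrable_subset[of _ I]) (use assms in \<open>auto simp: has_weak_deriv_def\<close>)
  moreover have "set_integrable lborel {a..b} (\<lambda>t. 1 :: real)"
    unfolding set_integrable_def by simp
  ultimately have "set_integrable lborel {a..b} (\<lambda>t. 1 + (u t)\<^sup>2)" by (intro set_integral_add)
  then show ?thesis unfolding set_integrable_def
  proof (rule Bochner_Integration.integrable_bound)
    have "\<bar>x\<bar> \<le> 1 + x\<^sup>2" for x :: real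
      using sum_squares_bound[of "\<bar>x\<bar>" 1] abs_ge_zero[of x] by (simp add: algebra_simps)
    then have "\<bar>u t\<bar> \<le> \<bar>1 + (u t)\<^sup>2\<bar>" for t by (metis abs_ge_self order_trans)
    then show "AE t in lborel. norm (indicator {a..b} t *\<^sub>R u t) \<le> norm (indicator {a..b} t *\<^sub>R (1 + (u t)\<^sup>2))"
      by (simp add: abs_mult mult_left_mono)
  qed measurable
qed

lemma has_weak_deriv_unique_cbox:
  assumes u: "has_weak_deriv I F u" and v: "has_weak_deriv I F v" and I: "{a..b} \<subseteq> I"
  shows "AE t in lborel. t \<in> {a..b} \<longrightarrow> u t = v t"
proof -
  have iu: "set_integrable lborel {c..b} u" "set_integrable lborel {c..b} v" if "a \<le> c" for c
    using has_weak_deriv_integrable u v I that by (meson atLeastatMost_subset_iff order_refl order_trans)+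
  have "AE t in lborel. t \<in> {a..b} \<longrightarrow> u t - v t = 0"
  proof (rule AE_eq_0_if_interval_integrals_eq_0)
    show "set_integrable lborel {a..b} (\<lambda>t. u t - v t)" using iu[of a] by (intro set_integral_diff) auto
    fix c assume c: "a \<le> c" "c \<le> b"
    then have "c \<in> I" "b \<in> I" using I by auto
    then have "(LINT t:{c..b}|lborel. u t) = (LINT t:{c..b}|lborel. v t)"
      using u v c by (metis has_weak_deriv_def)
    then show "(LINT t:{c..b}|lborel. u t - v t) = 0"
      using iu[OF c(1)] by (simp add: set_integral_diff)
  qed
  then show ?thesis by simp
qed

text \<open>The domain of a cable may be half-open or unbounded, so it is exhausted by countably
  many compact intervals with endpoints in a countable dense set.\<close>

lemma has_weak_deriv_unique:
  assumes u: "has_weak_deriv I F u" and v: "has_weak_deriv I F v"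
    and I: "\<And>a b. a \<in> I \<Longrightarrow> b \<in> I \<Longrightarrow> {a..b} \<subseteq> I"
  shows "AE t in lborel. t \<in> I \<longrightarrow> u t = v t"
proof (cases "\<exists>a b. a \<in> I \<and> b \<in> I \<and> a < b")
  case False
  then have "I = {} \<or> (\<exists>a. I = {a})" by (metis antisym_conv3 empty_iff insertI1 is_singletonI' is_singleton_def)
  then show ?thesis
  proof (elim disjE exE)
    fix a assume "I = {a}"
    then show ?thesis
      using AE_lborel_singleton[of a] by eventually_elim (simp add: \<open>I = {a}\<close>)
  qed simp
next
  case True
  then obtain x y where xy: "x \<in> I" "y \<in> I" "x < y" by auto
  obtain Q :: "real set" where Q: "countable Q" "\<And>U V. (U::real) < V \<Longrightarrow> \<exists>q\<in>Q. U < q \<and> q < V"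
    using countable_dense_setE[where 'a = real] by (metis countable_rat Rats_dense_in_real)
  define S where "S = {(a, b) \<in> Q \<times> Q. {a..b} \<subseteq> I}"
  have cS: "countable S" unfolding S_def using Q(1) by (intro countable_subset[OF _ countable_SIGMA[of Q "\<lambda>_. Q"]]) auto
  have "\<forall>s\<in>S. AE t in lborel. t \<in> {fst s..snd s} \<longrightarrow> u t = v t"
    using has_weak_deriv_unique_cbox[OF u v] by (auto simp: S_def)
  then have "AE t in lborel. \<forall>s\<in>S. t \<in> {fst s..snd s} \<longrightarrow> u t = v t"
    by (simp only: AE_ball_countable[OF cS])
  \<comment> \<open>Only the least and the greatest element of \<open>I\<close>, if they exist, can
    escape the compact intervals. They form a null set.\<close>
  moreover have "\<exists>e1 e2. \<forall>t\<in>I. t = e1 \<or> t = e2 \<or> (\<exists>s\<in>S. t \<in> {fst s..snd s})"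
  proof -
    have inner: "\<exists>s\<in>S. t \<in> {fst s..snd s}" if t: "a \<in> I" "b \<in> I" "a < t" "t < b" for a b t
    proof -
      obtain q r where "q \<in> Q" "a < q" "q < t" "r \<in> Q" "t < r" "r < b" using Q(2) t by meson
      then have "(q, r) \<in> S" "t \<in> {q..r}" using I[OF t(1,2)] by (auto simp: S_def)
      then show ?thesis by force
    qed
    define lo where "lo t \<longleftrightarrow> (\<forall>s\<in>I. t \<le> s)" for t
    define hi where "hi t \<longleftrightarrow> (\<forall>s\<in>I. s \<le> t)" for t
    have "t = (THE t. t \<in> I \<and> lo t) \<or> t = (THE t. t \<in> I \<and> hi t) \<or> (\<exists>s\<in>S. t \<in> {fst s..snd s})" if t: "t \<in> I" for t
    proof (cases "lo t \<or> hi t")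
      case True
      moreover have "lo t \<Longrightarrow> (THE t. t \<in> I \<and> lo t) = t" using t by (intro the_equality) (auto simp: lo_def intro: antisym)
      moreover have "hi t \<Longrightarrow> (THE t. t \<in> I \<and> hi t) = t" using t by (intro the_equality) (auto simp: hi_def intro: antisym)
      ultimately show ?thesis by auto
    next
      case False
      then obtain a b where "a \<in> I" "b \<in> I" "a < t" "t < b" by (auto simp: lo_def hi_def not_le)
      then show ?thesis using inner by blast
    qed
    then show ?thesis by blast
  qed
  then obtain e1 e2 where e: "\<And>t. t \<in> I \<Longrightarrow> t = e1 \<or> t = e2 \<or> (\<exists>s\<in>S. t \<in> {fst s..snd s})" by blast
  ultimately show ?thesis using AE_lborel_singleton[of e1] AE_lborel_singleton[of e2]
    by eventually_elim (use e in blast)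
qed

section \<open>Piecewise linear functions and their weak derivatives\<close>

definition clamp_to :: "real \<Rightarrow> real \<Rightarrow> real \<Rightarrow> real" where
  "clamp_to s t x = max s (min t x)"

text \<open>Since \<open>clamp_to s t\<close> is an antiderivative of the indicator of
  \<open>{s..t}\<close>, this is the derivative of a continuous function with slope \<open>A\<close>
  on one interval and \<open>B\<close> on the next. Both indicators count \<open>t1\<close>, a null
  set.\<close>

definition step_fun :: "real \<Rightarrow> real \<Rightarrow> real \<Rightarrow> real \<Rightarrow> real \<Rightarrow> real \<Rightarrow> real" where
  "step_fun A B t0 t1 t2 x = A * indicator {t0..t1} x + B * indicator {t1..t2} x"

lemma step_fun_measurable[measurable]: "step_fun A B t0 t1 t2 \<in> borel_measurable borel"
  unfolding step_fun_def[abs_def] by measurable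

lemma LINT_indicator_interval:
  assumes "s \<le> t" "a \<le> b"
  shows "(LINT x:{a..b}|lborel. indicator {s..t} x) = clamp_to s t b - clamp_to s t (a::real)"
proof -
  have "(LINT x:{a..b}|lborel. indicator {s..t} x) = (\<integral>x. indicator {max a s..min b t} x \<partial>lborel)"
    unfolding set_lebesgue_integral_def
    by (intro Bochner_Integration.integral_cong) (auto simp: indicator_def)
  also have "\<dots> = measure lborel {max a s..min b t}" by simp
  also have "\<dots> = clamp_to s t b - clamp_to s t a"
    using assms by (auto simp: clamp_to_def max_def min_def)
  finally show ?thesis .
qed

lemma set_integrable_indicator_interval:
  "set_integrable lborel {a..b::real} (\<lambda>x. c * indicator {s..t} x :: real)"
proof -
  have "integrable lborel (\<lambda>x. c * indicator {max a s..min b t} x :: real)"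
    by (intro integrable_mult_right integrable_lborel_indicator_Icc)
  moreover have "c * indicator {max a s..min b t} x = indicator {a..b} x *\<^sub>R (c * indicator {s..t} x)" for x
    by (auto simp: indicator_def)
  ultimately show ?thesis by (simp add: set_integrable_def)
qed

lemma has_weak_deriv_step_fun:
  assumes t: "t0 \<le> t1" "t1 \<le> t2" and I: "I \<in> sets borel"
    and F: "\<And>x. x \<in> I \<Longrightarrow> F x = C + A * clamp_to t0 t1 x + B * clamp_to t1 t2 x"
  shows "has_weak_deriv I F (step_fun A B t0 t1 t2)"
  unfolding has_weak_deriv_def
proof (intro conjI ballI impI)
  show "set_integrable lborel I (\<lambda>x. (step_fun A B t0 t1 t2 x)\<^sup>2)"
    unfolding set_integrable_def
  proof (rule Bochner_Integration.integrable_bound)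
    show "integrable lborel (\<lambda>x. (\<bar>A\<bar> + \<bar>B\<bar>)\<^sup>2 * indicator {t0..t2} x)" by simp
    have "\<bar>step_fun A B t0 t1 t2 x\<bar>\<^sup>2 \<le> (\<bar>A\<bar> + \<bar>B\<bar>)\<^sup>2 * indicator {t0..t2} x" for x
    proof (cases "x \<in> {t0..t2}")
      case True
      have "\<bar>step_fun A B t0 t1 t2 x\<bar> \<le> \<bar>A\<bar> + \<bar>B\<bar>"
        unfolding step_fun_def by (auto simp: indicator_def)
      then have "\<bar>step_fun A B t0 t1 t2 x\<bar>\<^sup>2 \<le> (\<bar>A\<bar> + \<bar>B\<bar>)\<^sup>2" by (intro power_mono) auto
      then show ?thesis using True by simp
    next
      case False
      then have "step_fun A B t0 t1 t2 x = 0" using t by (auto simp: step_fun_def indicator_def)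
      then show ?thesis using False by simp
    qed
    then have "indicator I x * (step_fun A B t0 t1 t2 x)\<^sup>2 \<le> (\<bar>A\<bar> + \<bar>B\<bar>)\<^sup>2 * indicator {t0..t2} x" for x
      using mult_mono[of "indicator I x :: real" 1 "(step_fun A B t0 t1 t2 x)\<^sup>2" "(\<bar>A\<bar> + \<bar>B\<bar>)\<^sup>2 * indicator {t0..t2} x"]
      by (simp add: power2_abs indicator_le_1)
    then show "AE x in lborel. norm (indicator I x *\<^sub>R (step_fun A B t0 t1 t2 x)\<^sup>2) \<le>
        norm ((\<bar>A\<bar> + \<bar>B\<bar>)\<^sup>2 * indicator {t0..t2} x)"
      by (auto simp: abs_mult)
  qed (use I in measurable)
  fix a b assume ab: "a \<in> I" "b \<in> I" "a \<le> b"
  have "(LINT x:{a..b}|lborel. step_fun A B t0 t1 t2 x) =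
    (LINT x:{a..b}|lborel. A * indicator {t0..t1} x) + (LINT x:{a..b}|lborel. B * indicator {t1..t2} x)"
    unfolding step_fun_def by (intro set_integral_add set_integrable_indicator_interval)
  also have "\<dots> = A * (clamp_to t0 t1 b - clamp_to t0 t1 a) + B * (clamp_to t1 t2 b - clamp_to t1 t2 a)"
    using t ab by (simp add: LINT_indicator_interval)
  finally show "F b - F a = (LINT x:{a..b}|lborel. step_fun A B t0 t1 t2 x)"
    using F ab by (simp add: algebra_simps)
qed measurable

text \<open>Pairing with a step function only sees \<open>F\<close> at the breakpoints. For this
  reason the Dirichlet form against a tent is a finite expression in values of the function, which
  survives pointwise limits.\<close>

lemma LINT_weak_deriv_step_fun:
  assumes u: "has_weak_deriv I F u" and t: "t0 \<le> t1" "t1 \<le> t2" "{t0..t2} \<subseteq> I"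
  shows "(LINT x:I|lborel. u x * step_fun A B t0 t1 t2 x) = A * (F t1 - F t0) + B * (F t2 - F t1)"
proof -
  have i: "set_integrable lborel {t0..t1} u" "set_integrable lborel {t1..t2} u"
    using t by (auto intro!: has_weak_deriv_integrable[OF u])
  have "(LINT x:I|lborel. u x * step_fun A B t0 t1 t2 x) =
    (\<integral>x. A * (indicator {t0..t1} x *\<^sub>R u x) + B * (indicator {t1..t2} x *\<^sub>R u x) \<partial>lborel)"
    unfolding set_lebesgue_integral_def
  proof (intro Bochner_Integration.integral_cong refl)
    fix x
    show "indicator I x *\<^sub>R (u x * step_fun A B t0 t1 t2 x) =
        A * (indicator {t0..t1} x *\<^sub>R u x) + B * (indicator {t1..t2} x *\<^sub>R u x)"
    proof (cases "x \<in> {t0..t2}")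
      case True
      then have "x \<in> I" using t by auto
      then show ?thesis by (simp add: step_fun_def algebra_simps)
    next
      case False
      then show ?thesis using t by (auto simp: step_fun_def indicator_def)
    qed
  qed
  also have "\<dots> = A * (LINT x:{t0..t1}|lborel. u x) + B * (LINT x:{t1..t2}|lborel. u x)"
    using i unfolding set_integrable_def set_lebesgue_integral_def
    by (subst Bochner_Integration.integral_add) auto
  also have "(LINT x:{t0..t1}|lborel. u x) = F t1 - F t0"
    using u t unfolding has_weak_deriv_def by (metis atLeastAtMost_iff order_refl order_trans subsetD)
  also have "(LINT x:{t1..t2}|lborel. u x) = F t2 - F t1"
    using u t unfolding has_weak_deriv_def by (metis atLeastAtMost_iff order_refl order_trans subsetD)
  finally show ?thesis .
qed

subsection \<open>Points of the cable system\<close>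

lemma continuous_on_cable_map: "continuous_on S (cable_map G c)"
proof (cases c)
  case (Edge x y)
  have "cable_map G c = (\<lambda>t. (\<lambda>z. (1 - 2 * weight G x y * t) * indicator {x} z + 2 * weight G x y * t * indicator {y} z, 0))"
    by (auto simp: Edge)
  then show ?thesis
    by (auto intro!: continuous_on_Pair continuous_on_coordinatewise_then_product continuous_intros)
next
  case (Ray x)
  have "cable_map G c = (\<lambda>t. (indicator {x}, t))" by (auto simp: Ray)
  then show ?thesis by (auto intro!: continuous_on_Pair continuous_intros)
qed

lemma cable_map_borel_measurable [measurable]: "cable_map G c \<in> borel_measurable borel"
  by (intro borel_measurable_continuous_onI continuous_on_cable_map)

lemma cable_dom_borel [measurable]: "cable_dom G c \<in> sets borel"
  by (cases c) auto

lemma cable_dom_interval: "a \<in> cable_dom G c \<Longrightarrow> b \<in> cable_dom G c \<Longrightarrow> {a..b} \<subseteq> cable_dom G c"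
proof (cases c)
  case (Ray x)
  assume "a \<in> cable_dom G c" "b \<in> cable_dom G c"
  then have ab: "0 \<le> a" "2 * killing G x * b < 1" using Ray by auto
  show ?thesis
  proof
    fix s assume s: "s \<in> {a..b}"
    have "2 * killing G x * s < 1"
    proof (cases "killing G x \<ge> 0")
      case True
      then have "2 * killing G x * s \<le> 2 * killing G x * b" using s by (intro mult_left_mono) auto
      then show ?thesis using ab by simp
    next
      case False
      then have "killing G x * s \<le> 0" using s ab by (intro mult_nonpos_nonneg) auto
      then show ?thesis by simp
    qed
    then show "s \<in> cable_dom G c" using s ab Ray by auto
  qed
qed auto

lemma cable_map_in: "c \<in> cables G \<Longrightarrow> t \<in> cable_dom G c \<Longrightarrow> cable_map G c t \<in> cable_system G"
  by (auto simp: cable_system_def)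

lemma cable_system_cases:
  assumes "p \<in> cable_system G"
  obtains c t where "c \<in> cables G" "t \<in> cable_dom G c" "p = cable_map G c t"
  using assms by (auto simp: cable_system_def)

text \<open>Every point of a cable is close to a nondegenerate compact piece of it, also at the ends
  of the closed edges and half-open rays. It gives nonempty open sets positive measure.\<close>

lemma cable_dom_fat:
  assumes c: "c \<in> cables G" and t: "t \<in> cable_dom G c" and e: "e > 0"
  obtains a b where "a < b" "{a..b} \<subseteq> cable_dom G c" "{a..b} \<subseteq> {t - e<..<t + e}"
proof (cases c)
  case (Edge x y)
  define l where "l = 1 / (2 * weight G x y)"
  have l: "l > 0" using c Edge by (auto simp: cables_def l_def)
  have t: "0 \<le> t" "t \<le> l" using t Edge by (auto simp: l_def)
  have d: "cable_dom G c = {0..l}" by (simp add: Edge l_def)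
  show ?thesis
  proof (cases "t < l")
    case True
    define r where "r = min (e/2) (l - t)"
    have "0 < r" "r < e" "t + r \<le> l" using True e by (auto simp: r_def)
    then show ?thesis by (intro that[of t "t + r"]) (use e t d in auto)
  next
    case False
    define r where "r = min (e/2) t"
    have "0 < r" "r < e" "r \<le> t" using False e t l by (auto simp: r_def)
    then show ?thesis by (intro that[of "t - r" t]) (use e t d in auto)
  qed
next
  case (Ray x)
  show ?thesis
  proof (cases "killing G x \<le> 0")
    case True
    have "s \<in> cable_dom G c" if "s \<ge> t" for s
    proof -
      have "0 \<le> s" using t that Ray by auto
      then have "killing G x * s \<le> 0" using True by (simp add: mult_nonpos_nonneg)
      then show ?thesis using Ray \<open>0 \<le> s\<close> by simp
    qed
    then show ?thesis using e by (intro that[of t "t + e/2"]) auto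
  next
    case False
    define l where "l = 1 / (2 * killing G x)"
    have d: "cable_dom G c = {0..<l}" using False by (auto simp: Ray l_def field_simps)
    have t: "0 \<le> t" "t < l" using t unfolding d by auto
    define r where "r = min (e/2) ((l - t)/2)"
    have "0 < r" "r < e" "r \<le> (l - t)/2" using e t by (auto simp: r_def simp del: le_divide_eq_numeral1)
    moreover have "t + r < l"
      using \<open>r \<le> (l - t)/2\<close> t by (simp add: field_simps)
    ultimately have r: "0 < r" "r < e" "t + r < l" by simp_all
    have "{t..t + r} \<subseteq> {0..<l}" "{t..t + r} \<subseteq> {t - e<..<t + e}"
      using r(2,3) t(1) e by auto
    then show ?thesis using r(1) unfolding d[symmetric] by (intro that[of t "t + r"]) auto
  qed
qed

subsection \<open>Lebesgue measure on the cable system\<close>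

lemma sets_restrict_cable_system_Pow: "sets (restrict_space borel (cable_system G)) \<subseteq> Pow (cable_system G)"
  using sets.space_closed[of "restrict_space borel (cable_system G)"] by (simp add: space_restrict_space)

lemma space_lebesgue_cable [simp]: "space (lebesgue_cable G) = cable_system G"
  unfolding lebesgue_cable_def by (rule space_measure_of[OF sets_restrict_cable_system_Pow])

lemma sets_lebesgue_cable: "sets (lebesgue_cable G) = sets (restrict_space borel (cable_system G))"
  unfolding lebesgue_cable_def
  using sets.sigma_sets_eq[of "restrict_space borel (cable_system G)"]
  by (simp add: sets_measure_of[OF sets_restrict_cable_system_Pow] space_restrict_space)

lemma in_sets_lebesgue_cable: "A \<in> sets borel \<Longrightarrow> A \<inter> cable_system G \<in> sets (lebesgue_cable G)"
  unfolding sets_lebesgue_cable sets_restrict_space by auto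

lemma cable_preimage_sets:
  assumes A: "A \<in> sets (restrict_space borel (cable_system G))" and c: "c \<in> cables G"
  shows "cable_dom G c \<inter> cable_map G c -` A \<in> sets borel"
proof -
  obtain B where B: "B \<in> sets borel" "A = cable_system G \<inter> B" using A by (auto simp: sets_restrict_space)
  have "cable_dom G c \<inter> cable_map G c -` A = cable_dom G c \<inter> (cable_map G c -` B \<inter> space borel)"
    using B cable_map_in[OF c] by auto
  also have "\<dots> \<in> sets borel" using B by (intro sets.Int measurable_sets) auto
  finally show ?thesis .
qed

text \<open>\<open>measure_of\<close> has the prescribed values only once the set function is known
  to be countably additive; additivity passes from Lebesgue measure on each cable to the sum over
  the cables.\<close>

lemma emeasure_lebesgue_cable:
  assumes A: "A \<in> sets (lebesgue_cable G)"
  shows "emeasure (lebesgue_cable G) A =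
    (\<integral>\<^sup>+ c. ennreal (cable_mult c) * emeasure lborel (cable_dom G c \<inter> cable_map G c -` A) \<partial>count_space (cables G))"
proof -
  let ?S = "sets (restrict_space borel (cable_system G))"
  let ?\<mu> = "\<lambda>A. \<integral>\<^sup>+ c. ennreal (cable_mult c) * emeasure lborel (cable_dom G c \<inter> cable_map G c -` A) \<partial>count_space (cables G)"
  have sa: "sigma_algebra (cable_system G) ?S"
    using sets.sigma_algebra_axioms[of "restrict_space borel (cable_system G)"] by (simp add: space_restrict_space)
  have "countably_additive ?S ?\<mu>"
  proof (rule countably_additiveI)
    fix A :: "nat \<Rightarrow> 'a cable_point set"
    assume A: "range A \<subseteq> ?S" and disj: "disjoint_family A" "\<Union> (range A) \<in> ?S"
    have "(\<Sum>i. ?\<mu> (A i)) = (\<integral>\<^sup>+ c. (\<Sum>i. ennreal (cable_mult c) * emeasure lborel (cable_dom G c \<inter> cable_map G c -` A i)) \<partial>count_space (cables G))"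
      by (rule nn_integral_suminf[symmetric]) simp
    also have "\<dots> = ?\<mu> (\<Union> (range A))"
    proof (intro nn_integral_cong)
      fix c assume "c \<in> space (count_space (cables G))"
      then have c: "c \<in> cables G" by simp
      have "(\<Sum>i. emeasure lborel (cable_dom G c \<inter> cable_map G c -` A i)) =
          emeasure lborel (\<Union>i. cable_dom G c \<inter> cable_map G c -` A i)"
      proof (intro suminf_emeasure)
        show "range (\<lambda>i. cable_dom G c \<inter> cable_map G c -` A i) \<subseteq> sets lborel"
          using A cable_preimage_sets[OF _ c] by auto
        show "disjoint_family (\<lambda>i. cable_dom G c \<inter> cable_map G c -` A i)"
          using disj unfolding disjoint_family_on_def by blast
      qed
      also have "(\<Union>i. cable_dom G c \<inter> cable_map G c -` A i) = cable_dom G c \<inter> cable_map G c -` \<Union> (range A)" by auto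
      finally show "(\<Sum>i. ennreal (cable_mult c) * emeasure lborel (cable_dom G c \<inter> cable_map G c -` A i)) =
          ennreal (cable_mult c) * emeasure lborel (cable_dom G c \<inter> cable_map G c -` \<Union> (range A))"
        by simp
    qed
    finally show "(\<Sum>i. ?\<mu> (A i)) = ?\<mu> (\<Union> (range A))" .
  qed
  moreover have "positive ?S ?\<mu>" by (simp add: positive_def)
  ultimately show ?thesis
    using emeasure_measure_of_sigma[OF sa, of ?\<mu> A] A by (simp add: lebesgue_cable_def[symmetric] sets_lebesgue_cable)
qed

text \<open>The measure has full support, so a continuous function that vanishes almost everywhere
  on an open set vanishes there.\<close>

lemma emeasure_lebesgue_cable_open_pos:
  assumes U: "open U" and p: "p \<in> U" "p \<in> cable_system G"
  shows "emeasure (lebesgue_cable G) (U \<inter> cable_system G) > 0"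
proof -
  obtain c t where c: "c \<in> cables G" "t \<in> cable_dom G c" "p = cable_map G c t"
    using p(2) by (rule cable_system_cases)
  have "open (cable_map G c -` U)" using U continuous_on_cable_map[of UNIV G c] by (rule open_vimage)
  moreover have "t \<in> cable_map G c -` U" using p(1) c(3) by simp
  ultimately obtain e where e: "e > 0" "ball t e \<subseteq> cable_map G c -` U"
    by (meson open_contains_ball)
  obtain a b where ab: "a < b" "{a..b} \<subseteq> cable_dom G c" "{a..b} \<subseteq> {t - e<..<t + e}"
    using cable_dom_fat[OF c(1,2) e(1)] .
  have sub: "{a..b} \<subseteq> cable_dom G c \<inter> cable_map G c -` (U \<inter> cable_system G)"
    using ab e cable_map_in[OF c(1)] by (auto simp: ball_eq_greaterThanLessThan)
  have A: "U \<inter> cable_system G \<in> sets (lebesgue_cable G)" using U by (intro in_sets_lebesgue_cable) auto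
  have "0 < ennreal (cable_mult c) * emeasure lborel {a..b}"
  proof -
    have "cable_mult c > 0" by (cases c) auto
    then show ?thesis using ab by (simp add: ennreal_zero_less_mult_iff)
  qed
  also have "\<dots> \<le> ennreal (cable_mult c) * emeasure lborel (cable_dom G c \<inter> cable_map G c -` (U \<inter> cable_system G))"
    using cable_preimage_sets[OF A[unfolded sets_lebesgue_cable] c(1)]
    by (intro mult_left_mono emeasure_mono sub) auto
  also have "\<dots> \<le> emeasure (lebesgue_cable G) (U \<inter> cable_system G)"
    unfolding emeasure_lebesgue_cable[OF A] using c(1) by (rule nn_integral_ge_point)
  finally show ?thesis .
qed

lemma emeasure_lebesgue_cable_finite:
  assumes A: "A \<in> sets (lebesgue_cable G)" and F: "finite F" "F \<subseteq> cables G"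
    and off: "\<And>c t. c \<in> cables G - F \<Longrightarrow> t \<in> cable_dom G c \<Longrightarrow> cable_map G c t \<notin> A"
    and on: "\<And>c t. c \<in> F \<Longrightarrow> t \<in> cable_dom G c \<Longrightarrow> cable_map G c t \<in> A \<Longrightarrow> t \<in> {lo c..hi c}"
  shows "emeasure (lebesgue_cable G) A < \<infinity>"
proof -
  have "emeasure (lebesgue_cable G) A =
     (\<Sum>c\<in>F. ennreal (cable_mult c) * emeasure lborel (cable_dom G c \<inter> cable_map G c -` A))"
    unfolding emeasure_lebesgue_cable[OF A]
  proof (rule nn_integral_count_space'[OF F(1) _ F(2)])
    fix c assume "c \<in> cables G" "c \<notin> F"
    then have "cable_dom G c \<inter> cable_map G c -` A = {}" using off[of c] by blast
    then show "ennreal (cable_mult c) * emeasure lborel (cable_dom G c \<inter> cable_map G c -` A) = 0" by simp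
  qed
  also have "\<dots> < \<infinity>"
  proof -
    have "emeasure lborel (cable_dom G c \<inter> cable_map G c -` A) < \<infinity>" if "c \<in> F" for c
    proof -
      have "emeasure lborel (cable_dom G c \<inter> cable_map G c -` A) \<le> emeasure lborel {lo c..hi c}"
        using on[OF that] by (intro emeasure_mono) auto
      also have "\<dots> < \<infinity>" by (simp add: emeasure_lborel_Icc_eq)
      finally show ?thesis .
    qed
    then show ?thesis using F(1) by (auto simp: ennreal_mult_less_top)
  qed
  finally show ?thesis .
qed

lemma continuous_on_lebesgue_cable_measurable:
  "continuous_on (cable_system G) k \<Longrightarrow> k \<in> borel_measurable (lebesgue_cable G)"
  using borel_measurable_continuous_on_restrict[of "cable_system G" k] measurable_cong_sets[OF sets_lebesgue_cable refl] by blast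

subsection \<open>Test functions\<close>

lemma cable_deriv_has_weak_deriv:
  "\<exists>u. has_weak_deriv (cable_dom G c) (f \<circ> cable_map G c) u \<Longrightarrow>
    has_weak_deriv (cable_dom G c) (f \<circ> cable_map G c) (cable_deriv G f c)"
  unfolding cable_deriv_def by (rule someI_ex[of "has_weak_deriv (cable_dom G c) (f \<circ> cable_map G c)"])

text \<open>\<open>cable_deriv\<close> is an arbitrary choice, fixed only up to null sets, so it may
  be replaced under the integral by any explicit weak derivative.\<close>

lemma LINT_mult_cable_deriv:
  assumes v: "has_weak_deriv (cable_dom G c) (f \<circ> cable_map G c) v" and [measurable]: "u \<in> borel_measurable lborel"
  shows "(LINT t:cable_dom G c|lborel. u t * cable_deriv G f c t) = (LINT t:cable_dom G c|lborel. u t * v t)"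
proof -
  have d: "has_weak_deriv (cable_dom G c) (f \<circ> cable_map G c) (cable_deriv G f c)"
    using v by (intro cable_deriv_has_weak_deriv) auto
  have [measurable]: "cable_deriv G f c \<in> borel_measurable lborel" "v \<in> borel_measurable lborel"
    using d v by (auto simp: has_weak_deriv_def)
  show ?thesis unfolding set_lebesgue_integral_def
  proof (rule integral_cong_AE)
    show "AE t in lborel. indicator (cable_dom G c) t *\<^sub>R (u t * cable_deriv G f c t) =
        indicator (cable_dom G c) t *\<^sub>R (u t * v t)"
      using has_weak_deriv_unique[OF d v] cable_dom_interval[of _ G c] by (auto simp: indicator_def elim: eventually_mono)
  qed measurable
qed

text \<open>Common criterion for both families of tents: on each cable of the finite set
  \<open>F\<close> the function is linear between the breakpoints \<open>T0\<close>,
  \<open>T1\<close>, \<open>T2\<close> and vanishes outside them, and it vanishes on all other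
  cables. Its support then lies in a finite union of images of compact intervals, and the form is a
  finite sum.\<close>

lemma
  fixes k :: "('v :: countable) cable_point \<Rightarrow> real"
  assumes cont: "continuous_on (cable_system G) k"
    and b: "\<And>p. p \<in> cable_system G \<Longrightarrow> 0 \<le> k p \<and> k p \<le> 1"
    and F: "finite F" "F \<subseteq> cables G"
    and T: "\<And>c. c \<in> F \<Longrightarrow> T0 c \<le> T1 c \<and> T1 c \<le> T2 c \<and> {T0 c..T2 c} \<subseteq> cable_dom G c"
    and on: "\<And>c t. c \<in> F \<Longrightarrow> t \<in> cable_dom G c \<Longrightarrow>
       k (cable_map G c t) = C c + A c * clamp_to (T0 c) (T1 c) t + B c * clamp_to (T1 c) (T2 c) t"
    and zero: "\<And>c t. c \<in> F \<Longrightarrow> t \<in> cable_dom G c \<Longrightarrow> t \<notin> {T0 c..T2 c} \<Longrightarrow> k (cable_map G c t) = 0"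
    and off: "\<And>c t. c \<in> cables G - F \<Longrightarrow> t \<in> cable_dom G c \<Longrightarrow> k (cable_map G c t) = 0"
  shows test_function_form_domain: "k \<in> form_domain G"
    and test_function_integrable: "integrable (lebesgue_cable G) k"
    and test_function_dirichlet_form: "u \<in> form_domain G \<Longrightarrow> dirichlet_form G u k =
       1 / 2 * (\<Sum>c\<in>F. cable_mult c * (A c * (u (cable_map G c (T1 c)) - u (cable_map G c (T0 c))) +
         B c * (u (cable_map G c (T2 c)) - u (cable_map G c (T1 c)))))"
proof -
  have wd: "has_weak_deriv (cable_dom G c) (k \<circ> cable_map G c) (step_fun (A c) (B c) (T0 c) (T1 c) (T2 c))" if "c \<in> F" for c
    using T[OF that] on[OF that] by (intro has_weak_deriv_step_fun[of _ _ _ _ _ "C c"]) auto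
  have wd0: "has_weak_deriv (cable_dom G c) (k \<circ> cable_map G c) (\<lambda>_. 0)" if "c \<in> cables G - F" for c
    unfolding has_weak_deriv_def using off[OF that] by (auto simp: set_integrable_def set_lebesgue_integral_def)
  have km[measurable]: "k \<in> borel_measurable (lebesgue_cable G)"
    by (rule continuous_on_lebesgue_cable_measurable[OF cont])
  define S where "S = {p \<in> cable_system G. k p \<noteq> 0}"
  have "S = {p \<in> space (lebesgue_cable G). k p \<noteq> 0}" by (simp add: S_def)
  also have "\<dots> \<in> sets (lebesgue_cable G)" by measurable
  finally have S: "S \<in> sets (lebesgue_cable G)" .
  have Sfin: "emeasure (lebesgue_cable G) S < \<infinity>"
    by (rule emeasure_lebesgue_cable_finite[OF S F, of T0 T2]) (use off zero in \<open>auto simp: S_def\<close>)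
  have iS: "integrable (lebesgue_cable G) (indicator S :: _ \<Rightarrow> real)"
    using S Sfin by (rule integrable_real_indicator)
  show ik: "integrable (lebesgue_cable G) k"
    by (rule Bochner_Integration.integrable_bound[OF iS]) (use b in \<open>auto simp: S_def indicator_def intro!: AE_I2\<close>)
  have ik2: "integrable (lebesgue_cable G) (\<lambda>p. (k p)\<^sup>2)"
    by (rule Bochner_Integration.integrable_bound[OF iS])
      (use b in \<open>auto simp: S_def indicator_def intro!: AE_I2 power_le_one\<close>)
  define K where "K = (\<Union>c\<in>F. cable_map G c ` {T0 c..T2 c})"
  have "compact K" unfolding K_def using F(1)
    by (intro compact_UN compact_continuous_image continuous_on_cable_map) auto
  moreover have "K \<subseteq> cable_system G" unfolding K_def using T F cable_map_in by fastforce
  moreover have "k p = 0" if "p \<in> cable_system G - K" for p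
  proof -
    have "p \<in> cable_system G" using that by simp
    then obtain c t where c: "c \<in> cables G" "t \<in> cable_dom G c" "p = cable_map G c t"
      by (rule cable_system_cases)
    show ?thesis
    proof (cases "c \<in> F")
      case True
      then have "t \<notin> {T0 c..T2 c}" using that c(3) unfolding K_def by blast
      then show ?thesis using zero[OF True c(2)] c by simp
    qed (use off c in auto)
  qed
  ultimately have "k \<in> compactly_supported G" unfolding compactly_supported_def using cont by blast
  then have C0: "k \<in> C0 G" unfolding C0_def by (auto intro!: bexI[of _ k])
  have z: "(LINT t:cable_dom G c|lborel. u t * cable_deriv G k c t) = 0" if "c \<in> cables G - F" "u \<in> borel_measurable lborel" for c u
    using LINT_mult_cable_deriv[OF wd0[OF that(1)] that(2)] by (simp add: set_lebesgue_integral_def)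
  have ex: "\<exists>u. has_weak_deriv (cable_dom G c) (k \<circ> cable_map G c) u" if "c \<in> cables G" for c
    using wd wd0 that by blast
  have cm: "cable_deriv G k c \<in> borel_measurable lborel" if "c \<in> cables G" for c
    using cable_deriv_has_weak_deriv[OF ex[OF that]] by (simp add: has_weak_deriv_def)
  have "(\<lambda>c. LINT t:cable_dom G c|lborel. (cable_deriv G k c t)\<^sup>2) summable_on F \<longleftrightarrow>
    (\<lambda>c. LINT t:cable_dom G c|lborel. (cable_deriv G k c t)\<^sup>2) summable_on cables G"
    by (rule summable_on_cong_neutral) (use F z cm in \<open>auto simp: power2_eq_square\<close>)
  then show "k \<in> form_domain G"
    unfolding form_domain_def using C0 ex ik2 F(1) by auto
  assume u: "u \<in> form_domain G"
  have du: "has_weak_deriv (cable_dom G c) (u \<circ> cable_map G c) (cable_deriv G u c)" if "c \<in> cables G" for c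
    using u that by (intro cable_deriv_has_weak_deriv) (auto simp: form_domain_def)
  have um: "cable_deriv G u c \<in> borel_measurable lborel" if "c \<in> cables G" for c
    using du[OF that] by (simp add: has_weak_deriv_def)
  have "(\<Sum>\<^sub>\<infinity>c\<in>cables G. cable_mult c * (LINT t:cable_dom G c|lborel. cable_deriv G u c t * cable_deriv G k c t)) =
    (\<Sum>\<^sub>\<infinity>c\<in>F. cable_mult c * (A c * (u (cable_map G c (T1 c)) - u (cable_map G c (T0 c))) +
         B c * (u (cable_map G c (T2 c)) - u (cable_map G c (T1 c)))))"
  proof (rule infsum_cong_neutral)
    fix c assume "c \<in> cables G \<inter> F"
    then have c: "c \<in> cables G" "c \<in> F" by auto
    have "(LINT t:cable_dom G c|lborel. cable_deriv G u c t * cable_deriv G k c t) =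
        (LINT t:cable_dom G c|lborel. cable_deriv G u c t * step_fun (A c) (B c) (T0 c) (T1 c) (T2 c) t)"
      by (rule LINT_mult_cable_deriv[OF wd[OF c(2)] um[OF c(1)]])
    also have "\<dots> = A c * (u (cable_map G c (T1 c)) - u (cable_map G c (T0 c))) +
         B c * (u (cable_map G c (T2 c)) - u (cable_map G c (T1 c)))"
      using LINT_weak_deriv_step_fun[OF du[OF c(1)], of "T0 c" "T1 c" "T2 c" "A c" "B c"] T[OF c(2)] by simp
    finally show "cable_mult c * (LINT t:cable_dom G c|lborel. cable_deriv G u c t * cable_deriv G k c t) =
      cable_mult c * (A c * (u (cable_map G c (T1 c)) - u (cable_map G c (T0 c))) +
         B c * (u (cable_map G c (T2 c)) - u (cable_map G c (T1 c))))" by simp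
  qed (use z um F in auto)
  then show "dirichlet_form G u k =
       1 / 2 * (\<Sum>c\<in>F. cable_mult c * (A c * (u (cable_map G c (T1 c)) - u (cable_map G c (T0 c))) +
         B c * (u (cable_map G c (T2 c)) - u (cable_map G c (T1 c)))))"
    unfolding dirichlet_form_def using F(1) by simp
qed

subsection \<open>Tent functions\<close>

text \<open>The position on an edge is a fraction of its length. This removes the weight from the
  formulas and treats both orientations alike.\<close>

definition edge_point :: "'v \<Rightarrow> 'v \<Rightarrow> real \<Rightarrow> 'v cable_point" where
  "edge_point x y \<theta> = (\<lambda>z. (1 - \<theta>) * indicator {x} z + \<theta> * indicator {y} z, 0)"

lemma edge_point_0: "edge_point x y 0 = vertex_point x"
  and edge_point_1: "edge_point x y 1 = vertex_point y"
  by (auto simp: edge_point_def vertex_point_def)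

lemma edge_point_swap: "edge_point x y (1 - \<theta>) = edge_point y x \<theta>"
  by (auto simp: edge_point_def)

lemma cable_map_Edge: "cable_map G (Edge x y) t = edge_point x y (2 * weight G x y * t)"
  by (simp add: edge_point_def)

lemma continuous_on_edge_point: "continuous_on S (edge_point x y)"
proof -
  have "edge_point x y = (\<lambda>\<theta>. (\<lambda>z. (1 - \<theta>) * indicator {x} z + \<theta> * indicator {y} z, 0))"
    by (auto simp: edge_point_def)
  then show ?thesis
    by (auto intro!: continuous_on_Pair continuous_on_coordinatewise_then_product continuous_intros)
qed

locale cable_graph =
  fixes G :: "('v::countable) weighted_graph"
  assumes weight_sym: "weight G x y = weight G y x"
    and no_loops: "\<not> weight G x x > 0"
    and locally_finite: "y \<in> verts G \<Longrightarrow> finite {z \<in> verts G. weight G y z > 0}"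
begin

lemma edge_point_in:
  assumes "x \<in> verts G" "y \<in> verts G" "weight G x y > 0" "0 \<le> \<theta>" "\<theta> \<le> 1"
  shows "edge_point x y \<theta> \<in> cable_system G"
proof -
  have "cable_map G (Edge x y) (\<theta> / (2 * weight G x y)) \<in> cable_system G"
    using assms by (intro cable_map_in) (auto simp: cables_def divide_right_mono)
  then show ?thesis using assms by (simp add: cable_map_Edge del: cable_map.simps)
qed

lemma vertex_point_in: "x \<in> verts G \<Longrightarrow> vertex_point x \<in> cable_system G"
  using cable_map_in[of "Ray x" G 0] by (auto simp: cables_def vertex_point_def)

lemma ray_point_in: "x \<in> verts G \<Longrightarrow> 0 \<le> s \<Longrightarrow> 2 * killing G x * s < 1 \<Longrightarrow> (indicator {x}, s) \<in> cable_system G"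
  using cable_map_in[of "Ray x" G s] by (auto simp: cables_def)

lemma cable_point_cases:
  assumes "p \<in> cable_system G"
  obtains x y \<theta> where "x \<in> verts G" "y \<in> verts G" "weight G x y > 0" "x \<noteq> y" "0 \<le> \<theta>" "\<theta> \<le> 1" "p = edge_point x y \<theta>"
    "p = cable_map G (Edge x y) (\<theta> / (2 * weight G x y))"
  | x s where "x \<in> verts G" "0 \<le> s" "2 * killing G x * s < 1" "p = (indicator {x}, s)"
proof -
  obtain c t where c: "c \<in> cables G" "t \<in> cable_dom G c" "p = cable_map G c t"
    using assms by (rule cable_system_cases)
  show ?thesis
  proof (cases c)
    case (Edge x y)
    then have w: "x \<in> verts G" "y \<in> verts G" "weight G x y > 0" "x \<noteq> y" "0 \<le> t" "t \<le> 1 / (2 * weight G x y)"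
      using c no_loops by (auto simp: cables_def)
    show ?thesis
      by (rule that(1)[of x y "2 * weight G x y * t"]) (use c w in \<open>auto simp: Edge cable_map_Edge field_simps simp del: cable_map.simps\<close>)
  next
    case (Ray x)
    then show ?thesis using c by (intro that(2)[of x t]) (auto simp: cables_def)
  qed
qed

lemma coord_nonneg: "p \<in> cable_system G \<Longrightarrow> 0 \<le> fst p x"
  and coord_le_1: "p \<in> cable_system G \<Longrightarrow> fst p x \<le> 1"
  by (erule cable_point_cases; auto simp: edge_point_def indicator_def)+

definition neighbours :: "'v \<Rightarrow> 'v set" where
  "neighbours y = {z \<in> verts G. weight G y z > 0}"

text \<open>The barycentric coordinate at \<open>y\<close> already falls linearly from 1 to 0 along
  the edges at \<open>y\<close>. The ray may be infinite, so the tent is cut off there at distance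
  \<open>R\<close>.\<close>

definition vertex_tent :: "'v \<Rightarrow> real \<Rightarrow> 'v cable_point \<Rightarrow> real" where
  "vertex_tent y R p = fst p y * max 0 (1 - snd p / R)"

lemma continuous_on_fst_apply: "continuous_on S (\<lambda>p :: 'v cable_point. fst p x)"
  by (intro continuous_on_product_then_coordinatewise[OF continuous_on_fst[OF continuous_on_id]])

text \<open>Testing at a vertex produces the discrete Laplacian there plus a difference quotient
  along the ray. The two orientations of an edge, each of multiplicity 1/2, add up to one
  contribution of full weight.\<close>

lemma
  assumes y: "y \<in> verts G" and R: "R > 0" "2 * killing G y * R < 1"
  shows vertex_tent_form_domain: "vertex_tent y R \<in> form_domain G"
    and vertex_tent_integrable: "integrable (lebesgue_cable G) (vertex_tent y R)"
    and vertex_tent_dirichlet_form: "u \<in> form_domain G \<Longrightarrow> dirichlet_form G u (vertex_tent y R) =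
      (\<Sum>z\<in>neighbours y. weight G y z * (u (vertex_point y) - u (vertex_point z))) +
      (u (vertex_point y) - u (indicator {y}, R)) / (2 * R)"
proof -
  define N where "N = neighbours y"
  have N: "finite N" "y \<notin> N" and N': "\<And>z. z \<in> N \<Longrightarrow> z \<in> verts G \<and> weight G y z > 0 \<and> weight G z y > 0 \<and> z \<noteq> y"
    using locally_finite[OF y] no_loops weight_sym by (auto simp: N_def neighbours_def)
  define F where "F = (\<lambda>z. Edge y z) ` N \<union> (\<lambda>z. Edge z y) ` N \<union> {Ray y}"
  \<comment> \<open>Slope, value at 0 and breakpoint on each oriented cable. One linear piece
    suffices, so the second slope is 0 and the last two breakpoints coincide.\<close>
  define A where "A c = (case c of Edge a b \<Rightarrow> (if a = y then -1 else 1) * (2 * weight G a b) | Ray _ \<Rightarrow> - 1 / R)" for c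
  define C :: "'v cable \<Rightarrow> real" where "C c = (case c of Edge a b \<Rightarrow> (if a = y then 1 else 0) | Ray _ \<Rightarrow> 1)" for c
  define T where "T c = (case c of Edge a b \<Rightarrow> 1 / (2 * weight G a b) | Ray _ \<Rightarrow> R)" for c
  have 1: "continuous_on (cable_system G) (vertex_tent y R)"
    unfolding vertex_tent_def[abs_def] by (intro continuous_intros continuous_on_fst_apply) (use R in auto)
  have 2: "0 \<le> vertex_tent y R p \<and> vertex_tent y R p \<le> 1" if p: "p \<in> cable_system G" for p
  proof -
    have "0 \<le> snd p" using p by (cases rule: cable_point_cases) (auto simp: edge_point_def)
    then have "max 0 (1 - snd p / R) \<le> 1" using R by auto
    then show ?thesis using coord_nonneg[OF p, of y] coord_le_1[OF p, of y] mult_mono[of "fst p y" 1 "max 0 (1 - snd p / R)" 1]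
      by (auto simp: vertex_tent_def)
  qed
  have 3: "finite F" "F \<subseteq> cables G" using N N' y by (auto simp: F_def cables_def)
  have 4: "0 \<le> T c \<and> T c \<le> T c \<and> {0..T c} \<subseteq> cable_dom G c" if "c \<in> F" for c
  proof -
    have "T c \<in> cable_dom G c" "0 \<in> cable_dom G c" "0 \<le> T c" using that N' R by (auto simp: F_def T_def less_imp_le)
    then show ?thesis using cable_dom_interval[of 0 G c "T c"] by simp
  qed
  have 5: "vertex_tent y R (cable_map G c t) = C c + A c * clamp_to 0 (T c) t + 0 * clamp_to (T c) (T c) t"
    if c: "c \<in> F" and t: "t \<in> cable_dom G c" for c t
  proof -
    from c consider z where "z \<in> N" "c = Edge y z" | z where "z \<in> N" "c = Edge z y" | "c = Ray y" by (auto simp: F_def)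
    then show ?thesis
    proof cases
      case (1 z)
      then have "clamp_to 0 (T c) t = t" using t by (auto simp: clamp_to_def T_def)
      then show ?thesis using 1 N'[of z] by (auto simp: vertex_tent_def C_def A_def indicator_def)
    next
      case (2 z)
      then have "clamp_to 0 (T c) t = t" using t by (auto simp: clamp_to_def T_def)
      then show ?thesis using 2 N'[of z] by (auto simp: vertex_tent_def C_def A_def indicator_def)
    next
      case 3
      then have "0 \<le> t" using t by auto
      then show ?thesis using 3 R by (auto simp: vertex_tent_def C_def A_def T_def clamp_to_def max_def min_def field_simps)
    qed
  qed
  have 6: "vertex_tent y R (cable_map G c t) = 0" if c: "c \<in> F" "t \<in> cable_dom G c" "t \<notin> {0..T c}" for c t
    using c R by (auto simp: F_def T_def vertex_tent_def max_def field_simps)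
  have 7: "vertex_tent y R (cable_map G c t) = 0" if c: "c \<in> cables G - F" "t \<in> cable_dom G c" for c t
  proof (cases c)
    case (Edge a b)
    then have "a \<noteq> y" "b \<noteq> y" using c(1) weight_sym by (auto simp: F_def cables_def N_def neighbours_def)
    then show ?thesis by (simp add: Edge vertex_tent_def)
  next
    case (Ray x)
    then have "x \<noteq> y" using c(1) by (auto simp: F_def)
    then show ?thesis by (simp add: Ray vertex_tent_def)
  qed
  note tf = 1 2 3 4 5 6 7
  show "vertex_tent y R \<in> form_domain G" by (rule test_function_form_domain[OF tf])
  show "integrable (lebesgue_cable G) (vertex_tent y R)" by (rule test_function_integrable[OF tf])
  assume u: "u \<in> form_domain G"
  have "dirichlet_form G u (vertex_tent y R) =
    1 / 2 * (\<Sum>c\<in>F. cable_mult c * (A c * (u (cable_map G c (T c)) - u (cable_map G c 0)) +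
         0 * (u (cable_map G c (T c)) - u (cable_map G c (T c)))))"
    by (rule test_function_dirichlet_form[OF tf u])
  also have "\<dots> = 1 / 2 * (\<Sum>c\<in>F. cable_mult c * (A c * (u (cable_map G c (T c)) - u (cable_map G c 0))))" by simp
  also have "(\<Sum>c\<in>F. cable_mult c * (A c * (u (cable_map G c (T c)) - u (cable_map G c 0)))) =
    (\<Sum>c\<in>(\<lambda>z. Edge y z) ` N. cable_mult c * (A c * (u (cable_map G c (T c)) - u (cable_map G c 0)))) +
    (\<Sum>c\<in>(\<lambda>z. Edge z y) ` N. cable_mult c * (A c * (u (cable_map G c (T c)) - u (cable_map G c 0)))) +
    (u (vertex_point y) - u (indicator {y}, R)) / R"
  proof -
    have "(\<lambda>z. Edge y z) ` N \<inter> (\<lambda>z. Edge z y) ` N = {}" using N by auto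
    moreover have "Ray y \<notin> (\<lambda>z. Edge y z) ` N \<union> (\<lambda>z. Edge z y) ` N" by auto
    ultimately show ?thesis unfolding F_def using N(1)
      by (simp add: sum.union_disjoint A_def T_def vertex_point_def minus_divide_left[symmetric] flip: minus_divide_left) (simp add: diff_divide_distrib)
  qed
  also have "(\<Sum>c\<in>(\<lambda>z. Edge y z) ` N. cable_mult c * (A c * (u (cable_map G c (T c)) - u (cable_map G c 0)))) =
    (\<Sum>z\<in>N. weight G y z * (u (vertex_point y) - u (vertex_point z)))"
  proof (subst sum.reindex)
    show "inj_on (Edge y) N" by (auto simp: inj_on_def)
    show "sum ((\<lambda>c. cable_mult c * (A c * (u (cable_map G c (T c)) - u (cable_map G c 0)))) \<circ> Edge y) N =
      (\<Sum>z\<in>N. weight G y z * (u (vertex_point y) - u (vertex_point z)))"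
    proof (intro sum.cong refl)
      fix z assume "z \<in> N"
      then have "weight G y z > 0" using N' by auto
      then show "((\<lambda>c. cable_mult c * (A c * (u (cable_map G c (T c)) - u (cable_map G c 0)))) \<circ> Edge y) z =
        weight G y z * (u (vertex_point y) - u (vertex_point z))"
        by (simp add: A_def T_def cable_map_Edge edge_point_0 edge_point_1 del: cable_map.simps) (simp add: algebra_simps)
    qed
  qed
  also have "(\<Sum>c\<in>(\<lambda>z. Edge z y) ` N. cable_mult c * (A c * (u (cable_map G c (T c)) - u (cable_map G c 0)))) =
    (\<Sum>z\<in>N. weight G y z * (u (vertex_point y) - u (vertex_point z)))"
  proof (subst sum.reindex)
    show "inj_on (\<lambda>z. Edge z y) N" by (auto simp: inj_on_def)
    show "sum ((\<lambda>c. cable_mult c * (A c * (u (cable_map G c (T c)) - u (cable_map G c 0)))) \<circ> (\<lambda>z. Edge z y)) N =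
      (\<Sum>z\<in>N. weight G y z * (u (vertex_point y) - u (vertex_point z)))"
    proof (intro sum.cong refl)
      fix z assume "z \<in> N"
      then have "weight G z y > 0" "z \<noteq> y" "weight G y z = weight G z y" using N'[of z] weight_sym[of y z] by auto
      then show "((\<lambda>c. cable_mult c * (A c * (u (cable_map G c (T c)) - u (cable_map G c 0)))) \<circ> (\<lambda>z. Edge z y)) z =
        weight G y z * (u (vertex_point y) - u (vertex_point z))"
        by (simp add: A_def T_def cable_map_Edge edge_point_0 edge_point_1 del: cable_map.simps)
    qed
  qed
  finally show "dirichlet_form G u (vertex_tent y R) =
      (\<Sum>z\<in>neighbours y. weight G y z * (u (vertex_point y) - u (vertex_point z))) +
      (u (vertex_point y) - u (indicator {y}, R)) / (2 * R)"
    by (simp add: N_def)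
qed

text \<open>The two linear functions meet at height 1 in \<open>edge_point x y \<theta>\<close>.
  Outside the edge one of the two coordinates is 0 and the other nonnegative, so that the minimum is
  0 there.\<close>

definition edge_tent :: "'v \<Rightarrow> 'v \<Rightarrow> real \<Rightarrow> 'v cable_point \<Rightarrow> real" where
  "edge_tent x y \<theta> p = min (fst p x / (1 - \<theta>)) (fst p y / \<theta>)"

lemma
  assumes xy: "x \<in> verts G" "y \<in> verts G" "weight G x y > 0" and \<theta>: "0 < \<theta>" "\<theta> < 1"
  shows edge_tent_form_domain: "edge_tent x y \<theta> \<in> form_domain G"
    and edge_tent_integrable: "integrable (lebesgue_cable G) (edge_tent x y \<theta>)"
    and edge_tent_dirichlet_form: "u \<in> form_domain G \<Longrightarrow> dirichlet_form G u (edge_tent x y \<theta>) =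
      weight G x y * ((u (edge_point x y \<theta>) - u (vertex_point x)) / \<theta> + (u (edge_point x y \<theta>) - u (vertex_point y)) / (1 - \<theta>))"
proof -
  define w where "w = weight G x y"
  have w: "w > 0" "weight G y x = w" "x \<noteq> y" using xy weight_sym no_loops by (auto simp: w_def)
  define F where "F = {Edge x y, Edge y x}"
  \<comment> \<open>\<open>\<tau> c\<close> is the position of the peak as seen in the orientation
    of \<open>c\<close>.\<close>
  define \<tau> where "\<tau> c = (if c = Edge x y then \<theta> else 1 - \<theta>)" for c :: "'v cable"
  have \<tau>: "0 < \<tau> c" "\<tau> c < 1" for c using \<theta> by (auto simp: \<tau>_def)
  define A where "A c = 2 * w / \<tau> c" for c
  define B where "B c = - 2 * w / (1 - \<tau> c)" for c
  define T where "T c = \<tau> c / (2 * w)" for c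
  define l where "l = 1 / (2 * w)"
  define C where "C c = - B c * T c" for c
  have tent: "edge_tent x y \<theta> (cable_map G c t) = min ((1 - 2 * w * t) / (1 - \<tau> c)) (2 * w * t / \<tau> c)"
    if "c \<in> F" for c t
    using that w by (auto simp: F_def edge_tent_def \<tau>_def w_def[symmetric] min.commute)
  have dom: "cable_dom G c = {0..l}" if "c \<in> F" for c using that w by (auto simp: F_def l_def w_def[symmetric])
  have 1: "continuous_on (cable_system G) (edge_tent x y \<theta>)"
    unfolding edge_tent_def[abs_def] by (intro continuous_intros continuous_on_fst_apply) (use \<theta> in auto)
  have 3: "finite F" "F \<subseteq> cables G" using xy w by (auto simp: F_def cables_def)
  have 7: "edge_tent x y \<theta> (cable_map G c t) = 0" if c: "c \<in> cables G - F" "t \<in> cable_dom G c" for c t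
  proof (cases c)
    case (Edge a b)
    have "cable_map G c t \<in> cable_system G" using c by (intro cable_map_in) auto
    note nn = coord_nonneg[OF this]
    have "weight G a b > 0" using Edge c by (auto simp: cables_def)
    then have "a \<noteq> b" using no_loops by auto
    then have "fst (cable_map G c t) x = 0 \<or> fst (cable_map G c t) y = 0"
      using c w(3) by (auto simp: Edge F_def indicator_def)
    moreover have "0 \<le> fst (cable_map G c t) x / (1 - \<theta>)" "0 \<le> fst (cable_map G c t) y / \<theta>" using nn[of x] nn[of y] \<theta> by simp_all
    ultimately show ?thesis unfolding edge_tent_def by (auto simp: min_def)
  next
    case (Ray z)
    then show ?thesis using w(3) \<theta> by (auto simp: edge_tent_def indicator_def min_def)
  qed
  have 2: "0 \<le> edge_tent x y \<theta> p \<and> edge_tent x y \<theta> p \<le> 1" if p: "p \<in> cable_system G" for p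
  proof -
    obtain c t where c: "c \<in> cables G" "t \<in> cable_dom G c" "p = cable_map G c t" using p by (rule cable_system_cases)
    have "edge_tent x y \<theta> p \<le> 1"
    proof (cases "c \<in> F")
      case True
      show ?thesis
      proof (cases "2 * w * t \<le> \<tau> c")
        case True
        then have "2 * w * t / \<tau> c \<le> 1" using \<tau> by simp
        then show ?thesis using tent[OF \<open>c \<in> F\<close>] c by simp
      next
        case False
        then have "(1 - 2 * w * t) / (1 - \<tau> c) \<le> 1" using \<tau>[of c] by simp
        then show ?thesis using tent[OF \<open>c \<in> F\<close>] c by simp
      qed
    qed (use 7[of c t] c in auto)
    moreover have "0 \<le> edge_tent x y \<theta> p" unfolding edge_tent_def using coord_nonneg[OF p] \<theta> by simp
    ultimately show ?thesis by simp
  qed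
  have 4: "0 \<le> T c \<and> T c \<le> l \<and> {0..l} \<subseteq> cable_dom G c" if "c \<in> F" for c
    using dom[OF that] \<tau>[of c] w by (auto simp: T_def l_def divide_right_mono)
  have 5: "edge_tent x y \<theta> (cable_map G c t) = C c + A c * clamp_to 0 (T c) t + B c * clamp_to (T c) l t"
    if c: "c \<in> F" and t: "t \<in> cable_dom G c" for c t
  proof -
    have t: "0 \<le> t" "t \<le> l" using t dom[OF c] by auto
    have T: "0 \<le> T c" "T c \<le> l" using 4[OF c] by auto
    show ?thesis
    proof (cases "t \<le> T c")
      case True
      then have cl: "clamp_to 0 (T c) t = t" "clamp_to (T c) l t = T c" using t T by (auto simp: clamp_to_def)
      have "2 * w * t \<le> \<tau> c" using True w by (simp add: T_def field_simps)
      then have "2 * w * t / \<tau> c \<le> (1 - 2 * w * t) / (1 - \<tau> c)" using \<tau>[of c] by (simp add: field_simps)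
      then show ?thesis unfolding tent[OF c] cl by (simp add: C_def A_def)
    next
      case False
      then have cl: "clamp_to 0 (T c) t = T c" "clamp_to (T c) l t = t" using t T by (auto simp: clamp_to_def)
      have "2 * w * t \<ge> \<tau> c" using False w by (simp add: T_def field_simps)
      then have "(1 - 2 * w * t) / (1 - \<tau> c) \<le> 2 * w * t / \<tau> c" using \<tau>[of c] by (simp add: field_simps)
      then have "edge_tent x y \<theta> (cable_map G c t) = (1 - 2 * w * t) / (1 - \<tau> c)" unfolding tent[OF c] by simp
      also have "\<dots> = 1 + B c * (t - T c)" using \<tau>[of c] w by (simp add: B_def T_def field_simps)
      also have "\<dots> = C c + A c * T c + B c * t" using \<tau>[of c] w by (simp add: C_def A_def T_def algebra_simps)
      finally show ?thesis unfolding cl .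
    qed
  qed
  have 6: "edge_tent x y \<theta> (cable_map G c t) = 0" if c: "c \<in> F" "t \<in> cable_dom G c" "t \<notin> {0..l}" for c t
    using c dom by auto
  note tf = 1 2 3 4 5 6 7
  show "edge_tent x y \<theta> \<in> form_domain G" by (rule test_function_form_domain[OF tf])
  show "integrable (lebesgue_cable G) (edge_tent x y \<theta>)" by (rule test_function_integrable[OF tf])
  assume u: "u \<in> form_domain G"
  have "dirichlet_form G u (edge_tent x y \<theta>) =
    1 / 2 * (\<Sum>c\<in>F. cable_mult c * (A c * (u (cable_map G c (T c)) - u (cable_map G c 0)) +
         B c * (u (cable_map G c l) - u (cable_map G c (T c)))))"
    by (rule test_function_dirichlet_form[OF tf u])
  also have "\<dots> = w * ((u (edge_point x y \<theta>) - u (vertex_point x)) / \<theta> + (u (edge_point x y \<theta>) - u (vertex_point y)) / (1 - \<theta>))"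
  proof -
    have "cable_map G (Edge x y) (T (Edge x y)) = edge_point x y \<theta>" "cable_map G (Edge y x) (T (Edge y x)) = edge_point x y \<theta>"
      "cable_map G (Edge x y) 0 = vertex_point x" "cable_map G (Edge y x) 0 = vertex_point y"
      "cable_map G (Edge x y) l = vertex_point y" "cable_map G (Edge y x) l = vertex_point x"
      using w edge_point_swap[of y x "\<theta>"]
      by (simp_all add: cable_map_Edge T_def \<tau>_def l_def w_def[symmetric] edge_point_0 edge_point_1 del: cable_map.simps)
    then show ?thesis using w(3) by (simp add: F_def A_def B_def \<tau>_def algebra_simps add_divide_distrib diff_divide_distrib)
  qed
  finally show "dirichlet_form G u (edge_tent x y \<theta>) =
      weight G x y * ((u (edge_point x y \<theta>) - u (vertex_point x)) / \<theta> + (u (edge_point x y \<theta>) - u (vertex_point y)) / (1 - \<theta>))"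
    by (simp add: w_def)
qed

end

subsection \<open>Measurability of the paths\<close>

text \<open>The default simp rules rewrite \<open>w t \<noteq> None\<close> and quantifiers over cable points into unusable forms.\<close>

declare split_paired_All [simp del] split_paired_Ex [simp del] not_None_eq [simp del]

text \<open>A function that is continuous in one variable and measurable in the other is a limit of
  functions that depend on the first variable only through a point of a countable dense set. Joint
  measurability of the local times, needed for Fubini, is obtained in this way.\<close>

lemma caratheodory_function_measurable:
  fixes F :: "'x::{metric_space,second_countable_topology} \<Rightarrow> 'w \<Rightarrow> real"
  assumes M1: "space M1 = X" "sets M1 = sets (restrict_space borel X)"
    and m: "\<And>q. q \<in> X \<Longrightarrow> F q \<in> borel_measurable M2"
    and c: "\<And>w. w \<in> space M2 \<Longrightarrow> continuous_on X (\<lambda>q. F q w)"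
  shows "(\<lambda>(q, w). F q w) \<in> borel_measurable (M1 \<Otimes>\<^sub>M M2)"
proof (cases "X = {}")
  case True
  then show ?thesis by (intro borel_measurableI) (auto simp: space_pair_measure M1)
next
  case False
  obtain D where D: "countable D" "D \<subseteq> X" "X \<subseteq> closure D" by (metis separable)
  have "D \<noteq> {}" using D False by auto
  define e where "e = from_nat_into D"
  have e: "e k \<in> D" for k unfolding e_def using from_nat_into[OF \<open>D \<noteq> {}\<close>] .
  \<comment> \<open>The first point of the dense sequence within distance \<open>1 / Suc n\<close>
    of \<open>q\<close>; taking the first one makes the choice measurable.\<close>
  define idx where "idx n q = (LEAST k. dist q (e k) < 1 / real (Suc n))" for n q
  have idx: "dist q (e (idx n q)) < 1 / real (Suc n)" if "q \<in> X" for q n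
  proof -
    have "\<exists>y\<in>D. dist y q < 1 / real (Suc n)"
      using D that by (auto simp: closure_approachable subset_iff)
    then obtain y where "y \<in> D" "dist q y < 1 / real (Suc n)" by (auto simp: dist_commute)
    moreover then obtain k where "e k = y" unfolding e_def using D(1) from_nat_into_surj by metis
    ultimately show ?thesis unfolding idx_def by (metis LeastI_ex)
  qed
  have dm: "(\<lambda>q. dist q y) \<in> borel_measurable M1" for y :: 'x
  proof -
    have "continuous_on X (\<lambda>q. dist q y)" by (intro continuous_intros)
    then show ?thesis
      using borel_measurable_continuous_on_restrict measurable_cong_sets[OF M1(2) refl] by blast
  qed
  have idxm: "idx n \<in> measurable M1 (count_space UNIV)" for n
    unfolding idx_def[abs_def] by (intro measurable_Least) (use dm in measurable)
  show ?thesis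
  proof (rule borel_measurable_LIMSEQ_real)
    show "(\<lambda>qw. (\<lambda>(q, w). F (e (idx n q)) w) qw) \<in> borel_measurable (M1 \<Otimes>\<^sub>M M2)" for n
    proof -
      have "(\<lambda>qw. F (e (idx n (fst qw))) (snd qw)) \<in> borel_measurable (M1 \<Otimes>\<^sub>M M2)"
      proof (rule measurable_compose_countable[where f = "\<lambda>k qw. F (e k) (snd qw)" and g = "\<lambda>qw. idx n (fst qw)"])
        show "(\<lambda>qw. F (e i) (snd qw)) \<in> borel_measurable (M1 \<Otimes>\<^sub>M M2)" for i
          using e D(2) by (intro measurable_compose[OF measurable_snd] m) auto
        show "(\<lambda>qw. idx n (fst qw)) \<in> measurable (M1 \<Otimes>\<^sub>M M2) (count_space UNIV)"
          by (rule measurable_compose[OF measurable_fst idxm])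
      qed
      then show ?thesis by (simp add: case_prod_beta')
    qed
    fix qw assume "qw \<in> space (M1 \<Otimes>\<^sub>M M2)"
    then obtain q w where qw: "qw = (q, w)" "q \<in> X" "w \<in> space M2" by (auto simp: space_pair_measure M1)
    have "(\<lambda>n. dist (e (idx n q)) q) \<longlonglongrightarrow> 0"
    proof (rule tendsto_sandwich[of "\<lambda>_. 0" _ _ "\<lambda>n. 1 / real (Suc n)"])
      show "\<forall>\<^sub>F n in sequentially. dist (e (idx n q)) q \<le> 1 / real (Suc n)"
        using idx[OF qw(2)] by (auto simp: dist_commute less_imp_le)
      show "(\<lambda>n. 1 / real (Suc n)) \<longlonglongrightarrow> 0" using LIMSEQ_inverse_real_of_nat by (simp add: inverse_eq_divide)
    qed auto
    then have "(\<lambda>n. e (idx n q)) \<longlonglongrightarrow> q" by (rule tendsto_dist_iff[THEN iffD2])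
    moreover have "\<forall>n. e (idx n q) \<in> X" using e D by auto
    ultimately have "(\<lambda>n. F (e (idx n q)) w) \<longlonglongrightarrow> F q w"
      using continuous_on_tendsto_compose[OF c[OF qw(3)], of "\<lambda>n. e (idx n q)" q sequentially] qw(2) by simp
    then show "(\<lambda>n. (\<lambda>(q, w). F (e (idx n q)) w) qw) \<longlonglongrightarrow> (\<lambda>(q, w). F q w) qw" by (simp add: qw)
  qed
qed

lemma square_integrable_Cauchy_Schwarz:
  fixes X Y :: "'a \<Rightarrow> real"
  assumes [measurable]: "X \<in> borel_measurable M" "Y \<in> borel_measurable M"
    and i: "integrable M (\<lambda>\<omega>. (X \<omega>)\<^sup>2)" "integrable M (\<lambda>\<omega>. (Y \<omega>)\<^sup>2)" "integrable M (\<lambda>\<omega>. X \<omega> * Y \<omega>)"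
  shows "(\<integral>\<omega>. X \<omega> * Y \<omega> \<partial>M)\<^sup>2 \<le> (\<integral>\<omega>. (X \<omega>)\<^sup>2 \<partial>M) * (\<integral>\<omega>. (Y \<omega>)\<^sup>2 \<partial>M)"
proof -
  define a b c where "a = (\<integral>\<omega>. (X \<omega>)\<^sup>2 \<partial>M)" and "b = (\<integral>\<omega>. X \<omega> * Y \<omega> \<partial>M)" and "c = (\<integral>\<omega>. (Y \<omega>)\<^sup>2 \<partial>M)"
  have ac: "0 \<le> a" "0 \<le> c" by (auto simp: a_def c_def)
  have q: "0 \<le> s\<^sup>2 * a + 2 * s * b + c" for s
  proof -
    have "0 \<le> (\<integral>\<omega>. (s * X \<omega> + Y \<omega>)\<^sup>2 \<partial>M)" by simp
    also have "\<dots> = (\<integral>\<omega>. s\<^sup>2 * (X \<omega>)\<^sup>2 + 2 * s * (X \<omega> * Y \<omega>) + (Y \<omega>)\<^sup>2 \<partial>M)"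
      by (intro Bochner_Integration.integral_cong refl) (simp add: power2_eq_square algebra_simps)
    also have "\<dots> = s\<^sup>2 * a + 2 * s * b + c" using i by (simp add: a_def b_def c_def)
    finally show ?thesis .
  qed
  have "b\<^sup>2 \<le> a * c"
  proof (cases "a = 0")
    case True
    have "b = 0"
    proof (rule ccontr)
      assume "b \<noteq> 0"
      then have "2 * (- (c + 1) / (2 * b)) * b + c = -1" by (simp add: field_simps)
      then show False using q[of "- (c + 1) / (2 * b)"] True by simp
    qed
    then show ?thesis using True by simp
  next
    case False
    then have "0 < a" using ac by simp
    have "(- b / a)\<^sup>2 * a + 2 * (- b / a) * b + c = c - b\<^sup>2 / a" using \<open>0 < a\<close> by (simp add: field_simps power2_eq_square)
    then have "b\<^sup>2 / a \<le> c" using q[of "- b / a"] by simp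
    then show ?thesis using \<open>0 < a\<close> by (simp add: field_simps)
  qed
  then show ?thesis by (simp add: a_def b_def c_def)
qed

locale path_process =
  fixes G :: "('v::countable) weighted_graph" and P :: "'v cable_point \<Rightarrow> 'v path measure"
  assumes markov: "markov_family G P"
begin

lemma prob_space_P: "p \<in> cable_system G \<Longrightarrow> prob_space (P p)"
  and space_P: "p \<in> cable_system G \<Longrightarrow> space (P p) = paths G"
  and sets_P: "p \<in> cable_system G \<Longrightarrow> sets (P p) = sets (path_sigma G {0..})"
  and start_P: "p \<in> cable_system G \<Longrightarrow> AE w in P p. w 0 = Some p"
  using markov by (auto simp: markov_family_def)

text \<open>Dead paths are sent to a pair that is not a cable point, as the coordinates of a cable
  point sum to 1. Values in one topological space allow limits to be taken.\<close>

definition pos :: "real \<Rightarrow> 'v path \<Rightarrow> 'v cable_point" where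
  "pos t w = (case w t of None \<Rightarrow> (\<lambda>_. 0, 0) | Some q \<Rightarrow> q)"

lemma path_eventsI:
  assumes "0 \<le> t" "A \<in> sets borel"
  shows "{w \<in> paths G. w t \<in> Some ` A} \<in> sets (path_sigma G {0..})"
proof -
  have "{{w \<in> paths G. w t \<in> Some ` A} | t A. t \<in> {0..} \<and> A \<in> sets borel} \<subseteq> Pow (paths G)" by auto
  then show ?thesis unfolding path_sigma_def using assms by (auto intro!: in_measure_of)
qed

lemma alive_event:
  assumes "0 \<le> t" shows "{w \<in> paths G. w t \<noteq> None} \<in> sets (path_sigma G {0..})"
proof -
  have "{w \<in> paths G. w t \<noteq> None} = {w \<in> paths G. w t \<in> Some ` UNIV}" by (auto simp: image_iff)
  then show ?thesis using path_eventsI[OF assms, of UNIV] by simp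
qed

context
  fixes p assumes p: "p \<in> cable_system G"
begin

lemma alive_measurable: "0 \<le> t \<Longrightarrow> Measurable.pred (P p) (\<lambda>w. w t \<noteq> None)"
  using alive_event[of t] by (simp add: pred_def space_P[OF p] sets_P[OF p])

lemma pos_measurable:
  assumes t: "0 \<le> t" shows "pos t \<in> borel_measurable (P p)"
proof (rule measurableI)
  fix A :: "'v cable_point set" assume A: "A \<in> sets borel"
  have "pos t -` A \<inter> space (P p) = {w \<in> paths G. w t \<in> Some ` A} \<union>
      (if (\<lambda>_. 0, 0) \<in> A then space (P p) - {w \<in> paths G. w t \<noteq> None} else {})"
    by (auto simp: pos_def space_P[OF p] image_iff split: option.splits if_splits)
  also have "\<dots> \<in> sets (P p)"
    using path_eventsI[OF t A] alive_event[OF t] by (auto simp: sets_P[OF p, symmetric])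
  finally show "pos t -` A \<inter> space (P p) \<in> sets (P p)" .
qed simp

text \<open>
  The next grid point is strictly later than \<open>t\<close>, so that right continuity makes the process a limit of the processes
  observed on the grid, and hence jointly measurable; negative times are mapped to positive ones.
\<close>

definition next_grid :: "nat \<Rightarrow> real \<Rightarrow> real" where
  "next_grid n t = (of_int \<lfloor>real (Suc n) * max 0 t\<rfloor> + 1) / real (Suc n)"

lemma next_grid: "max 0 t < next_grid n t" "next_grid n t \<le> max 0 t + 1 / real (Suc n)"
proof -
  have "real (Suc n) * max 0 t < of_int \<lfloor>real (Suc n) * max 0 t\<rfloor> + 1" by linarith
  then show "max 0 t < next_grid n t" unfolding next_grid_def by (subst pos_less_divide_eq) (simp_all add: mult.commute del: of_nat_Suc)
  have "of_int \<lfloor>real (Suc n) * max 0 t\<rfloor> \<le> real (Suc n) * max 0 t" by linarith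
  then have "next_grid n t \<le> (real (Suc n) * max 0 t + 1) / real (Suc n)"
    unfolding next_grid_def by (intro divide_right_mono) auto
  also have "\<dots> = max 0 t + 1 / real (Suc n)" by (simp add: add_divide_distrib)
  finally show "next_grid n t \<le> max 0 t + 1 / real (Suc n)" .
qed

lemma next_grid_tendsto: "(\<lambda>n. next_grid n t) \<longlonglongrightarrow> max 0 t"
proof (rule tendsto_sandwich[of "\<lambda>_. max 0 t" _ _ "\<lambda>n. max 0 t + 1 / real (Suc n)"])
  have "(\<lambda>n. max 0 t + 1 / real (Suc n)) \<longlonglongrightarrow> max 0 t + 0"
    using LIMSEQ_inverse_real_of_nat by (intro tendsto_add tendsto_const) (simp add: inverse_eq_divide)
  then show "(\<lambda>n. max 0 t + 1 / real (Suc n)) \<longlonglongrightarrow> max 0 t" by simp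
qed (use next_grid in \<open>auto intro: always_eventually less_imp_le\<close>)

text \<open>The grid time takes countably many values, so the map is a countable gluing of maps at
  fixed nonnegative times.\<close>

lemma measurable_at_next_grid:
  assumes f: "\<And>t. 0 \<le> t \<Longrightarrow> f t \<in> measurable (P p) N" "N = count_space UNIV \<or> N = borel"
  shows "(\<lambda>(t, w). f (next_grid n t) w) \<in> measurable (lborel \<Otimes>\<^sub>M P p) N"
proof -
  define h where "h i tw = f (of_nat (i + 1) / real (Suc n)) (snd tw)" for i and tw :: "real \<times> 'v path"
  define k where "k tw = nat \<lfloor>real (Suc n) * max 0 (fst tw)\<rfloor>" for tw :: "real \<times> 'v path"
  have "(\<lambda>tw. h (k tw) tw) \<in> measurable (lborel \<Otimes>\<^sub>M P p) N"
  proof (rule measurable_compose_countable)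
    show "h i \<in> measurable (lborel \<Otimes>\<^sub>M P p) N" for i
      unfolding h_def[abs_def] by (intro measurable_compose[OF measurable_snd] f) auto
    have "(\<lambda>x::real. nat \<lfloor>real (Suc n) * max 0 x\<rfloor>) \<in> measurable borel (count_space UNIV)" by measurable
    then show "k \<in> measurable (lborel \<Otimes>\<^sub>M P p) (count_space UNIV)" unfolding k_def[abs_def]
      by (intro measurable_compose[OF measurable_fst]) simp
  qed
  moreover have "h (k tw) tw = (case tw of (t, w) \<Rightarrow> f (next_grid n t) w)" for tw
  proof (cases tw)
    case (Pair t w)
    have "0 \<le> \<lfloor>real (Suc n) * max 0 t\<rfloor>" by simp
    then have "real (nat \<lfloor>real (Suc n) * max 0 t\<rfloor> + 1) = of_int \<lfloor>real (Suc n) * max 0 t\<rfloor> + 1" by simp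
    then show ?thesis unfolding Pair h_def k_def next_grid_def by (simp only: prod.case fst_conv snd_conv)
  qed
  ultimately show ?thesis by simp
qed

lemma path_alive_interval:
  assumes "w \<in> paths G" obtains \<zeta> :: ereal where "\<forall>t. w t \<noteq> None \<longleftrightarrow> 0 \<le> t \<and> ereal t < \<zeta>"
proof -
  have "\<exists>\<zeta>::ereal. \<forall>t. w t \<noteq> None \<longleftrightarrow> 0 \<le> t \<and> ereal t < \<zeta>" using assms by (simp only: paths_def mem_Collect_eq)
  then show ?thesis using that by blast
qed

lemma alive_right_open:
  assumes w: "w \<in> paths G" and t: "w t \<noteq> None" and s: "s \<longlonglongrightarrow> t" "\<And>n. s n \<ge> t"
  shows "\<forall>\<^sub>F n in sequentially. w (s n) \<noteq> None"
proof -
  obtain \<zeta> :: ereal where \<zeta>: "\<forall>t. w t \<noteq> None \<longleftrightarrow> 0 \<le> t \<and> ereal t < \<zeta>"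
    using path_alive_interval[OF w] .
  have "(\<lambda>n. ereal (s n)) \<longlonglongrightarrow> ereal t" using s by simp
  moreover have "ereal t < \<zeta>" "0 \<le> t" using \<zeta> t by auto
  ultimately have "\<forall>\<^sub>F n in sequentially. ereal (s n) < \<zeta>" by (intro order_tendstoD)
  then show ?thesis
  proof eventually_elim
    case (elim n)
    moreover have "0 \<le> s n" using \<open>0 \<le> t\<close> s(2)[of n] by simp
    ultimately show ?case using \<zeta> by blast
  qed
qed

lemma alive_mono: "w \<in> paths G \<Longrightarrow> w t \<noteq> None \<Longrightarrow> 0 \<le> s \<Longrightarrow> s \<le> t \<Longrightarrow> w s \<noteq> None"
  by (erule path_alive_interval) (auto intro: le_less_trans[of "ereal s" "ereal t"] simp del: not_None_eq)

lemma pos_right_continuous: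
  assumes w: "w \<in> paths G" and s: "s \<longlonglongrightarrow> t" "\<And>n. s n \<ge> t" "0 \<le> t"
  shows "(\<lambda>n. pos (s n) w) \<longlonglongrightarrow> pos t w"
proof (cases "w t = None")
  case True
  then have "w (s n) = None" for n using alive_mono[OF w, of "s n" t] s by blast
  then show ?thesis using True by (simp add: pos_def)
next
  case False
  have ev: "\<forall>\<^sub>F n in sequentially. w (s n) \<noteq> None" by (rule alive_right_open[OF w False s(1,2)])
  have c: "continuous_on {t. w t \<noteq> None} (\<lambda>t. the (w t))" using w by (simp add: paths_def)
  have "(\<lambda>n. the (w (s n))) \<longlonglongrightarrow> the (w t)"
    by (rule continuous_on_tendsto_compose[OF c s(1)]) (use False ev in auto)
  moreover have "\<forall>\<^sub>F n in sequentially. the (w (s n)) = pos (s n) w"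
    using ev by eventually_elim (auto simp: pos_def)
  moreover have "the (w t) = pos t w" using False by (auto simp: pos_def)
  ultimately show ?thesis using Lim_transform_eventually by fastforce
qed

lemma pos_joint_measurable: "(\<lambda>(t, w). pos (max 0 t) w) \<in> borel_measurable (lborel \<Otimes>\<^sub>M P p)"
proof (rule borel_measurable_LIMSEQ_metric)
  show "(\<lambda>(t, w). pos (next_grid n t) w) \<in> borel_measurable (lborel \<Otimes>\<^sub>M P p)" for n
    by (rule measurable_at_next_grid) (auto intro: pos_measurable)
  fix tw :: "real \<times> 'v path" assume "tw \<in> space (lborel \<Otimes>\<^sub>M P p)"
  then obtain t w where tw: "tw = (t, w)" "w \<in> paths G" by (auto simp: space_pair_measure space_P[OF p])
  show "(\<lambda>n. (\<lambda>(t, w). pos (next_grid n t) w) tw) \<longlonglongrightarrow> (\<lambda>(t, w). pos (max 0 t) w) tw"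
    unfolding tw prod.case
    by (rule pos_right_continuous[OF tw(2) next_grid_tendsto]) (use next_grid in \<open>auto intro: less_imp_le\<close>)
qed

lemma alive_joint_measurable: "Measurable.pred (lborel \<Otimes>\<^sub>M P p) (\<lambda>(t, w). w (max 0 t) \<noteq> None)"
proof -
  have m: "Measurable.pred (lborel \<Otimes>\<^sub>M P p) (\<lambda>(t, w). w (next_grid n t) \<noteq> None)" for n
    by (rule measurable_at_next_grid[where f = "\<lambda>t w. w t \<noteq> None" and N = "count_space UNIV"])
      (simp_all only: alive_measurable simp_thms)
  have "Measurable.pred (lborel \<Otimes>\<^sub>M P p) (\<lambda>x. \<exists>n. (\<lambda>(t, w). w (next_grid n t) \<noteq> None) x)"
    by (intro pred_intros_countable m)
  moreover have "(\<exists>n. (\<lambda>(t, w). w (next_grid n t) \<noteq> None) x) = (\<lambda>(t, w). w (max 0 t) \<noteq> None) x"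
    if x0: "x \<in> space (lborel \<Otimes>\<^sub>M P p)" for x
  proof -
    obtain t w where x: "x = (t, w)" and w: "w \<in> paths G" using x0 by (auto simp: space_pair_measure space_P[OF p])
    have "\<exists>n. w (next_grid n t) \<noteq> None" if "w (max 0 t) \<noteq> None"
    proof -
      have "\<forall>\<^sub>F n in sequentially. w (next_grid n t) \<noteq> None"
        by (rule alive_right_open[OF w that next_grid_tendsto]) (rule less_imp_le, rule next_grid(1))
      from eventually_happens'[OF sequentially_bot this] show ?thesis .
    qed
    moreover have "w (max 0 t) \<noteq> None" if "w (next_grid n t) \<noteq> None" for n
      using alive_mono[OF w that, of "max 0 t"] next_grid[where t = t and n = n] by auto
    ultimately show ?thesis unfolding x by auto
  qed
  ultimately show ?thesis by (rule measurable_cong[THEN iffD1, rotated])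
qed

lemma occupation_joint_measurable:
  assumes A: "A \<in> sets borel"
  shows "Measurable.pred (lborel \<Otimes>\<^sub>M P p) (\<lambda>(t, w). 0 \<le> t \<and> w t \<in> Some ` A)"
proof -
  have "(\<lambda>x. 0 \<le> fst x \<and> (\<lambda>(t, w). w (max 0 t) \<noteq> None) x \<and> (\<lambda>(t, w). pos (max 0 t) w) x \<in> A)
    \<in> measurable (lborel \<Otimes>\<^sub>M P p) (count_space UNIV)"
    by (intro pred_intros_logic alive_joint_measurable pred_sets2[OF A pos_joint_measurable]) measurable
  moreover have "(\<lambda>x. 0 \<le> fst x \<and> (\<lambda>(t, w). w (max 0 t) \<noteq> None) x \<and> (\<lambda>(t, w). pos (max 0 t) w) x \<in> A) =
    (\<lambda>(t, w). 0 \<le> t \<and> w t \<in> Some ` A)"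
  proof (intro ext, clarify, unfold prod.case fst_conv)
    fix t w
    show "(0 \<le> t \<and> w (max 0 t) \<noteq> None \<and> pos (max 0 t) w \<in> A) = (0 \<le> t \<and> w t \<in> Some ` A)"
    proof (cases "0 \<le> t")
      case True
      then have "max 0 t = t" by simp
      then show ?thesis using True by (cases "w t") (auto simp: pos_def)
    qed simp
  qed
  ultimately show ?thesis by simp
qed

end

end

subsection \<open>Local times and the Green function\<close>

locale green_process = path_process G P + cable_graph G
  for G :: "('v::countable) weighted_graph" and P +
  fixes L g
  assumes symmetric: "m_symmetric G P" and form: "associated_with_form G P" and local: "local_times G P L"
    and green_nonneg: "\<And>p q. p \<in> cable_system G \<Longrightarrow> q \<in> cable_system G \<Longrightarrow> 0 \<le> g p q"
    and green_eq: "\<And>p q. p \<in> cable_system G \<Longrightarrow> q \<in> cable_system G \<Longrightarrow>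
      ennreal (g p q) = (\<integral>\<^sup>+ w. (SUP t\<in>{t. w t \<noteq> None}. ennreal (L q t w)) \<partial>P p)"
begin

definition good_path :: "'v path \<Rightarrow> bool" where
  "good_path w \<longleftrightarrow> continuous_on (cable_system G \<times> {t. w t \<noteq> None}) (\<lambda>(q, t). L q t w) \<and>
        (\<forall>t. w t \<noteq> None \<longrightarrow>
           (\<forall>q\<in>cable_system G. 0 \<le> L q t w) \<and>
           (\<forall>A\<in>sets (lebesgue_cable G).
              emeasure lborel {s \<in> {0..t}. w s \<in> Some ` A} =
              (\<integral>\<^sup>+ q \<in> A. ennreal (L q t w) \<partial>lebesgue_cable G)))"

lemma AE_good_path: "p \<in> cable_system G \<Longrightarrow> AE w in P p. good_path w"
  using local by (simp add: local_times_def good_path_def)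

lemma local_time_measurable: "q \<in> cable_system G \<Longrightarrow> 0 \<le> t \<Longrightarrow> p \<in> cable_system G \<Longrightarrow> L q t \<in> borel_measurable (P p)"
  using local measurable_cong_sets[OF sets_P refl, of p borel] unfolding local_times_def by blast

lemma good_path_continuous: "good_path w \<Longrightarrow> w t \<noteq> None \<Longrightarrow> continuous_on (cable_system G) (\<lambda>q. L q t w)"
proof -
  assume w: "good_path w" "w t \<noteq> None"
  then have "continuous_on (cable_system G \<times> {t. w t \<noteq> None}) (\<lambda>(q, t). L q t w)" by (simp only: good_path_def)
  then have "continuous_on (cable_system G) (\<lambda>q. (\<lambda>(q, t). L q t w) (q, t))"
    by (rule continuous_on_compose2) (use w in \<open>auto intro!: continuous_intros\<close>)
  then show ?thesis by simp
qed

lemma good_path_nonneg: "good_path w \<Longrightarrow> w t \<noteq> None \<Longrightarrow> q \<in> cable_system G \<Longrightarrow> 0 \<le> L q t w"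
  unfolding good_path_def by blast

lemma good_path_occupation: "good_path w \<Longrightarrow> w t \<noteq> None \<Longrightarrow> A \<in> sets (lebesgue_cable G) \<Longrightarrow>
    emeasure lborel {s \<in> {0..t}. w s \<in> Some ` A} = (\<integral>\<^sup>+ q \<in> A. ennreal (L q t w) \<partial>lebesgue_cable G)"
  unfolding good_path_def by blast

lemma sets_lebesgue_cableE:
  assumes "A \<in> sets (lebesgue_cable G)"
  obtains B where "B \<in> sets borel" "A = B \<inter> cable_system G"
    "\<And>w s. w \<in> paths G \<Longrightarrow> w s \<in> Some ` A \<longleftrightarrow> w s \<in> Some ` B"
proof -
  obtain B where B: "B \<in> sets borel" "A = B \<inter> cable_system G"
    using assms by (auto simp: sets_lebesgue_cable sets_restrict_space)
  moreover have "w s \<in> Some ` A \<longleftrightarrow> w s \<in> Some ` B" if "w \<in> paths G" for w s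
    using that B by (auto simp: paths_def)
  ultimately show ?thesis using that by blast
qed

lemma occupation_set_measurable:
  assumes p: "p \<in> cable_system G" and w: "w \<in> paths G" and A: "A \<in> sets (lebesgue_cable G)"
  shows "{s. 0 \<le> s \<and> w s \<in> Some ` A} \<in> sets lborel"
proof -
  obtain B where B: "B \<in> sets borel" "\<And>w s. w \<in> paths G \<Longrightarrow> w s \<in> Some ` A \<longleftrightarrow> w s \<in> Some ` B"
    using sets_lebesgue_cableE[OF A] by metis
  have "(\<lambda>s. (s, w)) \<in> measurable lborel (lborel \<Otimes>\<^sub>M P p)"
    using w space_P[OF p] by (intro measurable_Pair2') simp
  from measurable_compose[OF this occupation_joint_measurable[OF p B(1)]]
  have "{s \<in> space lborel. 0 \<le> s \<and> w s \<in> Some ` B} \<in> sets lborel" by (simp add: pred_def)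
  then show ?thesis using B(2)[OF w] by simp
qed

lemma occupation_set_measurable':
  assumes p: "p \<in> cable_system G" and w: "w \<in> paths G" and A: "A \<in> sets (lebesgue_cable G)"
  shows "{s \<in> {0..t}. w s \<in> Some ` A} \<in> sets lborel"
proof -
  have "{s \<in> {0..t}. w s \<in> Some ` A} = {s. 0 \<le> s \<and> w s \<in> Some ` A} \<inter> {0..t}" by auto
  also have "\<dots> \<in> sets lborel" using occupation_set_measurable[OF assms] by (intro sets.Int) auto
  finally show ?thesis .
qed

text \<open>Monotonicity is not part of \<open>local_times\<close>. If the local time dropped at
  \<open>q\<close>, by continuity it would drop by at least \<open>\<delta>\<close> on a
  neighbourhood of positive measure, and the occupation time of that neighbourhood would
  decrease.\<close>

lemma local_time_mono:
  assumes p: "p \<in> cable_system G" and w: "w \<in> paths G" "good_path w"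
    and t: "0 \<le> t" "t \<le> t'" "w t' \<noteq> None" and q: "q \<in> cable_system G"
  shows "L q t w \<le> L q t' w"
proof (rule ccontr)
  assume "\<not> L q t w \<le> L q t' w"
  define h where "h x = L x t w - L x t' w" for x
  define \<delta> where "\<delta> = h q / 2"
  have \<delta>: "\<delta> > 0" using \<open>\<not> L q t w \<le> L q t' w\<close> by (simp add: \<delta>_def h_def)
  have al: "w t \<noteq> None" by (rule alive_mono[OF p w(1) t(3,1,2)])
  have ch: "continuous_on (cable_system G) h"
    unfolding h_def[abs_def] using good_path_continuous[OF w(2) al] good_path_continuous[OF w(2) t(3)] by (rule continuous_on_diff)
  then obtain r where r: "r > 0" "\<And>x. x \<in> cable_system G \<Longrightarrow> dist x q < r \<Longrightarrow> dist (h x) (h q) < \<delta>"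
    using q \<delta> unfolding continuous_on_iff by metis
  define A where "A = ball q r \<inter> cable_system G"
  have A: "A \<in> sets (lebesgue_cable G)" unfolding A_def by (intro in_sets_lebesgue_cable) auto
  have Apos: "emeasure (lebesgue_cable G) A > 0"
    unfolding A_def using q r by (intro emeasure_lebesgue_cable_open_pos[of _ q]) auto
  have m[measurable]: "(\<lambda>x. L x s w) \<in> borel_measurable (lebesgue_cable G)" if "w s \<noteq> None" for s
    using good_path_continuous[OF w(2) that] by (rule continuous_on_lebesgue_cable_measurable)
  have hA: "L x t' w + \<delta> \<le> L x t w" if "x \<in> A" for x
  proof -
    have "dist (h x) (h q) < \<delta>" using that by (intro r(2)) (simp_all add: A_def dist_commute)
    then have "h x > \<delta>" unfolding dist_real_def \<delta>_def by linarith
    then show ?thesis by (simp add: h_def)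
  qed
  let ?I = "\<lambda>s. \<integral>\<^sup>+ x \<in> A. ennreal (L x s w) \<partial>lebesgue_cable G"
  have "?I t' + ennreal \<delta> * emeasure (lebesgue_cable G) A =
    (\<integral>\<^sup>+ x. ennreal (L x t' w) * indicator A x + ennreal \<delta> * indicator A x \<partial>lebesgue_cable G)"
    using A t(3) by (subst nn_integral_add) (auto simp: nn_integral_cmult_indicator)
  also have "\<dots> \<le> ?I t"
  proof (intro nn_integral_mono)
    fix x
    show "ennreal (L x t' w) * indicator A x + ennreal \<delta> * indicator A x \<le> ennreal (L x t w) * indicator A x"
    proof (cases "x \<in> A")
      case True
      then have "x \<in> cable_system G" by (simp add: A_def)
      then have "0 \<le> L x t' w" by (rule good_path_nonneg[OF w(2) t(3)])
      then show ?thesis using hA[OF True] True \<delta> by (simp add: ennreal_plus[symmetric] ennreal_leI del: ennreal_plus)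
    qed simp
  qed
  also have "?I t \<le> ?I t'"
    unfolding good_path_occupation[OF w(2) al A, symmetric] good_path_occupation[OF w(2) t(3) A, symmetric]
    using t by (intro emeasure_mono occupation_set_measurable'[OF p w(1) A]) auto
  finally have le: "?I t' + ennreal \<delta> * emeasure (lebesgue_cable G) A \<le> ?I t'" .
  have "?I t' \<le> emeasure lborel {0..t'}"
    unfolding good_path_occupation[OF w(2) t(3) A, symmetric] by (intro emeasure_mono) auto
  then have "?I t' < \<infinity>" using t by (simp add: le_less_trans)
  then have "ennreal \<delta> * emeasure (lebesgue_cable G) A = 0"
    using le ennreal_add_left_cancel_le[of "?I t'" "ennreal \<delta> * emeasure (lebesgue_cable G) A" 0]
    by (auto simp: less_top)
  then show False using \<delta> Apos by auto
qed

section \<open>Local time accumulated over the whole lifetime\<close>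

definition rat_time :: "nat \<Rightarrow> real" where
  "rat_time = from_nat_into (\<rat> \<inter> {0..})"

lemma rat_time_nonneg: "0 \<le> rat_time i"
  using from_nat_into[of "\<rat> \<inter> {0..}" i] by (auto simp: rat_time_def)

lemma rat_time_surj: "t \<in> \<rat> \<Longrightarrow> 0 \<le> t \<Longrightarrow> \<exists>i. rat_time i = t"
  using from_nat_into_surj[of "\<rat> \<inter> {0..}" t] countable_rat by (auto simp: rat_time_def)

text \<open>By monotonicity the supremum over the lifetime may be taken over rational times; being
  countable, this one is measurable.\<close>

definition total_local_time :: "'v cable_point \<Rightarrow> 'v path \<Rightarrow> ennreal" where
  "total_local_time q w = (SUP i. if w (rat_time i) \<noteq> None then ennreal (L q (rat_time i) w) else 0)"

lemma SUP_local_time: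
  assumes p: "p \<in> cable_system G" and w: "w \<in> paths G" "good_path w" and q: "q \<in> cable_system G"
  shows "(SUP t\<in>{t. w t \<noteq> None}. ennreal (L q t w)) = total_local_time q w"
proof (rule antisym)
  show "(SUP t\<in>{t. w t \<noteq> None}. ennreal (L q t w)) \<le> total_local_time q w"
  proof (rule SUP_least)
    fix t assume t: "t \<in> {t. w t \<noteq> None}"
    obtain \<zeta> :: ereal where \<zeta>: "\<forall>t. w t \<noteq> None \<longleftrightarrow> 0 \<le> t \<and> ereal t < \<zeta>"
      using path_alive_interval[OF p w(1)] .
    then have "ereal t < \<zeta>" "0 \<le> t" using t by auto
    then obtain t' where t': "ereal t < ereal t'" "ereal t' < \<zeta>"
      using ereal_dense2 by blast
    then obtain s where s: "s \<in> \<rat>" "t < s" "s < t'" using Rats_dense_in_real[of t t'] by auto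
    have "ereal s < \<zeta>" using t' s by (meson ereal_less(2) less_ereal.simps(1) less_trans)
    then have al: "w s \<noteq> None" using \<zeta> s \<open>0 \<le> t\<close> by auto
    obtain i where i: "rat_time i = s" using rat_time_surj s \<open>0 \<le> t\<close> by (metis less_imp_le order_trans)
    have "ennreal (L q t w) \<le> ennreal (L q s w)"
      using s \<open>0 \<le> t\<close> by (intro ennreal_leI local_time_mono[OF p w _ _ al q]) auto
    also have "\<dots> \<le> total_local_time q w"
      unfolding total_local_time_def by (rule SUP_upper2[of i]) (use i al in auto)
    finally show "ennreal (L q t w) \<le> total_local_time q w" .
  qed
  show "total_local_time q w \<le> (SUP t\<in>{t. w t \<noteq> None}. ennreal (L q t w))"
    unfolding total_local_time_def by (rule SUP_least) (auto intro: SUP_upper)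
qed

lemma total_occupation:
  assumes p: "p \<in> cable_system G" and w: "w \<in> paths G" "good_path w" "w 0 \<noteq> None"
    and A: "A \<in> sets (lebesgue_cable G)"
  shows "(\<integral>\<^sup>+ q \<in> A. total_local_time q w \<partial>lebesgue_cable G) = emeasure lborel {s. 0 \<le> s \<and> w s \<in> Some ` A}"
proof -
  \<comment> \<open>The maxima \<open>a n\<close> form a nondecreasing sequence of times at which
    the path is alive, and they exhaust its lifetime. Inserting 0 keeps the sets nonempty, which is
    why the path has to be alive at time 0.\<close>
  define S where "S n = insert 0 (rat_time ` {i. i \<le> n \<and> w (rat_time i) \<noteq> None})" for n
  have S: "finite (S n)" "S n \<noteq> {}" for n by (auto simp: S_def)
  define a where "a n = Max (S n)" for n
  have aS: "a n \<in> S n" for n unfolding a_def by (rule Max_in[OF S])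
  have a0: "0 \<le> a n" for n unfolding a_def using S by (auto simp: S_def)
  have al: "w (a n) \<noteq> None" for n using aS[of n] w(3) by (auto simp: S_def simp del: not_None_eq)
  have amono: "a m \<le> a n" if "m \<le> n" for m n
    unfolding a_def using that by (intro Max_mono S) (auto simp: S_def)
  have arat: "\<exists>i. rat_time i = a n" for n
    using aS[of n] rat_time_surj[of 0] by (auto simp: S_def)
  have le_a: "rat_time i \<le> a i" if "w (rat_time i) \<noteq> None" for i
    unfolding a_def using that S by (intro Max_ge) (auto simp: S_def simp del: not_None_eq)
  have tl: "total_local_time q w = (SUP n. ennreal (L q (a n) w))" if q: "q \<in> cable_system G" for q
  proof (rule antisym)
    show "total_local_time q w \<le> (SUP n. ennreal (L q (a n) w))"
      unfolding total_local_time_def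
    proof (rule SUP_least)
      fix i
      show "(if w (rat_time i) \<noteq> None then ennreal (L q (rat_time i) w) else 0) \<le> (SUP n. ennreal (L q (a n) w))"
      proof (cases "w (rat_time i) \<noteq> None")
        case True
        have "ennreal (L q (rat_time i) w) \<le> ennreal (L q (a i) w)"
          by (intro ennreal_leI local_time_mono[OF p w(1,2) rat_time_nonneg le_a[OF True] al q])
        also have "\<dots> \<le> (SUP n. ennreal (L q (a n) w))" by (intro SUP_upper) simp
        finally show ?thesis using True by simp
      qed simp
    qed
    show "(SUP n. ennreal (L q (a n) w)) \<le> total_local_time q w"
    proof (rule SUP_least)
      fix n
      obtain i where i: "rat_time i = a n" using arat by blast
      show "ennreal (L q (a n) w) \<le> total_local_time q w"
        unfolding total_local_time_def by (rule SUP_upper2[of i]) (use i al[of n] in auto)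
    qed
  qed
  have m[measurable]: "(\<lambda>x. L x (a n) w) \<in> borel_measurable (lebesgue_cable G)" for n
    using good_path_continuous[OF w(2) al] by (rule continuous_on_lebesgue_cable_measurable)
  have "(\<integral>\<^sup>+ q \<in> A. total_local_time q w \<partial>lebesgue_cable G) =
    (\<integral>\<^sup>+ q. (SUP n. ennreal (L q (a n) w) * indicator A q) \<partial>lebesgue_cable G)"
    by (intro nn_integral_cong) (auto simp: tl SUP_mult_right_ennreal split: split_indicator)
  also have "\<dots> = (SUP n. \<integral>\<^sup>+ q. ennreal (L q (a n) w) * indicator A q \<partial>lebesgue_cable G)"
  proof (rule nn_integral_monotone_convergence_SUP_AE)
    show "AE q in lebesgue_cable G. ennreal (L q (a n) w) * indicator A q \<le> ennreal (L q (a (Suc n)) w) * indicator A q" for n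
      using amono[of n "Suc n"]
      by (intro AE_I2 mult_right_mono ennreal_leI local_time_mono[OF p w(1,2) a0 _ al]) auto
  qed (use A in measurable)
  also have "\<dots> = (SUP n. emeasure lborel {s \<in> {0..a n}. w s \<in> Some ` A})"
    using good_path_occupation[OF w(2) al A] by simp
  also have "\<dots> = emeasure lborel (\<Union>n. {s \<in> {0..a n}. w s \<in> Some ` A})"
  proof (rule SUP_emeasure_incseq)
    show "range (\<lambda>n. {s \<in> {0..a n}. w s \<in> Some ` A}) \<subseteq> sets lborel"
      using occupation_set_measurable'[OF p w(1) A] by blast
    show "incseq (\<lambda>n. {s \<in> {0..a n}. w s \<in> Some ` A})"
      unfolding incseq_def using amono by (auto intro: order_trans)
  qed
  also have "(\<Union>n. {s \<in> {0..a n}. w s \<in> Some ` A}) = {s. 0 \<le> s \<and> w s \<in> Some ` A}"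
  proof safe
    fix s b assume s: "0 \<le> s" "w s = Some b" "b \<in> A"
    obtain \<zeta> :: ereal where \<zeta>: "\<forall>t. w t \<noteq> None \<longleftrightarrow> 0 \<le> t \<and> ereal t < \<zeta>"
      using path_alive_interval[OF p w(1)] .
    have "w s \<noteq> None" using s by simp
    then have "ereal s < \<zeta>" using \<zeta> by blast
    then obtain t' where t': "ereal s < ereal t'" "ereal t' < \<zeta>" using ereal_dense2 by blast
    then obtain r where r: "r \<in> \<rat>" "s < r" "r < t'" using Rats_dense_in_real[of s t'] by auto
    have "ereal r < \<zeta>" using t' r by (meson less_ereal.simps(1) less_trans)
    then have alr: "w r \<noteq> None" using \<zeta> r s by auto
    obtain i where i: "rat_time i = r" using rat_time_surj r s by (metis less_imp_le order_trans)
    then have "s \<le> a i" using le_a[of i] alr r by auto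
    then have "s \<in> {s \<in> {0..a i}. w s \<in> Some ` A}" using s by auto
    then show "s \<in> (\<Union>n. {s \<in> {0..a n}. w s \<in> Some ` A})" by blast
  qed auto
  finally show ?thesis .
qed

text \<open>The expectation of the occupation formula. It identifies the Green function as the
  density of the expected occupation measure, the only way in which local times enter the
  sequel.\<close>

lemma expected_occupation:
  assumes p: "p \<in> cable_system G" and A: "A \<in> sets (lebesgue_cable G)" "emeasure (lebesgue_cable G) A < \<infinity>"
  shows "(\<integral>\<^sup>+ w. emeasure lborel {s. 0 \<le> s \<and> w s \<in> Some ` A} \<partial>P p) =
    (\<integral>\<^sup>+ q \<in> A. ennreal (g p q) \<partial>lebesgue_cable G)"
proof -
  interpret Pp: prob_space "P p" by (rule prob_space_P[OF p])
  have "AE w in P p. good_path w \<and> w 0 \<noteq> None"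
    using AE_good_path[OF p] start_P[OF p] by eventually_elim auto
  then obtain N where N: "\<And>w. w \<in> space (P p) - N \<Longrightarrow> good_path w \<and> w 0 \<noteq> None" "N \<in> null_sets (P p)"
    by (rule AE_E3) blast
  define \<Omega> where "\<Omega> = space (P p) - N"
  have \<Omega>[measurable]: "\<Omega> \<in> sets (P p)" using N(2) by (auto simp: \<Omega>_def)
  have AE\<Omega>: "AE w in P p. w \<in> \<Omega>"
    using AE_not_in[OF N(2)] by (auto simp: \<Omega>_def elim!: AE_mp)
  have good: "w \<in> paths G" "good_path w" "w 0 \<noteq> None" if "w \<in> \<Omega>" for w
    using that N(1)[of w] space_P[OF p] by (simp_all add: \<Omega>_def)
  \<comment> \<open>Set to 0 off a measurable set of full probability, so that continuity in
    \<open>q\<close> holds for every path, as joint measurability requires.\<close>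
  define F where "F i q w = (if w \<in> \<Omega> \<and> w (rat_time i) \<noteq> None then L q (rat_time i) w else 0)" for i q w
  have Fm: "(\<lambda>(q, w). F i q w) \<in> borel_measurable (lebesgue_cable G \<Otimes>\<^sub>M P p)" for i
  proof (rule caratheodory_function_measurable)
    show "F i q \<in> borel_measurable (P p)" if q: "q \<in> cable_system G" for q
      unfolding F_def[abs_def]
      using alive_measurable[OF p rat_time_nonneg] local_time_measurable[OF q rat_time_nonneg p]
      by (intro measurable_If) (auto intro!: pred_intros_logic simp: pred_def[symmetric])
    show "continuous_on (cable_system G) (\<lambda>q. F i q w)" for w
      unfolding F_def using good_path_continuous good by (cases "w \<in> \<Omega> \<and> w (rat_time i) \<noteq> None") auto
  qed (auto simp: sets_lebesgue_cable)
  define T where "T q w = (SUP i. ennreal (F i q w))" for q w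
  have Tm: "(\<lambda>(q, w). T q w) \<in> borel_measurable (lebesgue_cable G \<Otimes>\<^sub>M P p)"
  proof -
    have "(\<lambda>x. SUP i. ennreal ((\<lambda>(q, w). F i q w) x)) \<in> borel_measurable (lebesgue_cable G \<Otimes>\<^sub>M P p)"
      by (intro borel_measurable_SUP measurable_compose[OF Fm]) auto
    then show ?thesis by (simp add: T_def case_prod_beta')
  qed
  have T: "T q w = total_local_time q w" if "w \<in> \<Omega>" for q w
    unfolding T_def total_local_time_def F_def using that by (intro SUP_cong) auto
  \<comment> \<open>Restricted to \<open>A\<close> the measure is finite, which provides the
    sigma-finiteness for Fubini.\<close>
  define mA where "mA = density (lebesgue_cable G) (indicator A)"
  have "emeasure mA (space mA) = (\<integral>\<^sup>+ q. indicator A q * indicator (cable_system G) q \<partial>lebesgue_cable G)"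
    unfolding mA_def using A sets.top[of "lebesgue_cable G"] by (subst emeasure_density) auto
  also have "\<dots> = (\<integral>\<^sup>+ q. indicator A q \<partial>lebesgue_cable G)"
    by (intro nn_integral_cong) simp
  also have "\<dots> = emeasure (lebesgue_cable G) A" using A(1) by (rule nn_integral_indicator)
  finally have "emeasure mA (space mA) = emeasure (lebesgue_cable G) A" .
  then have "finite_measure mA" using A by (intro finite_measureI) (simp add: less_top[symmetric])
  interpret mA: finite_measure mA by fact
  interpret pair_sigma_finite mA "P p" ..
  have Tm': "(\<lambda>(q, w). T q w) \<in> borel_measurable (mA \<Otimes>\<^sub>M P p)"
    using Tm by (simp add: mA_def cong: measurable_cong_sets sets_pair_measure_cong)
  have Tm1: "(\<lambda>q. T q w) \<in> borel_measurable (lebesgue_cable G)" if "w \<in> space (P p)" for w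
    using measurable_compose[OF measurable_Pair2'[OF that] Tm] by simp
  have Tm2: "(\<lambda>q. \<integral>\<^sup>+ w. T q w \<partial>P p) \<in> borel_measurable (lebesgue_cable G)"
    by (rule Pp.borel_measurable_nn_integral[OF Tm])
  have "(\<integral>\<^sup>+ w. emeasure lborel {s. 0 \<le> s \<and> w s \<in> Some ` A} \<partial>P p) =
    (\<integral>\<^sup>+ w. (\<integral>\<^sup>+ q. T q w \<partial>mA) \<partial>P p)"
  proof (rule nn_integral_cong_AE)
    show "AE w in P p. emeasure lborel {s. 0 \<le> s \<and> w s \<in> Some ` A} = (\<integral>\<^sup>+ q. T q w \<partial>mA)"
      using AE\<Omega>
    proof eventually_elim
      case (elim w)
      have "(\<integral>\<^sup>+ q. T q w \<partial>mA) = (\<integral>\<^sup>+ q. indicator A q * T q w \<partial>lebesgue_cable G)"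
        unfolding mA_def using A Tm1[of w] elim by (intro nn_integral_density) (auto simp: \<Omega>_def)
      also have "\<dots> = (\<integral>\<^sup>+ q \<in> A. total_local_time q w \<partial>lebesgue_cable G)"
        by (intro nn_integral_cong) (simp add: T[OF elim] mult.commute)
      finally show ?case using total_occupation[OF p good[OF elim] A(1)] by simp
    qed
  qed
  also have "\<dots> = (\<integral>\<^sup>+ q. (\<integral>\<^sup>+ w. T q w \<partial>P p) \<partial>mA)"
    using Fubini'[OF Tm'] by simp
  also have "\<dots> = (\<integral>\<^sup>+ q. indicator A q * (\<integral>\<^sup>+ w. T q w \<partial>P p) \<partial>lebesgue_cable G)"
    unfolding mA_def using A Tm2 by (intro nn_integral_density) auto
  also have "\<dots> = (\<integral>\<^sup>+ q \<in> A. ennreal (g p q) \<partial>lebesgue_cable G)"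
  proof (intro nn_integral_cong)
    fix q assume "q \<in> space (lebesgue_cable G)"
    then have q: "q \<in> cable_system G" by simp
    have "(\<integral>\<^sup>+ w. T q w \<partial>P p) = (\<integral>\<^sup>+ w. (SUP t\<in>{t. w t \<noteq> None}. ennreal (L q t w)) \<partial>P p)"
    proof (rule nn_integral_cong_AE)
      show "AE w in P p. T q w = (SUP t\<in>{t. w t \<noteq> None}. ennreal (L q t w))"
        using AE\<Omega> by eventually_elim (simp only: T SUP_local_time[OF p good(1,2) q])
    qed
    then show "indicator A q * (\<integral>\<^sup>+ w. T q w \<partial>P p) = ennreal (g p q) * indicator A q"
      by (simp add: green_eq[OF p q] mult.commute)
  qed
  finally show ?thesis .
qed

end

subsection \<open>The resolvent\<close>

lemma integrable_exponential_density: "\<beta> > 0 \<Longrightarrow> integrable lborel (exponential_density \<beta>)"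
proof (rule integrableI_nonneg)
  assume \<beta>: "\<beta> > 0"
  interpret E: prob_space "density lborel (exponential_density \<beta>)" by (rule prob_space_exponential_density[OF \<beta>])
  have "emeasure (density lborel (exponential_density \<beta>)) UNIV = 1" using E.emeasure_space_1 by simp
  then have "(\<integral>\<^sup>+x. ennreal (exponential_density \<beta> x) \<partial>lborel) = 1"
    by (subst (asm) emeasure_density) auto
  then show "(\<integral>\<^sup>+x. ennreal (exponential_density \<beta> x) \<partial>lborel) < \<infinity>" by simp
  show "AE x in lborel. 0 \<le> exponential_density \<beta> x" using \<beta> by (intro AE_I2 exponential_density_nonneg)
qed simp

context green_process
begin

text \<open>The transition semigroup applied to an indicator, extended by 0 to negative times so
  that all time integrals run over the whole line.\<close>

definition occupation_prob :: "'v cable_point set \<Rightarrow> 'v cable_point \<Rightarrow> real \<Rightarrow> real" where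
  "occupation_prob A p t = measure (P p) {w \<in> space (P p). 0 \<le> t \<and> w t \<in> Some ` A}"

context
  fixes p A assumes p: "p \<in> cable_system G" and A: "A \<in> sets (lebesgue_cable G)"
begin

lemma occupation_event: "{w \<in> space (P p). 0 \<le> t \<and> w t \<in> Some ` A} \<in> sets (P p)"
proof (cases "0 \<le> t")
  case True
  obtain B where B: "B \<in> sets borel" "\<And>w s. w \<in> paths G \<Longrightarrow> w s \<in> Some ` A \<longleftrightarrow> w s \<in> Some ` B"
    using sets_lebesgue_cableE[OF A] by metis
  have "{w \<in> space (P p). 0 \<le> t \<and> w t \<in> Some ` A} = {w \<in> paths G. w t \<in> Some ` B}"
    unfolding space_P[OF p] using B(2) True by blast
  then show ?thesis using path_eventsI[OF True B(1)] by (simp add: sets_P[OF p])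
qed simp

lemma occupation_joint_event:
  "{x \<in> space (lborel \<Otimes>\<^sub>M P p). (\<lambda>(t, w). 0 \<le> t \<and> w t \<in> Some ` A) x} \<in> sets (lborel \<Otimes>\<^sub>M P p)"
proof -
  obtain B where B: "B \<in> sets borel" "\<And>w s. w \<in> paths G \<Longrightarrow> w s \<in> Some ` A \<longleftrightarrow> w s \<in> Some ` B"
    using sets_lebesgue_cableE[OF A] by metis
  have "{x \<in> space (lborel \<Otimes>\<^sub>M P p). (\<lambda>(t, w). 0 \<le> t \<and> w t \<in> Some ` A) x} =
    {x \<in> space (lborel \<Otimes>\<^sub>M P p). (\<lambda>(t, w). 0 \<le> t \<and> w t \<in> Some ` B) x}"
  proof (rule Collect_cong, rule conj_cong[OF refl])
    fix x :: "real \<times> 'v path" assume "x \<in> space (lborel \<Otimes>\<^sub>M P p)"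
    then have "snd x \<in> paths G" by (auto simp: space_pair_measure space_P[OF p])
    then show "(\<lambda>(t, w). 0 \<le> t \<and> w t \<in> Some ` A) x = (\<lambda>(t, w). 0 \<le> t \<and> w t \<in> Some ` B) x"
      using B(2)[of "snd x" "fst x"] by (simp add: case_prod_beta')
  qed
  then show ?thesis using occupation_joint_measurable[OF p B(1)] by (simp add: pred_def)
qed

lemma occupation_prob_measurable[measurable]: "occupation_prob A p \<in> borel_measurable lborel"
proof -
  interpret Pp: prob_space "P p" by (rule prob_space_P[OF p])
  have "(\<lambda>t. emeasure (P p) (Pair t -` {x \<in> space (lborel \<Otimes>\<^sub>M P p). (\<lambda>(t, w). 0 \<le> t \<and> w t \<in> Some ` A) x})) \<in> borel_measurable lborel"
    by (rule Pp.measurable_emeasure_Pair[OF occupation_joint_event])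
  moreover have "Pair t -` {x \<in> space (lborel \<Otimes>\<^sub>M P p). (\<lambda>(t, w). 0 \<le> t \<and> w t \<in> Some ` A) x} =
      {w \<in> space (P p). 0 \<le> t \<and> w t \<in> Some ` A}" for t
    by (auto simp: space_pair_measure)
  ultimately have "(\<lambda>t. emeasure (P p) {w \<in> space (P p). 0 \<le> t \<and> w t \<in> Some ` A}) \<in> borel_measurable lborel" by simp
  then have "(\<lambda>t. enn2real (emeasure (P p) {w \<in> space (P p). 0 \<le> t \<and> w t \<in> Some ` A})) \<in> borel_measurable lborel" by measurable
  then show ?thesis by (simp add: occupation_prob_def[abs_def] measure_def)
qed

lemma occupation_prob_nonneg: "0 \<le> occupation_prob A p t"
  by (simp add: occupation_prob_def)

lemma occupation_prob_le_1: "occupation_prob A p t \<le> 1"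
proof -
  interpret Pp: prob_space "P p" by (rule prob_space_P[OF p])
  show ?thesis by (simp add: occupation_prob_def)
qed

lemma occupation_prob_neg: "t < 0 \<Longrightarrow> occupation_prob A p t = 0"
  by (simp add: occupation_prob_def)

lemma nn_integral_occupation_prob:
  assumes fin: "emeasure (lebesgue_cable G) A < \<infinity>"
  shows "(\<integral>\<^sup>+ t. ennreal (occupation_prob A p t) \<partial>lborel) = (\<integral>\<^sup>+ q \<in> A. ennreal (g p q) \<partial>lebesgue_cable G)"
proof -
  interpret Pp: prob_space "P p" by (rule prob_space_P[OF p])
  interpret pair_sigma_finite lborel "P p" ..
  define J where "J = {x \<in> space (lborel \<Otimes>\<^sub>M P p). (\<lambda>(t, w). 0 \<le> t \<and> w t \<in> Some ` A) x}"
  have J: "J \<in> sets (lborel \<Otimes>\<^sub>M P p)" unfolding J_def by (rule occupation_joint_event)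
  have m: "(\<lambda>(t, w). indicator J (t, w) :: ennreal) \<in> borel_measurable (lborel \<Otimes>\<^sub>M P p)"
    using J by (simp add: case_prod_beta')
  have "(\<integral>\<^sup>+ t. ennreal (occupation_prob A p t) \<partial>lborel) = (\<integral>\<^sup>+ t. (\<integral>\<^sup>+ w. indicator J (t, w) \<partial>P p) \<partial>lborel)"
  proof (intro nn_integral_cong)
    fix t
    have "(\<integral>\<^sup>+ w. indicator J (t, w) \<partial>P p) = (\<integral>\<^sup>+ w. indicator {w \<in> space (P p). 0 \<le> t \<and> w t \<in> Some ` A} w \<partial>P p)"
      by (intro nn_integral_cong) (auto simp: J_def space_pair_measure indicator_def)
    also have "\<dots> = ennreal (occupation_prob A p t)"
      unfolding nn_integral_indicator[OF occupation_event] occupation_prob_def by (rule Pp.emeasure_eq_measure)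
    finally show "ennreal (occupation_prob A p t) = (\<integral>\<^sup>+ w. indicator J (t, w) \<partial>P p)" by simp
  qed
  also have "\<dots> = (\<integral>\<^sup>+ w. (\<integral>\<^sup>+ t. indicator J (t, w) \<partial>lborel) \<partial>P p)"
    using Fubini'[OF m] by simp
  also have "\<dots> = (\<integral>\<^sup>+ w. emeasure lborel {s. 0 \<le> s \<and> w s \<in> Some ` A} \<partial>P p)"
  proof (intro nn_integral_cong)
    fix w assume w: "w \<in> space (P p)"
    have "(\<integral>\<^sup>+ t. indicator J (t, w) \<partial>lborel) = (\<integral>\<^sup>+ t. indicator {s. 0 \<le> s \<and> w s \<in> Some ` A} t \<partial>lborel)"
      using w by (intro nn_integral_cong) (auto simp: J_def space_pair_measure indicator_def)
    also have "\<dots> = emeasure lborel {s. 0 \<le> s \<and> w s \<in> Some ` A}"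
      using occupation_set_measurable[OF p _ A, of w] w space_P[OF p] by simp
    finally show "(\<integral>\<^sup>+ t. indicator J (t, w) \<partial>lborel) = emeasure lborel {s. 0 \<le> s \<and> w s \<in> Some ` A}" .
  qed
  also have "\<dots> = (\<integral>\<^sup>+ q \<in> A. ennreal (g p q) \<partial>lebesgue_cable G)"
    by (rule expected_occupation[OF p A fin])
  finally show ?thesis .
qed

lemma integrable_discounted_occupation_prob:
  assumes "\<beta> > 0" shows "integrable lborel (\<lambda>t. exp (- \<beta> * t) * occupation_prob A p t)"
proof (rule Bochner_Integration.integrable_bound)
  show "integrable lborel (\<lambda>t. (1 / \<beta>) * exponential_density \<beta> t)"
    by (intro integrable_mult_right integrable_exponential_density assms)
  have "exp (- \<beta> * t) * occupation_prob A p t \<le> (1 / \<beta>) * exponential_density \<beta> t" for t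
    using assms occupation_prob_le_1[of t] occupation_prob_neg[of t]
    by (cases "t < 0") (auto simp: exponential_density_def mult.commute[of \<beta>])
  note le = this
  show "AE t in lborel. norm (exp (- \<beta> * t) * occupation_prob A p t) \<le> norm ((1 / \<beta>) * exponential_density \<beta> t)"
  proof (intro AE_I2)
    fix t
    have "norm (exp (- \<beta> * t) * occupation_prob A p t) = exp (- \<beta> * t) * occupation_prob A p t"
      by (simp add: occupation_prob_nonneg abs_mult)
    also note le
    also have "(1 / \<beta>) * exponential_density \<beta> t \<le> norm ((1 / \<beta>) * exponential_density \<beta> t)"
      unfolding real_norm_def by (rule abs_ge_self)
    finally show "norm (exp (- \<beta> * t) * occupation_prob A p t) \<le> norm ((1 / \<beta>) * exponential_density \<beta> t)" .
  qed
qed measurable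

definition discounted_occupation :: "real \<Rightarrow> real" where
  "discounted_occupation \<beta> = (\<integral>t. exp (- \<beta> * t) * occupation_prob A p t \<partial>lborel)"

lemma discounted_occupation_nonneg: "0 \<le> discounted_occupation \<beta>"
  unfolding discounted_occupation_def by (intro Bochner_Integration.integral_nonneg) (simp add: occupation_prob_nonneg)

text \<open>\<open>\<beta>\<close> times the discount is a probability density in time. The
  resulting bound \<open>1 / \<beta>\<close> is what later controls the resolvent uniformly in
  space.\<close>

lemma discounted_occupation_le:
  assumes "\<beta> > 0" shows "\<beta> * discounted_occupation \<beta> \<le> 1"
proof -
  interpret E: prob_space "density lborel (exponential_density \<beta>)" by (rule prob_space_exponential_density[OF assms])
  have "\<beta> * discounted_occupation \<beta> = (\<integral>t. exponential_density \<beta> t *\<^sub>R occupation_prob A p t \<partial>lborel)"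
    unfolding discounted_occupation_def
    by (subst integral_mult_right_zero[symmetric], intro Bochner_Integration.integral_cong refl)
      (auto simp: exponential_density_def occupation_prob_neg mult.commute)
  also have "\<dots> = (\<integral>t. occupation_prob A p t \<partial>density lborel (exponential_density \<beta>))"
    using assms by (intro integral_density[symmetric]) (auto intro: exponential_density_nonneg)
  also have "\<dots> \<le> (\<integral>t. 1 \<partial>density lborel (exponential_density \<beta>))"
    by (intro integral_mono E.integrable_const_bound[of _ 1])
      (auto simp: occupation_prob_nonneg occupation_prob_le_1)
  finally show ?thesis using E.prob_space by simp
qed

text \<open>The resolvent tends to the Green potential as \<open>\<beta>\<close> decreases to 0. The
  undiscounted occupation probability is integrable because the potential is finite, and it
  dominates.\<close>

lemma discounted_occupation_tendsto:
  assumes fin: "emeasure (lebesgue_cable G) A < \<infinity>" and U: "(\<integral>\<^sup>+ q \<in> A. ennreal (g p q) \<partial>lebesgue_cable G) = ennreal u" "0 \<le> u"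
  shows "(\<lambda>n. discounted_occupation (1 / real (Suc n))) \<longlonglongrightarrow> u"
proof -
  have nn: "(\<integral>\<^sup>+ t. ennreal (occupation_prob A p t) \<partial>lborel) = ennreal u"
    using nn_integral_occupation_prob[OF fin] U by simp
  then have int: "integrable lborel (occupation_prob A p)"
    by (intro integrableI_nonneg) (auto simp: occupation_prob_nonneg)
  have "(\<integral>t. occupation_prob A p t \<partial>lborel) = u"
    using nn U(2) by (subst integral_eq_nn_integral) (auto simp: occupation_prob_nonneg)
  moreover have "(\<lambda>n. discounted_occupation (1 / real (Suc n))) \<longlonglongrightarrow> (\<integral>t. occupation_prob A p t \<partial>lborel)"
    unfolding discounted_occupation_def
  proof (rule integral_dominated_convergence[OF _ _ int])
    show "AE t in lborel. (\<lambda>n. exp (- (1 / real (Suc n)) * t) * occupation_prob A p t) \<longlonglongrightarrow> occupation_prob A p t"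
    proof (intro AE_I2)
      fix t
      have "(\<lambda>n. 1 / real (Suc n)) \<longlonglongrightarrow> 0" using LIMSEQ_inverse_real_of_nat by (simp add: inverse_eq_divide)
      then have "(\<lambda>n. exp (- (1 / real (Suc n)) * t) * occupation_prob A p t) \<longlonglongrightarrow> exp (- 0 * t) * occupation_prob A p t"
        by (intro tendsto_intros)
      then show "(\<lambda>n. exp (- (1 / real (Suc n)) * t) * occupation_prob A p t) \<longlonglongrightarrow> occupation_prob A p t" by simp
    qed
    show "AE t in lborel. norm (exp (- (1 / real (Suc n)) * t) * occupation_prob A p t) \<le> occupation_prob A p t" for n
    proof (intro AE_I2)
      fix t
      show "norm (exp (- (1 / real (Suc n)) * t) * occupation_prob A p t) \<le> occupation_prob A p t"
        using occupation_prob_neg[of t] mult_right_mono[of "exp (- (1 / real (Suc n)) * t)" 1 "occupation_prob A p t"]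
        by (cases "t < 0") (auto simp: abs_mult occupation_prob_nonneg)
    qed
  qed measurable
  ultimately show ?thesis by simp
qed

end

lemma semigroup_op_combination:
  assumes p: "p \<in> cable_system G" and A: "A1 \<in> sets (lebesgue_cable G)" "A2 \<in> sets (lebesgue_cable G)" and t: "0 \<le> t"
  shows "semigroup_op P t (\<lambda>q. c1 * indicator A1 q + c2 * indicator A2 q) p =
    c1 * occupation_prob A1 p t + c2 * occupation_prob A2 p t"
proof -
  interpret Pp: prob_space "P p" by (rule prob_space_P[OF p])
  let ?E = "\<lambda>A. {w \<in> space (P p). 0 \<le> t \<and> w t \<in> Some ` A}"
  have "semigroup_op P t (\<lambda>q. c1 * indicator A1 q + c2 * indicator A2 q) p =
    (\<integral>w. c1 * indicator (?E A1) w + c2 * indicator (?E A2) w \<partial>P p)"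
    unfolding semigroup_op_def using t
  proof (intro Bochner_Integration.integral_cong refl)
    fix w assume w: "w \<in> space (P p)"
    show "(case w t of None \<Rightarrow> 0 | Some q \<Rightarrow> c1 * indicator A1 q + c2 * indicator A2 q) =
      c1 * indicator (?E A1) w + c2 * indicator (?E A2) w"
    proof (cases "w t")
      case None
      then have "w \<notin> ?E A1" "w \<notin> ?E A2" by auto
      then show ?thesis using None by simp
    next
      case (Some q)
      then have "w \<in> ?E A1 \<longleftrightarrow> q \<in> A1" "w \<in> ?E A2 \<longleftrightarrow> q \<in> A2" using w t by auto
      then show ?thesis using Some by (simp add: indicator_def)
    qed
  qed
  also have "\<dots> = c1 * occupation_prob A1 p t + c2 * occupation_prob A2 p t"
  proof -
    have i: "integrable (P p) (indicator (?E A) :: _ \<Rightarrow> real)" "(\<integral>w. indicator (?E A) w \<partial>P p) = occupation_prob A p t"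
      if "A \<in> sets (lebesgue_cable G)" for A
    proof -
      have ev: "?E A \<in> sets (P p)" by (rule occupation_event[OF p that])
      show "integrable (P p) (indicator (?E A) :: _ \<Rightarrow> real)"
        by (rule integrable_real_indicator[OF ev])
          (simp only: infinity_ennreal_def less_top[symmetric] Pp.emeasure_finite not_False_eq_True)
      have "?E A \<inter> space (P p) = ?E A" by blast
      then show "(\<integral>w. indicator (?E A) w \<partial>P p) = occupation_prob A p t"
        unfolding occupation_prob_def Bochner_Integration.integral_indicator by (rule arg_cong)
    qed
    show ?thesis
      unfolding Bochner_Integration.integral_add[OF integrable_mult_right[OF i(1)[OF A(1)]] integrable_mult_right[OF i(1)[OF A(2)]]]
        integral_mult_right_zero i(2)[OF A(1)] i(2)[OF A(2)] by (rule refl)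
  qed
  finally show ?thesis .
qed

lemma resolvent_op_combination:
  assumes p: "p \<in> cable_system G" and A: "A1 \<in> sets (lebesgue_cable G)" "A2 \<in> sets (lebesgue_cable G)" and \<beta>: "\<beta> > 0"
  shows "resolvent_op P \<beta> (\<lambda>q. c1 * indicator A1 q + c2 * indicator A2 q) p =
    c1 * discounted_occupation p A1 \<beta> + c2 * discounted_occupation p A2 \<beta>"
proof -
  have "resolvent_op P \<beta> (\<lambda>q. c1 * indicator A1 q + c2 * indicator A2 q) p =
    (\<integral>t. c1 * (exp (- \<beta> * t) * occupation_prob A1 p t) + c2 * (exp (- \<beta> * t) * occupation_prob A2 p t) \<partial>lborel)"
    unfolding resolvent_op_def set_lebesgue_integral_def
  proof (intro Bochner_Integration.integral_cong refl)
    fix t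
    show "indicator {0..} t *\<^sub>R (exp (- \<beta> * t) * semigroup_op P t (\<lambda>q. c1 * indicator A1 q + c2 * indicator A2 q) p) =
      c1 * (exp (- \<beta> * t) * occupation_prob A1 p t) + c2 * (exp (- \<beta> * t) * occupation_prob A2 p t)"
      by (cases "0 \<le> t") (simp_all add: semigroup_op_combination[OF p A] occupation_prob_neg[OF p] A algebra_simps)
  qed
  also have "\<dots> = c1 * discounted_occupation p A1 \<beta> + c2 * discounted_occupation p A2 \<beta>"
    unfolding Bochner_Integration.integral_add[OF integrable_mult_right[OF integrable_discounted_occupation_prob[OF p A(1) \<beta>]]
        integrable_mult_right[OF integrable_discounted_occupation_prob[OF p A(2) \<beta>]]]
      integral_mult_right_zero discounted_occupation_def[OF p A(1)] discounted_occupation_def[OF p A(2)] by (rule refl)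
  finally show ?thesis .
qed

lemma resolvent_op_indicator:
  assumes p: "p \<in> cable_system G" and A: "A \<in> sets (lebesgue_cable G)" and \<beta>: "\<beta> > 0"
  shows "resolvent_op P \<beta> (indicator A) p = discounted_occupation p A \<beta>"
proof -
  have "indicator A = (\<lambda>q. 1 * indicator A q + 0 * indicator A q :: real)" by auto
  then show ?thesis using resolvent_op_combination[OF p A A \<beta>, of 1 0] by simp
qed

end

section \<open>Cutting off a function of the form domain at a separating point\<close>

lemma has_weak_deriv_cong: "(\<And>x. x \<in> I \<Longrightarrow> F x = F' x) \<Longrightarrow> has_weak_deriv I F u = has_weak_deriv I F' u"
  unfolding has_weak_deriv_def by (intro conj_cong refl ball_cong) auto

lemma C0_continuous:
  assumes "f \<in> C0 G" shows "continuous_on (cable_system G) f"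
proof -
  have "\<exists>k. continuous_on (cable_system G) k \<and> (\<forall>p\<in>cable_system G. \<bar>f p - k p\<bar> \<le> 1 / real (Suc n))" for n
  proof -
    have "(0::real) < 1 / real (Suc n)" by simp
    then obtain k where "k \<in> compactly_supported G" "\<forall>p\<in>cable_system G. \<bar>f p - k p\<bar> \<le> 1 / real (Suc n)"
      using assms unfolding C0_def by blast
    then show ?thesis by (auto simp: compactly_supported_def)
  qed
  then obtain k where k: "\<And>n. continuous_on (cable_system G) (k n)"
    "\<And>n p. p \<in> cable_system G \<Longrightarrow> \<bar>f p - k n p\<bar> \<le> 1 / real (Suc n)" by metis
  have "uniform_limit (cable_system G) k f sequentially"
  proof (rule uniform_limitI)
    fix e :: real assume "e > 0"
    then obtain N where N: "1 / real (Suc N) < e" by (metis nat_approx_posE)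
    show "\<forall>\<^sub>F n in sequentially. \<forall>p\<in>cable_system G. dist (k n p) (f p) < e"
    proof (rule eventually_sequentiallyI, intro ballI)
      fix n p assume n: "N \<le> n" and p: "p \<in> cable_system G"
      have "dist (k n p) (f p) \<le> 1 / real (Suc n)" using k(2)[OF p, of n] by (simp add: dist_real_def abs_minus_commute)
      also have "\<dots> \<le> 1 / real (Suc N)" using n by (simp add: frac_le)
      finally show "dist (k n p) (f p) < e" using N by simp
    qed
  qed
  then show ?thesis by (rule uniform_limit_theorem[rotated]) (use k(1) in simp_all)
qed

lemma form_domain_C0: "f \<in> form_domain G \<Longrightarrow> f \<in> C0 G"
  by (simp add: form_domain_def)

text \<open>\<open>Br\<close> is attached to the rest only at \<open>y\<close>, where
  \<open>w\<close> vanishes, so the cut-off stays continuous. Every cable lies in \<open>Br\<close>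
  up to \<open>y\<close> or misses \<open>Br\<close>; hence the derivative of the cut-off is that of
  \<open>w\<close> or 0, and its pairing with \<open>w\<close> is the energy of \<open>w\<close> in
  \<open>Br\<close>.\<close>

lemma
  fixes w :: "('v::countable) cable_point \<Rightarrow> real"
  assumes w: "w \<in> form_domain G" and Br: "Br = cable_system G \<inter> U" "open U"
    and Out: "cable_system G - Br - {y} = cable_system G \<inter> U'" "open U'"
    and y: "y \<notin> Br" "w y = 0"
    and cab: "\<And>c. c \<in> cables G \<Longrightarrow> (\<forall>t\<in>cable_dom G c. cable_map G c t \<in> Br \<union> {y}) \<or> (\<forall>t\<in>cable_dom G c. cable_map G c t \<notin> Br)"
  shows form_domain_restrict: "(\<lambda>p. if p \<in> Br then w p else 0) \<in> form_domain G"
    and dirichlet_form_restrict_nonneg: "0 \<le> dirichlet_form G w (\<lambda>p. if p \<in> Br then w p else 0)"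
proof -
  define k where "k = (\<lambda>p. if p \<in> Br then w p else 0)"
  let ?X = "cable_system G"
  have cw: "continuous_on ?X w" by (rule C0_continuous[OF form_domain_C0[OF w]])
  \<comment> \<open>The two relatively closed pieces overlap at most in \<open>y\<close>, and there
    \<open>s (w y) = s 0 = 0\<close>.\<close>
  have paste: "continuous_on ?X (\<lambda>p. if p \<in> Br then s (w p) else 0)"
    if s: "continuous_on UNIV s" "s 0 = 0" for s :: "real \<Rightarrow> real"
  proof -
    have X: "?X = (?X - U') \<union> (?X - U)" using Br(1) Out(1) by blast
    have cl: "closedin (top_of_set ?X) (?X - U')" "closedin (top_of_set ?X) (?X - U)"
      unfolding Diff_eq using Br(2) Out(2) by (auto intro: closedin_closed_Int)
    have "continuous_on ((?X - U') \<union> (?X - U)) (\<lambda>p. if p \<in> Br then s (w p) else 0)"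
    proof (rule continuous_on_cases_local)
      show "closedin (top_of_set ((?X - U') \<union> (?X - U))) (?X - U')"
        using cl(1) unfolding X[symmetric] .
      show "closedin (top_of_set ((?X - U') \<union> (?X - U))) (?X - U)"
        using cl(2) unfolding X[symmetric] .
      show "continuous_on (?X - U') (\<lambda>p. s (w p))"
        by (rule continuous_on_compose2[OF s(1) continuous_on_subset[OF cw]]) auto
      show "s (w x) = 0" if "x \<in> ?X - U' \<and> x \<notin> Br \<or> x \<in> ?X - U \<and> x \<in> Br" for x
      proof -
        have "x = y" using that Br(1) Out(1) by blast
        then show ?thesis using y s by simp
      qed
    qed simp
    then show ?thesis using X by simp
  qed
  have C0: "k \<in> C0 G" unfolding C0_def
  proof (safe)
    fix \<epsilon> :: real assume \<epsilon>: "\<epsilon> > 0"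
    then obtain j where j: "j \<in> compactly_supported G" "\<And>p. p \<in> ?X \<Longrightarrow> \<bar>w p - j p\<bar> \<le> \<epsilon>"
      using form_domain_C0[OF w] unfolding C0_def by blast
    then obtain K where K: "K \<subseteq> ?X" "compact K" "\<And>p. p \<in> ?X - K \<Longrightarrow> j p = 0"
      by (auto simp: compactly_supported_def)
    \<comment> \<open>Soft thresholding moves values by at most \<open>\<epsilon>\<close> and
      annihilates \<open>w\<close> off \<open>K\<close>. Cutting off the approximant
      \<open>j\<close> itself could be discontinuous, as \<open>j y\<close> need not vanish.\<close>
    define s where "s t = max (t - \<epsilon>) 0 + min (t + \<epsilon>) 0" for t
    have s: "continuous_on UNIV s" "s 0 = 0" "\<bar>t - s t\<bar> \<le> \<epsilon>" "\<bar>t\<bar> \<le> \<epsilon> \<Longrightarrow> s t = 0" for t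
      using \<epsilon> unfolding s_def[abs_def] by (auto intro!: continuous_intros)
    define kk where "kk = (\<lambda>p. if p \<in> Br then s (w p) else 0)"
    have "continuous_on ?X kk" unfolding kk_def by (rule paste[OF s(1,2)])
    moreover have "kk p = 0" if "p \<in> ?X - K" for p
    proof -
      have "p \<in> ?X" using that by simp
      then have "\<bar>w p\<bar> \<le> \<epsilon>" using j(2)[of p] K(3)[OF that] by simp
      then show ?thesis by (simp add: kk_def s)
    qed
    ultimately have "kk \<in> compactly_supported G" using K unfolding compactly_supported_def by blast
    moreover have "\<forall>p\<in>?X. \<bar>k p - kk p\<bar> \<le> \<epsilon>" using s \<epsilon> by (simp add: k_def kk_def)
    ultimately show "\<exists>kk\<in>compactly_supported G. \<forall>p\<in>?X. \<bar>k p - kk p\<bar> \<le> \<epsilon>" by blast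
  qed
  define Cin where "Cin = {c \<in> cables G. \<forall>t\<in>cable_dom G c. cable_map G c t \<in> Br \<union> {y}}"
  have din: "has_weak_deriv (cable_dom G c) (k \<circ> cable_map G c) u = has_weak_deriv (cable_dom G c) (w \<circ> cable_map G c) u"
    if c: "c \<in> Cin" for c u
  proof (rule has_weak_deriv_cong)
    fix t assume "t \<in> cable_dom G c"
    then have "cable_map G c t \<in> Br \<union> {y}" using c by (simp add: Cin_def)
    then show "(k \<circ> cable_map G c) t = (w \<circ> cable_map G c) t" using y by (auto simp: k_def)
  qed
  have cdin: "cable_deriv G k c = cable_deriv G w c" if c: "c \<in> Cin" for c
    using din[OF c] by (simp add: cable_deriv_def)
  have dout: "has_weak_deriv (cable_dom G c) (k \<circ> cable_map G c) (\<lambda>_. 0)" if c: "c \<in> cables G - Cin" for c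
  proof -
    have "\<forall>t\<in>cable_dom G c. cable_map G c t \<notin> Br" using cab[of c] c unfolding Cin_def by blast
    then have "(k \<circ> cable_map G c) t = 0" if "t \<in> cable_dom G c" for t using that by (simp add: k_def)
    then show ?thesis unfolding has_weak_deriv_def by (auto simp: set_integrable_def set_lebesgue_integral_def)
  qed
  have dw: "has_weak_deriv (cable_dom G c) (w \<circ> cable_map G c) (cable_deriv G w c)" if "c \<in> cables G" for c
    using w that by (intro cable_deriv_has_weak_deriv) (simp add: form_domain_def)
  have ex: "\<exists>u. has_weak_deriv (cable_dom G c) (k \<circ> cable_map G c) u" if "c \<in> cables G" for c
  proof (cases "c \<in> Cin")
    case True then show ?thesis using din dw that by blast
  next
    case False then show ?thesis using dout that by blast
  qed
  have zero: "(LINT t:cable_dom G c|lborel. u t * cable_deriv G k c t) = 0" if "c \<in> cables G - Cin" "u \<in> borel_measurable lborel" for c u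
    using LINT_mult_cable_deriv[OF dout[OF that(1)] that(2)] by (simp add: set_lebesgue_integral_def)
  have km: "cable_deriv G k c \<in> borel_measurable lborel" if "c \<in> cables G" for c
    using cable_deriv_has_weak_deriv[OF ex[OF that]] by (simp add: has_weak_deriv_def)
  have wm: "cable_deriv G w c \<in> borel_measurable lborel" if "c \<in> cables G" for c
    using dw[OF that] by (simp add: has_weak_deriv_def)
  have CinS: "Cin \<subseteq> cables G" by (auto simp: Cin_def)
  have "(\<lambda>c. LINT t:cable_dom G c|lborel. (cable_deriv G w c t)\<^sup>2) summable_on Cin"
  proof (rule summable_on_subset_banach[OF _ CinS])
    show "(\<lambda>c. LINT t:cable_dom G c|lborel. (cable_deriv G w c t)\<^sup>2) summable_on cables G"
      using w unfolding form_domain_def by blast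
  qed
  moreover have "(\<lambda>c. LINT t:cable_dom G c|lborel. (cable_deriv G w c t)\<^sup>2) summable_on Cin \<longleftrightarrow>
      (\<lambda>c. LINT t:cable_dom G c|lborel. (cable_deriv G k c t)\<^sup>2) summable_on cables G"
    using CinS zero km cdin by (intro summable_on_cong_neutral) (auto simp: power2_eq_square)
  ultimately have sm: "(\<lambda>c. LINT t:cable_dom G c|lborel. (cable_deriv G k c t)\<^sup>2) summable_on cables G" by simp
  have BrS: "Br \<in> sets (lebesgue_cable G)"
    using in_sets_lebesgue_cable[of U G] Br by (simp add: Int_commute)
  have "integrable (lebesgue_cable G) (\<lambda>p. indicator Br p * (w p)\<^sup>2)"
  proof -
    have "integrable (lebesgue_cable G) (\<lambda>p. (w p)\<^sup>2)" using w unfolding form_domain_def by blast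
    from integrable_real_mult_indicator[OF BrS this] show ?thesis by (simp only: mult.commute)
  qed
  moreover have "(\<lambda>p. indicator Br p * (w p)\<^sup>2) = (\<lambda>p. (k p)\<^sup>2)" by (auto simp: k_def indicator_def)
  ultimately have i2: "integrable (lebesgue_cable G) (\<lambda>p. (k p)\<^sup>2)" by simp
  show "(\<lambda>p. if p \<in> Br then w p else 0) \<in> form_domain G"
    unfolding k_def[symmetric] form_domain_def using C0 ex i2 sm by blast
  have "0 \<le> cable_mult c * (LINT t:cable_dom G c|lborel. cable_deriv G w c t * cable_deriv G k c t)" if c: "c \<in> cables G" for c
  proof (cases "c \<in> Cin")
    case True
    have "0 \<le> cable_mult c" by (cases c) auto
    moreover have "0 \<le> (LINT t:cable_dom G c|lborel. cable_deriv G w c t * cable_deriv G w c t)"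
      unfolding set_lebesgue_integral_def by (intro Bochner_Integration.integral_nonneg) simp
    ultimately show ?thesis using cdin[OF True] by simp
  next
    case False
    then show ?thesis using zero[of c, OF _ wm[OF c]] c by simp
  qed
  then show "0 \<le> dirichlet_form G w (\<lambda>p. if p \<in> Br then w p else 0)"
    unfolding k_def[symmetric] dirichlet_form_def by (simp add: infsum_nonneg)
qed

section \<open>Neighbourhoods shrinking to a point inside one edge\<close>

context cable_graph
begin

text \<open>Positivity of both coordinates keeps the set inside the open edge even if
  \<open>\<theta>\<close> is 0 or 1. A source at a vertex is thus approached along one chosen edge
  and stays out of the other edges and the ray, so it can be kept outside a branch.\<close>

definition edge_nbhd :: "'v \<Rightarrow> 'v \<Rightarrow> real \<Rightarrow> nat \<Rightarrow> 'v cable_point set" where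
  "edge_nbhd a b \<theta> j = ({p. fst p a > 0} \<inter> {p. fst p b > 0} \<inter> ball (edge_point a b \<theta>) (1 / real (Suc j))) \<inter> cable_system G"

lemma open_coord_pos: "open {p :: 'v cable_point. fst p a > 0}"
  by (intro open_Collect_less continuous_intros continuous_on_fst_apply)

context
  fixes a b and \<theta> :: real assumes ab: "a \<in> verts G" "b \<in> verts G" "weight G a b > 0" and \<theta>: "0 \<le> \<theta>" "\<theta> \<le> 1"
begin

lemma edge_nbhd_sets: "edge_nbhd a b \<theta> j \<in> sets (lebesgue_cable G)"
  unfolding edge_nbhd_def by (intro in_sets_lebesgue_cable borel_open open_Int open_coord_pos open_ball)

lemma edge_nbhd_subset: "edge_nbhd a b \<theta> j \<subseteq> edge_point a b ` {0..1}"
proof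
  fix p assume p: "p \<in> edge_nbhd a b \<theta> j"
  then have pos: "fst p a > 0" "fst p b > 0" and pX: "p \<in> cable_system G" by (auto simp: edge_nbhd_def)
  have ne: "a \<noteq> b" using ab no_loops by auto
  from pX show "p \<in> edge_point a b ` {0..1}"
  proof (cases rule: cable_point_cases)
    case (1 x y t)
    have nz: "fst p z = 0" if "z \<noteq> x" "z \<noteq> y" for z using that 1(7) by (simp add: edge_point_def)
    have "a = x \<or> a = y" "b = x \<or> b = y" using pos nz[of a] nz[of b] by (metis less_irrefl)+
    then consider "a = x" "b = y" | "a = y" "b = x" using ne by auto
    then show ?thesis
    proof cases
      case 2
      have "p = edge_point a b (1 - t)" using edge_point_swap[of y x t] 1 2 by simp
      then show ?thesis using 1 by auto
    qed (use 1 in auto)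
  next
    case (2 x s)
    then show ?thesis using pos ne by (auto simp: indicator_def split: if_splits)
  qed
qed

lemma edge_nbhd_dist: "p \<in> edge_nbhd a b \<theta> j \<Longrightarrow> dist p (edge_point a b \<theta>) < 1 / real (Suc j)"
  by (simp add: edge_nbhd_def dist_commute)

lemma edge_nbhd_in: "edge_nbhd a b \<theta> j \<subseteq> cable_system G"
  by (auto simp: edge_nbhd_def)

lemma edge_nbhd_pos: "0 < emeasure (lebesgue_cable G) (edge_nbhd a b \<theta> j)"
proof -
  have ne: "a \<noteq> b" using ab no_loops by auto
  \<comment> \<open>Proper convex combinations of \<open>\<theta>\<close> and the midpoint 1/2 lie
    strictly inside the edge and tend to \<open>\<theta>\<close>.\<close>
  define t where "t n = \<theta> + (1/2 - \<theta>) * (1 / real (Suc (Suc n)))" for n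
  have lim0: "(\<lambda>n. 1 / real (Suc (Suc n))) \<longlonglongrightarrow> 0"
    using LIMSEQ_Suc[OF LIMSEQ_inverse_real_of_nat] by (simp add: inverse_eq_divide)
  have "(\<lambda>n. \<theta> + (1/2 - \<theta>) * (1 / real (Suc (Suc n)))) \<longlonglongrightarrow> \<theta> + (1/2 - \<theta>) * 0"
    by (intro tendsto_intros lim0)
  then have "t \<longlonglongrightarrow> \<theta>" by (simp add: t_def[abs_def])
  then have "(\<lambda>n. edge_point a b (t n)) \<longlonglongrightarrow> edge_point a b \<theta>"
    by (intro continuous_on_tendsto_compose[OF continuous_on_edge_point[of UNIV]]) auto
  then have "\<forall>\<^sub>F n in sequentially. dist (edge_point a b (t n)) (edge_point a b \<theta>) < 1 / real (Suc j)"
    by (rule tendstoD) simp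
  from eventually_happens'[OF sequentially_bot this]
  obtain n where n: "dist (edge_point a b (t n)) (edge_point a b \<theta>) < 1 / real (Suc j)" by blast
  define s where "s = 1 / real (Suc (Suc n))"
  have s: "0 < s" "s < 1" by (auto simp: s_def)
  have t': "t n = (1 - s) * \<theta> + s / 2" unfolding t_def s_def[symmetric] by (simp add: algebra_simps)
  have "0 < t n" unfolding t' using s \<theta> by (intro add_nonneg_pos mult_nonneg_nonneg) auto
  moreover have "0 < (1 - s) * (1 - \<theta>) + s / 2" using s \<theta> by (intro add_nonneg_pos mult_nonneg_nonneg) auto
  then have "t n < 1" unfolding t' by (simp add: algebra_simps)
  ultimately have "fst (edge_point a b (t n)) a > 0" "fst (edge_point a b (t n)) b > 0" "edge_point a b (t n) \<in> cable_system G"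
    using ne ab edge_point_in[of a b "t n"] by (auto simp: edge_point_def)
  then show ?thesis unfolding edge_nbhd_def using n
    by (intro emeasure_lebesgue_cable_open_pos[of _ "edge_point a b (t n)"] open_Int open_coord_pos open_ball)
      (auto simp: dist_commute)
qed

lemma edge_nbhd_finite: "emeasure (lebesgue_cable G) (edge_nbhd a b \<theta> j) < \<infinity>"
proof (rule emeasure_lebesgue_cable_finite[OF edge_nbhd_sets, of "{Edge a b, Edge b a}" _ "\<lambda>_. 0" "\<lambda>_. 1 / (2 * weight G a b)"])
  have ne: "a \<noteq> b" using ab no_loops by auto
  show "{Edge a b, Edge b a} \<subseteq> cables G" using ab weight_sym[of a b] by (auto simp: cables_def)
  show "cable_map G c t \<notin> edge_nbhd a b \<theta> j" if c: "c \<in> cables G - {Edge a b, Edge b a}" for c t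
  proof (cases c)
    case (Edge x y)
    then show ?thesis using c ne by (auto simp: edge_nbhd_def indicator_def)
  next
    case (Ray x)
    then show ?thesis using ne by (auto simp: edge_nbhd_def indicator_def split: if_splits)
  qed
  show "t \<in> {0..1 / (2 * weight G a b)}" if "c \<in> {Edge a b, Edge b a}" "t \<in> cable_dom G c" for c t
    using that weight_sym[of a b] by auto
qed simp

lemma edge_nbhd_integrable:
  assumes F: "continuous_on (cable_system G) F"
  shows "set_integrable (lebesgue_cable G) (edge_nbhd a b \<theta> j) (F :: _ \<Rightarrow> real)"
proof -
  have m: "F \<in> borel_measurable (lebesgue_cable G)" by (rule continuous_on_lebesgue_cable_measurable[OF F])
  have "edge_point a b ` {0..1} \<subseteq> cable_system G" using ab by (auto intro: edge_point_in)
  then have "compact (F ` edge_point a b ` {0..1})"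
    by (intro compact_continuous_image continuous_on_subset[OF F] continuous_on_edge_point) auto
  then obtain B where B: "\<And>x. x \<in> F ` edge_point a b ` {0..1} \<Longrightarrow> \<bar>x\<bar> \<le> B"
    using compact_imp_bounded bounded_real by metis
  show ?thesis unfolding set_integrable_def
  proof (rule Bochner_Integration.integrable_bound)
    show "integrable (lebesgue_cable G) (\<lambda>p. B * indicator (edge_nbhd a b \<theta> j) p)"
      by (intro integrable_mult_right integrable_real_indicator edge_nbhd_sets edge_nbhd_finite)
    show "AE p in lebesgue_cable G. norm (indicator (edge_nbhd a b \<theta> j) p *\<^sub>R F p) \<le> norm (B * indicator (edge_nbhd a b \<theta> j) p)"
    proof (intro AE_I2)
      fix p
      show "norm (indicator (edge_nbhd a b \<theta> j) p *\<^sub>R F p) \<le> norm (B * indicator (edge_nbhd a b \<theta> j) p)"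
      proof (cases "p \<in> edge_nbhd a b \<theta> j")
        case True
        then have "\<bar>F p\<bar> \<le> B" using edge_nbhd_subset B by blast
        then show ?thesis using True by simp
      qed simp
    qed
  qed (use m edge_nbhd_sets in measurable)
qed

lemma edge_nbhd_measure_pos: "0 < measure (lebesgue_cable G) (edge_nbhd a b \<theta> j)"
  using edge_nbhd_pos[of j] edge_nbhd_finite[of j] by (simp add: measure_def enn2real_positive_iff)

lemma edge_nbhd_average_tendsto:
  assumes F: "continuous_on (cable_system G) (F :: _ \<Rightarrow> real)"
  shows "(\<lambda>j. (LINT q:edge_nbhd a b \<theta> j|lebesgue_cable G. F q) / measure (lebesgue_cable G) (edge_nbhd a b \<theta> j))
    \<longlonglongrightarrow> F (edge_point a b \<theta>)"
proof (rule LIMSEQ_I)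
  fix r :: real assume r: "r > 0"
  let ?q = "edge_point a b \<theta>"
  have q: "?q \<in> cable_system G" using ab \<theta> by (rule edge_point_in)
  obtain \<delta> where \<delta>: "\<delta> > 0" "\<And>x. x \<in> cable_system G \<Longrightarrow> dist x ?q < \<delta> \<Longrightarrow> dist (F x) (F ?q) < r / 2"
    using F q r unfolding continuous_on_iff by (metis half_gt_zero)
  obtain N where N: "1 / real (Suc N) < \<delta>" using \<delta>(1) by (metis nat_approx_posE)
  show "\<exists>no. \<forall>j\<ge>no. norm ((LINT q:edge_nbhd a b \<theta> j|lebesgue_cable G. F q) / measure (lebesgue_cable G) (edge_nbhd a b \<theta> j) - F ?q) < r"
  proof (intro exI allI impI)
    fix j assume j: "N \<le> j"
    let ?A = "edge_nbhd a b \<theta> j"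
    have c: "(LINT q:?A|lebesgue_cable G. F ?q) = F ?q * measure (lebesgue_cable G) ?A"
      unfolding set_lebesgue_integral_def using edge_nbhd_in[of j] edge_nbhd_sets[of j] by (simp add: Int_absorb2 mult.commute)
    have ic: "set_integrable (lebesgue_cable G) ?A (\<lambda>_. x :: real)" for x by (rule edge_nbhd_integrable) simp
    have "1 / real (Suc j) \<le> 1 / real (Suc N)" using j by (simp add: frac_le)
    then have close: "\<bar>F p - F ?q\<bar> \<le> r / 2" if "p \<in> ?A" for p
      using edge_nbhd_dist[OF that] edge_nbhd_in[of j] that \<delta>(2)[of p] N by (fastforce simp: dist_real_def)
    have "\<bar>(LINT q:?A|lebesgue_cable G. F q) - F ?q * measure (lebesgue_cable G) ?A\<bar> = \<bar>LINT q:?A|lebesgue_cable G. F q - F ?q\<bar>"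
      unfolding c[symmetric] by (subst set_integral_diff(2)[OF edge_nbhd_integrable[OF F] ic]) simp
    also have "\<dots> \<le> (LINT q:?A|lebesgue_cable G. \<bar>F q - F ?q\<bar>)"
      using set_integral_norm_bound[OF set_integral_diff(1)[OF edge_nbhd_integrable[OF F] ic]] by simp
    also have "\<dots> \<le> (LINT q:?A|lebesgue_cable G. r / 2)"
      by (rule set_integral_mono[OF _ ic]) (use close set_integral_diff(1)[OF edge_nbhd_integrable[OF F] ic] in \<open>auto intro: set_integrable_abs\<close>)
    also have "\<dots> = r / 2 * measure (lebesgue_cable G) ?A"
      unfolding set_lebesgue_integral_def using edge_nbhd_in[of j] edge_nbhd_sets[of j] by (simp add: Int_absorb2 mult.commute)
    also have "\<dots> < r * measure (lebesgue_cable G) ?A" using r edge_nbhd_measure_pos[of j] by simp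
    finally have "\<bar>(LINT q:?A|lebesgue_cable G. F q) - F ?q * measure (lebesgue_cable G) ?A\<bar> / measure (lebesgue_cable G) ?A < r"
      using edge_nbhd_measure_pos[of j] by (simp add: pos_divide_less_eq)
    moreover have "\<bar>(LINT q:?A|lebesgue_cable G. F q) - F ?q * measure (lebesgue_cable G) ?A\<bar> / measure (lebesgue_cable G) ?A =
      \<bar>(LINT q:?A|lebesgue_cable G. F q) / measure (lebesgue_cable G) ?A - F ?q\<bar>"
    proof -
      have "(LINT q:?A|lebesgue_cable G. F q) / measure (lebesgue_cable G) ?A - F ?q =
        ((LINT q:?A|lebesgue_cable G. F q) - F ?q * measure (lebesgue_cable G) ?A) / measure (lebesgue_cable G) ?A"
        using edge_nbhd_measure_pos[of j] by (simp add: diff_divide_distrib)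
      then show ?thesis using edge_nbhd_measure_pos[of j] by (simp only: abs_divide)
    qed
    ultimately show "norm ((LINT q:?A|lebesgue_cable G. F q) / measure (lebesgue_cable G) ?A - F ?q) < r" by simp
  qed
qed

end

end

subsection \<open>The Green function as a covariance\<close>

locale gff_process = green_process G P L g
  for G :: "('v::countable) weighted_graph" and P L g +
  fixes M :: "('v cable_point \<Rightarrow> real) measure"
  assumes prob_space_M: "prob_space M"
    and sets_M: "sets M = sets (restrict_space (Pi\<^sub>M (cable_system G) (\<lambda>_. borel)) {\<phi>. continuous_on (cable_system G) \<phi>})"
    and gaussian_M: "\<And>F a. finite F \<Longrightarrow> F \<subseteq> cable_system G \<Longrightarrow> centered_gaussian M (\<lambda>\<phi>. \<Sum>p\<in>F. a p * \<phi> p)"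
    and covariance_M: "\<And>p q. p \<in> cable_system G \<Longrightarrow> q \<in> cable_system G \<Longrightarrow> (LINT \<phi>|M. \<phi> p * \<phi> q) = g p q"
begin

sublocale M: prob_space M by (rule prob_space_M)

lemma field_measurable[measurable]: "p \<in> cable_system G \<Longrightarrow> (\<lambda>\<phi>. \<phi> p) \<in> borel_measurable M"
  using measurable_restrict_space1[OF measurable_component_singleton[of p "cable_system G" "\<lambda>_. borel"], of "{\<phi>. continuous_on (cable_system G) \<phi>}"]
    measurable_cong_sets[OF sets_M refl, of borel] by blast

lemma field_continuous: "\<phi> \<in> space M \<Longrightarrow> continuous_on (cable_system G) \<phi>"
  using sets_eq_imp_space_eq[OF sets_M] by (auto simp: space_restrict_space)

lemma field_pair_gaussian:
  assumes "p \<in> cable_system G" "q \<in> cable_system G"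
  shows "centered_gaussian M (\<lambda>\<phi>. c * \<phi> p + d * \<phi> q)"
proof -
  have "centered_gaussian M (\<lambda>\<phi>. \<Sum>r\<in>{p, q}. ((if r = p then c else 0) + (if r = q then d else 0)) * \<phi> r)"
    using assms by (intro gaussian_M) auto
  moreover have "(\<Sum>r\<in>{p, q}. ((if r = p then c else 0) + (if r = q then d else 0)) * \<phi> r) = c * \<phi> p + d * \<phi> q" for \<phi> :: "'v cable_point \<Rightarrow> real"
    by (cases "p = q") (auto simp: algebra_simps)
  ultimately show ?thesis by simp
qed

lemma field_gaussian: "p \<in> cable_system G \<Longrightarrow> centered_gaussian M (\<lambda>\<phi>. \<phi> p)"
  using field_pair_gaussian[of p p 1 0] by simp

lemma field_square_integrable: "p \<in> cable_system G \<Longrightarrow> integrable M (\<lambda>\<phi>. (\<phi> p)\<^sup>2)"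
  by (rule M.centered_gaussian_law_var(1)[OF field_gaussian])

lemma field_product_integrable: "p \<in> cable_system G \<Longrightarrow> q \<in> cable_system G \<Longrightarrow> integrable M (\<lambda>\<phi>. \<phi> p * \<phi> q)"
  by (intro integrable_mult_of_squares field_measurable field_square_integrable)

text \<open>Symmetry and the Cauchy-Schwarz inequality come for free because \<open>g\<close> is a
  covariance.\<close>

lemma green_sym: "p \<in> cable_system G \<Longrightarrow> q \<in> cable_system G \<Longrightarrow> g p q = g q p"
  by (simp only: covariance_M[symmetric] mult.commute)

lemma green_diag: "p \<in> cable_system G \<Longrightarrow> g p p = (LINT \<phi>|M. (\<phi> p)\<^sup>2)"
  by (simp only: covariance_M[symmetric] power2_eq_square)

lemma green_Cauchy_Schwarz:
  assumes p: "p \<in> cable_system G" and q: "q \<in> cable_system G"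
  shows "(g p q)\<^sup>2 \<le> g p p * g q q"
  using square_integrable_Cauchy_Schwarz[OF field_measurable[OF p] field_measurable[OF q]
      field_square_integrable[OF p] field_square_integrable[OF q] field_product_integrable[OF p q]]
  by (simp only: covariance_M[OF p q] green_diag[OF p] green_diag[OF q])

text \<open>Sample paths are continuous, so the characteristic functions
  \<open>exp (- v n / 2)\<close> of the differences tend to 1 and their variances to 0. The
  Cauchy-Schwarz inequality turns this into continuity of the covariance.\<close>

lemma green_continuous:
  assumes p: "p \<in> cable_system G"
  shows "continuous_on (cable_system G) (g p)"
  unfolding continuous_on_sequentially
proof (intro allI ballI impI, elim conjE)
  fix s q assume q: "q \<in> cable_system G" and s: "\<forall>n. s n \<in> cable_system G" "s \<longlonglongrightarrow> q"
  define D where "D n \<phi> = 1 * \<phi> (s n) + (-1) * \<phi> q" for n and \<phi> :: "'v cable_point \<Rightarrow> real"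
  have gD: "centered_gaussian M (D n)" for n
    unfolding D_def[abs_def] using s q by (intro field_pair_gaussian) auto
  have Dm[measurable]: "D n \<in> borel_measurable M" for n using gD[of n] by (simp add: centered_gaussian_def)
  define v where "v n = (LINT \<phi>|M. (D n \<phi>)\<^sup>2)" for n
  have "(\<lambda>n. LINT \<phi>|M. iexp (D n \<phi>)) \<longlonglongrightarrow> (LINT \<phi>|M. 1)"
  proof (rule integral_dominated_convergence[where w = "\<lambda>_. 1"])
    show "AE \<phi> in M. (\<lambda>n. iexp (D n \<phi>)) \<longlonglongrightarrow> 1"
    proof (intro AE_I2)
      fix \<phi> assume "\<phi> \<in> space M"
      from field_continuous[OF this] have "(\<lambda>n. \<phi> (s n)) \<longlonglongrightarrow> \<phi> q"
        using continuous_on_tendsto_compose[of "cable_system G" \<phi> s q sequentially] s q by simp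
      then have "(\<lambda>n. iexp (1 * \<phi> (s n) + (-1) * \<phi> q)) \<longlonglongrightarrow> iexp (1 * \<phi> q + (-1) * \<phi> q)"
        by (intro tendsto_intros)
      then show "(\<lambda>n. iexp (D n \<phi>)) \<longlonglongrightarrow> 1" by (simp add: D_def)
    qed
  qed auto
  then have "(\<lambda>n. complex_of_real (exp (- v n / 2))) \<longlonglongrightarrow> complex_of_real 1"
    by (simp add: M.centered_gaussian_law_var(3)[OF gD] v_def M.prob_space)
  then have "(\<lambda>n. exp (- v n / 2)) \<longlonglongrightarrow> 1" by (simp only: tendsto_of_real_iff)
  then have "(\<lambda>n. ln (exp (- v n / 2))) \<longlonglongrightarrow> ln 1" by (intro tendsto_ln) auto
  then have "(\<lambda>n. -2 * (- v n / 2)) \<longlonglongrightarrow> -2 * 0" by (intro tendsto_mult tendsto_const) simp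
  then have v: "v \<longlonglongrightarrow> 0" by simp
  have bound: "\<bar>g p (s n) - g p q\<bar> \<le> sqrt (g p p * v n)" for n
  proof -
    have sn: "s n \<in> cable_system G" using s by blast
    have iD: "integrable M (\<lambda>\<phi>. (D n \<phi>)\<^sup>2)" by (rule M.centered_gaussian_law_var(1)[OF gD])
    have "(LINT \<phi>|M. \<phi> p * D n \<phi>) = (LINT \<phi>|M. \<phi> p * \<phi> (s n) - \<phi> p * \<phi> q)"
      by (simp add: D_def algebra_simps)
    also have "\<dots> = g p (s n) - g p q"
      using field_product_integrable[OF p sn] field_product_integrable[OF p q] by (simp add: covariance_M p q sn)
    finally have e: "g p (s n) - g p q = (LINT \<phi>|M. \<phi> p * D n \<phi>)" by simp
    have "(LINT \<phi>|M. \<phi> p * D n \<phi>)\<^sup>2 \<le> g p p * v n"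
      unfolding green_diag[OF p] v_def
      by (rule square_integrable_Cauchy_Schwarz[OF field_measurable[OF p] Dm field_square_integrable[OF p] iD
          integrable_mult_of_squares[OF field_measurable[OF p] Dm field_square_integrable[OF p] iD]])
    then have "sqrt ((g p (s n) - g p q)\<^sup>2) \<le> sqrt (g p p * v n)" unfolding e by (rule real_sqrt_le_mono)
    then show ?thesis by simp
  qed
  have "(\<lambda>n. sqrt (g p p * v n)) \<longlonglongrightarrow> sqrt (g p p * 0)" by (intro tendsto_intros v)
  then have lim: "(\<lambda>n. sqrt (g p p * v n)) \<longlonglongrightarrow> 0" by simp
  have "(\<lambda>n. g p (s n) - g p q) \<longlonglongrightarrow> 0"
    by (rule Lim_null_comparison[OF _ lim]) (use bound in simp)
  then show "(g p \<circ> s) \<longlonglongrightarrow> g p q" by (simp add: comp_def LIM_zero_iff)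
qed

lemma resolvent_combination_form:
  fixes c1 c2 :: real
  assumes A: "A1 \<in> sets (lebesgue_cable G)" "A2 \<in> sets (lebesgue_cable G)"
    and fin: "emeasure (lebesgue_cable G) A1 < \<infinity>" "emeasure (lebesgue_cable G) A2 < \<infinity>" and \<beta>: "\<beta> > 0"
  defines "f \<equiv> \<lambda>q. c1 * indicator A1 q + c2 * indicator A2 q"
  shows "resolvent_op P \<beta> f \<in> form_domain G"
    and "k \<in> form_domain G \<Longrightarrow> dirichlet_form G (resolvent_op P \<beta> f) k
        + \<beta> * (LINT p|lebesgue_cable G. resolvent_op P \<beta> f p * k p) = (LINT p|lebesgue_cable G. f p * k p)"
proof -
  have fm: "f \<in> borel_measurable (lebesgue_cable G)" unfolding f_def using A by measurable
  have "integrable (lebesgue_cable G) (\<lambda>q. (c1\<^sup>2 + 2 * \<bar>c1 * c2\<bar>) * indicator A1 q + c2\<^sup>2 * indicator A2 q)"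
    using A fin by (intro Bochner_Integration.integrable_add integrable_mult_right integrable_real_indicator)
  then have "integrable (lebesgue_cable G) (\<lambda>p. (f p)\<^sup>2)"
  proof (rule Bochner_Integration.integrable_bound)
    have "c1 * c2 \<le> \<bar>c1 * c2\<bar>" by simp
    then have "(f q)\<^sup>2 \<le> (c1\<^sup>2 + 2 * \<bar>c1 * c2\<bar>) * indicator A1 q + c2\<^sup>2 * indicator A2 q" for q
      by (auto simp: f_def indicator_def power2_eq_square algebra_simps)
    then show "AE q in lebesgue_cable G. norm ((f q)\<^sup>2) \<le> norm ((c1\<^sup>2 + 2 * \<bar>c1 * c2\<bar>) * indicator A1 q + c2\<^sup>2 * indicator A2 q)"
      by (intro AE_I2) (metis abs_ge_self abs_power2 order_trans real_norm_def)
  qed (use fm in measurable)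
  then have "resolvent_op P \<beta> f \<in> form_domain G \<and> (\<forall>k\<in>form_domain G. dirichlet_form G (resolvent_op P \<beta> f) k
        + \<beta> * (LINT p|lebesgue_cable G. resolvent_op P \<beta> f p * k p) = (LINT p|lebesgue_cable G. f p * k p))"
    using form \<beta> fm unfolding associated_with_form_def by blast
  then show "resolvent_op P \<beta> f \<in> form_domain G"
    and "k \<in> form_domain G \<Longrightarrow> dirichlet_form G (resolvent_op P \<beta> f) k
        + \<beta> * (LINT p|lebesgue_cable G. resolvent_op P \<beta> f p * k p) = (LINT p|lebesgue_cable G. f p * k p)" by blast+
qed

lemma resolvent_indicator_form:
  assumes A: "A \<in> sets (lebesgue_cable G)" and fin: "emeasure (lebesgue_cable G) A < \<infinity>" and \<beta>: "\<beta> > 0"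
  shows "resolvent_op P \<beta> (indicator A) \<in> form_domain G"
    and "k \<in> form_domain G \<Longrightarrow> dirichlet_form G (resolvent_op P \<beta> (indicator A)) k
        + \<beta> * (LINT p|lebesgue_cable G. resolvent_op P \<beta> (indicator A) p * k p) = (LINT p:A|lebesgue_cable G. k p)"
proof -
  have e: "(\<lambda>q. 1 * indicator A q + 0 * indicator A q) = (indicator A :: _ \<Rightarrow> real)" by auto
  show "resolvent_op P \<beta> (indicator A) \<in> form_domain G"
    using resolvent_combination_form(1)[OF A A fin fin \<beta>, of 1 0] unfolding e .
  show "dirichlet_form G (resolvent_op P \<beta> (indicator A)) k
        + \<beta> * (LINT p|lebesgue_cable G. resolvent_op P \<beta> (indicator A) p * k p) = (LINT p:A|lebesgue_cable G. k p)"
    if "k \<in> form_domain G"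
    using resolvent_combination_form(2)[OF A A fin fin \<beta> that, of 1 0] unfolding e by (simp add: set_lebesgue_integral_def)
qed

context
  fixes a b and \<theta> :: real assumes ab: "a \<in> verts G" "b \<in> verts G" "weight G a b > 0" and \<theta>: "0 \<le> \<theta>" "\<theta> \<le> 1"
begin

lemma green_nbhd_tendsto:
  assumes p: "p \<in> cable_system G"
  shows "(\<lambda>n. resolvent_op P (1 / real (Suc n)) (indicator (edge_nbhd a b \<theta> j)) p)
    \<longlonglongrightarrow> (LINT q:edge_nbhd a b \<theta> j|lebesgue_cable G. g p q)"
proof -
  let ?A = "edge_nbhd a b \<theta> j"
  note A = edge_nbhd_sets[OF ab \<theta>, of j] and fin = edge_nbhd_finite[OF ab \<theta>, of j]
  have i: "set_integrable (lebesgue_cable G) ?A (g p)"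
    by (rule edge_nbhd_integrable[OF ab \<theta> green_continuous[OF p]])
  have nn: "0 \<le> indicator ?A q * g p q" for q
  proof (cases "q \<in> ?A")
    case True
    then have "q \<in> cable_system G" using edge_nbhd_in[OF ab \<theta>] by blast
    then show ?thesis using green_nonneg[OF p] by simp
  qed simp
  have "(\<integral>\<^sup>+ q \<in> ?A. ennreal (g p q) \<partial>lebesgue_cable G) = (\<integral>\<^sup>+ q. ennreal (indicator ?A q *\<^sub>R g p q) \<partial>lebesgue_cable G)"
    by (intro nn_integral_cong) (simp add: indicator_def)
  also have "\<dots> = ennreal (LINT q:?A|lebesgue_cable G. g p q)"
    unfolding set_lebesgue_integral_def
    by (rule nn_integral_eq_integral) (use i nn in \<open>auto simp: set_integrable_def\<close>)
  finally have U: "(\<integral>\<^sup>+ q \<in> ?A. ennreal (g p q) \<partial>lebesgue_cable G) = ennreal (LINT q:?A|lebesgue_cable G. g p q)" .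
  have "0 \<le> (LINT q:?A|lebesgue_cable G. g p q)"
    unfolding set_lebesgue_integral_def by (intro Bochner_Integration.integral_nonneg) (use nn in simp)
  from discounted_occupation_tendsto[OF p A fin U this] show ?thesis
    by (simp add: resolvent_op_indicator[OF p A])
qed

text \<open>\<open>g\<close> with one point fixed need not be in the form domain, so the equation is
  obtained for resolvents of indicators and transported by two pointwise limits:
  \<open>\<beta>\<close> to 0, then averages over a shrinking source. The hypotheses on
  \<open>D\<close> are what these limits require; a tent satisfies them because its \<open>D\<close>
  involves finitely many values.\<close>

lemma green_test:
  assumes k: "k \<in> form_domain G" "integrable (lebesgue_cable G) k"
    and D: "\<And>u. u \<in> form_domain G \<Longrightarrow> dirichlet_form G u k = D u"
    and Dlim: "\<And>un u. (\<And>p. p \<in> cable_system G \<Longrightarrow> (\<lambda>n. un n p) \<longlonglongrightarrow> u p) \<Longrightarrow> (\<lambda>n. D (un n)) \<longlonglongrightarrow> D u"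
    and Dscale: "\<And>u c. D (\<lambda>p. u p / c) = D u / c"
  shows "D (\<lambda>p. g p (edge_point a b \<theta>)) = k (edge_point a b \<theta>)"
proof -
  have ck: "continuous_on (cable_system G) k" by (rule C0_continuous[OF form_domain_C0[OF k(1)]])
  have step: "D (\<lambda>p. LINT q:edge_nbhd a b \<theta> j|lebesgue_cable G. g p q) = (LINT q:edge_nbhd a b \<theta> j|lebesgue_cable G. k q)" for j
  proof -
    let ?A = "edge_nbhd a b \<theta> j"
    note A = edge_nbhd_sets[OF ab \<theta>, of j] and fin = edge_nbhd_finite[OF ab \<theta>, of j]
    define \<beta> where "\<beta> n = 1 / real (Suc n)" for n
    have \<beta>: "\<beta> n > 0" for n by (simp add: \<beta>_def)
    have \<beta>0: "\<beta> \<longlonglongrightarrow> 0" unfolding \<beta>_def using LIMSEQ_inverse_real_of_nat by (simp add: inverse_eq_divide)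
    define un where "un n = resolvent_op P (\<beta> n) (indicator ?A)" for n
    have un: "(\<lambda>n. un n p) \<longlonglongrightarrow> (LINT q:?A|lebesgue_cable G. g p q)" if "p \<in> cable_system G" for p
      using green_nbhd_tendsto[OF that] by (simp add: un_def \<beta>_def)
    have unf: "un n \<in> form_domain G" for n unfolding un_def by (rule resolvent_indicator_form(1)[OF A fin \<beta>])
    have unm: "un n \<in> borel_measurable (lebesgue_cable G)" for n
      by (rule continuous_on_lebesgue_cable_measurable[OF C0_continuous[OF form_domain_C0[OF unf]]])
    have km: "k \<in> borel_measurable (lebesgue_cable G)" using k(2) by auto
    have un_eq: "un n p = discounted_occupation p ?A (\<beta> n)" if "p \<in> cable_system G" for n p
      unfolding un_def by (rule resolvent_op_indicator[OF that A \<beta>])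
    \<comment> \<open>The mass term disappears in the limit: \<open>\<beta> n * un n\<close> tends
      to 0 pointwise and lies between 0 and 1, so \<open>\<bar>k\<bar>\<close> dominates.\<close>
    have small: "(\<lambda>n. LINT p|lebesgue_cable G. \<beta> n * un n p * k p) \<longlonglongrightarrow> (LINT p|lebesgue_cable G. 0)"
    proof (rule integral_dominated_convergence[where w = "\<lambda>p. \<bar>k p\<bar>"])
      show "AE p in lebesgue_cable G. (\<lambda>n. \<beta> n * un n p * k p) \<longlonglongrightarrow> 0"
      proof (intro AE_I2)
        fix p assume "p \<in> space (lebesgue_cable G)"
        then have "(\<lambda>n. \<beta> n * un n p * k p) \<longlonglongrightarrow> 0 * (LINT q:?A|lebesgue_cable G. g p q) * k p"
          by (intro tendsto_intros \<beta>0 un) simp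
        then show "(\<lambda>n. \<beta> n * un n p * k p) \<longlonglongrightarrow> 0" by simp
      qed
      show "AE p in lebesgue_cable G. norm (\<beta> n * un n p * k p) \<le> \<bar>k p\<bar>" for n
      proof (intro AE_I2)
        fix p assume "p \<in> space (lebesgue_cable G)"
        then have p: "p \<in> cable_system G" by simp
        have "0 \<le> \<beta> n * un n p" "\<beta> n * un n p \<le> 1"
          using discounted_occupation_nonneg[OF p A] discounted_occupation_le[OF p A \<beta>] \<beta>[of n]
          by (simp_all add: un_eq[OF p])
        then show "norm (\<beta> n * un n p * k p) \<le> \<bar>k p\<bar>"
          by (simp add: abs_mult mult_left_le_one_le flip: abs_mult) (simp add: abs_mult mult_left_le_one_le)
      qed
    qed (use k unm km in auto)
    have eq: "D (un n) = (LINT q:?A|lebesgue_cable G. k q) - (LINT p|lebesgue_cable G. \<beta> n * un n p * k p)" for n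
      using resolvent_indicator_form(2)[OF A fin \<beta> k(1), of n] D[OF unf, of n] by (simp add: un_def mult.assoc)
    have "(\<lambda>n. D (un n)) \<longlonglongrightarrow> (LINT q:?A|lebesgue_cable G. k q) - (LINT p|lebesgue_cable G. 0)"
      unfolding eq by (intro tendsto_diff tendsto_const small)
    moreover have "(\<lambda>n. D (un n)) \<longlonglongrightarrow> D (\<lambda>p. LINT q:?A|lebesgue_cable G. g p q)" by (rule Dlim[OF un])
    ultimately show ?thesis using LIMSEQ_unique by fastforce
  qed
  let ?m = "\<lambda>j. measure (lebesgue_cable G) (edge_nbhd a b \<theta> j)"
  have "(\<lambda>j. D (\<lambda>p. (LINT q:edge_nbhd a b \<theta> j|lebesgue_cable G. g p q) / ?m j)) \<longlonglongrightarrow> D (\<lambda>p. g p (edge_point a b \<theta>))"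
    by (rule Dlim) (rule edge_nbhd_average_tendsto[OF ab \<theta> green_continuous])
  then have "(\<lambda>j. (LINT q:edge_nbhd a b \<theta> j|lebesgue_cable G. k q) / ?m j) \<longlonglongrightarrow> D (\<lambda>p. g p (edge_point a b \<theta>))"
    by (simp only: Dscale step)
  then show ?thesis using edge_nbhd_average_tendsto[OF ab \<theta> ck] LIMSEQ_unique by blast
qed

end

text \<open>
  The function \<open>w p = g y q\<^sub>2 g p q\<^sub>1 - g y q\<^sub>1 g p q\<^sub>2\<close> vanishes at \<open>y\<close>, so its restriction to \<open>Br\<close> is in the form domain; as
  the sources lie outside \<open>Br\<close>, testing the resolvent equation against it gives zero.  The sources are smoothed, with
  \<open>\<beta> > 0\<close>, because \<open>g\<close> itself need not be in the form domain.
\<close>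

lemma green_separation:
  assumes Br: "Br = cable_system G \<inter> U" "open U"
    and Out: "cable_system G - Br - {y} = cable_system G \<inter> U'" "open U'"
    and y: "y \<in> cable_system G" "y \<notin> Br"
    and cab: "\<And>c. c \<in> cables G \<Longrightarrow> (\<forall>t\<in>cable_dom G c. cable_map G c t \<in> Br \<union> {y}) \<or> (\<forall>t\<in>cable_dom G c. cable_map G c t \<notin> Br)"
    and q1: "a1 \<in> verts G" "b1 \<in> verts G" "weight G a1 b1 > 0" "0 \<le> \<theta>1" "\<theta>1 \<le> 1"
    and q2: "a2 \<in> verts G" "b2 \<in> verts G" "weight G a2 b2 > 0" "0 \<le> \<theta>2" "\<theta>2 \<le> 1"
    and disj: "\<And>j. edge_nbhd a1 b1 \<theta>1 j \<inter> Br = {}" "\<And>j. edge_nbhd a2 b2 \<theta>2 j \<inter> Br = {}"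
    and p: "p \<in> Br"
  shows "g y (edge_point a2 b2 \<theta>2) * g p (edge_point a1 b1 \<theta>1) = g y (edge_point a1 b1 \<theta>1) * g p (edge_point a2 b2 \<theta>2)"
proof -
  have pX: "p \<in> cable_system G" using p Br by blast
  have step: "discounted_occupation y (edge_nbhd a2 b2 \<theta>2 j) \<beta> * discounted_occupation p (edge_nbhd a1 b1 \<theta>1 j) \<beta> =
      discounted_occupation y (edge_nbhd a1 b1 \<theta>1 j) \<beta> * discounted_occupation p (edge_nbhd a2 b2 \<theta>2 j) \<beta>"
    if \<beta>: "\<beta> > 0" for j \<beta>
  proof -
    define A1 A2 where "A1 = edge_nbhd a1 b1 \<theta>1 j" and "A2 = edge_nbhd a2 b2 \<theta>2 j"
    have A: "A1 \<in> sets (lebesgue_cable G)" "A2 \<in> sets (lebesgue_cable G)"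
      and fin: "emeasure (lebesgue_cable G) A1 < \<infinity>" "emeasure (lebesgue_cable G) A2 < \<infinity>"
      using edge_nbhd_sets[OF q1] edge_nbhd_sets[OF q2] edge_nbhd_finite[OF q1] edge_nbhd_finite[OF q2] by (simp_all add: A1_def A2_def)
    \<comment> \<open>The coefficients are chosen to make \<open>w\<close> vanish at
      \<open>y\<close>, which allows the cut-off to \<open>Br\<close>.\<close>
    define c1 c2 where "c1 = discounted_occupation y A2 \<beta>" and "c2 = - discounted_occupation y A1 \<beta>"
    define f where "f = (\<lambda>q. c1 * indicator A1 q + c2 * indicator A2 q :: real)"
    define w where "w = resolvent_op P \<beta> f"
    have w: "w \<in> form_domain G" unfolding w_def f_def by (rule resolvent_combination_form(1)[OF A fin \<beta>])
    have wq: "w q = c1 * discounted_occupation q A1 \<beta> + c2 * discounted_occupation q A2 \<beta>" if "q \<in> cable_system G" for q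
      unfolding w_def f_def by (rule resolvent_op_combination[OF that A \<beta>])
    have wy: "w y = 0" using wq[OF y(1)] by (simp add: c1_def c2_def)
    define k where "k = (\<lambda>p. if p \<in> Br then w p else 0)"
    have k: "k \<in> form_domain G" and E: "0 \<le> dirichlet_form G w k"
      unfolding k_def by (rule form_domain_restrict[OF w Br Out y(2) wy cab] dirichlet_form_restrict_nonneg[OF w Br Out y(2) wy cab]; assumption)+
    have z: "(c1 * indicator A1 q + c2 * indicator A2 q) * k q = 0" for q
      using disj[of j] by (auto simp: k_def A1_def[symmetric] A2_def[symmetric] indicator_def)
    then have "dirichlet_form G w k + \<beta> * (LINT p|lebesgue_cable G. w p * k p) = 0"
      unfolding w_def f_def
      by (simp only: resolvent_combination_form(2)[OF A fin \<beta> k, of c1 c2] z Bochner_Integration.integral_zero)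
    \<comment> \<open>Energy and mass of the cut-off are both nonnegative and add up to 0, so the
      cut-off vanishes almost everywhere.\<close>
    moreover have wk: "w q * k q = (k q)\<^sup>2" for q by (simp add: k_def power2_eq_square)
    ultimately have "\<beta> * (LINT p|lebesgue_cable G. (k p)\<^sup>2) \<le> 0" using E by simp
    then have "(LINT p|lebesgue_cable G. (k p)\<^sup>2) \<le> 0" using \<beta> by (simp add: mult_le_0_iff)
    moreover have "0 \<le> (LINT p|lebesgue_cable G. (k p)\<^sup>2)" by simp
    ultimately have "(LINT p|lebesgue_cable G. (k p)\<^sup>2) = 0" by linarith
    moreover have ik: "integrable (lebesgue_cable G) (\<lambda>p. (k p)\<^sup>2)" using k unfolding form_domain_def by blast
    ultimately have ae: "AE p in lebesgue_cable G. (k p)\<^sup>2 = 0"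
      using integral_nonneg_eq_0_iff_AE[OF ik] by simp
    \<comment> \<open>Continuity and full support of the measure turn the almost everywhere
      statement into one at the point \<open>p\<close>.\<close>
    have "w p = 0"
    proof (rule ccontr)
      assume "w p \<noteq> 0"
      have cw: "continuous_on (cable_system G) w" by (rule C0_continuous[OF form_domain_C0[OF w]])
      then obtain \<delta> where \<delta>: "\<delta> > 0" "\<And>x. x \<in> cable_system G \<Longrightarrow> dist x p < \<delta> \<Longrightarrow> dist (w x) (w p) < \<bar>w p\<bar>"
        using pX \<open>w p \<noteq> 0\<close> unfolding continuous_on_iff by (metis zero_less_abs_iff)
      define V where "V = ball p \<delta> \<inter> U"
      have V: "emeasure (lebesgue_cable G) (V \<inter> cable_system G) > 0"
        using p \<delta> Br pX by (intro emeasure_lebesgue_cable_open_pos[of _ p]) (auto simp: V_def)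
      have "V \<inter> cable_system G \<in> sets (lebesgue_cable G)"
        using Br(2) by (intro in_sets_lebesgue_cable) (auto simp: V_def)
      moreover have "k x \<noteq> 0" if "x \<in> V \<inter> cable_system G" for x
      proof -
        have "x \<in> Br" "dist x p < \<delta>" using that Br by (auto simp: V_def dist_commute)
        moreover have "dist (w x) (w p) < \<bar>w p\<bar>" using \<delta>(2)[of x] that calculation by blast
        then have "w x \<noteq> 0" by (auto simp: dist_real_def)
        ultimately show ?thesis by (simp add: k_def)
      qed
      then have "AE x in lebesgue_cable G. x \<notin> V \<inter> cable_system G" using ae by (auto elim!: eventually_mono)
      ultimately have "emeasure (lebesgue_cable G) (V \<inter> cable_system G) = 0"
      proof -
        assume V': "V \<inter> cable_system G \<in> sets (lebesgue_cable G)"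
          and AE: "AE x in lebesgue_cable G. x \<notin> V \<inter> cable_system G"
        have "{x \<in> space (lebesgue_cable G). \<not> x \<notin> V \<inter> cable_system G} = V \<inter> cable_system G" by auto
        from AE_iff_measurable[OF V' this] AE show ?thesis by blast
      qed
      then show False using V by simp
    qed
    then show ?thesis using wq[OF pX] by (simp add: c1_def c2_def A1_def A2_def)
  qed
  \<comment> \<open>The identity is passed to the limit twice: \<open>\<beta>\<close> to 0 at a
    fixed source, then shrinking sources. The Boolean distinguishes the two sources.\<close>
  define I where "I x i j = (if i then LINT q:edge_nbhd a1 b1 \<theta>1 j|lebesgue_cable G. g x q else LINT q:edge_nbhd a2 b2 \<theta>2 j|lebesgue_cable G. g x q)" for x i j
  have lim1: "(\<lambda>n. discounted_occupation x (edge_nbhd a1 b1 \<theta>1 j) (1 / real (Suc n))) \<longlonglongrightarrow> I x True j"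
    if "x \<in> cable_system G" for x j
    using green_nbhd_tendsto[OF q1 that] by (simp add: I_def resolvent_op_indicator[OF that edge_nbhd_sets[OF q1]])
  have lim2: "(\<lambda>n. discounted_occupation x (edge_nbhd a2 b2 \<theta>2 j) (1 / real (Suc n))) \<longlonglongrightarrow> I x False j"
    if "x \<in> cable_system G" for x j
    using green_nbhd_tendsto[OF q2 that] by (simp add: I_def resolvent_op_indicator[OF that edge_nbhd_sets[OF q2]])
  have Ieq: "I y False j * I p True j = I y True j * I p False j" for j
  proof (rule LIMSEQ_unique)
    show "(\<lambda>n. discounted_occupation y (edge_nbhd a2 b2 \<theta>2 j) (1 / real (Suc n)) * discounted_occupation p (edge_nbhd a1 b1 \<theta>1 j) (1 / real (Suc n)))
      \<longlonglongrightarrow> I y False j * I p True j" by (intro tendsto_mult lim1 lim2 y pX)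
    show "(\<lambda>n. discounted_occupation y (edge_nbhd a2 b2 \<theta>2 j) (1 / real (Suc n)) * discounted_occupation p (edge_nbhd a1 b1 \<theta>1 j) (1 / real (Suc n)))
      \<longlonglongrightarrow> I y True j * I p False j"
    proof -
      have eq: "(\<lambda>n. discounted_occupation y (edge_nbhd a2 b2 \<theta>2 j) (1 / real (Suc n)) * discounted_occupation p (edge_nbhd a1 b1 \<theta>1 j) (1 / real (Suc n)))
        = (\<lambda>n. discounted_occupation y (edge_nbhd a1 b1 \<theta>1 j) (1 / real (Suc n)) * discounted_occupation p (edge_nbhd a2 b2 \<theta>2 j) (1 / real (Suc n)))"
        by (intro ext step) simp
      show ?thesis unfolding eq by (intro tendsto_mult lim1 lim2 y pX)
    qed
  qed
  define J where "J x i j = I x i j / measure (lebesgue_cable G) (if i then edge_nbhd a1 b1 \<theta>1 j else edge_nbhd a2 b2 \<theta>2 j)" for x i j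
  have J1: "(\<lambda>j. J x True j) \<longlonglongrightarrow> g x (edge_point a1 b1 \<theta>1)" if "x \<in> cable_system G" for x
    using edge_nbhd_average_tendsto[OF q1 green_continuous[OF that]] by (simp add: J_def I_def)
  have J2: "(\<lambda>j. J x False j) \<longlonglongrightarrow> g x (edge_point a2 b2 \<theta>2)" if "x \<in> cable_system G" for x
    using edge_nbhd_average_tendsto[OF q2 green_continuous[OF that]] by (simp add: J_def I_def)
  have Jeq: "J y False j * J p True j = J y True j * J p False j" for j
    using Ieq[of j] by (simp add: J_def mult.commute)
  show ?thesis
  proof (rule LIMSEQ_unique)
    show "(\<lambda>j. J y False j * J p True j) \<longlonglongrightarrow> g y (edge_point a2 b2 \<theta>2) * g p (edge_point a1 b1 \<theta>1)"
      by (intro tendsto_mult J1 J2 y pX)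
    show "(\<lambda>j. J y False j * J p True j) \<longlonglongrightarrow> g y (edge_point a1 b1 \<theta>1) * g p (edge_point a2 b2 \<theta>2)"
      unfolding Jeq by (intro tendsto_mult J1 J2 y pX)
  qed
qed

end

section \<open>Maximum principle and the Kirchhoff equations\<close>

context gff_process
begin

text \<open>The open sets of points with positive coordinate at \<open>v\<close> cover the cable
  system, and each contains only one vertex. Hence a compact set contains finitely many
  vertices.\<close>

lemma finite_vertices_above:
  assumes f: "f \<in> C0 G" and c: "0 < c"
  shows "finite {v \<in> verts G. c \<le> f (vertex_point v)}"
proof -
  obtain j where j: "j \<in> compactly_supported G" "\<And>p. p \<in> cable_system G \<Longrightarrow> \<bar>f p - j p\<bar> \<le> c / 2"
  proof -
    have "0 < c / 2" using c by simp
    then show ?thesis using f that unfolding C0_def by blast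
  qed
  then obtain K where K: "K \<subseteq> cable_system G" "compact K" "\<And>p. p \<in> cable_system G - K \<Longrightarrow> j p = 0"
    by (auto simp: compactly_supported_def)
  have cov: "K \<subseteq> (\<Union>v\<in>verts G. {p. fst p v > 0})"
  proof
    fix p assume "p \<in> K"
    then have "p \<in> cable_system G" using K by blast
    then show "p \<in> (\<Union>v\<in>verts G. {p. fst p v > 0})"
    proof (cases rule: cable_point_cases)
      case (1 x y \<theta>)
      have "fst p x = 1 - \<theta>" "fst p y = \<theta>" unfolding 1(7) using 1(4) by (auto simp: edge_point_def)
      then have "0 < fst p x \<or> 0 < fst p y" using 1(5,6) by linarith
      then show ?thesis using 1(1,2) by blast
    next
      case (2 x s)
      then have "0 < fst p x" by simp
      then show ?thesis using 2(1) by blast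
    qed
  qed
  have op: "\<And>v. v \<in> verts G \<Longrightarrow> open {p :: 'v cable_point. fst p v > 0}" by (rule open_coord_pos)
  obtain C where C: "C \<subseteq> verts G" "finite C" "K \<subseteq> (\<Union>v\<in>C. {p. fst p v > 0})"
    by (rule compactE_image[OF K(2) op cov])
  have "{v \<in> verts G. c \<le> f (vertex_point v)} \<subseteq> C"
  proof safe
    fix v assume v: "v \<in> verts G" "c \<le> f (vertex_point v)"
    have "\<bar>f (vertex_point v) - j (vertex_point v)\<bar> \<le> c / 2" by (rule j(2)[OF vertex_point_in[OF v(1)]])
    then have "j (vertex_point v) \<noteq> 0" using v(2) c by auto
    then have "vertex_point v \<in> K" using K(3) vertex_point_in[OF v(1)] by blast
    then show "v \<in> C" using C(3) by (auto simp: vertex_point_def indicator_def split: if_splits)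
  qed
  then show ?thesis using C(2) by (rule finite_subset)
qed

text \<open>
  The function \<open>rank\<close> makes every vertex of \<open>S\<close> lead to \<open>y\<close> through neighbours of decreasing rank.
\<close>

lemma green_maximum_principle:
  fixes rank :: "'v \<Rightarrow> nat"
  assumes ab: "a \<in> verts G" "b \<in> verts G" "weight G a b > 0" "0 \<le> \<theta>" "\<theta> \<le> 1"
    and y: "y \<in> verts G" and S: "S \<subseteq> verts G" "\<And>v. v \<in> S \<Longrightarrow> killing G v = 0"
    and nb: "\<And>v. v \<in> S \<Longrightarrow> neighbours v \<subseteq> insert y S"
    and parent: "\<And>v. v \<in> S \<Longrightarrow> \<exists>z\<in>neighbours v. z = y \<or> rank z < rank v"
    and off: "\<And>v p j. v \<in> S \<Longrightarrow> p \<in> edge_nbhd a b \<theta> j \<Longrightarrow> fst p v = 0"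
    and v: "v \<in> S"
  shows "g (vertex_point v) (edge_point a b \<theta>) \<le> g (vertex_point y) (edge_point a b \<theta>)"
proof -
  have step: "discounted_occupation (vertex_point v) (edge_nbhd a b \<theta> j) \<beta> \<le> discounted_occupation (vertex_point y) (edge_nbhd a b \<theta> j) \<beta>"
    if \<beta>: "\<beta> > 0" and v: "v \<in> S" for j \<beta> v
  proof (rule ccontr)
    let ?A = "edge_nbhd a b \<theta> j"
    note A = edge_nbhd_sets[OF ab, of j] and fin = edge_nbhd_finite[OF ab, of j]
    define u where "u = resolvent_op P \<beta> (indicator ?A)"
    have u: "u \<in> form_domain G" unfolding u_def by (rule resolvent_indicator_form(1)[OF A fin \<beta>])
    have ueq: "u p = discounted_occupation p ?A \<beta>" if "p \<in> cable_system G" for p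
      unfolding u_def by (rule resolvent_op_indicator[OF that A \<beta>])
    have u0: "0 \<le> u p" and u1: "u p \<le> 1 / \<beta>" if "p \<in> cable_system G" for p
      using discounted_occupation_nonneg[OF that A, of \<beta>] discounted_occupation_le[OF that A \<beta>] \<beta>
      by (simp_all add: ueq[OF that] field_simps)
    \<comment> \<open>Subharmonicity of \<open>u\<close> at \<open>x\<close>: the tent misses the
      source and the mass term is nonnegative. As \<open>killing G x = 0\<close> the tent may be
      stretched arbitrarily far along the ray, where \<open>u \<le> 1 / \<beta>\<close> makes the
      flux at most \<open>1 / (2 * \<beta> * R)\<close>.\<close>
    have sub: "(\<Sum>z\<in>neighbours x. weight G x z * (u (vertex_point x) - u (vertex_point z))) \<le> 0" if x: "x \<in> S" for x
    proof -
      define s where "s = (\<Sum>z\<in>neighbours x. weight G x z * (u (vertex_point x) - u (vertex_point z)))"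
      have xV: "x \<in> verts G" and kx: "killing G x = 0" using x S by auto
      have sR: "s \<le> 1 / (2 * \<beta> * R)" if R: "R > 0" for R
      proof -
        have R': "2 * killing G x * R < 1" using kx by simp
        let ?k = "vertex_tent x R"
        have "dirichlet_form G u ?k + \<beta> * (LINT p|lebesgue_cable G. u p * ?k p) = (LINT p:?A|lebesgue_cable G. ?k p)"
          unfolding u_def by (rule resolvent_indicator_form(2)[OF A fin \<beta> vertex_tent_form_domain[OF xV R R']])
        moreover have "(LINT p:?A|lebesgue_cable G. ?k p) = (LINT p|lebesgue_cable G. 0)"
          unfolding set_lebesgue_integral_def using off[OF x]
          by (intro Bochner_Integration.integral_cong refl) (auto simp: vertex_tent_def indicator_def)
        moreover have "0 \<le> (LINT p|lebesgue_cable G. u p * ?k p)"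
        proof (intro Bochner_Integration.integral_nonneg)
          fix p assume "p \<in> space (lebesgue_cable G)"
          then have "p \<in> cable_system G" by simp
          then show "0 \<le> u p * ?k p" using u0 coord_nonneg by (auto simp: vertex_tent_def)
        qed
        moreover from this have "0 \<le> \<beta> * (LINT p|lebesgue_cable G. u p * ?k p)" using \<beta> by (intro mult_nonneg_nonneg) auto
        ultimately have "dirichlet_form G u ?k \<le> 0" by simp
        then have "s + (u (vertex_point x) - u (indicator {x}, R)) / (2 * R) \<le> 0"
          unfolding vertex_tent_dirichlet_form[OF xV R R' u] s_def .
        then have "s \<le> (u (indicator {x}, R) - u (vertex_point x)) / (2 * R)" by (simp add: diff_divide_distrib)
        also have "\<dots> \<le> (1 / \<beta>) / (2 * R)"
        proof (rule divide_right_mono)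
          have "(indicator {x}, R) \<in> cable_system G" using xV R R' by (intro ray_point_in) auto
          from u1[OF this] u0[OF vertex_point_in[OF xV]]
          show "u (indicator {x}, R) - u (vertex_point x) \<le> 1 / \<beta>" by simp
        qed (use R in simp)
        finally show ?thesis by (simp add: mult.assoc mult.commute mult.left_commute)
      qed
      have "s \<le> 0"
      proof (rule ccontr)
        assume "\<not> s \<le> 0"
        then have s: "s > 0" by simp
        \<comment> \<open>The choice \<open>R = 1 / (\<beta> * s)\<close> turns the bound into
          \<open>s \<le> s / 2\<close>.\<close>
        have "s \<le> 1 / (2 * \<beta> * (1 / (\<beta> * s)))" using s \<beta> by (intro sR) simp
        also have "\<dots> = s / 2" using s \<beta> by simp
        finally show False using s by simp
      qed
      then show ?thesis by (simp add: s_def)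
    qed
    assume "\<not> discounted_occupation (vertex_point v) ?A \<beta> \<le> discounted_occupation (vertex_point y) ?A \<beta>"
    then have gt: "u (vertex_point y) < u (vertex_point v)"
      using v S y by (auto simp: ueq vertex_point_in)
    define c where "c = u (vertex_point v)"
    have c: "c > 0" using gt u0[OF vertex_point_in[OF y]] by (simp add: c_def)
    define T where "T = {w \<in> S. c \<le> u (vertex_point w)}"
    have finT: "finite T"
      by (rule finite_subset[OF _ finite_vertices_above[OF form_domain_C0[OF u] c]]) (use S in \<open>auto simp: T_def\<close>)
    have vT: "v \<in> T" using v by (simp add: T_def c_def)
    define m where "m = Max ((\<lambda>w. u (vertex_point w)) ` T)"
    have m: "u (vertex_point w) \<le> m" if "w \<in> T" for w unfolding m_def using finT that by simp
    have mc: "c \<le> m" using m[OF vT] by (simp add: c_def)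
    have "m \<in> (\<lambda>w. u (vertex_point w)) ` T" unfolding m_def using finT vT by (intro Max_in) auto
    then have ex: "\<exists>w. w \<in> T \<and> u (vertex_point w) = m" by auto
    \<comment> \<open>A maximum over \<open>T\<close> is attained since \<open>T\<close> is finite.
      At a maximiser of least rank some neighbour is strictly smaller, being \<open>y\<close> or of
      smaller rank, which contradicts subharmonicity.\<close>
    define x where "x = arg_min rank (\<lambda>w. w \<in> T \<and> u (vertex_point w) = m)"
    have x: "x \<in> T" "u (vertex_point x) = m" and xmin: "\<And>w. w \<in> T \<Longrightarrow> u (vertex_point w) = m \<Longrightarrow> rank x \<le> rank w"
      using arg_min_nat_lemma[of "\<lambda>w. w \<in> T \<and> u (vertex_point w) = m" _ rank] ex unfolding x_def by metis+
    have xS: "x \<in> S" using x by (simp add: T_def)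
    have le: "u (vertex_point z) \<le> m" if "z \<in> neighbours x" for z
    proof (cases "z = y")
      case True then show ?thesis using gt mc by (simp add: c_def)
    next
      case False
      then have "z \<in> S" using nb[OF xS] that by auto
      then show ?thesis using m[of z] mc by (cases "z \<in> T") (auto simp: T_def)
    qed
    obtain z where z: "z \<in> neighbours x" "z = y \<or> rank z < rank x" using parent[OF xS] by blast
    have "u (vertex_point z) < m"
    proof (rule ccontr)
      assume "\<not> u (vertex_point z) < m"
      then have zm: "u (vertex_point z) = m" using le[OF z(1)] by simp
      then have "z \<noteq> y" using gt mc by (auto simp: c_def)
      then have "z \<in> T" using nb[OF xS] z(1) zm mc by (auto simp: T_def)
      then show False using xmin[OF _ zm] z(2) \<open>z \<noteq> y\<close> by auto
    qed
    moreover have w: "weight G x z > 0" if "z \<in> neighbours x" for z using that by (simp add: neighbours_def)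
    ultimately have "0 < weight G x z * (u (vertex_point x) - u (vertex_point z))" using z x(2) by simp
    moreover have "finite (neighbours x)" unfolding neighbours_def using xS S by (intro locally_finite) auto
    ultimately have "0 < (\<Sum>z\<in>neighbours x. weight G x z * (u (vertex_point x) - u (vertex_point z)))"
      using z(1) le w x(2) by (intro sum_pos2[of _ z]) (auto simp: less_imp_le)
    then show False using sub[OF xS] by simp
  qed
  have vX: "vertex_point v \<in> cable_system G" "vertex_point y \<in> cable_system G" using v y S by (auto intro: vertex_point_in)
  have le: "(LINT q:edge_nbhd a b \<theta> j|lebesgue_cable G. g (vertex_point v) q) \<le> (LINT q:edge_nbhd a b \<theta> j|lebesgue_cable G. g (vertex_point y) q)" for j
    using green_nbhd_tendsto[OF ab vX(1), of j] green_nbhd_tendsto[OF ab vX(2), of j]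
    by (rule LIMSEQ_le) (auto simp: resolvent_op_indicator[OF vX(1) edge_nbhd_sets[OF ab]] resolvent_op_indicator[OF vX(2) edge_nbhd_sets[OF ab]] intro!: step v)
  show ?thesis
    using edge_nbhd_average_tendsto[OF ab green_continuous[OF vX(1)]] edge_nbhd_average_tendsto[OF ab green_continuous[OF vX(2)]]
    by (rule LIMSEQ_le) (auto intro!: divide_right_mono le)
qed

text \<open>Testing with the tent peaked at the point and solving for its value. The last term is
  the Green function of the edge killed at both ends; it vanishes unless \<open>q\<close> is an
  interior point of this edge.\<close>

lemma green_edge:
  assumes xy: "x \<in> verts G" "y \<in> verts G" "weight G x y > 0" and t: "0 \<le> t" "t \<le> 1"
    and ab: "a \<in> verts G" "b \<in> verts G" "weight G a b > 0" "0 \<le> \<theta>" "\<theta> \<le> 1"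
  defines "q \<equiv> edge_point a b \<theta>"
  shows "g (edge_point x y t) q = (1 - t) * g (vertex_point x) q + t * g (vertex_point y) q +
    min (t * fst q x) ((1 - t) * fst q y) / weight G x y"
proof -
  have qX: "q \<in> cable_system G" unfolding q_def using ab by (intro edge_point_in)
  consider "t = 0" | "t = 1" | "0 < t" "t < 1" using t by linarith
  then show ?thesis
  proof cases
    case 1
    then show ?thesis using coord_nonneg[OF qX, of y] by (simp add: edge_point_0)
  next
    case 2
    then show ?thesis using coord_nonneg[OF qX, of x] by (simp add: edge_point_1)
  next
    case 3
    define D where "D u = weight G x y * ((u (edge_point x y t) - u (vertex_point x)) / t + (u (edge_point x y t) - u (vertex_point y)) / (1 - t))"
      for u :: "'v cable_point \<Rightarrow> real"
    have "D (\<lambda>p. g p q) = edge_tent x y t q" unfolding q_def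
    proof (rule green_test[OF ab edge_tent_form_domain[OF xy 3] edge_tent_integrable[OF xy 3]])
      show "dirichlet_form G u (edge_tent x y t) = D u" if "u \<in> form_domain G" for u
        unfolding D_def by (rule edge_tent_dirichlet_form[OF xy 3 that])
      have X: "edge_point x y t \<in> cable_system G" "vertex_point x \<in> cable_system G" "vertex_point y \<in> cable_system G"
        using xy t by (auto intro: edge_point_in vertex_point_in)
      show "(\<lambda>n. D (un n)) \<longlonglongrightarrow> D u" if "\<And>p. p \<in> cable_system G \<Longrightarrow> (\<lambda>n. un n p) \<longlonglongrightarrow> u p" for un u
        unfolding D_def using 3 by (intro tendsto_intros that X) auto
      show "D (\<lambda>p. u p / c) = D u / c" for u c
      proof -
        have "(y1 / c - y2 / c) / r = (y1 - y2) / r / c" for y1 y2 r :: real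
          by (simp add: diff_divide_distrib[symmetric] mult.commute)
        then show ?thesis unfolding D_def by (simp only: add_divide_distrib[symmetric] times_divide_eq_right)
      qed
    qed
    then have eq: "weight G x y * ((g (edge_point x y t) q - g (vertex_point x) q) / t +
        (g (edge_point x y t) q - g (vertex_point y) q) / (1 - t)) = edge_tent x y t q"
      by (simp only: D_def)
    define m where "m = g (edge_point x y t) q"
    define E where "E = (m - g (vertex_point x) q) / t + (m - g (vertex_point y) q) / (1 - t)"
    have E: "E = edge_tent x y t q / weight G x y"
      using eq xy(3) unfolding E_def m_def by (metis less_irrefl nonzero_mult_div_cancel_left)
    have "t * (1 - t) * E = (1 - t) * (t * ((m - g (vertex_point x) q) / t)) + t * ((1 - t) * ((m - g (vertex_point y) q) / (1 - t)))"
      unfolding E_def by (simp only: distrib_left mult.assoc mult.commute mult.left_commute)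
    also have "\<dots> = (1 - t) * (m - g (vertex_point x) q) + t * (m - g (vertex_point y) q)" using 3 by simp
    also have "\<dots> = m - ((1 - t) * g (vertex_point x) q + t * g (vertex_point y) q)" by (simp add: algebra_simps)
    finally have 1: "t * (1 - t) * E = m - ((1 - t) * g (vertex_point x) q + t * g (vertex_point y) q)" .
    have "t * (1 - t) * edge_tent x y t q = min (t * fst q x) ((1 - t) * fst q y)"
    proof -
      have "t * (1 - t) * (fst q x / (1 - t)) = t * fst q x" "t * (1 - t) * (fst q y / t) = (1 - t) * fst q y"
        using 3 by simp_all
      moreover have "0 \<le> t * (1 - t)" using 3 by simp
      ultimately show ?thesis unfolding edge_tent_def min_mult_distrib_left by (simp only: if_True)
    qed
    then have "t * (1 - t) * E = min (t * fst q x) ((1 - t) * fst q y) / weight G x y"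
      unfolding E by (metis times_divide_eq_right)
    then show ?thesis using 1 by (simp add: m_def)
  qed
qed

text \<open>Kirchhoff equation with unit source. The flux into the ray stays as a difference
  quotient, to be removed later by letting \<open>R\<close> grow.\<close>

lemma green_vertex:
  assumes y: "y \<in> verts G" and R: "R > 0" "2 * killing G y * R < 1"
    and ab: "a \<in> verts G" "b \<in> verts G" "weight G a b > 0" "0 \<le> \<theta>" "\<theta> \<le> 1"
  defines "q \<equiv> edge_point a b \<theta>"
  shows "(\<Sum>z\<in>neighbours y. weight G y z * (g (vertex_point y) q - g (vertex_point z) q)) +
      (g (vertex_point y) q - g (indicator {y}, R) q) / (2 * R) = fst q y"
proof -
  define D where "D u = (\<Sum>z\<in>neighbours y. weight G y z * (u (vertex_point y) - u (vertex_point z))) +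
      (u (vertex_point y) - u (indicator {y}, R)) / (2 * R)" for u :: "'v cable_point \<Rightarrow> real"
  have "D (\<lambda>p. g p q) = vertex_tent y R q" unfolding q_def
  proof (rule green_test[OF ab vertex_tent_form_domain[OF y R] vertex_tent_integrable[OF y R]])
    show "dirichlet_form G u (vertex_tent y R) = D u" if "u \<in> form_domain G" for u
      unfolding D_def by (rule vertex_tent_dirichlet_form[OF y R that])
    have X: "vertex_point y \<in> cable_system G" "(indicator {y}, R) \<in> cable_system G"
      using y R by (auto intro: ray_point_in vertex_point_in)
    have Xz: "vertex_point z \<in> cable_system G" if "z \<in> neighbours y" for z
      using that by (auto simp: neighbours_def intro: vertex_point_in)
    show "(\<lambda>n. D (un n)) \<longlonglongrightarrow> D u" if "\<And>p. p \<in> cable_system G \<Longrightarrow> (\<lambda>n. un n p) \<longlonglongrightarrow> u p" for un u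
      unfolding D_def using R by (intro tendsto_intros that X Xz) auto
    show "D (\<lambda>p. u p / c) = D u / c" for u c
      unfolding D_def by (simp add: add_divide_distrib sum_divide_distrib diff_divide_distrib[symmetric] mult.commute)
  qed
  moreover have "snd q = 0" by (simp add: q_def edge_point_def)
  ultimately show ?thesis by (simp add: D_def vertex_tent_def)
qed

end

subsection \<open>The weighted tree\<close>

lemma regular_tree_Cons_iff: "i # v \<in> regular_tree d \<longleftrightarrow> v \<in> regular_tree d \<and> i < (if v = [] then d + 1 else d)"
  by (auto elim: regular_tree.cases intro: regular_tree.intros)

lemma regular_tree_tl: "v \<in> regular_tree d \<Longrightarrow> tl v \<in> regular_tree d"
  by (cases v) (auto simp: regular_tree_Cons_iff regular_tree.root)

lemma tree_weight_sym: "tree_weight \<alpha> x y = tree_weight \<alpha> y x"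
  by (auto simp: tree_weight_def)

lemma tree_weight_child [simp]: "tree_weight \<alpha> x (i # x) = \<alpha> ^ length x" "tree_weight \<alpha> (i # x) x = \<alpha> ^ length x"
  by (auto simp: tree_weight_def)

lemma tree_weight_pos_iff: "0 < \<alpha> \<Longrightarrow> tree_weight \<alpha> x y > 0 \<longleftrightarrow> (\<exists>i. y = i # x) \<or> (\<exists>i. x = i # y)"
  by (auto simp: tree_weight_def)

text \<open>As the most recent label comes first, the descendants of \<open>v\<close> are the lists
  with suffix \<open>v\<close>.\<close>

definition below :: "nat list \<Rightarrow> nat list \<Rightarrow> bool" where
  "below v w \<longleftrightarrow> (\<exists>u. w = u @ v)"

lemma below_refl [simp]: "below v v" by (simp add: below_def)

lemma below_Cons: "below v w \<Longrightarrow> below v (i # w)"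
  unfolding below_def by (metis append_Cons)

lemma below_length: "below v w \<Longrightarrow> length v \<le> length w"
  by (auto simp: below_def)

lemma below_not_root: "below v w \<Longrightarrow> v \<noteq> [] \<Longrightarrow> w \<noteq> []"
  by (auto simp: below_def)

lemma below_tl: "below v w \<Longrightarrow> w \<noteq> v \<Longrightarrow> below v (tl w)"
  unfolding below_def by (metis append_self_conv2 tl_append2)

lemma not_below_tl: "v \<noteq> [] \<Longrightarrow> \<not> below v (tl v)"
  by (auto dest!: below_length) (cases v; simp)

locale weighted_tree =
  fixes \<alpha> :: real and d :: nat
  assumes \<alpha>: "0 < \<alpha>" "\<alpha> < 1" and d: "2 \<le> d"
begin

abbreviation T where "T \<equiv> tree_graph \<alpha> d"

lemma verts_T [simp]: "verts T = regular_tree d" and weight_T [simp]: "weight T = tree_weight \<alpha>"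
  and killing_T [simp]: "killing T = tree_killing \<alpha> d"
  by (simp_all add: tree_graph_def)

sublocale cable_graph T
proof
  show "weight T x y = weight T y x" for x y by (simp add: tree_weight_sym)
  show "\<not> weight T x x > 0" for x by (simp add: tree_weight_def)
  fix y assume "y \<in> verts T"
  have "{z \<in> verts T. weight T y z > 0} \<subseteq> insert (tl y) ((\<lambda>i. i # y) ` {..d})"
    using \<alpha> by (auto simp: tree_weight_pos_iff regular_tree_Cons_iff split: if_splits)
  then show "finite {z \<in> verts T. weight T y z > 0}" by (rule finite_subset) simp
qed

lemma neighbours_T:
  assumes "v \<in> regular_tree d" "v \<noteq> []"
  shows "neighbours v = insert (tl v) ((\<lambda>i. i # v) ` {..<d})"
proof
  show "neighbours v \<subseteq> insert (tl v) ((\<lambda>i. i # v) ` {..<d})"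
    using assms \<alpha> by (auto simp: neighbours_def tree_weight_pos_iff regular_tree_Cons_iff)
  show "insert (tl v) ((\<lambda>i. i # v) ` {..<d}) \<subseteq> neighbours v"
    using assms \<alpha> regular_tree_tl[OF assms(1)] by (cases v) (auto simp: neighbours_def tree_weight_pos_iff regular_tree_Cons_iff)
qed

lemma sum_neighbours_T:
  assumes v: "v \<in> regular_tree d" "v \<noteq> []"
  shows "(\<Sum>z\<in>neighbours v. weight T v z * f z) = \<alpha> ^ (length v - 1) * f (tl v) + (\<Sum>i<d. \<alpha> ^ length v * f (i # v))"
proof -
  have nin: "tl v \<notin> (\<lambda>i. i # v) ` {..<d}"
  proof
    assume "tl v \<in> (\<lambda>i. i # v) ` {..<d}"
    then obtain i where "tl v = i # v" by auto
    from arg_cong[OF this, of length] show False by simp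
  qed
  have w: "tree_weight \<alpha> v (tl v) = \<alpha> ^ (length v - 1)" using v(2) by (cases v) auto
  have inj: "inj_on (\<lambda>i. i # v) {..<d}" by (auto simp: inj_on_def)
  show ?thesis unfolding neighbours_T[OF v] using nin w by (simp add: sum.reindex[OF inj])
qed

lemma killing_nonroot: "v \<noteq> [] \<Longrightarrow> tree_killing \<alpha> d v = 0"
  by (simp add: tree_killing_def)

lemma parent_edge:
  assumes "v \<in> regular_tree d" "v \<noteq> []"
  shows "tl v \<in> verts T" "v \<in> verts T" "weight T (tl v) v > 0"
  using assms regular_tree_tl[of v d] \<alpha> by (cases v; simp)+

text \<open>Contains the edge from \<open>tl v\<close> to \<open>v\<close> without its endpoint
  \<open>tl v\<close>. Describing it by positive coordinates makes it relatively open.\<close>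

definition branch :: "nat list \<Rightarrow> nat list cable_point set" where
  "branch v = {p \<in> cable_system T. \<exists>w\<in>regular_tree d. below v w \<and> fst p w > 0}"

lemma edge_orientation:
  assumes "x \<in> verts T" "y \<in> verts T" "weight T x y > 0"
  obtains i where "y = i # x" | i where "x = i # y"
  using assms \<alpha> by (auto simp: tree_weight_pos_iff)

lemma tree_point_cases:
  assumes "p \<in> cable_system T"
  obtains v \<theta> where "v \<in> regular_tree d" "v \<noteq> []" "0 \<le> \<theta>" "\<theta> \<le> 1" "p = edge_point (tl v) v \<theta>"
  | x s where "x \<in> regular_tree d" "0 \<le> s" "p = (indicator {x}, s)"
  using assms
proof (cases rule: cable_point_cases)
  case (1 x y \<theta>)
  from 1(1-3) show ?thesis
  proof (cases rule: edge_orientation)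
    case (1 i)
    then show ?thesis using that(1)[of y \<theta>] \<open>y \<in> verts T\<close> \<open>0 \<le> \<theta>\<close> \<open>\<theta> \<le> 1\<close> \<open>p = edge_point x y \<theta>\<close> by simp
  next
    case (2 i)
    then show ?thesis using that(1)[of x "1 - \<theta>"] \<open>x \<in> verts T\<close> \<open>0 \<le> \<theta>\<close> \<open>\<theta> \<le> 1\<close> \<open>p = edge_point x y \<theta>\<close>
      by (simp add: edge_point_swap)
  qed
next
  case (2 x s)
  then show ?thesis using that(2) by simp
qed

lemma fst_edge_point: "x \<noteq> y \<Longrightarrow> fst (edge_point x y \<theta>) z = (if z = x then 1 - \<theta> else if z = y then \<theta> else 0)"
  by (simp add: edge_point_def)

lemma tl_neq: "v \<noteq> [] \<Longrightarrow> tl v \<noteq> v"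
  by (cases v) auto

lemma branch_edge_iff:
  assumes v: "v \<noteq> []" and w: "w \<in> regular_tree d" "w \<noteq> []" and \<theta>: "0 \<le> \<theta>" "\<theta> \<le> 1"
  shows "edge_point (tl w) w \<theta> \<in> branch v \<longleftrightarrow> below v w \<and> (w = v \<longrightarrow> 0 < \<theta>)"
proof -
  have X: "edge_point (tl w) w \<theta> \<in> cable_system T" using parent_edge[OF w] \<theta> by (rule edge_point_in)
  note f = fst_edge_point[OF tl_neq[OF w(2)]]
  have bt: "below v w" if "below v (tl w)"
    using below_Cons[OF that, of "hd w"] w(2) by simp
  show ?thesis
  proof
    assume "edge_point (tl w) w \<theta> \<in> branch v"
    then obtain z where z: "below v z" "fst (edge_point (tl w) w \<theta>) z > 0" by (auto simp: branch_def)
    then have "z = tl w \<or> (z = w \<and> 0 < \<theta>)" by (auto simp: f split: if_splits)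
    then show "below v w \<and> (w = v \<longrightarrow> 0 < \<theta>)" using z(1) bt not_below_tl[OF v] by auto
  next
    assume b: "below v w \<and> (w = v \<longrightarrow> 0 < \<theta>)"
    show "edge_point (tl w) w \<theta> \<in> branch v"
    proof (cases "0 < \<theta>")
      case True
      then have "fst (edge_point (tl w) w \<theta>) w > 0" using tl_neq[OF w(2)] by (simp add: f)
      then show ?thesis using X b w by (auto simp: branch_def)
    next
      case False
      then have "below v (tl w)" using b below_tl[of v w] by auto
      moreover have "fst (edge_point (tl w) w \<theta>) (tl w) > 0" using False by (simp add: f)
      ultimately show ?thesis using X regular_tree_tl[OF w(1)] by (auto simp: branch_def)
    qed
  qed
qed

lemma branch_ray_iff:
  assumes "x \<in> regular_tree d" "(indicator {x}, s) \<in> cable_system T"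
  shows "(indicator {x}, s) \<in> branch v \<longleftrightarrow> below v x"
  using assms by (auto simp: branch_def indicator_def split: if_splits)

lemma branch_open: "branch v = cable_system T \<inter> (\<Union>w\<in>{w\<in>regular_tree d. below v w}. {p. fst p w > 0})"
  "open (\<Union>w\<in>{w\<in>regular_tree d. below v w}. {p :: nat list cable_point. fst p w > 0})"
  by (auto simp: branch_def intro!: open_UN open_coord_pos)

text \<open>Without the attaching point \<open>tl v\<close> the complement is open too. Its points
  have a positive coordinate at some vertex other than \<open>tl v\<close> and outside the branch,
  except those on the ray at \<open>tl v\<close>, which the second part of \<open>U'\<close>
  covers.\<close>

lemma branch_complement:
  assumes v: "v \<in> regular_tree d" "v \<noteq> []"
  defines "U' \<equiv> (\<Union>w\<in>{w\<in>regular_tree d. \<not> below v w \<and> w \<noteq> tl v}. {p. fst p w > 0}) \<union> ({p. fst p (tl v) > 0} \<inter> {p :: nat list cable_point. snd p > 0})"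
  shows "cable_system T - branch v - {vertex_point (tl v)} = cable_system T \<inter> U'" "open U'"
proof -
  have "open {p :: nat list cable_point. snd p > 0}" by (intro open_Collect_less continuous_intros)
  then show "open U'" unfolding U'_def by (intro open_Un open_UN ballI open_Int open_coord_pos)
  have "p \<notin> branch v \<and> p \<noteq> vertex_point (tl v) \<longleftrightarrow> p \<in> U'" if p: "p \<in> cable_system T" for p
    using p
  proof (cases rule: tree_point_cases)
    case (1 w \<theta>)
    note f = fst_edge_point[OF tl_neq[OF 1(2)]]
    have eq: "edge_point (tl w) w \<theta> = vertex_point (tl v) \<longleftrightarrow> (\<theta> = 0 \<and> tl w = tl v) \<or> (\<theta> = 1 \<and> w = tl v)"
    proof
      assume e: "edge_point (tl w) w \<theta> = vertex_point (tl v)"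
      have "fst (edge_point (tl w) w \<theta>) z = (if z = tl v then 1 else 0)" for z
        unfolding e by (simp add: vertex_point_def)
      from this[of w] this[of "tl w"] this[of "tl v"] show "(\<theta> = 0 \<and> tl w = tl v) \<or> (\<theta> = 1 \<and> w = tl v)"
        using tl_neq[OF 1(2)] by (auto simp: f split: if_splits)
    qed (auto simp: edge_point_0 edge_point_1)
    have U: "edge_point (tl w) w \<theta> \<in> U' \<longleftrightarrow> (\<not> below v w \<and> w \<noteq> tl v \<and> 0 < \<theta>) \<or> (\<not> below v (tl w) \<and> tl w \<noteq> tl v \<and> \<theta> < 1)"
    proof -
      have s: "snd (edge_point (tl w) w \<theta>) = 0" by (simp add: edge_point_def)
      show ?thesis unfolding U'_def using 1 regular_tree_tl[OF 1(1)] tl_neq[OF 1(2)] s by (auto simp: f split: if_splits)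
    qed
    have c1: "below v w \<Longrightarrow> w \<noteq> v \<Longrightarrow> below v (tl w)" by (rule below_tl)
    have c2: "below v (tl w) \<Longrightarrow> below v w" using below_Cons[of v "tl w" "hd w"] 1(2) by simp
    have c3: "\<not> below v (tl v)" by (rule not_below_tl[OF v(2)])
    show ?thesis unfolding 1(5) branch_edge_iff[OF v(2) 1(1-4)] eq U
    proof (cases "below v w")
      case True
      show "(\<not> (below v w \<and> (w = v \<longrightarrow> 0 < \<theta>)) \<and> \<not> (\<theta> = 0 \<and> tl w = tl v \<or> \<theta> = 1 \<and> w = tl v)) =
        (\<not> below v w \<and> w \<noteq> tl v \<and> 0 < \<theta> \<or> \<not> below v (tl w) \<and> tl w \<noteq> tl v \<and> \<theta> < 1)"
        using True 1(3,4) c1 c3 by (cases "w = v") auto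
    next
      case False
      show "(\<not> (below v w \<and> (w = v \<longrightarrow> 0 < \<theta>)) \<and> \<not> (\<theta> = 0 \<and> tl w = tl v \<or> \<theta> = 1 \<and> w = tl v)) =
        (\<not> below v w \<and> w \<noteq> tl v \<and> 0 < \<theta> \<or> \<not> below v (tl w) \<and> tl w \<noteq> tl v \<and> \<theta> < 1)"
        using False 1(3,4) c2 tl_neq[OF 1(2)] by (cases "\<theta> = 0"; cases "\<theta> = 1"; cases "w = tl v"; cases "tl w = tl v"; auto)
    qed
  next
    case (2 x s)
    have eq: "(indicator {x} :: nat list \<Rightarrow> real, s) = vertex_point (tl v) \<longleftrightarrow> x = tl v \<and> s = 0"
    proof
      assume e: "(indicator {x} :: nat list \<Rightarrow> real, s) = vertex_point (tl v)"
      then have "(indicator {x} :: nat list \<Rightarrow> real) x = indicator {tl v} x" by (simp add: vertex_point_def)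
      then show "x = tl v \<and> s = 0" using e by (auto simp: vertex_point_def indicator_def split: if_splits)
    qed (simp add: vertex_point_def)
    have U: "(indicator {x} :: nat list \<Rightarrow> real, s) \<in> U' \<longleftrightarrow> (\<not> below v x \<and> x \<noteq> tl v) \<or> (x = tl v \<and> 0 < s)"
      unfolding U'_def using 2 by (auto simp: indicator_def split: if_splits)
    show ?thesis unfolding 2(3) branch_ray_iff[OF 2(1) p[unfolded 2(3)]] eq U
      using 2(2) not_below_tl[OF v(2)] by (cases "x = tl v"; cases "s = 0"; auto)
  qed
  then show "cable_system T - branch v - {vertex_point (tl v)} = cable_system T \<inter> U'" by blast
qed

lemma cable_point_of_edge_cable:
  assumes c: "Edge a b \<in> cables T" and t: "t \<in> cable_dom T (Edge a b)"
  obtains \<theta> where "0 \<le> \<theta>" "\<theta> \<le> 1" "cable_map T (Edge a b) t = edge_point a b \<theta>"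
proof -
  have "weight T a b > 0" using c by (auto simp: cables_def)
  then show ?thesis using t by (intro that[of "2 * weight T a b * t"]) (auto simp: cable_map_Edge field_simps simp del: cable_map.simps)
qed

lemma cables_branch:
  assumes v: "v \<in> regular_tree d" "v \<noteq> []" and c: "c \<in> cables T"
  shows "(\<forall>t\<in>cable_dom T c. cable_map T c t \<in> branch v \<union> {vertex_point (tl v)}) \<or> (\<forall>t\<in>cable_dom T c. cable_map T c t \<notin> branch v)"
proof (cases c)
  case (Ray x)
  then have "x \<in> regular_tree d" using c by (auto simp: cables_def)
  moreover have "cable_map T c t \<in> cable_system T" if "t \<in> cable_dom T c" for t using c that by (rule cable_map_in)
  ultimately show ?thesis using branch_ray_iff[of x _ v] unfolding Ray by (cases "below v x") auto
next
  case (Edge a b)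
  then have ab: "a \<in> verts T" "b \<in> verts T" "weight T a b > 0" using c by (auto simp: cables_def)
  have "\<exists>w. w \<in> regular_tree d \<and> w \<noteq> [] \<and> (\<forall>\<theta>. 0 \<le> \<theta> \<longrightarrow> \<theta> \<le> 1 \<longrightarrow> (\<exists>\<theta>'. 0 \<le> \<theta>' \<and> \<theta>' \<le> 1 \<and> edge_point a b \<theta> = edge_point (tl w) w \<theta>'))"
    using ab
  proof (cases rule: edge_orientation)
    case (1 i)
    then show ?thesis using ab by (intro exI[of _ b]) auto
  next
    case (2 i)
    then show ?thesis using ab edge_point_swap[of b a]
      by (intro exI[of _ a]) (auto intro!: exI[of _ "1 - _"] simp: edge_point_swap)
  qed
  then obtain w where w: "w \<in> regular_tree d" "w \<noteq> []"
    "\<And>\<theta>. 0 \<le> \<theta> \<Longrightarrow> \<theta> \<le> 1 \<Longrightarrow> \<exists>\<theta>'. 0 \<le> \<theta>' \<and> \<theta>' \<le> 1 \<and> edge_point a b \<theta> = edge_point (tl w) w \<theta>'" by blast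
  have pt: "\<exists>\<theta>'. 0 \<le> \<theta>' \<and> \<theta>' \<le> 1 \<and> cable_map T c t = edge_point (tl w) w \<theta>'" if "t \<in> cable_dom T c" for t
    using cable_point_of_edge_cable[of a b t] c that w(3) unfolding Edge by metis
  show ?thesis
  proof (cases "below v w")
    case True
    have "cable_map T c t \<in> branch v \<union> {vertex_point (tl v)}" if "t \<in> cable_dom T c" for t
    proof -
      obtain \<theta> where \<theta>: "0 \<le> \<theta>" "\<theta> \<le> 1" "cable_map T c t = edge_point (tl w) w \<theta>" using pt[OF \<open>t \<in> cable_dom T c\<close>] by blast
      show ?thesis
      proof (cases "w = v \<and> \<theta> = 0")
        case True then show ?thesis using \<theta> by (simp add: edge_point_0)
      next
        case False
        then show ?thesis using \<theta> True branch_edge_iff[OF v(2) w(1,2) \<theta>(1,2)] by auto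
      qed
    qed
    then show ?thesis by blast
  next
    case False
    then show ?thesis using pt branch_edge_iff[OF v(2) w(1,2)] by metis
  qed
qed

lemma edge_nbhd_branch:
  assumes v: "v \<noteq> []" and w: "w \<in> regular_tree d" "w \<noteq> []" "\<not> below v w" and \<theta>: "0 \<le> \<theta>" "\<theta> \<le> 1"
  shows "edge_nbhd (tl w) w \<theta> j \<inter> branch v = {}"
proof -
  have "p \<notin> branch v" if "p \<in> edge_nbhd (tl w) w \<theta> j" for p
  proof -
    have "p \<in> edge_point (tl w) w ` {0..1}" using edge_nbhd_subset[OF parent_edge[OF w(1,2)] \<theta>] that by blast
    then show ?thesis using branch_edge_iff[OF v w(1,2)] w(3) by auto
  qed
  then show ?thesis by blast
qed

end

subsection \<open>The Green function of the weighted tree\<close>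

locale tree_gff = weighted_tree \<alpha> d + gff_process "tree_graph \<alpha> d" P L g M
  for \<alpha> d P L g M
begin

abbreviation V where "V \<equiv> regular_tree d"

definition gv :: "nat list \<Rightarrow> nat list \<Rightarrow> real" where
  "gv x y = g (vertex_point x) (vertex_point y)"

text \<open>For the diffusion this quotient is the probability of hitting the parent from
  \<open>v\<close>.\<close>

definition hit :: "nat list \<Rightarrow> real" where
  "hit v = gv v (tl v) / gv (tl v) (tl v)"

text \<open>Variance of the field at \<open>v\<close> given its value at the parent.\<close>

definition cond_var :: "nat list \<Rightarrow> real" where
  "cond_var v = gv v v - (gv v (tl v))\<^sup>2 / gv (tl v) (tl v)"

definition lam :: "nat list \<Rightarrow> real" where
  "lam v = \<alpha> ^ (length v - 1)"

lemma lam_pos: "0 < lam v"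
  using \<alpha> by (simp add: lam_def)

lemma vertex_in: "v \<in> V \<Longrightarrow> vertex_point v \<in> cable_system T"
  by (rule vertex_point_in) simp

lemma edge_in: "w \<in> V \<Longrightarrow> w \<noteq> [] \<Longrightarrow> 0 \<le> \<theta> \<Longrightarrow> \<theta> \<le> 1 \<Longrightarrow> edge_point (tl w) w \<theta> \<in> cable_system T"
  by (rule edge_point_in[OF parent_edge])

lemma vertex_as_edge: "edge_point (tl v) v 1 = vertex_point v"
  by (rule edge_point_1)

lemma gv_sym: "x \<in> V \<Longrightarrow> y \<in> V \<Longrightarrow> gv x y = gv y x"
  unfolding gv_def by (rule green_sym[OF vertex_in vertex_in])

lemma gv_nonneg: "x \<in> V \<Longrightarrow> y \<in> V \<Longrightarrow> 0 \<le> gv x y"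
  unfolding gv_def by (rule green_nonneg[OF vertex_in vertex_in])

text \<open>The second source is put at the attaching vertex \<open>tl v\<close> itself, approached
  along the edge above it. That edge exists because \<open>tl v\<close> is not the root, and it lies
  outside the branch.\<close>

lemma branch_separation:
  assumes v: "v \<in> V" "v \<noteq> []" "tl v \<noteq> []" and p: "p \<in> branch v"
    and w: "w \<in> V" "w \<noteq> []" "\<not> below v w" and \<theta>: "0 \<le> \<theta>" "\<theta> \<le> 1"
  shows "gv (tl v) (tl v) * g p (edge_point (tl w) w \<theta>) = g (vertex_point (tl v)) (edge_point (tl w) w \<theta>) * g p (vertex_point (tl v))"
proof -
  have x: "tl v \<in> V" using v(1) by (rule regular_tree_tl)
  have nb: "\<not> below v (tl v)" by (rule not_below_tl[OF v(2)])
  have y: "vertex_point (tl v) \<notin> branch v"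
    using branch_edge_iff[OF v(2) x v(3), of 1] nb by (simp add: vertex_as_edge)
  have "g (vertex_point (tl v)) (edge_point (tl (tl v)) (tl v) 1) * g p (edge_point (tl w) w \<theta>) =
    g (vertex_point (tl v)) (edge_point (tl w) w \<theta>) * g p (edge_point (tl (tl v)) (tl v) 1)"
    by (rule green_separation[OF branch_open branch_complement[OF v(1,2)] vertex_in[OF x] y cables_branch[OF v(1,2)]
          parent_edge[OF w(1,2)] \<theta> parent_edge[OF x v(3)] _ _ edge_nbhd_branch[OF v(2) w \<theta>] edge_nbhd_branch[OF v(2) x v(3) nb] p]) auto
  then show ?thesis by (simp add: vertex_as_edge gv_def)
qed

text \<open>The open ray at \<open>v\<close> plays the part of the branch, so the Green function on
  the ray is a multiple of its value at \<open>v\<close>, with a factor that does not depend on the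
  source.\<close>

lemma ray_separation:
  assumes v: "v \<in> V" "v \<noteq> []" and R: "0 < R"
    and w: "w \<in> V" "w \<noteq> []" and \<theta>: "0 \<le> \<theta>" "\<theta> \<le> 1"
  shows "gv v v * g (indicator {v}, R) (edge_point (tl w) w \<theta>) = g (vertex_point v) (edge_point (tl w) w \<theta>) * g (indicator {v}, R) (vertex_point v)"
proof -
  define U where "U = {p :: nat list cable_point. fst p v > 0} \<inter> {p. snd p > 0}"
  define U' where "U' = (\<Union>w\<in>V - {v}. {p :: nat list cable_point. fst p w > 0})"
  define Br where "Br = cable_system T \<inter> U"
  have op: "open U" "open U'"
    unfolding U_def U'_def by (auto intro!: open_Int open_UN open_coord_pos open_Collect_less continuous_intros)
  have "p \<notin> Br \<and> p \<noteq> vertex_point v \<longleftrightarrow> p \<in> U'" if p: "p \<in> cable_system T" for p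
    using p
  proof (cases rule: tree_point_cases)
    case (1 w \<theta>)
    note f = fst_edge_point[OF tl_neq[OF 1(2)]]
    have "p \<notin> Br" by (simp add: 1(5) Br_def U_def edge_point_def)
    moreover have "p = vertex_point v \<longleftrightarrow> p \<notin> U'"
    proof
      assume "p = vertex_point v"
      then show "p \<notin> U'" by (auto simp: U'_def vertex_point_def indicator_def split: if_splits)
    next
      assume "p \<notin> U'"
      then have z: "fst p z \<le> 0" if "z \<in> V" "z \<noteq> v" for z using that by (auto simp: U'_def not_less)
      have "w = v \<or> \<theta> = 0" using z[of w] 1 f[of \<theta> w] tl_neq[OF 1(2)] by auto
      moreover have "tl w = v \<or> \<theta> = 1" using z[of "tl w"] 1 f[of \<theta> "tl w"] regular_tree_tl[OF 1(1)] by auto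
      ultimately show "p = vertex_point v"
        using 1(5) tl_neq[OF 1(2)] by (auto simp: edge_point_0 edge_point_1)
    qed
    ultimately show ?thesis by auto
  next
    case (2 x s)
    have "p = vertex_point v \<longleftrightarrow> x = v \<and> s = 0"
    proof
      assume e: "p = vertex_point v"
      then have "fst p x = indicator {v} x" by (simp add: vertex_point_def)
      then have "x = v" using 2(3) by (simp add: indicator_def split: if_splits)
      moreover have "s = 0" using e 2(3) by (simp add: vertex_point_def)
      ultimately show "x = v \<and> s = 0" by simp
    qed (simp add: 2 vertex_point_def)
    moreover have "p \<in> Br \<longleftrightarrow> x = v \<and> 0 < s"
      using p unfolding 2(3) Br_def U_def by (auto simp: indicator_def split: if_splits)
    moreover have "p \<in> U' \<longleftrightarrow> x \<noteq> v"
      using 2(1) unfolding 2(3) U'_def by (auto simp: indicator_def split: if_splits)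
    ultimately show ?thesis using 2(2) by auto
  qed
  then have Out: "cable_system T - Br - {vertex_point v} = cable_system T \<inter> U'" by blast
  have y: "vertex_point v \<notin> Br" by (simp add: Br_def U_def vertex_point_def)
  have cab: "(\<forall>t\<in>cable_dom T c. cable_map T c t \<in> Br \<union> {vertex_point v}) \<or> (\<forall>t\<in>cable_dom T c. cable_map T c t \<notin> Br)"
    if c: "c \<in> cables T" for c
  proof (cases "c = Ray v")
    case True
    have "cable_map T c t \<in> Br \<union> {vertex_point v}" if t: "t \<in> cable_dom T c" for t
    proof (cases "t = 0")
      case True then show ?thesis using \<open>c = Ray v\<close> by (simp add: vertex_point_def)
    next
      case False
      then have "t > 0" using t \<open>c = Ray v\<close> by auto
      then show ?thesis using cable_map_in[OF c t] \<open>c = Ray v\<close> by (simp add: Br_def U_def)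
    qed
    then show ?thesis by blast
  next
    case False
    have "cable_map T c t \<notin> Br" for t
      using False by (cases c) (auto simp: Br_def U_def indicator_def split: if_splits)
    then show ?thesis by blast
  qed
  have nb: "edge_nbhd (tl w) w \<theta> j \<inter> Br = {}" if w: "w \<in> V" "w \<noteq> []" and \<theta>: "0 \<le> \<theta>" "\<theta> \<le> 1" for w \<theta> j
  proof -
    have "p \<notin> Br" if "p \<in> edge_nbhd (tl w) w \<theta> j" for p
      using edge_nbhd_subset[OF parent_edge[OF w] \<theta>, of j] that by (auto simp: Br_def U_def edge_point_def)
    then show ?thesis by blast
  qed
  have ray: "(indicator {v}, R) \<in> cable_system T"
    using v R by (intro ray_point_in) (auto simp: killing_nonroot)
  then have p: "(indicator {v}, R) \<in> Br" using R by (simp add: Br_def U_def)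
  have "g (vertex_point v) (edge_point (tl v) v 1) * g (indicator {v}, R) (edge_point (tl w) w \<theta>) =
    g (vertex_point v) (edge_point (tl w) w \<theta>) * g (indicator {v}, R) (edge_point (tl v) v 1)"
    by (rule green_separation[OF Br_def op(1) Out op(2) vertex_in[OF v(1)] y cab parent_edge[OF w] \<theta> parent_edge[OF v]
      _ _ nb[OF w \<theta>] nb[OF v] p]) auto
  then show ?thesis by (simp add: vertex_as_edge gv_def)
qed

lemma vertex_equation:
  assumes v: "v \<in> V" "v \<noteq> []" and R: "0 < R" and w: "w \<in> V" "w \<noteq> []"
  shows "lam v * (gv v w - gv (tl v) w) + (\<Sum>i<d. \<alpha> ^ length v * (gv v w - gv (i # v) w))
    + (gv v w - g (indicator {v}, R) (vertex_point w)) / (2 * R) = (if w = v then 1 else 0)"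
proof -
  have "(\<Sum>z\<in>neighbours v. weight T v z * (g (vertex_point v) (edge_point (tl w) w 1) - g (vertex_point z) (edge_point (tl w) w 1))) +
      (g (vertex_point v) (edge_point (tl w) w 1) - g (indicator {v}, R) (edge_point (tl w) w 1)) / (2 * R) = fst (edge_point (tl w) w 1) v"
    using v R by (intro green_vertex parent_edge[OF w]) (auto simp: killing_nonroot)
  then show ?thesis
    unfolding vertex_as_edge sum_neighbours_T[OF v] gv_def[symmetric] lam_def[symmetric]
    by (simp add: vertex_point_def indicator_def)
qed

text \<open>If \<open>gv v v\<close> were 0, every term on the left of the Kirchhoff equation with
  source at \<open>v\<close> would be at most 0, while the right side is 1.\<close>

lemma gv_pos: assumes v: "v \<in> V" "v \<noteq> []" shows "0 < gv v v"
proof (rule ccontr)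
  assume "\<not> 0 < gv v v"
  then have z: "gv v v = 0" using gv_nonneg[OF v(1) v(1)] by simp
  have ch: "i # v \<in> V" if "i < d" for i using v that by (simp add: regular_tree_Cons_iff)
  have ray: "(indicator {v}, 1) \<in> cable_system T"
    using v by (intro ray_point_in) (auto simp: killing_nonroot)
  have "0 \<le> lam v * gv (tl v) v" using lam_pos[of v] gv_nonneg[OF regular_tree_tl[OF v(1)] v(1)] by simp
  moreover have "0 \<le> (\<Sum>i<d. \<alpha> ^ length v * gv (i # v) v)"
    using \<alpha> gv_nonneg[OF ch v(1)] by (intro sum_nonneg mult_nonneg_nonneg) auto
  moreover have "0 \<le> g (indicator {v}, 1) (vertex_point v)" by (rule green_nonneg[OF ray vertex_in[OF v(1)]])
  ultimately show False
    using vertex_equation[OF v _ v, of 1] z by (simp add: sum_negf)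
qed

lemma gv_Cauchy_Schwarz: "x \<in> V \<Longrightarrow> y \<in> V \<Longrightarrow> (gv x y)\<^sup>2 \<le> gv x x * gv y y"
  unfolding gv_def by (rule green_Cauchy_Schwarz[OF vertex_in vertex_in])

text \<open>The maximum principle applies to the strict descendants of \<open>x\<close>, with the
  generation as rank: the parent of such a vertex is again one, or \<open>x\<close> itself.\<close>

lemma gv_le:
  assumes x: "x \<in> V" "x \<noteq> []" and w: "w \<in> V" "below x w"
  shows "gv w x \<le> gv x x"
proof (cases "w = x")
  case False
  define S where "S = {w \<in> V. below x w \<and> w \<noteq> x}"
  have Sne: "v \<noteq> []" if "v \<in> S" for v using that below_not_root x(2) by (auto simp: S_def)
  have Stl: "tl v = x \<or> tl v \<in> S" if "v \<in> S" for v
    using that below_tl[of x v] regular_tree_tl[of v d] by (auto simp: S_def)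
  have "g (vertex_point w) (edge_point (tl x) x 1) \<le> g (vertex_point x) (edge_point (tl x) x 1)"
  proof (rule green_maximum_principle[where S = S and rank = length])
    show "tl x \<in> verts T" "x \<in> verts T" "0 < weight T (tl x) x" using parent_edge[OF x] by auto
    then show "x \<in> verts T" by simp
    show "S \<subseteq> verts T" by (auto simp: S_def)
    show "killing T v = 0" if "v \<in> S" for v using Sne[OF that] by (simp add: killing_nonroot)
    show "neighbours v \<subseteq> insert x S" if v: "v \<in> S" for v
    proof -
      have vV: "v \<in> V" using v by (simp add: S_def)
      have "i # v \<in> S" if "i < d" for i
      proof -
        have "length x \<le> length v" using v below_length by (auto simp: S_def)
        then have "i # v \<noteq> x" by auto
        then show ?thesis using v that Sne[OF v] below_Cons[of x v i] by (simp add: S_def regular_tree_Cons_iff)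
      qed
      then show ?thesis using Stl[OF v] unfolding neighbours_T[OF vV Sne[OF v]] by auto
    qed
    show "\<exists>z\<in>neighbours v. z = x \<or> length z < length v" if v: "v \<in> S" for v
    proof -
      have vV: "v \<in> V" using v by (simp add: S_def)
      show ?thesis unfolding neighbours_T[OF vV Sne[OF v]] using Sne[OF v] by auto
    qed
    show "fst p v = 0" if v: "v \<in> S" and p: "p \<in> edge_nbhd (tl x) x 1 j" for v p j
    proof -
      obtain \<theta> where "p = edge_point (tl x) x \<theta>"
        using edge_nbhd_subset[OF parent_edge[OF x], of 1 j] p by auto
      moreover have "v \<noteq> x" "v \<noteq> tl x" using v not_below_tl[OF x(2)] by (auto simp: S_def)
      ultimately show ?thesis using fst_edge_point[OF tl_neq[OF x(2)]] by simp
    qed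
    show "w \<in> S" using w False by (simp add: S_def)
  qed auto
  then show ?thesis by (simp add: vertex_as_edge gv_def)
qed simp

section \<open>Conditional variance and hitting probability at one vertex\<close>

context
  fixes v assumes v: "v \<in> V" "tl v \<noteq> []"
begin

lemma v_facts: "v \<noteq> []" "tl v \<in> V" "\<not> below v (tl v)"
proof -
  show ne: "v \<noteq> []" using v(2) by auto
  show "tl v \<in> V" using v(1) by (rule regular_tree_tl)
  show "\<not> below v (tl v)" by (rule not_below_tl[OF ne])
qed

lemma v_branch: "vertex_point v \<in> branch v"
  using branch_edge_iff[OF v_facts(1) v(1) v_facts(1), of 1] by (simp add: vertex_as_edge)

text \<open>By separation the values at the children and on the ray are multiples of the value at
  \<open>v\<close>, so the Kirchhoff equation at \<open>v\<close> is a single linear equation in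
  which \<open>D\<close> is the conductance leading away from the parent. Dropping the nonnegative
  return factors \<open>hi\<close> and \<open>hR\<close> bounds \<open>D\<close> from above.\<close>

lemma cond_var_eq:
  assumes R: "0 < R"
  obtains D where "D \<le> real d * \<alpha> * lam v + 1 / (2 * R)" "cond_var v * (lam v + D) = 1" "hit v * (lam v + D) = lam v"
proof -
  let ?x = "tl v"
  note vv = v_facts
  have pos: "0 < gv v v" "0 < gv ?x ?x" using gv_pos v vv by auto
  have ch: "i # v \<in> V" if "i < d" for i using v vv that by (simp add: regular_tree_Cons_iff)
  have ray: "(indicator {v}, R) \<in> cable_system T"
    using v vv R by (intro ray_point_in) (auto simp: killing_nonroot)
  define hi where "hi i = gv (i # v) v / gv v v" for i
  define hR where "hR = g (indicator {v}, R) (vertex_point v) / gv v v"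
  have hi0: "0 \<le> hi i" if "i < d" for i using gv_nonneg[OF ch[OF that] v(1)] pos by (simp add: hi_def)
  have hR0: "0 \<le> hR" using green_nonneg[OF ray vertex_in[OF v(1)]] pos by (simp add: hR_def)
  have sep: "gv (i # v) w = hi i * gv v w" if i: "i < d" and w: "w = v \<or> w = ?x" for i w
  proof -
    have nb: "\<not> below (i # v) w" using w below_length[of "i # v" w] by auto
    have b: "vertex_point (i # v) \<in> branch (i # v)"
      using branch_edge_iff[of "i # v" "i # v" 1] ch[OF i] vertex_as_edge[of "i # v"] by simp
    have "gv v v * gv (i # v) w = gv v w * gv (i # v) v"
      using branch_separation[OF ch[OF i] _ _ b, of w 1] w v vv nb vertex_as_edge[of w] by (auto simp: gv_def)
    then show ?thesis using pos by (simp add: hi_def field_simps)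
  qed
  have sepR: "g (indicator {v}, R) (vertex_point w) = hR * gv v w" if w: "w = v \<or> w = ?x" for w
  proof -
    have "gv v v * g (indicator {v}, R) (vertex_point w) = gv v w * g (indicator {v}, R) (vertex_point v)"
      using ray_separation[OF v(1) vv(1) R, of w 1] w v vv vertex_as_edge[of w] by (auto simp: gv_def)
    then show ?thesis using pos by (simp add: hR_def field_simps)
  qed
  define D where "D = (\<Sum>i<d. \<alpha> ^ length v * (1 - hi i)) + (1 - hR) / (2 * R)"
  have len: "\<alpha> ^ length v = \<alpha> * lam v" using vv(1) by (cases v) (auto simp: lam_def)
  \<comment> \<open>The same \<open>D\<close> serves for both sources \<open>v\<close> and
    \<open>tl v\<close>, so \<open>cond_var\<close> can be found by elimination.\<close>
  have eq: "gv v w * (lam v + D) = lam v * gv ?x w + (if w = v then 1 else 0)" if w: "w = v \<or> w = ?x" for w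
  proof -
    have wV: "w \<in> V" "w \<noteq> []" using w v vv by auto
    have s: "(\<Sum>i<d. \<alpha> ^ length v * (gv v w - gv (i # v) w)) = gv v w * (\<Sum>i<d. \<alpha> ^ length v * (1 - hi i))"
      unfolding sum_distrib_left by (intro sum.cong refl) (simp add: sep[OF _ w] algebra_simps)
    have r: "(gv v w - g (indicator {v}, R) (vertex_point w)) / (2 * R) = gv v w * ((1 - hR) / (2 * R))"
      by (simp add: sepR[OF w] algebra_simps)
    have "lam v * (gv v w - gv ?x w) + gv v w * D = (if w = v then 1 else 0)"
      using vertex_equation[OF v(1) vv(1) R wV] unfolding s r D_def distrib_left by (simp only: add.assoc)
    then show ?thesis by (simp add: algebra_simps)
  qed
  have e1: "gv v v * (lam v + D) = lam v * gv v ?x + 1" using eq[of v] gv_sym[OF vv(2) v(1)] by simp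
  have e2: "gv v ?x * (lam v + D) = lam v * gv ?x ?x" using eq[of ?x] tl_neq[OF vv(1)] by simp
  show ?thesis
  proof (rule that[of D])
    have "(\<Sum>i<d. \<alpha> ^ length v * (1 - hi i)) \<le> (\<Sum>i<d. \<alpha> ^ length v)"
      using hi0 \<alpha> by (intro sum_mono) (simp add: mult_left_le)
    moreover have "(1 - hR) / (2 * R) \<le> 1 / (2 * R)" using hR0 R by (intro divide_right_mono) auto
    ultimately show "D \<le> real d * \<alpha> * lam v + 1 / (2 * R)" by (simp add: D_def len)
    show "hit v * (lam v + D) = lam v" using e2 pos by (simp add: hit_def)
    have "cond_var v * (lam v + D) = gv v v * (lam v + D) - gv v ?x * (gv v ?x * (lam v + D)) / gv ?x ?x"
      by (simp add: cond_var_def left_diff_distrib power2_eq_square)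
    also have "\<dots> = 1" unfolding e1 e2 using pos by simp
    finally show "cond_var v * (lam v + D) = 1" .
  qed
qed

lemma cond_var_nonneg: "0 \<le> cond_var v"
proof -
  have pos: "0 < gv (tl v) (tl v)" using gv_pos v v_facts by auto
  have "(gv v (tl v))\<^sup>2 / gv (tl v) (tl v) \<le> gv v v"
    using gv_Cauchy_Schwarz[OF v(1) v_facts(2)] pos by (simp add: divide_le_eq)
  then show ?thesis by (simp add: cond_var_def)
qed

text \<open>The ray contributes at most \<open>1 / (2 * R)\<close> to the conductance and
  \<open>R\<close> is arbitrary, because vertices other than the root are not killed.\<close>

lemma cond_var_ge: "1 \<le> cond_var v * (lam v * (1 + real d * \<alpha>))"
proof (rule ccontr)
  assume "\<not> 1 \<le> cond_var v * (lam v * (1 + real d * \<alpha>))"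
  then have gap: "0 < 1 - cond_var v * (lam v * (1 + real d * \<alpha>))" by simp
  define e where "e = 1 - cond_var v * (lam v * (1 + real d * \<alpha>))"
  \<comment> \<open>Makes the ray contribution \<open>cond_var v / (2 * R)\<close> smaller than the
    supposed gap \<open>e\<close>; the summand 1 keeps \<open>R\<close> positive.\<close>
  define R where "R = (cond_var v + 1) / e"
  have R: "0 < R" using gap cond_var_nonneg by (simp add: R_def e_def)
  obtain D where D: "D \<le> real d * \<alpha> * lam v + 1 / (2 * R)" "cond_var v * (lam v + D) = 1"
    using cond_var_eq[OF R] by metis
  have "1 = cond_var v * (lam v + D)" using D(2) by simp
  also have "\<dots> \<le> cond_var v * (lam v + (real d * \<alpha> * lam v + 1 / (2 * R)))"
    using D(1) cond_var_nonneg by (intro mult_left_mono) auto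
  finally have "e \<le> cond_var v * (1 / (2 * R))" by (simp add: e_def algebra_simps)
  also have "\<dots> = e * (cond_var v / (2 * (cond_var v + 1)))" using gap by (simp add: R_def e_def[symmetric])
  also have "\<dots> < e * 1"
    using gap cond_var_nonneg by (intro mult_strict_left_mono) (auto simp: e_def[symmetric])
  finally show False by simp
qed

lemma hit_eq: "hit v = lam v * cond_var v"
proof -
  obtain D where D: "cond_var v * (lam v + D) = 1" "hit v * (lam v + D) = lam v"
    using cond_var_eq[of 1] by auto
  then have "lam v + D \<noteq> 0" by auto
  then have "cond_var v = 1 / (lam v + D)" "hit v = lam v / (lam v + D)" using D by (simp_all add: eq_divide_eq)
  then show ?thesis by simp
qed

lemma hit_ge: "1 / (1 + real d * \<alpha>) \<le> hit v"
proof -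
  have "0 < 1 + real d * \<alpha>" using \<alpha> by (intro add_pos_nonneg) auto
  moreover have "1 \<le> hit v * (1 + real d * \<alpha>)" using cond_var_ge by (simp add: hit_eq mult.assoc mult.commute mult.left_commute)
  ultimately show ?thesis by (simp add: divide_le_eq)
qed

lemma hit_pos: "0 < hit v"
proof -
  have "0 < 1 / (1 + real d * \<alpha>)" using \<alpha> by (intro divide_pos_pos add_pos_nonneg) auto
  then show ?thesis using hit_ge by linarith
qed

lemma hit_le_1: "hit v \<le> 1"
proof -
  have "below (tl v) v" using below_Cons[of "tl v" "tl v" "hd v"] v_facts(1) by simp
  then have "gv v (tl v) \<le> gv (tl v) (tl v)" using gv_le v v_facts by blast
  moreover have "0 < gv (tl v) (tl v)" using gv_pos v v_facts by auto
  ultimately show ?thesis by (simp add: hit_def)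
qed

text \<open>Interpolates linearly between 1 at the parent and \<open>hit v\<close> at
  \<open>v\<close>: the probability of hitting the parent from a point of the edge.\<close>

definition hprof :: "real \<Rightarrow> real" where
  "hprof \<theta> = 1 - \<theta> + \<theta> * hit v"

lemma hprof_ge: "0 \<le> \<theta> \<Longrightarrow> \<theta> \<le> 1 \<Longrightarrow> hit v \<le> hprof \<theta>"
  using mult_left_mono[OF hit_le_1, of "1 - \<theta>"] by (simp add: hprof_def algebra_simps)

lemma hprof_pos: "0 \<le> \<theta> \<Longrightarrow> \<theta> \<le> 1 \<Longrightarrow> 0 < hprof \<theta>"
  using hprof_ge hit_pos by fastforce

text \<open>A point outside the branch has coordinate 0 at \<open>v\<close>, so the kink term of
  \<open>green_edge\<close> vanishes and only the linear interpolation remains.\<close>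

lemma green_edge_out:
  assumes \<theta>: "0 \<le> \<theta>" "\<theta> \<le> 1" and w: "w \<in> V" "w \<noteq> []" "\<not> below v w" and s: "0 \<le> s" "s \<le> 1"
  shows "g (edge_point (tl v) v \<theta>) (edge_point (tl w) w s) = hprof \<theta> * g (vertex_point (tl v)) (edge_point (tl w) w s)"
proof -
  let ?q = "edge_point (tl w) w s"
  have pos: "0 < gv (tl v) (tl v)" using gv_pos v v_facts by auto
  have "w \<noteq> v" "tl w \<noteq> v" using w below_Cons[of v "tl w" "hd w"] by auto
  then have q0: "fst ?q v = 0" using fst_edge_point[OF tl_neq[OF w(2)]] by simp
  have "0 \<le> fst ?q (tl v)" by (rule coord_nonneg[OF edge_in[OF w(1,2) s]])
  then have kink: "min (\<theta> * fst ?q (tl v)) ((1 - \<theta>) * fst ?q v) = 0" using \<theta> by (simp add: q0)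
  have "gv (tl v) (tl v) * g (vertex_point v) ?q = g (vertex_point (tl v)) ?q * gv v (tl v)"
    using branch_separation[OF v(1) v_facts(1) v(2) v_branch w s] by (simp add: gv_def)
  then have "g (vertex_point v) ?q = hit v * g (vertex_point (tl v)) ?q"
    using pos by (simp add: hit_def field_simps)
  then show ?thesis
    using green_edge[OF parent_edge[OF v(1) v_facts(1)] \<theta> parent_edge[OF w(1,2)] s] kink
    by (simp add: hprof_def algebra_simps)
qed

text \<open>Divided by \<open>hprof v \<theta> * hprof v s\<close> this depends on the smaller
  parameter alone, as for a time-changed Brownian motion. Hence the increments of the normalised
  field are orthogonal.\<close>

lemma green_edge_edge:
  assumes \<theta>: "0 \<le> \<theta>" "\<theta> \<le> s" "s \<le> 1"
  shows "g (edge_point (tl v) v \<theta>) (edge_point (tl v) v s) = hprof \<theta> * hprof s * gv (tl v) (tl v) + \<theta> / lam v * hprof s"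
proof -
  let ?x = "tl v"
  let ?q = "edge_point ?x v s"
  have s: "0 \<le> s" "s \<le> 1" and \<theta>1: "\<theta> \<le> 1" using \<theta> by auto
  note vv = v_facts
  have pos: "0 < gv ?x ?x" using gv_pos v vv by auto
  have qX: "?q \<in> cable_system T" by (rule edge_in[OF v(1) vv(1) s])
  have qx: "g ?q (vertex_point ?x) = hprof s * gv ?x ?x"
    using green_edge_out[OF s vv(2) v(2) vv(3), of 1] by (simp add: vertex_as_edge gv_def)
  then have xq: "g (vertex_point ?x) ?q = hprof s * gv ?x ?x"
    using green_sym[OF qX vertex_in[OF vv(2)]] by simp
  have w: "weight T ?x v = lam v" using vv(1) by (cases v) (auto simp: lam_def)
  have f: "fst (vertex_point v) ?x = (0::real)" "fst ?q ?x = 1 - s" "fst ?q v = s"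
    using tl_neq[OF vv(1)] fst_edge_point[OF tl_neq[OF vv(1)]] by (auto simp: vertex_point_def)
  have "g ?q (vertex_point v) = (1 - s) * gv ?x v + s * gv v v"
    using green_edge[OF parent_edge[OF v(1) vv(1)] s parent_edge[OF v(1) vv(1)], of 1] s f(1)
    by (simp add: vertex_as_edge gv_def vertex_point_def min_def)
  then have vq: "g (vertex_point v) ?q = (1 - s) * gv v ?x + s * gv v v"
    using green_sym[OF qX vertex_in[OF v(1)]] gv_sym[OF vv(2) v(1)] by simp
  have g1: "gv v ?x = hit v * gv ?x ?x" using pos by (simp add: hit_def)
  have g2: "gv v v = cond_var v + (hit v)\<^sup>2 * gv ?x ?x" using pos by (simp add: cond_var_def hit_def power2_eq_square)
  have mn: "min (\<theta> * fst ?q ?x) ((1 - \<theta>) * fst ?q v) = \<theta> * (1 - s)"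
    unfolding f using \<theta> by (simp add: min_def algebra_simps)
  have h: "lam v * cond_var v = hit v" by (simp add: hit_eq)
  have "g (edge_point ?x v \<theta>) ?q = (1 - \<theta>) * (hprof s * gv ?x ?x) + \<theta> * ((1 - s) * (hit v * gv ?x ?x) + s * (cond_var v + (hit v)\<^sup>2 * gv ?x ?x)) + \<theta> * (1 - s) / lam v"
    using green_edge[OF parent_edge[OF v(1) vv(1)] \<theta>(1) \<theta>1 parent_edge[OF v(1) vv(1)] s]
    unfolding mn w xq vq g1 g2 .
  also have "\<dots> = (1 - \<theta>) * (hprof s * gv ?x ?x) + \<theta> * hit v * hprof s * gv ?x ?x + \<theta> * (s * cond_var v + (1 - s) / lam v)"
    by (simp add: hprof_def power2_eq_square algebra_simps)
  also have "s * cond_var v + (1 - s) / lam v = hprof s / lam v"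
    using lam_pos[of v] h by (simp add: hprof_def field_simps)
  finally have "g (edge_point ?x v \<theta>) ?q = (1 - \<theta> + \<theta> * hit v) * hprof s * gv ?x ?x + \<theta> / lam v * hprof s"
    by (simp add: algebra_simps)
  then show ?thesis by (simp only: hprof_def)
qed

end

end

subsection \<open>Open edges\<close>

lemma below_trans: "below u v \<Longrightarrow> below v w \<Longrightarrow> below u w"
  by (auto simp: below_def)

lemma below_antisym: "below u v \<Longrightarrow> below v u \<Longrightarrow> u = v"
  by (auto simp: below_def)

lemma below_linear: "below u w \<Longrightarrow> below v w \<Longrightarrow> below u v \<or> below v u"
  by (auto simp: below_def append_eq_append_conv2)

lemma descendants_below: "w \<in> descendants d L v \<Longrightarrow> below v w"
  by (auto simp: descendants_def below_def)

lemma descendants_in_tree: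
  assumes "v \<in> regular_tree d" "v \<noteq> []" shows "descendants d L v \<subseteq> regular_tree d"
proof -
  have "u @ v \<in> regular_tree d" if "set u \<subseteq> {..<d}" for u
    using that by (induction u) (use assms in \<open>auto simp: regular_tree_Cons_iff\<close>)
  then show ?thesis by (auto simp: descendants_def)
qed

context gff_process
begin

lemma field_combinations_gaussian:
  assumes I: "finite I" and pq: "\<And>i. i \<in> I \<Longrightarrow> p i \<in> cable_system G" "\<And>i. i \<in> I \<Longrightarrow> q i \<in> cable_system G"
    and X: "\<And>i \<phi>. i \<in> I \<Longrightarrow> X i \<phi> = c i * \<phi> (p i) + e i * \<phi> (q i)"
  shows "centered_gaussian M (\<lambda>\<phi>. \<Sum>i\<in>I. a i * X i \<phi>)"
proof -
  define F where "F = p ` I \<union> q ` I"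
  have F: "finite F" "F \<subseteq> cable_system G" using I pq by (auto simp: F_def)
  \<comment> \<open>The points \<open>p i\<close> and \<open>q i\<close> may coincide for different
    \<open>i\<close>; \<open>b r\<close> collects all coefficients belonging to the point
    \<open>r\<close>.\<close>
  define b where "b r = (\<Sum>i\<in>I. a i * ((if r = p i then c i else 0) + (if r = q i then e i else 0)))" for r
  have "(\<Sum>i\<in>I. a i * X i \<phi>) = (\<Sum>r\<in>F. b r * \<phi> r)" for \<phi>
  proof -
    have "(\<Sum>r\<in>F. b r * \<phi> r) = (\<Sum>i\<in>I. \<Sum>r\<in>F. a i * ((if r = p i then c i else 0) + (if r = q i then e i else 0)) * \<phi> r)"
      unfolding b_def sum_distrib_right by (rule sum.swap)
    also have "\<dots> = (\<Sum>i\<in>I. a i * X i \<phi>)"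
    proof (rule sum.cong[OF refl])
      fix i assume i: "i \<in> I"
      have "(\<Sum>r\<in>F. a i * ((if r = p i then c i else 0) + (if r = q i then e i else 0)) * \<phi> r) =
        (\<Sum>r\<in>F. (if r = p i then a i * c i * \<phi> r else 0) + (if r = q i then a i * e i * \<phi> r else 0))"
        by (intro sum.cong refl) (auto simp: algebra_simps)
      also have "\<dots> = a i * c i * \<phi> (p i) + a i * e i * \<phi> (q i)"
        using F(1) i by (simp add: sum.distrib F_def)
      finally show "(\<Sum>r\<in>F. a i * ((if r = p i then c i else 0) + (if r = q i then e i else 0)) * \<phi> r) = a i * X i \<phi>"
        by (simp add: X[OF i] algebra_simps)
    qed
    finally show ?thesis by simp
  qed
  then show ?thesis using gaussian_M[OF F, of b] by simp
qed

lemma field_combination_covariance: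
  assumes "p \<in> cable_system G" "q \<in> cable_system G" "r \<in> cable_system G" "s \<in> cable_system G"
  shows "(LINT \<phi>|M. (a * \<phi> p + b * \<phi> q) * (c * \<phi> r + e * \<phi> s)) =
    c * (a * g p r + b * g q r) + e * (a * g p s + b * g q s)"
proof -
  have "(LINT \<phi>|M. (a * \<phi> p + b * \<phi> q) * (c * \<phi> r + e * \<phi> s)) =
    (LINT \<phi>|M. (c * a) * (\<phi> p * \<phi> r) + (c * b) * (\<phi> q * \<phi> r) + (e * a) * (\<phi> p * \<phi> s) + (e * b) * (\<phi> q * \<phi> s))"
    by (intro Bochner_Integration.integral_cong refl) (simp add: algebra_simps)
  also have "\<dots> = c * a * g p r + c * b * g q r + e * a * g p s + e * b * g q s"
    using assms by (simp add: field_product_integrable covariance_M)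
  finally show ?thesis by (simp add: algebra_simps)
qed

end

context tree_gff
begin

text \<open>
  The edges at the root are left out: the root may be killed and has \<open>d + 1\<close> children.
\<close>

definition deep :: "nat list \<Rightarrow> bool" where
  "deep v \<longleftrightarrow> v \<in> V \<and> tl v \<noteq> []"

lemma deepD: assumes "deep v" shows "v \<in> V" "tl v \<noteq> []" "v \<noteq> []" "tl v \<in> V"
  using assms v_facts[of v] by (auto simp: deep_def)

text \<open>
  The quantity \<open>b\<^sub>v\<close>; \<open>lam v\<close> is the weight of the edge from \<open>v\<close> to its parent.
\<close>

definition threshold :: "nat list \<Rightarrow> real" where
  "threshold v = 1 / sqrt (lam v * (1 + real d * \<alpha>))"

lemma d\<alpha>_pos: "0 < 1 + real d * \<alpha>"
  using \<alpha> by (intro add_pos_nonneg) auto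

lemma threshold_pos: "0 < threshold v"
  using lam_pos[of v] d\<alpha>_pos by (simp add: threshold_def)

lemma threshold_sq: "(threshold v)\<^sup>2 = 1 / (lam v * (1 + real d * \<alpha>))"
  using lam_pos[of v] d\<alpha>_pos by (simp add: threshold_def power_divide)

lemma lam_tl: "deep v \<Longrightarrow> lam v = \<alpha> * lam (tl v)"
  using deepD[of v] by (cases v; cases "tl v") (auto simp: lam_def)

text \<open>
  Since \<open>hprof v\<close> is harmonic on the edge, the normed field has orthogonal increments.
\<close>

definition normed :: "nat list \<Rightarrow> real \<Rightarrow> (nat list cable_point \<Rightarrow> real) \<Rightarrow> real" where
  "normed v \<theta> \<phi> = \<phi> (edge_point (tl v) v \<theta>) / hprof v \<theta>"

text \<open>
  Only the increments from the parent \<open>x\<close> enter, with \<open>b\<^sub>x / 2\<close> in place of the field at \<open>x\<close>: a field value of at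
  least \<open>b\<^sub>x\<close> leaves the margin \<open>b\<^sub>x / 2\<close>.  The condition along the edge is imposed at dyadic points of level \<open>N\<close>.
\<close>

definition open_edge :: "nat \<Rightarrow> nat list \<Rightarrow> (nat list cable_point \<Rightarrow> real) \<Rightarrow> bool" where
  "open_edge N v \<phi> \<longleftrightarrow> (\<forall>k\<le>2 ^ N. 0 \<le> threshold (tl v) / 2 + (normed v (real k / 2 ^ N) \<phi> - \<phi> (vertex_point (tl v))))
     \<and> threshold v / hit v \<le> threshold (tl v) / 2 + (normed v 1 \<phi> - \<phi> (vertex_point (tl v)))"

definition incr :: "nat \<Rightarrow> nat list \<Rightarrow> nat \<Rightarrow> (nat list cable_point \<Rightarrow> real) \<Rightarrow> real" where
  "incr N v k \<phi> = normed v (real (Suc k) / 2 ^ N) \<phi> - normed v (real k / 2 ^ N) \<phi>"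

lemma hprof_0: "deep v \<Longrightarrow> hprof v 0 = 1" and hprof_1: "deep v \<Longrightarrow> hprof v 1 = hit v"
  using hprof_def[of v] by (auto simp: deep_def)

lemma sum_incr:
  assumes v: "deep v"
  shows "(\<Sum>i<k. incr N v i \<phi>) = normed v (real k / 2 ^ N) \<phi> - \<phi> (vertex_point (tl v))"
proof -
  have "(\<Sum>i<k. incr N v i \<phi>) = normed v (real k / 2 ^ N) \<phi> - normed v (real 0 / 2 ^ N) \<phi>"
    unfolding incr_def by (rule sum_lessThan_telescope[of "\<lambda>i. normed v (real i / 2 ^ N) \<phi>"])
  then show ?thesis by (simp add: normed_def hprof_0[OF v] edge_point_0)
qed

lemma open_edge_incr:
  assumes v: "deep v"
  shows "open_edge N v \<phi> \<longleftrightarrow> (\<forall>k\<le>2 ^ N. 0 \<le> threshold (tl v) / 2 + (\<Sum>i<k. incr N v i \<phi>)) \<and> threshold v / hit v \<le> threshold (tl v) / 2 + (\<Sum>i<2 ^ N. incr N v i \<phi>)"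
  unfolding open_edge_def sum_incr[OF v] by simp

lemma dyadic_range: "k \<le> 2 ^ N \<Longrightarrow> 0 \<le> real k / 2 ^ N \<and> real k / 2 ^ N \<le> 1"
  by (simp add: divide_le_eq_1)

lemma incr_form: "incr N v k \<phi> = (1 / hprof v (real (Suc k) / 2 ^ N)) * \<phi> (edge_point (tl v) v (real (Suc k) / 2 ^ N)) +
    (- 1 / hprof v (real k / 2 ^ N)) * \<phi> (edge_point (tl v) v (real k / 2 ^ N))"
  by (simp add: incr_def normed_def)

text \<open>Both ends of an increment, once normalised, have the same covariance with a point
  outside the branch, namely that of the field at \<open>tl v\<close>.\<close>

lemma incr_orthogonal:
  assumes v: "deep v" and k: "k < 2 ^ N" and w: "w \<in> V" "w \<noteq> []" "\<not> below v w" and s: "0 \<le> s" "s \<le> 1"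
  shows "(1 / hprof v (real (Suc k) / 2 ^ N)) * g (edge_point (tl v) v (real (Suc k) / 2 ^ N)) (edge_point (tl w) w s) +
    (- 1 / hprof v (real k / 2 ^ N)) * g (edge_point (tl v) v (real k / 2 ^ N)) (edge_point (tl w) w s) = 0"
proof -
  have r: "0 \<le> real (Suc k) / 2 ^ N \<and> real (Suc k) / 2 ^ N \<le> 1" "0 \<le> real k / 2 ^ N \<and> real k / 2 ^ N \<le> 1"
    using dyadic_range[of "Suc k" N] dyadic_range[of k N] k by auto
  have n: "hprof v (real (Suc k) / 2 ^ N) \<noteq> 0" "hprof v (real k / 2 ^ N) \<noteq> 0"
    using hprof_pos[of v "real (Suc k) / 2 ^ N"] hprof_pos[of v "real k / 2 ^ N"] r v by (auto simp: deep_def)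
  have e: "g (edge_point (tl v) v \<theta>) (edge_point (tl w) w s) = hprof v \<theta> * g (vertex_point (tl v)) (edge_point (tl w) w s)"
    if "0 \<le> \<theta> \<and> \<theta> \<le> 1" for \<theta>
    using green_edge_out[of v \<theta> w s] v w s that by (simp add: deep_def)
  show ?thesis unfolding e[OF r(1)] e[OF r(2)] using n by simp
qed

lemma normed_covariance:
  assumes v: "deep v" and \<theta>: "0 \<le> \<theta>" "\<theta> \<le> s" "s \<le> 1"
  shows "g (edge_point (tl v) v \<theta>) (edge_point (tl v) v s) = hprof v \<theta> * hprof v s * (gv (tl v) (tl v) + \<theta> / (lam v * hprof v \<theta>))"
proof -
  have "0 < hprof v \<theta>" using hprof_pos[of v \<theta>] v \<theta> by (simp add: deep_def)
  then show ?thesis using green_edge_edge[of v \<theta> s] v \<theta> by (simp add: deep_def field_simps)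
qed

text \<open>The normalised covariance \<open>\<tau> i\<close> is a function of the smaller index, so
  it cancels when the later increment is formed.\<close>

lemma incr_uncorrelated_same_edge:
  assumes v: "deep v" and k: "k < l" "l < 2 ^ N"
  shows "(LINT \<phi>|M. incr N v k \<phi> * incr N v l \<phi>) = 0"
proof -
  define t where "t i = real i / 2 ^ N" for i
  define p where "p i = edge_point (tl v) v (t i)" for i
  define h where "h i = hprof v (t i)" for i
  have tr: "0 \<le> t i" "t i \<le> 1" if "i \<le> 2 ^ N" for i using dyadic_range[OF that] by (auto simp: t_def)
  have pX: "p i \<in> cable_system T" if "i \<le> 2 ^ N" for i
    unfolding p_def using deepD[OF v] tr[OF that] by (intro edge_in) auto
  have h: "h i > 0" if "i \<le> 2 ^ N" for i
    unfolding h_def using hprof_pos[of v "t i"] v tr[OF that] by (simp add: deep_def)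
  define \<tau> where "\<tau> i = gv (tl v) (tl v) + t i / (lam v * h i)" for i
  have cov: "g (p i) (p j) = h i * h j * \<tau> i" if "i \<le> j" "j \<le> 2 ^ N" for i j
    unfolding p_def h_def \<tau>_def using that tr[of i] tr[of j] by (intro normed_covariance[OF v]) (auto simp: t_def divide_right_mono)
  have "(LINT \<phi>|M. incr N v k \<phi> * incr N v l \<phi>) =
    (LINT \<phi>|M. ((1 / h (Suc k)) * \<phi> (p (Suc k)) + (- 1 / h k) * \<phi> (p k)) * ((1 / h (Suc l)) * \<phi> (p (Suc l)) + (- 1 / h l) * \<phi> (p l)))"
    unfolding incr_form h_def p_def t_def ..
  also have "\<dots> = (1 / h (Suc l)) * ((1 / h (Suc k)) * g (p (Suc k)) (p (Suc l)) + (- 1 / h k) * g (p k) (p (Suc l))) +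
    (- 1 / h l) * ((1 / h (Suc k)) * g (p (Suc k)) (p l) + (- 1 / h k) * g (p k) (p l))"
    using k by (intro field_combination_covariance pX) auto
  also have "\<dots> = 0"
    using k h[of k] h[of "Suc k"] h[of l] h[of "Suc l"] by (simp add: cov diff_divide_distrib)
  finally show ?thesis .
qed

lemma incr_in:
  assumes v: "deep v" and k: "k < 2 ^ N"
  shows "edge_point (tl v) v (real (Suc k) / 2 ^ N) \<in> cable_system T" "edge_point (tl v) v (real k / 2 ^ N) \<in> cable_system T"
  using deepD[OF v] dyadic_range[of "Suc k" N] dyadic_range[of k N] k by (auto intro!: edge_in)

lemma incr_gaussian:
  assumes v: "deep v"
  shows "centered_gaussian M (\<lambda>\<phi>. \<Sum>i<2 ^ N. a i * incr N v i \<phi>)"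
  by (rule field_combinations_gaussian[where p = "\<lambda>i. edge_point (tl v) v (real (Suc i) / 2 ^ N)"
    and q = "\<lambda>i. edge_point (tl v) v (real i / 2 ^ N)", OF _ _ _ incr_form]) (use incr_in[OF v] in auto)

lemma total_incr_variance:
  assumes v: "deep v"
  shows "(LINT \<phi>|M. (\<Sum>i<2 ^ N. incr N v i \<phi>)\<^sup>2) = 1 / (lam v * hit v)"
proof -
  note dv = deepD[OF v]
  have h: "0 < hit v" using hit_pos[of v] v by (simp add: deep_def)
  have X: "vertex_point v \<in> cable_system T" "vertex_point (tl v) \<in> cable_system T" using dv by (auto intro: vertex_in)
  have "(\<Sum>i<2 ^ N. incr N v i \<phi>) = (1 / hit v) * \<phi> (vertex_point v) + (-1) * \<phi> (vertex_point (tl v))" for \<phi>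
    unfolding sum_incr[OF v] by (simp add: normed_def hprof_1[OF v] vertex_as_edge)
  then have "(LINT \<phi>|M. (\<Sum>i<2 ^ N. incr N v i \<phi>)\<^sup>2) =
    (LINT \<phi>|M. ((1 / hit v) * \<phi> (vertex_point v) + (-1) * \<phi> (vertex_point (tl v))) * ((1 / hit v) * \<phi> (vertex_point v) + (-1) * \<phi> (vertex_point (tl v))))"
    by (simp only: power2_eq_square)
  also have "\<dots> = (1 / hit v) * ((1 / hit v) * gv v v + (-1) * gv (tl v) v) + (-1) * ((1 / hit v) * gv v (tl v) + (-1) * gv (tl v) (tl v))"
    unfolding gv_def by (intro field_combination_covariance X)
  also have "\<dots> = cond_var v / (hit v)\<^sup>2"
  proof -
    have pos: "0 < gv (tl v) (tl v)" using gv_pos dv by auto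
    have 1: "gv v (tl v) = hit v * gv (tl v) (tl v)" using pos by (simp add: hit_def)
    have 2: "gv (tl v) v = hit v * gv (tl v) (tl v)" using 1 gv_sym[OF dv(4) dv(1)] by simp
    have 3: "gv v v = cond_var v + (hit v)\<^sup>2 * gv (tl v) (tl v)" using pos by (simp add: cond_var_def hit_def power2_eq_square)
    show ?thesis unfolding 1 2 3 using h by (simp add: field_simps power2_eq_square)
  qed
  also have "\<dots> = 1 / (lam v * hit v)"
  proof -
    have e: "hit v = lam v * cond_var v" using hit_eq[of v] v by (simp add: deep_def)
    then have "cond_var v = hit v / lam v" using lam_pos[of v] by simp
    then show ?thesis using h lam_pos[of v] by (simp add: power2_eq_square)
  qed
  finally show ?thesis .
qed

text \<open>The first factor is half the ratio of the parent's threshold to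
  \<open>sqrt ((1 + d * \<alpha>) / lam v)\<close>, the largest possible standard deviation of the
  total increment. The second comes from \<open>std_normal_interval\<close>.\<close>

definition p_open :: real where
  "p_open = sqrt \<alpha> / (2 * (1 + real d * \<alpha>)) * std_normal_density 2"

lemma prob_open_edge:
  assumes v: "deep v"
  shows "p_open \<le> M.prob {\<phi> \<in> space M. open_edge N v \<phi>}"
proof -
  note dv = deepD[OF v]
  have h: "0 < hit v" "1 / (1 + real d * \<alpha>) \<le> hit v" using hit_pos[of v] hit_ge[of v] v by (auto simp: deep_def)
  have hq: "1 \<le> hit v * (1 + real d * \<alpha>)" using h d\<alpha>_pos by (simp add: divide_le_eq)
  let ?\<xi> = "incr N v"
  have g1: "centered_gaussian M (?\<xi> i)" if "i < 2 ^ N" for i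
    using incr_gaussian[OF v, of "\<lambda>j. if j = i then 1 else 0" N] that by (simp add: if_distrib[of "\<lambda>x. x * _"] cong: if_cong)
  have ind: "M.indep_vars (\<lambda>_. borel) ?\<xi> {..<2 ^ N}"
  proof (rule M.gaussian_uncorrelated_imp_indep[OF _ incr_gaussian[OF v]])
    show "(LINT \<phi>|M. incr N v i \<phi> * incr N v j \<phi>) = 0" if "i \<in> {..<2 ^ N}" "j \<in> {..<2 ^ N}" "i \<noteq> j" for i j
      using that incr_uncorrelated_same_edge[OF v, of i j N] incr_uncorrelated_same_edge[OF v, of j i N]
      by (cases i j rule: linorder_cases) (auto simp: mult.commute)
  qed simp
  define a where "a = threshold (tl v) / 2"
  define b where "b = threshold v / hit v"
  define S where "S \<phi> = (\<Sum>i<2 ^ N. incr N v i \<phi>)" for \<phi>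
  define \<sigma> where "\<sigma> = sqrt (1 / (lam v * hit v))"
  define \<delta> where "\<delta> = sqrt \<alpha> / (2 * (1 + real d * \<alpha>))"
  have gS: "centered_gaussian M S" unfolding S_def[abs_def] using incr_gaussian[OF v, of "\<lambda>_. 1" N] by simp
  have \<sigma>: "\<sigma> > 0" "\<sigma>\<^sup>2 = 1 / (lam v * hit v)" using lam_pos[of v] h by (auto simp: \<sigma>_def)
  \<comment> \<open>The target is at most one standard deviation away, because
    \<open>hit v * (1 + d * \<alpha>) \<ge> 1\<close>. This keeps the Gaussian window inside
    \<open>[0, 2]\<close>.\<close>
  have b\<sigma>: "b \<le> \<sigma>"
  proof (rule power2_le_imp_le)
    have "b\<^sup>2 = 1 / (lam v * hit v) * (1 / (hit v * (1 + real d * \<alpha>)))"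
      unfolding b_def power_divide threshold_sq by (simp add: power2_eq_square)
    also have "\<dots> \<le> 1 / (lam v * hit v) * 1"
      using lam_pos[of v] h hq by (intro mult_left_mono) (auto simp: divide_le_eq_1)
    finally show "b\<^sup>2 \<le> \<sigma>\<^sup>2" by (simp add: \<sigma>)
  qed (use \<sigma> in simp)
  have \<delta>0: "0 \<le> \<delta>" using \<alpha> d\<alpha>_pos by (simp add: \<delta>_def)
  have \<delta>1: "\<delta> \<le> 1"
  proof -
    have "sqrt \<alpha> \<le> 1" using \<alpha> by simp
    also have "1 \<le> 2 * (1 + real d * \<alpha>)" using \<alpha> by simp
    finally show ?thesis using d\<alpha>_pos by (simp add: \<delta>_def divide_le_eq_1)
  qed
  \<comment> \<open>The starting height is half the parent's threshold, and
    \<open>lam v = \<alpha> * lam (tl v)\<close> expresses it through the weight of this edge. The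
    inequality is tight when \<open>hit v\<close> has its least value
    \<open>1 / (1 + d * \<alpha>)\<close>.\<close>
  have \<delta>\<sigma>: "\<delta> * \<sigma> \<le> a"
  proof (rule power2_le_imp_le)
    have l: "lam v = \<alpha> * lam (tl v)" by (rule lam_tl[OF v])
    have D: "(\<delta> * \<sigma>)\<^sup>2 = \<alpha> / (4 * (1 + real d * \<alpha>)\<^sup>2) * (1 / (lam v * hit v))"
      unfolding power_mult_distrib \<sigma>(2) \<delta>_def power_divide using \<alpha> by simp
    have A: "a\<^sup>2 = \<alpha> / (4 * (1 + real d * \<alpha>)\<^sup>2) * ((1 + real d * \<alpha>) / lam v)"
      unfolding a_def power_divide threshold_sq l using \<alpha> d\<alpha>_pos lam_pos[of "tl v"]
      by (simp add: power2_eq_square del: distrib_left_numeral) (simp add: algebra_simps)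
    have "1 / (lam v * hit v) \<le> (1 + real d * \<alpha>) / lam v"
      using h hq lam_pos[of v] by (simp add: field_simps)
    then show "(\<delta> * \<sigma>)\<^sup>2 \<le> a\<^sup>2" unfolding D A using \<alpha> d\<alpha>_pos by (intro mult_left_mono) auto
  qed (use threshold_pos[of "tl v"] in \<open>simp add: a_def\<close>)
  have ab: "0 \<le> a" "0 \<le> b" using threshold_pos[of "tl v"] threshold_pos[of v] h by (auto simp: a_def b_def)
  have "p_open = \<delta> * std_normal_density 2" by (simp add: p_open_def \<delta>_def)
  also have "\<dots> \<le> M.prob {\<phi> \<in> space M. a + S \<phi> \<ge> b} - M.prob {\<phi> \<in> space M. a + S \<phi> \<le> - b}"
    by (rule M.centered_gaussian_two_sided[OF gS _ \<sigma>(1) ab(2) b\<sigma> \<delta>0 \<delta>1 \<delta>\<sigma>])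
      (simp add: S_def total_incr_variance[OF v] \<sigma>)
  also have "\<dots> \<le> M.prob {\<phi> \<in> space M. (\<forall>k\<le>2 ^ N. a + (\<Sum>i<k. ?\<xi> i \<phi>) \<ge> 0) \<and> a + (\<Sum>i<2 ^ N. ?\<xi> i \<phi>) \<ge> b}"
    unfolding S_def using M.centered_gaussian_distr_uminus[OF g1]
    by (intro M.reflection_lower_bound[OF ind _ ab]) auto
  also have "\<dots> = M.prob {\<phi> \<in> space M. open_edge N v \<phi>}"
    by (simp add: open_edge_incr[OF v] a_def b_def)
  finally show ?thesis .
qed

subsection \<open>Seeds\<close>

definition hit_anc :: "nat list \<Rightarrow> nat list \<Rightarrow> real" where
  "hit_anc u v = gv v u / gv u u"

text \<open>Residual of the field at \<open>v\<close> after projection onto the field at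
  \<open>anc v\<close>; it is orthogonal to the field outside the branch of
  \<open>1 # anc v\<close>. The factor 1 keeps the shape of a two-point combination.\<close>

definition seed_var :: "(nat list \<Rightarrow> nat list) \<Rightarrow> nat list \<Rightarrow> (nat list cable_point \<Rightarrow> real) \<Rightarrow> real" where
  "seed_var anc v \<phi> = 1 * \<phi> (vertex_point v) + (- hit_anc (anc v) v) * \<phi> (vertex_point (anc v))"

text \<open>
  A seed \<open>v\<close> lies in the branch of the child \<open>1 # anc v\<close> of \<open>anc v\<close>, which contains no other seed and no \<open>anc w\<close>; hence the
  innovations \<open>seed_var anc v\<close> are independent, also of the edges below the seeds.
\<close>

definition seeds :: "nat list set \<Rightarrow> (nat list \<Rightarrow> nat list) \<Rightarrow> bool" where
  "seeds Y anc \<longleftrightarrow> finite Y \<and> (\<forall>v\<in>Y. anc v \<in> V \<and> anc v \<noteq> [] \<and> v \<in> V \<and> below (1 # anc v) v) \<and>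
     (\<forall>v\<in>Y. \<forall>w\<in>Y. v \<noteq> w \<longrightarrow> \<not> below (1 # anc v) w \<and> \<not> below (1 # anc v) (anc w))"

context
  fixes Y anc assumes Y: "seeds Y anc"
begin

lemma seedD:
  assumes "v \<in> Y"
  shows "anc v \<in> V" "anc v \<noteq> []" "v \<in> V" "below (1 # anc v) v" "1 # anc v \<in> V" "deep v" "v \<noteq> []" "below (anc v) v"
proof -
  show 1: "anc v \<in> V" "anc v \<noteq> []" "v \<in> V" "below (1 # anc v) v" using Y assms by (auto simp: seeds_def)
  show "1 # anc v \<in> V" using 1 d by (simp add: regular_tree_Cons_iff)
  have "length (1 # anc v) \<le> length v" using 1(4) by (rule below_length)
  then have "2 \<le> length v" using 1(2) by (cases "anc v") auto
  then show "deep v" using 1(3) by (cases v; cases "tl v") (auto simp: deep_def)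
  then show "v \<noteq> []" by (rule deepD)
  have "below (anc v) (1 # anc v)" by (rule below_Cons) simp
  then show "below (anc v) v" using 1(4) by (rule below_trans)
qed

lemma seed_branch: "v \<in> Y \<Longrightarrow> vertex_point v \<in> branch (1 # anc v)"
  using branch_edge_iff[of "1 # anc v" v 1] seedD[of v] by (simp add: vertex_as_edge)

lemma seed_orthogonal:
  assumes v: "v \<in> Y" and w: "w \<in> V" "w \<noteq> []" "\<not> below (1 # anc v) w" and s: "0 \<le> s" "s \<le> 1"
  shows "1 * g (vertex_point v) (edge_point (tl w) w s) + (- hit_anc (anc v) v) * g (vertex_point (anc v)) (edge_point (tl w) w s) = 0"
proof -
  have "gv (anc v) (anc v) * g (vertex_point v) (edge_point (tl w) w s) = g (vertex_point (anc v)) (edge_point (tl w) w s) * gv v (anc v)"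
    using branch_separation[OF seedD(5)[OF v] _ _ seed_branch[OF v] w s] seedD[OF v] by (simp add: gv_def)
  moreover have "0 < gv (anc v) (anc v)" using seedD[OF v] by (intro gv_pos)
  ultimately show ?thesis by (simp add: hit_anc_def field_simps)
qed

lemma seed_gaussian: "v \<in> Y \<Longrightarrow> centered_gaussian M (seed_var anc v)"
  unfolding seed_var_def[abs_def] using seedD[of v] by (intro field_pair_gaussian vertex_in)

text \<open>Conditioning on a more distant ancestor leaves at least the variance left by
  conditioning on the parent: the Green function factorises at \<open>tl v\<close>, and the
  Cauchy-Schwarz inequality compares the two subtracted terms.\<close>

lemma seed_variance:
  assumes v: "v \<in> Y" shows "(threshold v)\<^sup>2 \<le> (LINT \<phi>|M. (seed_var anc v \<phi>)\<^sup>2)"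
proof -
  let ?u = "anc v" and ?x = "tl v"
  note sv = seedD[OF v] and dv = deepD[OF seedD(6)[OF v]]
  have pos: "0 < gv ?u ?u" "0 < gv ?x ?x" using sv dv gv_pos by auto
  have nb: "\<not> below v ?u" using below_length[of v ?u] below_length[OF sv(4)] by auto
  have vb: "vertex_point v \<in> branch v" using v_branch[of v] dv by simp
  have "gv ?x ?x * gv v ?u = gv ?x ?u * gv v ?x"
    using branch_separation[OF dv(1,3,2) vb sv(1,2) nb, of 1] by (simp add: vertex_as_edge gv_def)
  then have e: "gv v ?u = gv ?x ?u * gv v ?x / gv ?x ?x" using pos by (simp add: field_simps)
  have "(gv v ?u)\<^sup>2 / gv ?u ?u = (gv ?x ?u)\<^sup>2 / gv ?u ?u * ((gv v ?x)\<^sup>2 / (gv ?x ?x)\<^sup>2)"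
    unfolding e by (simp add: power_divide power_mult_distrib)
  also have "\<dots> \<le> gv ?x ?x * ((gv v ?x)\<^sup>2 / (gv ?x ?x)\<^sup>2)"
    using gv_Cauchy_Schwarz[OF dv(4) sv(1)] pos by (intro mult_right_mono) (auto simp: divide_le_eq)
  also have "\<dots> = (gv v ?x)\<^sup>2 / gv ?x ?x" using pos by (simp add: power2_eq_square)
  finally have le: "(gv v ?u)\<^sup>2 / gv ?u ?u \<le> (gv v ?x)\<^sup>2 / gv ?x ?x" .
  have "(LINT \<phi>|M. (seed_var anc v \<phi>)\<^sup>2) = 1 * (1 * gv v v + (- hit_anc ?u v) * gv ?u v) + (- hit_anc ?u v) * (1 * gv v ?u + (- hit_anc ?u v) * gv ?u ?u)"
    unfolding seed_var_def power2_eq_square gv_def using sv by (intro field_combination_covariance vertex_in)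
  also have "\<dots> = gv v v - (gv v ?u)\<^sup>2 / gv ?u ?u"
    using pos gv_sym[OF sv(1,3)] by (simp add: hit_anc_def power2_eq_square)
  also have "\<dots> \<ge> cond_var v" using le by (simp add: cond_var_def)
  finally have "cond_var v \<le> (LINT \<phi>|M. (seed_var anc v \<phi>)\<^sup>2)" .
  moreover have "(threshold v)\<^sup>2 \<le> cond_var v"
    using cond_var_ge[of v] dv lam_pos[of v] d\<alpha>_pos by (simp add: threshold_sq divide_le_eq)
  ultimately show ?thesis by simp
qed

text \<open>The threshold is at most the standard deviation, and a standard normal variable lies in
  \<open>[3/2, 2)\<close> with at least this probability. The surplus of half a threshold is
  reserved for the contribution of \<open>anc v\<close>.\<close>

lemma prob_seed:
  assumes v: "v \<in> Y"
  shows "std_normal_density 2 / 2 \<le> M.prob {\<phi> \<in> space M. seed_var anc v \<phi> \<ge> 3 / 2 * threshold v}"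
proof -
  interpret N: prob_space std_normal_distribution by (rule prob_space_normal_density) simp
  let ?Z = "seed_var anc v"
  define s where "s = sqrt (LINT \<phi>|M. (?Z \<phi>)\<^sup>2)"
  have s: "threshold v \<le> s" unfolding s_def using seed_variance[OF v] by (rule real_le_rsqrt)
  have [measurable]: "?Z \<in> borel_measurable M" using seed_gaussian[OF v] by (simp add: centered_gaussian_def)
  have law: "distr M borel ?Z = distr std_normal_distribution borel (\<lambda>x. s * x)"
    unfolding s_def by (rule M.centered_gaussian_law_var(2)[OF seed_gaussian[OF v]])
  have "std_normal_density 2 / 2 = (1/2) * std_normal_density 2" by simp
  also have "\<dots> \<le> N.prob {3/2..<3/2 + 1/2}" by (rule std_normal_interval) auto
  also have "\<dots> \<le> N.prob {x. s * x \<in> {3 / 2 * threshold v..}}"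
  proof (rule N.finite_measure_mono)
    show "{3/2..<3/2 + 1/2} \<subseteq> {x. s * x \<in> {3 / 2 * threshold v..}}"
    proof
      fix x :: real assume "x \<in> {3/2..<3/2 + 1/2}"
      then have "threshold v * (3/2) \<le> s * x" using s threshold_pos[of v] by (intro mult_mono) auto
      then show "x \<in> {x. s * x \<in> {3 / 2 * threshold v..}}" by simp
    qed
    have "(\<lambda>x. s * x) -` {3 / 2 * threshold v..} \<inter> space std_normal_distribution \<in> sets std_normal_distribution"
      by (rule measurable_sets[of _ _ borel]) auto
    then show "{x. s * x \<in> {3 / 2 * threshold v..}} \<in> sets std_normal_distribution" by (simp add: vimage_def)
  qed
  also have "\<dots> = measure (distr std_normal_distribution borel (\<lambda>x. s * x)) {3 / 2 * threshold v..}"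
    by (subst measure_distr) (auto simp: vimage_def)
  also have "\<dots> = M.prob {\<phi> \<in> space M. ?Z \<phi> \<ge> 3 / 2 * threshold v}"
    unfolding law[symmetric] by (subst measure_distr) (auto intro!: arg_cong[of _ _ M.prob])
  finally show ?thesis .
qed

text \<open>Merges both kinds of events into one family indexed by vertices. At a seed the condition
  on the innovation replaces the state of the edge above it, which no search started from a seed
  examines.\<close>

definition good_vertex :: "nat \<Rightarrow> nat list \<Rightarrow> (nat list cable_point \<Rightarrow> real) \<Rightarrow> bool" where
  "good_vertex N v \<phi> \<longleftrightarrow> (if v \<in> Y then seed_var anc v \<phi> \<ge> 3 / 2 * threshold v else open_edge N v \<phi>)"

lemma seed_not_below_other: "v \<in> Y \<Longrightarrow> w \<in> Y \<Longrightarrow> below v w \<Longrightarrow> v = w"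
  using Y below_trans seedD(4) unfolding seeds_def by blast

lemma descendants_disjoint_seeds: "disjoint_family_on (descendants d D) Y"
  unfolding disjoint_family_on_def using below_linear descendants_below seed_not_below_other by (metis disjoint_iff)

lemma descendant_deep:
  assumes "y \<in> Y" "w \<in> descendants d D y" shows "deep w"
proof -
  have "w \<in> V" using descendants_in_tree[of y d D] seedD[OF assms(1)] assms(2) by auto
  moreover have "2 \<le> length w"
  proof -
    have "length y \<le> length w" using descendants_below[OF assms(2)] by (rule below_length)
    moreover have "2 \<le> length y" using deepD[OF seedD(6)[OF assms(1)]] by (cases y; cases "tl y") auto
    ultimately show ?thesis by simp
  qed
  ultimately show ?thesis by (cases w; cases "tl w") (auto simp: deep_def)
qed

text \<open>All events are functions of finitely many Gaussian variables, one per seed and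
  \<open>2 ^ N\<close> per remaining vertex. Two variables are uncorrelated because, for one of
  them, the points defining the other lie outside its branch, or because they are increments of the
  same edge.\<close>

lemma good_vertex_indep:
  "M.indep_vars (\<lambda>_. count_space UNIV) (good_vertex N) (\<Union>y\<in>Y. descendants d D y)"
proof -
  define W where "W = (\<Union>y\<in>Y. descendants d D y)"
  have finW: "finite W" unfolding W_def using Y finite_descendants by (auto simp: seeds_def)
  have Wdeep: "deep w" if "w \<in> W" for w using that descendant_deep by (auto simp: W_def)
  \<comment> \<open>The block of variables that determines \<open>good_vertex N v\<close>; the index
    0 at a seed is a dummy.\<close>
  define K where "K v = (if v \<in> Y then {(v, 0)} else {v} \<times> {..<(2::nat) ^ N})" for v :: "nat list"
  define I where "I = (\<Union>v\<in>W. K v)"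
  define c where "c i = (case i of (v, k) \<Rightarrow> if v \<in> Y then 1 else 1 / hprof v (real (Suc k) / 2 ^ N))" for i :: "nat list \<times> nat"
  define e where "e i = (case i of (v, k) \<Rightarrow> if v \<in> Y then - hit_anc (anc v) v else - 1 / hprof v (real k / 2 ^ N))" for i :: "nat list \<times> nat"
  define p where "p i = (case i of (v, k) \<Rightarrow> if v \<in> Y then vertex_point v else edge_point (tl v) v (real (Suc k) / 2 ^ N))" for i :: "nat list \<times> nat"
  define q where "q i = (case i of (v, k) \<Rightarrow> if v \<in> Y then vertex_point (anc v) else edge_point (tl v) v (real k / 2 ^ N))" for i :: "nat list \<times> nat"
  define X where "X i \<phi> = c i * \<phi> (p i) + e i * \<phi> (q i)" for i and \<phi> :: "nat list cable_point \<Rightarrow> real"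
  have finI: "finite I" unfolding I_def using finW by (auto simp: K_def)
  have IE: "(v \<in> Y \<and> k = 0) \<or> (v \<notin> Y \<and> deep v \<and> k < 2 ^ N)" and IW: "v \<in> W" if "(v, k) \<in> I" for v k
    using that Wdeep by (auto simp: I_def K_def split: if_splits)
  have pX: "p i \<in> cable_system T" "q i \<in> cable_system T" if "i \<in> I" for i
  proof -
    obtain v k where i: "i = (v, k)" by (cases i)
    have "p (v, k) \<in> cable_system T \<and> q (v, k) \<in> cable_system T"
      using IE[of v k] that seedD[of v] incr_in[of v k N] unfolding i by (auto simp: p_def q_def intro: vertex_in)
    then show "p i \<in> cable_system T" "q i \<in> cable_system T" by (auto simp: i)
  qed
  have seedX: "X (v, k) \<phi> = seed_var anc v \<phi>" if "v \<in> Y" for v k \<phi>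
    using that by (simp add: X_def c_def e_def p_def q_def seed_var_def)
  have incrX: "X (v, k) \<phi> = incr N v k \<phi>" if "v \<notin> Y" for v k \<phi>
    using that by (simp add: X_def c_def e_def p_def q_def incr_form)
  have orth: "(LINT \<phi>|M. X (v, k) \<phi> * X (w, l) \<phi>) = 0"
    if vk: "(v, k) \<in> I" and wl: "(w, l) \<in> I"
      and o1: "c (v, k) * g (p (v, k)) (p (w, l)) + e (v, k) * g (q (v, k)) (p (w, l)) = 0"
      and o2: "c (v, k) * g (p (v, k)) (q (w, l)) + e (v, k) * g (q (v, k)) (q (w, l)) = 0" for v k w l
    unfolding X_def by (subst field_combination_covariance) (use pX[OF vk] pX[OF wl] o1 o2 in auto)
  have pts: "\<exists>s z. 0 \<le> s \<and> s \<le> 1 \<and> p (w, l) = edge_point (tl z) z s \<and> (z = w)"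
    "\<exists>s z. 0 \<le> s \<and> s \<le> 1 \<and> q (w, l) = edge_point (tl z) z s \<and> (z = w \<or> (w \<in> Y \<and> z = anc w))" if wl: "(w, l) \<in> I" for w l
  proof -
    show "\<exists>s z. 0 \<le> s \<and> s \<le> 1 \<and> p (w, l) = edge_point (tl z) z s \<and> (z = w)"
    proof (cases "w \<in> Y")
      case True then show ?thesis by (intro exI[of _ 1] exI[of _ w]) (simp add: p_def vertex_as_edge)
    next
      case False
      then show ?thesis using IE[OF wl] dyadic_range[of "Suc l" N]
        by (intro exI[of _ "real (Suc l) / 2 ^ N"] exI[of _ w]) (simp add: p_def)
    qed
    show "\<exists>s z. 0 \<le> s \<and> s \<le> 1 \<and> q (w, l) = edge_point (tl z) z s \<and> (z = w \<or> (w \<in> Y \<and> z = anc w))"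
    proof (cases "w \<in> Y")
      case True then show ?thesis by (intro exI[of _ 1] exI[of _ "anc w"]) (simp add: q_def vertex_as_edge)
    next
      case False
      then show ?thesis using IE[OF wl] dyadic_range[of l N]
        by (intro exI[of _ "real l / 2 ^ N"] exI[of _ w]) (simp add: q_def)
    qed
  qed
  have wV: "w \<in> V" "w \<noteq> []" if "(w, l) \<in> I" for w l
    using IE[OF that] seedD[of w] deepD[of w] by auto
  \<comment> \<open>Asymmetric on purpose: only the variable at \<open>v\<close> needs vanishing
    covariance with both points of the other variable. Symmetry of the product then allows either
    order.\<close>
  have orth_incr: "(LINT \<phi>|M. X (v, k) \<phi> * X (w, l) \<phi>) = 0"
    if vk: "(v, k) \<in> I" and wl: "(w, l) \<in> I" and v: "v \<notin> Y" and nb: "\<not> below v w" "w \<in> Y \<Longrightarrow> \<not> below v (anc w)" for v k w l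
  proof -
    have dv: "deep v" "k < 2 ^ N" using IE[OF vk] v by auto
    have o: "c (v, k) * g (p (v, k)) (edge_point (tl z) z s) + e (v, k) * g (q (v, k)) (edge_point (tl z) z s) = 0"
      if "z \<in> V" "z \<noteq> []" "\<not> below v z" "0 \<le> s" "s \<le> 1" for z s
      using incr_orthogonal[OF dv that] v by (simp add: c_def e_def p_def q_def)
    obtain s where s: "0 \<le> s" "s \<le> 1" "p (w, l) = edge_point (tl w) w s" using pts(1)[OF wl] by blast
    obtain s' z' where s': "0 \<le> s'" "s' \<le> 1" "q (w, l) = edge_point (tl z') z' s'" "z' = w \<or> (w \<in> Y \<and> z' = anc w)"
      using pts(2)[OF wl] by blast
    show ?thesis
    proof (rule orth[OF vk wl])
      show "c (v, k) * g (p (v, k)) (p (w, l)) + e (v, k) * g (q (v, k)) (p (w, l)) = 0"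
        unfolding s(3) by (rule o[OF wV[OF wl] nb(1) s(1,2)])
      have z': "z' \<in> V" "z' \<noteq> []" "\<not> below v z'" using s'(4) nb wV[OF wl] seedD[of w] by auto
      show "c (v, k) * g (p (v, k)) (q (w, l)) + e (v, k) * g (q (v, k)) (q (w, l)) = 0"
        unfolding s'(3) by (rule o[OF z' s'(1,2)])
    qed
  qed
  \<comment> \<open>\<open>v\<close> lies strictly below some seed \<open>y\<close>. If a seed
    \<open>w\<close> were at or below \<open>v\<close>, then \<open>y = w\<close> and so
    \<open>v = y\<close>; if \<open>anc w\<close> were, it would lie in the branch of
    \<open>1 # anc y\<close>, which is excluded by its length or by \<open>seeds\<close>.\<close>
  have not_below_seed: "\<not> below v w \<and> \<not> below v (anc w)" if v: "v \<in> W" "v \<notin> Y" and w: "w \<in> Y" for v w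
  proof -
    obtain y where y: "y \<in> Y" "v \<in> descendants d D y" using v by (auto simp: W_def)
    have yv: "below y v" by (rule descendants_below[OF y(2)])
    have b: "below (1 # anc y) v" using seedD(4)[OF y(1)] yv by (rule below_trans)
    have "\<not> below v w"
    proof
      assume "below v w"
      then have "y = w" using seed_not_below_other[OF y(1) w] below_trans[OF yv] by blast
      then show False using \<open>below v w\<close> yv below_antisym v(2) w by blast
    qed
    moreover have "\<not> below v (anc w)"
    proof
      assume "below v (anc w)"
      then have bb: "below (1 # anc y) (anc w)" by (rule below_trans[OF b])
      show False
      proof (cases "y = w")
        case True
        then show False using below_length[OF bb] by simp
      next
        case False
        then show False using bb Y y(1) w by (auto simp: seeds_def)
      qed
    qed
    ultimately show ?thesis by simp
  qed
  have uncor: "(LINT \<phi>|M. X i \<phi> * X j \<phi>) = 0" if "i \<in> I" "j \<in> I" "i \<noteq> j" for i j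
  proof -
    obtain v k where i: "i = (v, k)" by (cases i)
    obtain w l where j: "j = (w, l)" by (cases j)
    have vk: "(v, k) \<in> I" and wl: "(w, l) \<in> I" using that i j by auto
    have sym: "(LINT \<phi>|M. X (v, k) \<phi> * X (w, l) \<phi>) = (LINT \<phi>|M. X (w, l) \<phi> * X (v, k) \<phi>)" by (simp add: mult.commute)
    have "(LINT \<phi>|M. X (v, k) \<phi> * X (w, l) \<phi>) = 0"
    proof (cases "v = w")
      case True
      have "v \<notin> Y" "deep v" "k < 2 ^ N" "l < 2 ^ N" "k \<noteq> l"
        using IE[OF vk] IE[OF wl] that(3) True by (auto simp: i j)
      then show ?thesis using True incrX incr_uncorrelated_same_edge[of v k l N] incr_uncorrelated_same_edge[of v l k N]
        by (cases k l rule: linorder_cases) (auto simp: mult.commute)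
    next
      case False
      show ?thesis
      proof (cases "v \<in> Y")
        case vY: True
        show ?thesis
        proof (cases "w \<in> Y")
          case True
          have nb: "\<not> below (1 # anc v) w" "\<not> below (1 # anc v) (anc w)" using Y vY True False by (auto simp: seeds_def)
          show ?thesis
            using seed_orthogonal[OF vY _ _ nb(1), of 1] seed_orthogonal[OF vY _ _ nb(2), of 1] seedD[OF True] True vY
            by (intro orth[OF vk wl]) (simp_all add: c_def e_def p_def q_def vertex_as_edge)
        next
          case wY: False
          show ?thesis unfolding sym
            using not_below_seed[OF IW[OF wl] wY vY] by (intro orth_incr[OF wl vk wY]) auto
        qed
      next
        case vY: False
        show ?thesis
        proof (cases "w \<in> Y")
          case True
          show ?thesis using not_below_seed[OF IW[OF vk] vY True] by (intro orth_incr[OF vk wl vY]) auto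
        next
          case wY: False
          show ?thesis
          proof (cases "below v w")
            case True
            then have "\<not> below w v" using False below_antisym by blast
            then show ?thesis unfolding sym using vY by (intro orth_incr[OF wl vk wY]) auto
          next
            case False
            then show ?thesis using wY by (intro orth_incr[OF vk wl vY]) auto
          qed
        qed
      qed
    qed
    then show ?thesis by (simp add: i j)
  qed
  have ind: "M.indep_vars (\<lambda>_. borel) X I"
    by (rule M.gaussian_uncorrelated_imp_indep[OF finI field_combinations_gaussian[OF finI pX X_def] uncor])
  have KI: "K v \<subseteq> I" if "v \<in> W" for v using that by (auto simp: I_def)
  have disj: "disjoint_family_on K W" by (auto simp: disjoint_family_on_def K_def)
  \<comment> \<open>\<open>good_vertex\<close> as a function of its block alone, so that
    independence of blocks transfers to the events.\<close>
  define Q where "Q v f \<longleftrightarrow> (if v \<in> Y then 3 / 2 * threshold v \<le> f (v, 0) else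
    (\<forall>k\<in>{..2 ^ N}. 0 \<le> threshold (tl v) / 2 + (\<Sum>i<k. f (v, i))) \<and> threshold v / hit v \<le> threshold (tl v) / 2 + (\<Sum>i<2 ^ N. f (v, i)))"
    for v and f :: "nat list \<times> nat \<Rightarrow> real"
  have Qm: "Q v \<in> measurable (PiM (K v) (\<lambda>_. borel)) (count_space UNIV)" if "v \<in> W" for v
  proof (cases "v \<in> Y")
    case True
    have "(\<lambda>f. f (v, 0)) \<in> borel_measurable (PiM (K v) (\<lambda>_. borel))"
      by (rule measurable_component_singleton) (simp add: K_def True)
    then show ?thesis unfolding Q_def[abs_def] pred_def
      using borel_measurable_le[OF measurable_const[of "3 / 2 * threshold v"]] True by (simp del: times_divide_eq_left)
  next
    case False
    have m: "(\<lambda>f. \<Sum>i<k. f (v, i) :: real) \<in> borel_measurable (PiM (K v) (\<lambda>_. borel))" if "k \<le> 2 ^ N" for k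
      by (intro borel_measurable_sum measurable_component_singleton) (use that False in \<open>auto simp: K_def\<close>)
    have "Measurable.pred (PiM (K v) (\<lambda>_. borel)) (\<lambda>f. 0 \<le> threshold (tl v) / 2 + (\<Sum>i<k. f (v, i)))" if "k \<in> {..2 ^ N}" for k
      using m[of k] that by simp
    then have "Measurable.pred (PiM (K v) (\<lambda>_. borel)) (\<lambda>f. \<forall>k\<in>{..2 ^ N}. 0 \<le> threshold (tl v) / 2 + (\<Sum>i<k. f (v, i)))"
      by (intro pred_intros_finite) auto
    moreover have "Measurable.pred (PiM (K v) (\<lambda>_. borel)) (\<lambda>f. threshold v / hit v \<le> threshold (tl v) / 2 + (\<Sum>i<2 ^ N. f (v, i)))"
      using m[of "2 ^ N"] by simp
    ultimately show ?thesis unfolding Q_def[abs_def] using False by (simp add: pred_intros_logic)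
  qed
  have "M.indep_vars (\<lambda>_. count_space UNIV) (\<lambda>v \<phi>. Q v (\<lambda>i\<in>K v. X i \<phi>)) W"
    by (rule M.indep_vars_compose2[OF M.indep_vars_restrict[OF ind KI disj] Qm])
  moreover have "Q v (\<lambda>i\<in>K v. X i \<phi>) = good_vertex N v \<phi>" if v: "v \<in> W" for v \<phi>
  proof (cases "v \<in> Y")
    case True
    then show ?thesis by (simp add: Q_def good_vertex_def K_def seedX)
  next
    case False
    have s: "(\<Sum>i<k. (\<lambda>i\<in>K v. X i \<phi>) (v, i)) = (\<Sum>i<k. incr N v i \<phi>)" if "k \<le> 2 ^ N" for k
      using that False by (intro sum.cong refl) (auto simp: K_def incrX)
    show ?thesis unfolding Q_def good_vertex_def open_edge_incr[OF Wdeep[OF v]] using False s by (auto simp del: restrict_apply)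
  qed
  then have "(\<lambda>\<phi>. Q v (\<lambda>i\<in>K v. X i \<phi>)) = good_vertex N v" if "v \<in> W" for v using that by blast
  then have "M.indep_vars (\<lambda>_. count_space UNIV) (\<lambda>v \<phi>. Q v (\<lambda>i\<in>K v. X i \<phi>)) W = M.indep_vars (\<lambda>_. count_space UNIV) (good_vertex N) W"
    by (intro M.indep_vars_cong) auto
  ultimately show ?thesis unfolding W_def[symmetric] by blast
qed

text \<open>Each seed succeeds independently with probability at least
  \<open>std_normal_density 2 / 2\<close>, times 1/2 for survival below it. The bound depends
  neither on the dyadic level \<open>N\<close> nor on the depth \<open>D\<close>.\<close>

lemma prob_seed_reach:
  assumes dp: "2 \<le> real d * p_open"
  shows "1 - (1 - std_normal_density 2 / 4) ^ card Y \<le>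
    M.prob {\<phi> \<in> space M. \<exists>v\<in>Y. seed_var anc v \<phi> \<ge> 3 / 2 * threshold v \<and> reach d (\<lambda>w. open_edge N w \<phi>) D v}"
proof -
  define W where "W = (\<Union>y\<in>Y. descendants d D y)"
  have finY: "finite Y" using Y by (simp add: seeds_def)
  have ind: "M.indep_vars (\<lambda>_. count_space UNIV) (good_vertex N) W"
    unfolding W_def by (rule good_vertex_indep)
  have DW: "descendants d D y \<subseteq> W" if "y \<in> Y" for y using that by (auto simp: W_def)
  have gm: "Measurable.pred M (good_vertex N w)" if "w \<in> W" for w
    using ind that unfolding M.indep_vars_def by blast
  have notY: "w \<notin> Y" if "y \<in> Y" "w \<in> descendants d D y - {y}" for y w
    using that seed_not_below_other[of y w] descendants_below by blast
  have p0: "0 \<le> p_open" unfolding p_open_def using \<alpha> d\<alpha>_pos by simp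
  have half: "1 / 2 \<le> M.prob {\<phi> \<in> space M. reach d (\<lambda>w. good_vertex N w \<phi>) D y}" if y: "y \<in> Y" for y
  proof (rule M.prob_reach_ge_half[OF ind _ _ p0 dp])
    show "descendants d D y - {y} \<subseteq> W" using DW[OF y] by auto
    show "p_open \<le> M.prob {\<phi> \<in> space M. good_vertex N w \<phi>}" if w: "w \<in> descendants d D y - {y}" for w
      using notY[OF y w] prob_open_edge[OF descendant_deep[OF y, of w D], of N] w by (simp add: good_vertex_def)
  qed
  have eq: "reach d (\<lambda>w. good_vertex N w \<phi>) D y = reach d (\<lambda>w. open_edge N w \<phi>) D y" if y: "y \<in> Y" for y \<phi>
    using notY[OF y] by (intro reach_cong) (simp add: good_vertex_def)
  have "M.prob {\<phi> \<in> space M. \<forall>c\<in>Y. \<not> (good_vertex N c \<phi> \<and> reach d (\<lambda>v. good_vertex N v \<phi>) D c)} =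
    (\<Prod>c\<in>Y. 1 - M.prob {\<phi> \<in> space M. good_vertex N c \<phi>} * M.prob {\<phi> \<in> space M. reach d (\<lambda>v. good_vertex N v \<phi>) D c})"
    by (rule M.prob_no_reach[OF ind finY DW descendants_disjoint_seeds])
  also have "\<dots> \<le> (\<Prod>c\<in>Y. 1 - std_normal_density 2 / 4)"
  proof (intro prod_mono conjI)
    fix c assume c: "c \<in> Y"
    have "std_normal_density 2 / 2 \<le> M.prob {\<phi> \<in> space M. good_vertex N c \<phi>}"
      using prob_seed[OF c] c by (simp add: good_vertex_def)
    then have "std_normal_density 2 / 2 * (1 / 2) \<le> M.prob {\<phi> \<in> space M. good_vertex N c \<phi>} * M.prob {\<phi> \<in> space M. reach d (\<lambda>v. good_vertex N v \<phi>) D c}"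
      using half[OF c] by (intro mult_mono) auto
    then show "1 - M.prob {\<phi> \<in> space M. good_vertex N c \<phi>} * M.prob {\<phi> \<in> space M. reach d (\<lambda>v. good_vertex N v \<phi>) D c} \<le> 1 - std_normal_density 2 / 4"
      by simp
    show "0 \<le> 1 - M.prob {\<phi> \<in> space M. good_vertex N c \<phi>} * M.prob {\<phi> \<in> space M. reach d (\<lambda>v. good_vertex N v \<phi>) D c}"
      by (simp add: mult_le_one)
  qed
  also have "\<dots> = (1 - std_normal_density 2 / 4) ^ card Y" by simp
  finally have le: "M.prob {\<phi> \<in> space M. \<forall>c\<in>Y. \<not> (good_vertex N c \<phi> \<and> reach d (\<lambda>v. good_vertex N v \<phi>) D c)} \<le> (1 - std_normal_density 2 / 4) ^ card Y" .
  have ev: "Measurable.pred M (\<lambda>\<phi>. \<exists>c\<in>Y. good_vertex N c \<phi> \<and> reach d (\<lambda>v. good_vertex N v \<phi>) D c)"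
  proof (intro pred_intros_finite finY pred_intros_logic)
    fix c assume c: "c \<in> Y"
    then show "Measurable.pred M (good_vertex N c)" using gm DW[OF c] self_in_descendants by blast
    show "Measurable.pred M (\<lambda>\<phi>. reach d (\<lambda>v. good_vertex N v \<phi>) D c)"
      using gm DW[OF c] by (intro reach_measurable) auto
  qed
  have "M.prob {\<phi> \<in> space M. \<not> (\<exists>c\<in>Y. good_vertex N c \<phi> \<and> reach d (\<lambda>v. good_vertex N v \<phi>) D c)} =
    1 - M.prob {\<phi> \<in> space M. \<exists>c\<in>Y. good_vertex N c \<phi> \<and> reach d (\<lambda>v. good_vertex N v \<phi>) D c}"
    using ev by (intro M.prob_neg) (simp add: pred_def)
  moreover have "{\<phi> \<in> space M. \<exists>c\<in>Y. good_vertex N c \<phi> \<and> reach d (\<lambda>v. good_vertex N v \<phi>) D c} =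
    {\<phi> \<in> space M. \<exists>v\<in>Y. seed_var anc v \<phi> \<ge> 3 / 2 * threshold v \<and> reach d (\<lambda>w. open_edge N w \<phi>) D v}"
    using eq by (auto simp: good_vertex_def)
  ultimately show ?thesis using le by simp
qed

end

end

subsection \<open>Percolation above every level\<close>

text \<open>If each index failed from some stage on, all of them would fail at a common later stage;
  the sum of the finitely many stages is such a bound.\<close>

lemma antimono_pigeonhole:
  fixes P :: "nat \<Rightarrow> 'i \<Rightarrow> bool"
  assumes "finite I" and anti: "\<And>N N' i. i \<in> I \<Longrightarrow> N \<le> N' \<Longrightarrow> P N' i \<Longrightarrow> P N i" and ex: "\<And>N. \<exists>i\<in>I. P N i"
  shows "\<exists>i\<in>I. \<forall>N. P N i"
proof (rule ccontr)
  assume "\<not> ?thesis"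
  then obtain n where n: "\<And>i. i \<in> I \<Longrightarrow> \<not> P (n i) i" by metis
  obtain i where i: "i \<in> I" "P (\<Sum>i\<in>I. n i) i" using ex by blast
  have "n i \<le> (\<Sum>i\<in>I. n i)" using assms(1) i(1) by (simp add: member_le_sum)
  then show False using anti[OF i(1) _ i(2)] n[OF i(1)] by blast
qed

lemma reach_mono: "(\<And>w. \<eta> w \<Longrightarrow> \<eta>' w) \<Longrightarrow> reach d \<eta> n v \<Longrightarrow> reach d \<eta>' n v"
  by (induction n arbitrary: v) auto

lemma reach_less: "n \<le> n' \<Longrightarrow> reach d \<eta> n' v \<Longrightarrow> reach d \<eta> n v"
proof (induction n arbitrary: v n')
  case (Suc n)
  then obtain k where "n' = Suc k" "n \<le> k" by (cases n') auto
  then show ?case using Suc by auto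
qed simp

text \<open>Koenig-type exchange of quantifiers: a path that is open at level \<open>N\<close> may
  depend on \<open>N\<close>, but with finitely many children one child serves all levels.\<close>

lemma reach_all:
  fixes \<eta> :: "nat \<Rightarrow> nat list \<Rightarrow> bool"
  assumes anti: "\<And>N N' w. N \<le> N' \<Longrightarrow> \<eta> N' w \<Longrightarrow> \<eta> N w" and r: "\<And>N. reach d (\<eta> N) n v"
  shows "reach d (\<lambda>w. \<forall>N. \<eta> N w) n v"
  using r
proof (induction n arbitrary: v)
  case (Suc n)
  have "\<exists>i\<in>{..<d}. \<forall>N. \<eta> N (i # v) \<and> reach d (\<eta> N) n (i # v)"
  proof (rule antimono_pigeonhole[where P = "\<lambda>N i. \<eta> N (i # v) \<and> reach d (\<eta> N) n (i # v)"])
    show "\<eta> N (i # v) \<and> reach d (\<eta> N) n (i # v)" if "N \<le> N'" "\<eta> N' (i # v) \<and> reach d (\<eta> N') n (i # v)" for N N' i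
      using that anti[OF that(1)] reach_mono[of "\<eta> N'" "\<eta> N"] by blast
    show "\<exists>i\<in>{..<d}. \<eta> N (i # v) \<and> reach d (\<eta> N) n (i # v)" for N using Suc.prems[of N] by auto
  qed simp
  then obtain i where i: "i < d" "\<And>N. \<eta> N (i # v)" "\<And>N. reach d (\<eta> N) n (i # v)" by blast
  then show ?case using Suc.IH[OF i(3)] by auto
qed simp

lemma floor_dyadic_tendsto: "(\<lambda>N. real (nat \<lfloor>\<theta> * 2 ^ N\<rfloor>) / 2 ^ N) \<longlonglongrightarrow> \<theta>" if "0 \<le> \<theta>"
proof (rule real_tendsto_sandwich)
  have r: "real (nat \<lfloor>\<theta> * 2 ^ N\<rfloor>) = of_int \<lfloor>\<theta> * 2 ^ N\<rfloor>" for N using that by simp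
  show "\<forall>\<^sub>F N in sequentially. \<theta> - (1 / 2) ^ N \<le> real (nat \<lfloor>\<theta> * 2 ^ N\<rfloor>) / 2 ^ N"
  proof (intro always_eventually allI)
    fix N
    have "(\<theta> - (1 / 2) ^ N) * 2 ^ N = \<theta> * 2 ^ N - 1" by (simp add: algebra_simps power_divide)
    also have "\<dots> \<le> of_int \<lfloor>\<theta> * 2 ^ N\<rfloor>" by linarith
    finally show "\<theta> - (1 / 2) ^ N \<le> real (nat \<lfloor>\<theta> * 2 ^ N\<rfloor>) / 2 ^ N" unfolding r by (simp add: pos_le_divide_eq)
  qed
  show "\<forall>\<^sub>F N in sequentially. real (nat \<lfloor>\<theta> * 2 ^ N\<rfloor>) / 2 ^ N \<le> \<theta>"
    unfolding r by (simp add: pos_divide_le_eq)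
  have "(\<lambda>N. \<theta> - (1 / 2) ^ N) \<longlonglongrightarrow> \<theta> - 0" by (intro tendsto_diff tendsto_const LIMSEQ_realpow_zero) auto
  then show "(\<lambda>N. \<theta> - (1 / 2) ^ N) \<longlonglongrightarrow> \<theta>" by simp
qed simp

context tree_gff
begin

text \<open>The dyadic points of level \<open>N\<close> are among those of level \<open>N'\<close>,
  and the condition at the endpoint is the same.\<close>

lemma open_edge_antimono:
  assumes "N \<le> N'" "open_edge N' v \<phi>" shows "open_edge N v \<phi>"
proof -
  have "0 \<le> threshold (tl v) / 2 + (normed v (real k / 2 ^ N) \<phi> - \<phi> (vertex_point (tl v)))" if k: "k \<le> 2 ^ N" for k
  proof -
    have e: "(2::nat) ^ N' = 2 ^ N * 2 ^ (N' - N)" using assms(1) by (simp flip: power_add)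
    have "k * 2 ^ (N' - N) \<le> 2 ^ N'" unfolding e using k by simp
    moreover have "(2::real) ^ N' = 2 ^ N * 2 ^ (N' - N)" using assms(1) by (simp flip: power_add)
    then have "real (k * 2 ^ (N' - N)) / 2 ^ N' = real k / 2 ^ N" by simp
    ultimately show ?thesis using assms(2) unfolding open_edge_def by metis
  qed
  then show ?thesis using assms(2) by (simp add: open_edge_def)
qed

text \<open>On the edge the normalised field is at least half the parent's threshold and
  \<open>hprof\<close> is at least \<open>1 / (1 + d * \<alpha>)\<close>; this explains the
  condition linking \<open>h\<close> to the threshold. Continuity extends the bound from dyadic
  points to the whole edge.\<close>

lemma open_edge_above:
  assumes w: "deep w" and \<phi>: "\<phi> \<in> space M" and op: "\<And>N. open_edge N w \<phi>"
    and b: "threshold (tl w) \<le> \<phi> (vertex_point (tl w))" "2 * h * (1 + real d * \<alpha>) \<le> threshold (tl w)"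
  shows "threshold w \<le> \<phi> (vertex_point w)"
    and "0 \<le> \<theta> \<Longrightarrow> \<theta> \<le> 1 \<Longrightarrow> h \<le> \<phi> (edge_point (tl w) w \<theta>)"
proof -
  note dw = deepD[OF w]
  have hp: "0 < hit w" "1 / (1 + real d * \<alpha>) \<le> hit w" using hit_pos[of w] hit_ge[of w] w by (auto simp: deep_def)
  have "threshold w / hit w \<le> normed w 1 \<phi>" using op[of 0] b(1) threshold_pos[of "tl w"] by (simp add: open_edge_def)
  then show "threshold w \<le> \<phi> (vertex_point w)" using hp by (simp add: normed_def hprof_1[OF w] vertex_as_edge divide_le_cancel)
  have dy: "h \<le> \<phi> (edge_point (tl w) w (real k / 2 ^ N))" if k: "k \<le> 2 ^ N" for k N
  proof -
    let ?t = "real k / 2 ^ N"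
    have t: "0 \<le> ?t" "?t \<le> 1" using dyadic_range[OF k] by auto
    have hq: "0 < hprof w ?t" "hit w \<le> hprof w ?t" using hprof_pos[of w ?t] hprof_ge[of w ?t] w t by (auto simp: deep_def)
    have "h \<le> 1 / (1 + real d * \<alpha>) * (threshold (tl w) / 2)" using b(2) d\<alpha>_pos by (simp add: field_simps)
    also have "\<dots> \<le> hprof w ?t * (threshold (tl w) / 2)" using hp hq threshold_pos[of "tl w"] by (intro mult_right_mono) auto
    also have "\<dots> \<le> hprof w ?t * normed w ?t \<phi>"
    proof (rule mult_left_mono)
      have "0 \<le> threshold (tl w) / 2 + (normed w ?t \<phi> - \<phi> (vertex_point (tl w)))" using op[of N] k by (simp add: open_edge_def)
      then show "threshold (tl w) / 2 \<le> normed w ?t \<phi>" using b(1) by linarith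
    qed (use hq in simp)
    also have "\<dots> = \<phi> (edge_point (tl w) w ?t)" using hq by (simp add: normed_def)
    finally show ?thesis .
  qed
  show "h \<le> \<phi> (edge_point (tl w) w \<theta>)" if \<theta>: "0 \<le> \<theta>" "\<theta> \<le> 1"
  proof (rule LIMSEQ_le_const)
    define t where "t N = real (nat \<lfloor>\<theta> * 2 ^ N\<rfloor>) / 2 ^ N" for N :: nat
    have k: "nat \<lfloor>\<theta> * 2 ^ N\<rfloor> \<le> 2 ^ N" for N
    proof -
      have "\<theta> * 2 ^ N \<le> 2 ^ N" using \<theta> by simp
      then have "\<lfloor>\<theta> * 2 ^ N\<rfloor> \<le> \<lfloor>2 ^ N :: real\<rfloor>" by (rule floor_mono)
      also have "\<lfloor>2 ^ N :: real\<rfloor> = int (2 ^ N)" using floor_of_int[of "2 ^ N", where 'a = real] by simp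
      finally show ?thesis by simp
    qed
    have tr: "t N \<in> {0..1}" for N using dyadic_range[OF k[of N]] by (simp add: t_def)
    have c: "continuous_on {0..1} (\<lambda>\<theta>. \<phi> (edge_point (tl w) w \<theta>))"
      by (rule continuous_on_compose2[OF field_continuous[OF \<phi>] continuous_on_edge_point]) (use dw edge_in in auto)
    show "(\<lambda>N. \<phi> (edge_point (tl w) w (t N))) \<longlonglongrightarrow> \<phi> (edge_point (tl w) w \<theta>)"
      by (rule continuous_on_tendsto_compose[OF c]) (use floor_dyadic_tendsto[OF \<theta>(1)] \<theta> tr in \<open>auto simp: t_def[abs_def]\<close>)
    show "\<exists>n. \<forall>N\<ge>n. h \<le> \<phi> (edge_point (tl w) w (t N))" using dy[OF k] by (auto simp: t_def)
  qed
qed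

lemma threshold_child: "v \<noteq> [] \<Longrightarrow> threshold v \<le> threshold (i # v)"
proof -
  assume v: "v \<noteq> []"
  have "lam (i # v) = \<alpha> * lam v" using v by (cases v) (auto simp: lam_def)
  then have "lam (i # v) \<le> lam v" using lam_pos[of v] \<alpha> mult_right_mono[of \<alpha> 1 "lam v"] by simp
  then have "sqrt (lam (i # v) * (1 + real d * \<alpha>)) \<le> sqrt (lam v * (1 + real d * \<alpha>))"
    using d\<alpha>_pos by (intro real_sqrt_le_mono mult_right_mono) auto
  then show ?thesis unfolding threshold_def using lam_pos[of "i # v"] d\<alpha>_pos by (intro divide_left_mono) (auto intro!: mult_pos_pos)
qed

lemma deep_child: "v \<in> V \<Longrightarrow> v \<noteq> [] \<Longrightarrow> i < d \<Longrightarrow> deep (i # v)"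
  by (simp add: deep_def regular_tree_Cons_iff)

lemma reach_connected:
  assumes \<phi>: "\<phi> \<in> space M" and "v \<in> V" "v \<noteq> []" "threshold v \<le> \<phi> (vertex_point v)" "2 * h * (1 + real d * \<alpha>) \<le> threshold v" "h \<le> \<phi> (vertex_point v)"
    and "reach d (\<lambda>w. \<forall>N. open_edge N w \<phi>) n v"
  shows "\<exists>w\<in>V. length w = length v + n \<and> connected_component (level_set T h \<phi>) (vertex_point v) (vertex_point w)"
  using assms(2-)
proof (induction n arbitrary: v)
  case 0
  then show ?case using vertex_in[OF 0(1)] by (intro bexI[of _ v]) (auto simp: level_set_def connected_component_refl_eq)
next
  case (Suc n)
  note vp = Suc.prems
  obtain i where i: "i < d" "\<And>N. open_edge N (i # v) \<phi>" "reach d (\<lambda>w. \<forall>N. open_edge N w \<phi>) n (i # v)" using vp(6) by auto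
  let ?w = "i # v"
  have w: "deep ?w" using deep_child vp(1,2) i(1) by blast
  have ab: "threshold ?w \<le> \<phi> (vertex_point ?w)" using open_edge_above(1)[OF w \<phi> i(2), of h] vp by simp
  have ed: "h \<le> \<phi> (edge_point v ?w \<theta>)" if "0 \<le> \<theta>" "\<theta> \<le> 1" for \<theta>
    using open_edge_above(2)[OF w \<phi> i(2), of h \<theta>] vp that by simp
  have ein: "edge_point v ?w \<theta> \<in> cable_system T" if "0 \<le> \<theta>" "\<theta> \<le> 1" for \<theta>
    using edge_in[of ?w \<theta>] deepD[OF w] that by simp
  have "connected_component (level_set T h \<phi>) (vertex_point v) (vertex_point ?w)"
    unfolding connected_component_def
  proof (intro exI conjI)
    show "connected (edge_point v ?w ` {0..1})" by (intro connected_continuous_image continuous_on_edge_point) simp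
    show "edge_point v ?w ` {0..1} \<subseteq> level_set T h \<phi>" using ed ein by (auto simp: level_set_def)
    show "vertex_point v \<in> edge_point v ?w ` {0..1}" by (rule image_eqI[of _ _ 0]) (simp_all add: edge_point_0)
    show "vertex_point ?w \<in> edge_point v ?w ` {0..1}" by (rule image_eqI[of _ _ 1]) (simp_all add: edge_point_1)
  qed
  moreover have "\<exists>z\<in>V. length z = length ?w + n \<and> connected_component (level_set T h \<phi>) (vertex_point ?w) (vertex_point z)"
  proof (rule Suc.IH[OF deepD(1)[OF w] _ ab _ _ i(3)])
    show "2 * h * (1 + real d * \<alpha>) \<le> threshold ?w" using vp(4) threshold_child[OF vp(2), of i] by linarith
    show "h \<le> \<phi> (vertex_point ?w)" using ed[of 1] by (simp add: edge_point_1)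
  qed simp
  ultimately show ?case using connected_component_trans by fastforce
qed

lemma reach_percolates:
  assumes \<phi>: "\<phi> \<in> space M" and v: "v \<in> V" "v \<noteq> []" "threshold v \<le> \<phi> (vertex_point v)" "2 * h * (1 + real d * \<alpha>) \<le> threshold v" "h \<le> threshold v"
    and r: "\<And>n. reach d (\<lambda>w. open_edge n w \<phi>) n v"
  shows "percolates T h \<phi>"
proof -
  let ?F = "connected_component_set (level_set T h \<phi>) (vertex_point v)"
  \<comment> \<open>The hypothesis uses one index for level and depth. Both conditions weaken as the
    index decreases, so the index \<open>max n N\<close> covers depth \<open>n\<close> at level
    \<open>N\<close>.\<close>
  have r': "reach d (\<lambda>w. \<forall>N. open_edge N w \<phi>) n v" for n
  proof (rule reach_all)
    show "reach d (\<lambda>w. open_edge N w \<phi>) n v" for N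
      using reach_less[OF _ r[of "max n N"], of n] reach_mono[of "\<lambda>w. open_edge (max n N) w \<phi>" "\<lambda>w. open_edge N w \<phi>" d n v]
        open_edge_antimono[of N "max n N"] by auto
  qed (rule open_edge_antimono)
  have ex: "\<exists>w\<in>V. length w = length v + n \<and> vertex_point w \<in> ?F" for n
    using reach_connected[OF \<phi> v(1-4) _ r'] v(3,5) by auto
  have "vertex_point v \<in> level_set T h \<phi>" using vertex_in[OF v(1)] v(3,5) by (simp add: level_set_def)
  then have "?F \<in> components (level_set T h \<phi>)" by (auto simp: components_def)
  moreover have "infinite {x \<in> verts T. vertex_point x \<in> ?F}"
  proof
    \<comment> \<open>A finite set of vertices has bounded generation, whereas the cluster meets a
      generation beyond the sum of all its lengths.\<close>
    assume f: "finite {x \<in> verts T. vertex_point x \<in> ?F}"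
    obtain w where w: "w \<in> V" "length w = length v + Suc (\<Sum>x\<in>{x \<in> verts T. vertex_point x \<in> ?F}. length x)" "vertex_point w \<in> ?F"
      using ex by blast
    have "length w \<le> (\<Sum>x\<in>{x \<in> verts T. vertex_point x \<in> ?F}. length x)"
      using f w(1,3) by (intro member_le_sum) auto
    then show False using w(2) by simp
  qed
  ultimately show ?thesis unfolding percolates_def unbounded_def by blast
qed

section \<open>Choice of seeds far from the root in disjoint branches\<close>

lemma threshold_large: "\<exists>m. \<forall>v. m \<le> length v \<longrightarrow> B \<le> threshold v"
proof -
  let ?c = "(max B 1)\<^sup>2 * (1 + real d * \<alpha>)"
  have c: "0 < ?c" using d\<alpha>_pos by simp
  obtain n where n: "\<alpha> ^ n < 1 / ?c" using real_arch_pow_inv[of "1 / ?c" \<alpha>] c \<alpha> by auto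
  have "B \<le> threshold v" if "Suc n \<le> length v" for v
  proof -
    have "lam v \<le> \<alpha> ^ n" unfolding lam_def using that \<alpha> by (intro power_decreasing) auto
    then have "lam v \<le> 1 / ?c" using n by simp
    then have "lam v * ?c \<le> 1" using c by (simp add: pos_le_divide_eq)
    then have "(max B 1)\<^sup>2 \<le> (threshold v)\<^sup>2" using lam_pos[of v] d\<alpha>_pos by (simp add: threshold_sq pos_le_divide_eq mult.commute mult.left_commute)
    then have "max B 1 \<le> threshold v" using less_imp_le[OF threshold_pos[of v]] by (rule power2_le_imp_le)
    then show ?thesis by simp
  qed
  then show ?thesis by blast
qed

text \<open>The ancestors \<open>u j\<close> follow the ray of zeros; \<open>y j\<close> leaves it
  at \<open>u j\<close> and follows labels 1. Different seeds leave the ray at different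
  generations, so their branches are disjoint. Since \<open>u j\<close> does not depend on the
  length of the detour, the detour can be made so long that the threshold at \<open>y j\<close>
  dwarfs the variance at \<open>u j\<close>.\<close>

lemma seeds_exist:
  assumes e: "0 < e"
  shows "\<exists>Y anc. seeds Y anc \<and> card Y = n \<and> (\<forall>v\<in>Y. B \<le> threshold v \<and> gv (anc v) (anc v) \<le> e * (threshold v)\<^sup>2)"
proof -
  define u :: "nat \<Rightarrow> nat list" where "u j = replicate (Suc j) 0" for j
  have "\<exists>m. \<forall>v. m \<le> length v \<longrightarrow> max B (sqrt (gv (u j) (u j) / e)) \<le> threshold v" for j by (rule threshold_large)
  then obtain m where m: "\<And>j v. m j \<le> length v \<Longrightarrow> max B (sqrt (gv (u j) (u j) / e)) \<le> threshold v" by metis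
  define y where "y j = replicate (Suc (m j)) 1 @ u j" for j
  define anc where "anc = dropWhile ((=) (1::nat))"
  have anc: "anc (y j) = u j" for j
  proof -
    have "dropWhile ((=) 1) (replicate k 1 @ u j) = u j" for k by (induction k) (auto simp: u_def)
    then show ?thesis by (simp only: anc_def y_def)
  qed
  have repV: "replicate k (1::nat) @ u j \<in> V" for k j
  proof (induction k)
    case 0
    have "replicate k 0 \<in> V" for k by (induction k) (use d in \<open>auto simp: regular_tree_Cons_iff regular_tree.root\<close>)
    then show ?case by (simp add: u_def del: replicate_Suc)
  next
    case (Suc k)
    then show ?case using d by (simp add: regular_tree_Cons_iff)
  qed
  have y_eq: "y j = replicate (m j) 1 @ (1 # u j)" for j
    unfolding y_def replicate_Suc by (simp add: replicate_app_Cons_same)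
  \<comment> \<open>Counting the zeros at the root end of the list, which comes first after
    \<open>rev\<close>, recovers \<open>j\<close>.\<close>
  have tw: "length (takeWhile ((=) 0) (rev (w @ 1 # u j))) = Suc j" for w j
  proof -
    have "takeWhile ((=) 0) (rev (w @ 1 # u j)) = takeWhile ((=) 0) (replicate (Suc j) 0 @ 1 # rev w)"
      by (simp add: u_def del: replicate_Suc)
    also have "\<dots> = replicate (Suc j) 0 @ takeWhile ((=) 0) (1 # rev w)"
      by (rule takeWhile_append2) (simp del: replicate_Suc)
    finally show ?thesis by simp
  qed
  have nb: "\<not> below (1 # u j) (y k)" if "j \<noteq> k" for j k
  proof
    assume "below (1 # u j) (y k)"
    then obtain w where "y k = w @ 1 # u j" by (auto simp: below_def)
    then show False using tw[of "replicate (m k) 1" k] tw[of w j] that by (simp add: y_eq)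
  qed
  have nb': "\<not> below (1 # u j) (u k)" for j k
  proof
    assume "below (1 # u j) (u k)"
    then have "1 \<in> set (u k)" by (auto simp: below_def)
    then show False by (simp add: u_def del: replicate_Suc)
  qed
  have inj: "inj y"
  proof (rule injI)
    fix j k assume "y j = y k"
    then show "j = k" using tw[of "replicate (m k) 1" k] tw[of "replicate (m j) 1" j] by (simp add: y_eq)
  qed
  have "seeds (y ` {..<n}) anc"
    unfolding seeds_def
  proof (intro conjI ballI impI)
    fix v assume "v \<in> y ` {..<n}"
    then obtain j where j: "v = y j" by blast
    show "anc v \<in> V" using repV[of 0 j] by (simp add: j anc)
    show "anc v \<noteq> []" by (simp add: j anc) (simp add: u_def)
    show "v \<in> V" unfolding j y_def by (rule repV)
    show "below (1 # anc v) v" unfolding j anc by (auto simp: y_eq below_def)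
    fix w assume w: "w \<in> y ` {..<n}" "v \<noteq> w"
    then obtain k where k: "w = y k" by blast
    have jk: "j \<noteq> k" using w(2) j k by blast
    show "\<not> below (1 # anc v) w" unfolding j k anc by (rule nb[OF jk])
    show "\<not> below (1 # anc v) (anc w)" unfolding j k anc by (rule nb')
  qed simp
  moreover have "card (y ` {..<n}) = n" using inj by (simp add: card_image inj_on_def inj_def)
  moreover have "B \<le> threshold v \<and> gv (anc v) (anc v) \<le> e * (threshold v)\<^sup>2" if "v \<in> y ` {..<n}" for v
  proof -
    obtain j where j: "v = y j" using \<open>v \<in> y ` {..<n}\<close> by blast
    have b: "max B (sqrt (gv (u j) (u j) / e)) \<le> threshold v" using m[of j v] by (simp add: j y_def)
    have "gv (u j) (u j) / e \<le> (threshold v)\<^sup>2" using b by (intro sqrt_le_D) simp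
    then show ?thesis using b e by (simp add: j anc pos_divide_le_eq mult.commute)
  qed
  ultimately show ?thesis by blast
qed

lemma open_edge_measurable:
  assumes v: "deep v" shows "Measurable.pred M (open_edge N v)"
proof -
  note dv = deepD[OF v]
  have p: "(\<lambda>\<phi>. \<phi> (vertex_point (tl v))) \<in> borel_measurable M" using dv by (intro field_measurable vertex_in)
  have n: "(\<lambda>\<phi>. normed v \<theta> \<phi>) \<in> borel_measurable M" if "0 \<le> \<theta>" "\<theta> \<le> 1" for \<theta>
    unfolding normed_def using dv that by (intro borel_measurable_divide borel_measurable_const field_measurable edge_in) auto
  have le: "Measurable.pred M (\<lambda>\<phi>. a \<le> threshold (tl v) / 2 + (normed v \<theta> \<phi> - \<phi> (vertex_point (tl v))))" if "0 \<le> \<theta>" "\<theta> \<le> 1" for a \<theta>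
    unfolding pred_def by (intro borel_measurable_le borel_measurable_const borel_measurable_add borel_measurable_diff n[OF that] p)
  have "Measurable.pred M (\<lambda>\<phi>. \<forall>k\<in>{..2 ^ N}. 0 \<le> threshold (tl v) / 2 + (normed v (real k / 2 ^ N) \<phi> - \<phi> (vertex_point (tl v))))"
    by (rule pred_intros_finite(3)) (use le dyadic_range in auto)
  moreover have "Measurable.pred M (\<lambda>\<phi>. threshold v / hit v \<le> threshold (tl v) / 2 + (normed v 1 \<phi> - \<phi> (vertex_point (tl v))))"
    by (rule le) auto
  ultimately have "Measurable.pred M (\<lambda>\<phi>. (\<forall>k\<in>{..2 ^ N}. 0 \<le> threshold (tl v) / 2 + (normed v (real k / 2 ^ N) \<phi> - \<phi> (vertex_point (tl v))))
    \<and> threshold v / hit v \<le> threshold (tl v) / 2 + (normed v 1 \<phi> - \<phi> (vertex_point (tl v))))"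
    by (rule pred_intros_logic(3))
  then show ?thesis unfolding open_edge_def[abs_def] Ball_def atMost_iff .
qed

text \<open>Chebyshev's inequality; the maximum principle gives \<open>hit_anc \<le> 1\<close>. It
  bounds the chance that the ancestor cancels the surplus of half a threshold in the seed
  condition.\<close>

lemma prob_hit_anc_large:
  assumes Y: "seeds Y anc" and v: "v \<in> Y" and e: "gv (anc v) (anc v) \<le> e * (threshold v)\<^sup>2"
  shows "M.prob {\<phi> \<in> space M. \<bar>hit_anc (anc v) v * \<phi> (vertex_point (anc v))\<bar> \<ge> threshold v / 2} \<le> 4 * e"
proof -
  note sv = seedD[OF Y v]
  let ?Z = "\<lambda>\<phi>. hit_anc (anc v) v * \<phi> (vertex_point (anc v))"
  have Zm: "?Z \<in> borel_measurable M" using sv by (intro borel_measurable_times borel_measurable_const field_measurable vertex_in)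
  have Zi: "integrable M (\<lambda>\<phi>. (?Z \<phi>)\<^sup>2)"
    unfolding power_mult_distrib using sv by (intro integrable_mult_right field_square_integrable vertex_in)
  have gp: "0 < gv (anc v) (anc v)" using sv by (intro gv_pos)
  have h: "0 \<le> hit_anc (anc v) v" "hit_anc (anc v) v \<le> 1"
    using gv_nonneg[OF sv(3,1)] gp gv_le[OF sv(1,2,3,8)] by (auto simp: hit_anc_def)
  have "M.prob {\<phi> \<in> space M. \<bar>?Z \<phi>\<bar> \<ge> threshold v / 2} \<le> M.expectation (\<lambda>\<phi>. (?Z \<phi>)\<^sup>2) / (threshold v / 2)\<^sup>2"
    using threshold_pos[of v] by (intro M.second_moment_method Zm Zi) simp
  also have "M.expectation (\<lambda>\<phi>. (?Z \<phi>)\<^sup>2) = (hit_anc (anc v) v)\<^sup>2 * gv (anc v) (anc v)"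
    unfolding power_mult_distrib gv_def using sv by (simp add: green_diag vertex_in)
  also have "\<dots> / (threshold v / 2)\<^sup>2 \<le> (1 * (e * (threshold v)\<^sup>2)) / (threshold v / 2)\<^sup>2"
    using h gp e by (intro divide_right_mono mult_mono power_le_one) auto
  also have "\<dots> = 4 * e" using threshold_pos[of v] by (simp add: power_divide)
  finally show ?thesis .
qed

text \<open>A measurable event inside percolation is constructed: some seed starts a path that is
  open at every dyadic level and to every depth, and its ancestor does no harm. The probability
  survives the limit because the bounds are uniform and the events decrease.\<close>

lemma percolation_event:
  assumes dp: "2 \<le> real d * p_open" and \<epsilon>: "0 < \<epsilon>"
  shows "\<exists>A\<in>sets M. (\<forall>\<phi>\<in>A. percolates T h \<phi>) \<and> 1 - \<epsilon> \<le> M.prob A"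
proof -
  define q where "q = 1 - std_normal_density 2 / 4"
  have q: "0 \<le> q" "q < 1"
  proof -
    have "std_normal_density 2 \<le> 1 / sqrt (2 * pi)" unfolding std_normal_density_def by (simp add: divide_right_mono)
    also have "\<dots> \<le> 1" using pi_gt3 by (simp add: divide_le_eq_1)
    finally show "0 \<le> q" by (simp add: q_def)
  qed (simp add: q_def std_normal_density_def)
  \<comment> \<open>Enough seeds for all of them to fail with probability below
    \<open>\<epsilon> / 2\<close>.\<close>
  obtain n where n: "q ^ n < \<epsilon> / 2" using real_arch_pow_inv[of "\<epsilon> / 2" q] q \<epsilon> by auto
  \<comment> \<open>Each of the \<open>n\<close> ancestors does harm with probability at most
    \<open>4 * e\<close>, which adds up to at most \<open>\<epsilon> / 2\<close>;
    \<open>Suc n\<close> avoids a division by 0.\<close>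
  define e where "e = \<epsilon> / (8 * real (Suc n))"
  have e: "0 < e" using \<epsilon> by (simp add: e_def)
  obtain Y anc where Y: "seeds Y anc" "card Y = n"
    and B: "\<And>v. v \<in> Y \<Longrightarrow> max h (2 * h * (1 + real d * \<alpha>)) \<le> threshold v" "\<And>v. v \<in> Y \<Longrightarrow> gv (anc v) (anc v) \<le> e * (threshold v)\<^sup>2"
    using seeds_exist[OF e, of n "max h (2 * h * (1 + real d * \<alpha>))"] by blast
  have finY: "finite Y" using Y by (simp add: seeds_def)
  define bad where "bad v = {\<phi> \<in> space M. \<bar>hit_anc (anc v) v * \<phi> (vertex_point (anc v))\<bar> \<ge> threshold v / 2}" for v
  define S where "S k v \<phi> \<longleftrightarrow> seed_var anc v \<phi> \<ge> 3 / 2 * threshold v \<and> reach d (\<lambda>w. open_edge k w \<phi>) k v" for k v \<phi>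
  \<comment> \<open>The index \<open>k\<close> serves as dyadic level and as depth at once, which
    makes the events decreasing.\<close>
  define E where "E k = {\<phi> \<in> space M. \<exists>v\<in>Y. \<phi> \<notin> bad v \<and> S k v \<phi>}" for k
  have Sm: "Measurable.pred M (S k v)" if v: "v \<in> Y" for k v
  proof -
    have [measurable]: "seed_var anc v \<in> borel_measurable M" using seed_gaussian[OF Y(1) v] by (simp add: centered_gaussian_def)
    have [measurable]: "Measurable.pred M (\<lambda>\<phi>. reach d (\<lambda>w. open_edge k w \<phi>) k v)"
      using descendant_deep[OF Y(1) v, of _ k] by (intro reach_measurable open_edge_measurable) auto
    show ?thesis unfolding S_def[abs_def] by measurable
  qed
  have badm: "bad v \<in> sets M" if v: "v \<in> Y" for v
  proof -
    have [measurable]: "(\<lambda>\<phi>. \<phi> (vertex_point (anc v))) \<in> borel_measurable M"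
      using seedD[OF Y(1) v] by (intro field_measurable vertex_in)
    show ?thesis unfolding bad_def by measurable
  qed
  have Em: "E k \<in> sets M" for k
  proof -
    have "E k = (\<Union>v\<in>Y. {\<phi> \<in> space M. S k v \<phi>} - bad v)" unfolding E_def by auto
    also have "\<dots> \<in> sets M" using Sm badm by (intro sets.finite_UN finY sets.Diff) (auto simp: pred_def)
    finally show ?thesis .
  qed
  have Santi: "S k v \<phi>" if "k \<le> k'" "S k' v \<phi>" for k k' v \<phi>
    using that reach_less[OF that(1)] reach_mono[of "\<lambda>w. open_edge k' w \<phi>" "\<lambda>w. open_edge k w \<phi>"] open_edge_antimono[OF that(1)]
    unfolding S_def by blast
  have dec: "decseq E" unfolding decseq_def E_def using Santi by blast
  have Ep: "1 - \<epsilon> \<le> M.prob (E k)" for k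
  proof -
    let ?F = "{\<phi> \<in> space M. \<exists>v\<in>Y. S k v \<phi>}"
    have Fm: "?F \<in> sets M" using pred_intros_finite(4)[OF finY Sm] by (simp add: pred_def)
    have "1 - q ^ n \<le> M.prob ?F"
      unfolding q_def Y(2)[symmetric] S_def by (rule prob_seed_reach[OF Y(1) dp])
    also have "\<dots> \<le> M.prob (E k \<union> (\<Union>v\<in>Y. bad v))"
      using Em badm finY by (intro M.finite_measure_mono sets.Un sets.finite_UN) (auto simp: E_def)
    also have "\<dots> \<le> M.prob (E k) + M.prob (\<Union>v\<in>Y. bad v)"
      using Em badm finY by (intro measure_Un_le sets.finite_UN) auto
    also have "M.prob (\<Union>v\<in>Y. bad v) \<le> (\<Sum>v\<in>Y. M.prob (bad v))"
      using badm finY by (intro M.finite_measure_subadditive_finite) auto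
    also have "\<dots> \<le> (\<Sum>v\<in>Y. 4 * e)"
      unfolding bad_def by (intro sum_mono prob_hit_anc_large[OF Y(1)] B(2))
    also have "\<dots> \<le> \<epsilon> / 2" using \<epsilon> by (simp add: Y(2) e_def field_simps)
    finally show ?thesis using n by simp
  qed
  have "(\<lambda>k. M.prob (E k)) \<longlonglongrightarrow> M.prob (\<Inter>k. E k)"
    using Em dec by (intro M.finite_Lim_measure_decseq) auto
  then have "1 - \<epsilon> \<le> M.prob (\<Inter>k. E k)" using Ep by (intro LIMSEQ_le_const) auto
  moreover have "percolates T h \<phi>" if \<phi>: "\<phi> \<in> (\<Inter>k. E k)" for \<phi>
  proof -
    have "\<exists>v\<in>Y. \<forall>k. \<phi> \<notin> bad v \<and> S k v \<phi>"
      using \<phi> Santi by (intro antimono_pigeonhole finY) (auto simp: E_def)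
    then obtain v where v: "v \<in> Y" "\<phi> \<notin> bad v" "\<And>k. S k v \<phi>" by blast
    have sp: "\<phi> \<in> space M" using \<phi> by (auto simp: E_def)
    have "\<bar>hit_anc (anc v) v * \<phi> (vertex_point (anc v))\<bar> < threshold v / 2" using v(2) sp by (auto simp: bad_def)
    moreover have "seed_var anc v \<phi> \<ge> 3 / 2 * threshold v" using v(3)[of 0] by (simp add: S_def)
    ultimately have "threshold v \<le> \<phi> (vertex_point v)" unfolding seed_var_def by (simp add: abs_less_iff)
    then show ?thesis
      using seedD[OF Y(1) v(1)] B(1)[OF v(1)] v(3) by (intro reach_percolates[OF sp, of v]) (auto simp: S_def)
  qed
  ultimately show ?thesis using Em by (intro bexI[of _ "\<Inter>k. E k"]) auto
qed

lemma percolates_AE: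
  assumes dp: "2 \<le> real d * p_open"
  shows "AE \<phi> in M. percolates T h \<phi>"
proof -
  have "\<exists>A\<in>sets M. (\<forall>\<phi>\<in>A. percolates T h \<phi>) \<and> 1 - 1 / real (Suc k) \<le> M.prob A" for k
    by (rule percolation_event[OF dp]) simp
  then obtain A where A: "\<And>k. A k \<in> sets M" "\<And>k \<phi>. \<phi> \<in> A k \<Longrightarrow> percolates T h \<phi>" "\<And>k. 1 - 1 / real (Suc k) \<le> M.prob (A k)"
    by metis
  have U: "(\<Union>k. A k) \<in> sets M" using A(1) by blast
  have "1 - 1 / real (Suc k) \<le> M.prob (\<Union>k. A k)" for k
    using A(3)[of k] M.finite_measure_mono[OF _ U, of "A k"] by force
  moreover have "(\<lambda>k. 1 - 1 / real (Suc k)) \<longlonglongrightarrow> 1"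
    using tendsto_diff[OF tendsto_const[of 1] LIMSEQ_inverse_real_of_nat] by (simp add: inverse_eq_divide)
  ultimately have "1 \<le> M.prob (\<Union>k. A k)" by (intro LIMSEQ_le_const2) auto
  then have "M.prob (\<Union>k. A k) = 1" using M.prob_le_1[of "\<Union>k. A k"] by linarith
  then have "AE \<phi> in M. \<phi> \<in> (\<Union>k. A k)" by (rule M.AE_prob_1)
  then show ?thesis by eventually_elim (use A(2) in blast)
qed

lemma critical_level_infinite:
  assumes dp: "2 \<le> real d * p_open"
  shows "critical_level T M = \<infinity>"
proof -
  have "\<not> (AE \<phi> in M. \<not> percolates T h \<phi>)" for h
  proof
    assume "AE \<phi> in M. \<not> percolates T h \<phi>"
    then have "AE \<phi> in M. False" using percolates_AE[OF dp, of h] by eventually_elim blast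
    then show False by simp
  qed
  then have "{ereal h | h. AE \<phi> in M. \<not> percolates T h \<phi>} = {}" by blast
  then show ?thesis by (simp add: critical_level_def top_ereal_def)
qed

end

section \<open>From a free field on the tree to the theorem\<close>

lemma gaussian_free_field_tree_gff:
  assumes "0 < \<alpha>" "\<alpha> < 1" "2 \<le> d" and M: "gaussian_free_field (tree_graph \<alpha> d) M"
  obtains P L g where "tree_gff \<alpha> d P L g M"
proof -
  interpret weighted_tree \<alpha> d by unfold_locales fact+
  note gff = M[unfolded gaussian_free_field_def]
  obtain g where "green_function T g"
    and cov: "\<forall>p\<in>cable_system T. \<forall>q\<in>cable_system T. (LINT \<phi>|M. \<phi> p * \<phi> q) = g p q"
    using gff by (elim conjE exE)
  then obtain P L where D: "cable_diffusion T P" "local_times T P L"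
    and g: "\<forall>p\<in>cable_system T. \<forall>q\<in>cable_system T. 0 \<le> g p q \<and>
        ennreal (g p q) = (\<integral>\<^sup>+ w. (SUP t\<in>{t. w t \<noteq> None}. ennreal (L q t w)) \<partial>P p)"
    unfolding green_function_def by (elim conjE exE)
  interpret M: prob_space M using gff by (elim conjE)
  have "tree_gff \<alpha> d P L g M"
  proof unfold_locales
    show "markov_family T P" "m_symmetric T P" "associated_with_form T P" using D(1) by (auto simp: cable_diffusion_def)
    show "local_times T P L" by (rule D(2))
    show "0 \<le> g p q" if "p \<in> cable_system T" "q \<in> cable_system T" for p q
      by (rule conjunct1[OF g[rule_format, OF that]])
    show "ennreal (g p q) = (\<integral>\<^sup>+ w. (SUP t\<in>{t. w t \<noteq> None}. ennreal (L q t w)) \<partial>P p)"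
      if "p \<in> cable_system T" "q \<in> cable_system T" for p q
      by (rule conjunct2[OF g[rule_format, OF that]])
    show "(LINT \<phi>|M. \<phi> p * \<phi> q) = g p q" if "p \<in> cable_system T" "q \<in> cable_system T" for p q
      by (rule cov[rule_format, OF that])
    show "sets M = sets (restrict_space (Pi\<^sub>M (cable_system T) (\<lambda>_. borel)) {\<phi>. continuous_on (cable_system T) \<phi>})"
      using gff by (elim conjE)
    show "centered_gaussian M (\<lambda>\<phi>. \<Sum>p\<in>F. a p * \<phi> p)" if "finite F" "F \<subseteq> cable_system T" for F a
      using gff that by (elim conjE) blast
  qed
  then show ?thesis by (rule that)
qed

theorem proposition7p1:
  shows "\<exists>C::real. \<forall>(\<alpha>::real) (d::nat).
    0 < \<alpha> \<and> \<alpha> < 1 \<and> d \<ge> 2 \<and>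
    real d * (1 - exp (- (sqrt \<alpha> / (real d * \<alpha> + 1)))) > C \<longrightarrow>
    (\<forall>M. gaussian_free_field (tree_graph \<alpha> d) M \<longrightarrow>
       (\<forall>h::real. AE \<phi> in M. percolates (tree_graph \<alpha> d) h \<phi>) \<and>
       critical_level (tree_graph \<alpha> d) M = \<infinity>)"
proof (intro exI[of _ "4 / std_normal_density 2"] allI impI)
  \<comment> \<open>The constant turns the hypothesis, weakened by \<open>1 - exp (- x) \<le> x\<close>, into \<open>2 \<le> d * p_open\<close>.\<close>
  fix \<alpha> :: real and d :: nat and M
  assume *: "0 < \<alpha> \<and> \<alpha> < 1 \<and> d \<ge> 2 \<and> real d * (1 - exp (- (sqrt \<alpha> / (real d * \<alpha> + 1)))) > 4 / std_normal_density 2"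
    and M: "gaussian_free_field (tree_graph \<alpha> d) M"
  obtain P L g where "tree_gff \<alpha> d P L g M" using gaussian_free_field_tree_gff[OF _ _ _ M] * by blast
  then interpret tree_gff \<alpha> d P L g M .
  have "1 - exp (- (sqrt \<alpha> / (real d * \<alpha> + 1))) \<le> sqrt \<alpha> / (real d * \<alpha> + 1)"
    using exp_ge_add_one_self[of "- (sqrt \<alpha> / (real d * \<alpha> + 1))"] by linarith
  then have "real d * (1 - exp (- (sqrt \<alpha> / (real d * \<alpha> + 1)))) \<le> real d * (sqrt \<alpha> / (real d * \<alpha> + 1))"
    by (intro mult_left_mono) auto
  then have "4 / std_normal_density 2 \<le> real d * (sqrt \<alpha> / (real d * \<alpha> + 1))" using * by linarith
  moreover have "0 < std_normal_density 2" by (simp add: normal_density_pos)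
  ultimately have "4 \<le> real d * (sqrt \<alpha> / (real d * \<alpha> + 1)) * std_normal_density 2" by (simp only: pos_divide_le_eq)
  also have "\<dots> = 2 * (real d * p_open)" by (simp add: p_open_def add.commute del: distrib_left_numeral)
  finally have "2 \<le> real d * p_open" by simp
  then show "(\<forall>h::real. AE \<phi> in M. percolates (tree_graph \<alpha> d) h \<phi>) \<and> critical_level (tree_graph \<alpha> d) M = \<infinity>"
    using percolates_AE critical_level_infinite by blast
qed

end
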